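(* Fix $h\ge0$, $D\in\mathbb R$. There exists $\beta'>0$ such that for every $\beta\in(0,\beta')$: for any integer $n$ and nonnegative integers $h(k),h'(k)$ ($k\in[n]$), $h,h'$, with $H_1=\sum_kh(k)+\sum_kh'(k)+h+h'$, letting $\{(g_{T_k},g_{S_k}):k\in[n]\}$ be i.i.d. centered Gaussian vectors with covariance matrix $\Sigma_1=\begin{pmatrix}A_1^2&C_1^2\\C_1^2&B_1^2\end{pmatrix}$, $$\nu\Big(\prod_kT_k^{h(k)}\prod_lS_l^{h'(l)}T^hS^{h'}\Big)=\Big(\prod_k\mathbb E\big[g_{T_k}^{h(k)}g_{S_k}^{h'(k)}\big]\Big)\nu(T^hS^{h'})+O(N^{-(H_1+1)/2}),$$ with implied constant independent of $N$.
   Context: Fix an integer $\mathcal S\ge1$ and $N\ge2$; $\Sigma_N=\{0,\pm1,\dots,\pm\mathcal S\}^N$. For $\beta>0$, $h\ge0$, $D\in\mathbb R$ and i.i.d. standard Gaussians $(g_{i,j})_{i<j}$, $H_N(\sigma)=\frac{\beta}{\sqrt N}\sum_{i<j}g_{i,j}\sigma_i\sigma_j+D\sum_i\sigma_i^2+h\sum_i\sigma_i$, Gibbs measure $G(\sigma)\propto e^{H_N(\sigma)}$ on $\Sigma_N$. Replicas are i.i.d. samples from $G$ given the disorder; $\langle\cdot\rangle$ is the product Gibbs average, $\nu(f)=\mathbb E\langle f\rangle$. $p,q$: for $\eta\sim N(0,1)$, $\langle\phi\rangle_\eta=\sum_s\phi(s)w_\eta(s)/\sum_sw_\eta(s)$,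 $w_\eta(s)=\exp(\beta\sqrt q\eta s+hs+(D+\frac{\beta^2}{2}(p-q))s^2)$, $s\in\{0,\pm1,\dots,\pm\mathcal S\}$; $(p,q)$ solves $q=\mathbb E\langle s\rangle_\eta^2$, $p=\mathbb E\langle s^2\rangle_\eta$ (unique at high temperature). Basis: $b_i=\langle\sigma_i\rangle$, $\tilde b_i=\langle\sigma_i^2\rangle$; $T_k=\frac1N\sum_i(\sigma^k_i-b_i)b_i$, $T=\frac1N\sum_ib_i^2-q$, $S_k=\frac1N\sum_i((\sigma_i^k)^2-\tilde b_i)$, $S=\frac1N\sum_i\tilde b_i-p$. Constants: $m_j=\langle s^j\rangle_\eta$, expectations over $\eta$: $\mathcal D=\mathbb E[m_4-m_2^2]$, $F=\mathbb E[m_2^2-m_1^2m_2]$, $G=\mathbb E[m_1^2(m_2-m_1^2)]$, $\mathcal E=\mathbb E[m_1(m_3-m_1m_2)]$; $M_1=1-\beta^2(F-3G)$, $M_2=1-\frac{\beta^2}{2}\mathcal D$, $M_3=1-\beta^2(F-G)$, $M=M_1M_2+\beta^4\mathcal E^2$; $A_1^2=\frac{GM_2+\frac{\beta^2}{2}\mathcal E^2}{NMM_3}$, $B_1^2=\frac{\mathcal DM_1-2\beta^2\mathcal E^2}{NM}$, $C_1^2=\frac{\mathcal E}{NM}$. *)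

theory Defs
  imports "HOL-Probability.Probability"
begin

definition spins :: "nat \<Rightarrow> real set" where
  "spins S = real_of_int ` {- int S .. int S}"

definition configs :: "nat \<Rightarrow> nat \<Rightarrow> (nat \<Rightarrow> real) set" where
  "configs S N = PiE {..<N} (\<lambda>_. spins S)"

definition pairs :: "nat \<Rightarrow> (nat \<times> nat) set" where
  "pairs N = {(i, j). i < j \<and> j < N}"

definition hamiltonian ::
  "real \<Rightarrow> real \<Rightarrow> real \<Rightarrow> nat \<Rightarrow> (nat \<times> nat \<Rightarrow> real) \<Rightarrow> (nat \<Rightarrow> real) \<Rightarrow> real" where
  "hamiltonian \<beta> D hf N g \<sigma> =
     \<beta> / sqrt (real N) * (\<Sum>(i, j)\<in>pairs N. g (i, j) * \<sigma> i * \<sigma> j)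
     + D * (\<Sum>i<N. (\<sigma> i)\<^sup>2) + hf * (\<Sum>i<N. \<sigma> i)"

definition gibbs :: "nat \<Rightarrow> real \<Rightarrow> real \<Rightarrow> real \<Rightarrow> nat \<Rightarrow> (nat \<times> nat \<Rightarrow> real) \<Rightarrow> (nat \<Rightarrow> real) \<Rightarrow> real" where
  "gibbs S \<beta> D hf N g \<sigma> =
     exp (hamiltonian \<beta> D hf N g \<sigma>) / (\<Sum>\<tau>\<in>configs S N. exp (hamiltonian \<beta> D hf N g \<tau>))"

definition gavg :: "nat \<Rightarrow> real \<Rightarrow> real \<Rightarrow> real \<Rightarrow> nat \<Rightarrow> (nat \<times> nat \<Rightarrow> real) \<Rightarrow> ((nat \<Rightarrow> real) \<Rightarrow> real) \<Rightarrow> real" where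
  "gavg S \<beta> D hf N g f = (\<Sum>\<sigma>\<in>configs S N. gibbs S \<beta> D hf N g \<sigma> * f \<sigma>)"

text \<open>Product Gibbs average over n replicas sigma^1,...,sigma^n (rho k = sigma^k).\<close>
definition gavg_n :: "nat \<Rightarrow> real \<Rightarrow> real \<Rightarrow> real \<Rightarrow> nat \<Rightarrow> nat \<Rightarrow> (nat \<times> nat \<Rightarrow> real)
    \<Rightarrow> ((nat \<Rightarrow> nat \<Rightarrow> real) \<Rightarrow> real) \<Rightarrow> real" where
  "gavg_n S \<beta> D hf N n g F =
     (\<Sum>\<rho>\<in>PiE {1..n} (\<lambda>_. configs S N). (\<Prod>k\<in>{1..n}. gibbs S \<beta> D hf N g (\<rho> k)) * F \<rho>)"

definition disorder :: "nat \<Rightarrow> (nat \<times> nat \<Rightarrow> real) measure" where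
  "disorder N = PiM (pairs N) (\<lambda>_. density lborel std_normal_density)"

definition nu :: "nat \<Rightarrow> real \<Rightarrow> real \<Rightarrow> real \<Rightarrow> nat \<Rightarrow> nat
    \<Rightarrow> ((nat \<times> nat \<Rightarrow> real) \<Rightarrow> (nat \<Rightarrow> nat \<Rightarrow> real) \<Rightarrow> real) \<Rightarrow> real" where
  "nu S \<beta> D hf N n F = (\<integral>g. gavg_n S \<beta> D hf N n g (F g) \<partial>disorder N)"

definition bb :: "nat \<Rightarrow> real \<Rightarrow> real \<Rightarrow> real \<Rightarrow> nat \<Rightarrow> (nat \<times> nat \<Rightarrow> real) \<Rightarrow> nat \<Rightarrow> real" where
  "bb S \<beta> D hf N g i = gavg S \<beta> D hf N g (\<lambda>\<sigma>. \<sigma> i)"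

definition bt :: "nat \<Rightarrow> real \<Rightarrow> real \<Rightarrow> real \<Rightarrow> nat \<Rightarrow> (nat \<times> nat \<Rightarrow> real) \<Rightarrow> nat \<Rightarrow> real" where
  "bt S \<beta> D hf N g i = gavg S \<beta> D hf N g (\<lambda>\<sigma>. (\<sigma> i)\<^sup>2)"

definition Tk :: "nat \<Rightarrow> real \<Rightarrow> real \<Rightarrow> real \<Rightarrow> nat \<Rightarrow> (nat \<times> nat \<Rightarrow> real) \<Rightarrow> (nat \<Rightarrow> nat \<Rightarrow> real) \<Rightarrow> nat \<Rightarrow> real" where
  "Tk S \<beta> D hf N g \<rho> k = (\<Sum>i<N. (\<rho> k i - bb S \<beta> D hf N g i) * bb S \<beta> D hf N g i) / real N"

definition Sk :: "nat \<Rightarrow> real \<Rightarrow> real \<Rightarrow> real \<Rightarrow> nat \<Rightarrow> (nat \<times> nat \<Rightarrow> real) \<Rightarrow> (nat \<Rightarrow> nat \<Rightarrow> real) \<Rightarrow> nat \<Rightarrow> real" where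
  "Sk S \<beta> D hf N g \<rho> k = (\<Sum>i<N. (\<rho> k i)\<^sup>2 - bt S \<beta> D hf N g i) / real N"

definition Tq :: "nat \<Rightarrow> real \<Rightarrow> real \<Rightarrow> real \<Rightarrow> real \<Rightarrow> nat \<Rightarrow> (nat \<times> nat \<Rightarrow> real) \<Rightarrow> real" where
  "Tq S \<beta> D hf q N g = (\<Sum>i<N. (bb S \<beta> D hf N g i)\<^sup>2) / real N - q"

definition Sp :: "nat \<Rightarrow> real \<Rightarrow> real \<Rightarrow> real \<Rightarrow> real \<Rightarrow> nat \<Rightarrow> (nat \<times> nat \<Rightarrow> real) \<Rightarrow> real" where
  "Sp S \<beta> D hf p N g = (\<Sum>i<N. bt S \<beta> D hf N g i) / real N - p"

definition std_normal :: "real measure" where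
  "std_normal = density lborel std_normal_density"

definition weta :: "real \<Rightarrow> real \<Rightarrow> real \<Rightarrow> real \<Rightarrow> real \<Rightarrow> real \<Rightarrow> real \<Rightarrow> real" where
  "weta \<beta> D hf p q \<eta> s = exp (\<beta> * sqrt q * \<eta> * s + hf * s + (D + \<beta>\<^sup>2 / 2 * (p - q)) * s\<^sup>2)"

definition meta :: "nat \<Rightarrow> real \<Rightarrow> real \<Rightarrow> real \<Rightarrow> real \<Rightarrow> real \<Rightarrow> nat \<Rightarrow> real \<Rightarrow> real" where
  "meta S \<beta> D hf p q j \<eta> =
     (\<Sum>s\<in>spins S. s ^ j * weta \<beta> D hf p q \<eta> s) / (\<Sum>s\<in>spins S. weta \<beta> D hf p q \<eta> s)"

definition fixed_point :: "nat \<Rightarrow> real \<Rightarrow> real \<Rightarrow> real \<Rightarrow> real \<Rightarrow> real \<Rightarrow> bool" where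
  "fixed_point S \<beta> D hf p q \<longleftrightarrow>
     q = (\<integral>\<eta>. (meta S \<beta> D hf p q 1 \<eta>)\<^sup>2 \<partial>std_normal) \<and>
     p = (\<integral>\<eta>. meta S \<beta> D hf p q 2 \<eta> \<partial>std_normal)"

definition cD :: "nat \<Rightarrow> real \<Rightarrow> real \<Rightarrow> real \<Rightarrow> real \<Rightarrow> real \<Rightarrow> real" where
  "cD S \<beta> D hf p q = (\<integral>\<eta>. meta S \<beta> D hf p q 4 \<eta> - (meta S \<beta> D hf p q 2 \<eta>)\<^sup>2 \<partial>std_normal)"

definition cF :: "nat \<Rightarrow> real \<Rightarrow> real \<Rightarrow> real \<Rightarrow> real \<Rightarrow> real \<Rightarrow> real" where
  "cF S \<beta> D hf p q = (\<integral>\<eta>. (meta S \<beta> D hf p q 2 \<eta>)\<^sup>2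
      - (meta S \<beta> D hf p q 1 \<eta>)\<^sup>2 * meta S \<beta> D hf p q 2 \<eta> \<partial>std_normal)"

definition cG :: "nat \<Rightarrow> real \<Rightarrow> real \<Rightarrow> real \<Rightarrow> real \<Rightarrow> real \<Rightarrow> real" where
  "cG S \<beta> D hf p q = (\<integral>\<eta>. (meta S \<beta> D hf p q 1 \<eta>)\<^sup>2
      * (meta S \<beta> D hf p q 2 \<eta> - (meta S \<beta> D hf p q 1 \<eta>)\<^sup>2) \<partial>std_normal)"

definition cE :: "nat \<Rightarrow> real \<Rightarrow> real \<Rightarrow> real \<Rightarrow> real \<Rightarrow> real \<Rightarrow> real" where
  "cE S \<beta> D hf p q = (\<integral>\<eta>. meta S \<beta> D hf p q 1 \<eta>
      * (meta S \<beta> D hf p q 3 \<eta> - meta S \<beta> D hf p q 1 \<eta> * meta S \<beta> D hf p q 2 \<eta>) \<partial>std_normal)"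

definition cM1 :: "nat \<Rightarrow> real \<Rightarrow> real \<Rightarrow> real \<Rightarrow> real \<Rightarrow> real \<Rightarrow> real" where
  "cM1 S \<beta> D hf p q = 1 - \<beta>\<^sup>2 * (cF S \<beta> D hf p q - 3 * cG S \<beta> D hf p q)"

definition cM2 :: "nat \<Rightarrow> real \<Rightarrow> real \<Rightarrow> real \<Rightarrow> real \<Rightarrow> real \<Rightarrow> real" where
  "cM2 S \<beta> D hf p q = 1 - \<beta>\<^sup>2 / 2 * cD S \<beta> D hf p q"

definition cM3 :: "nat \<Rightarrow> real \<Rightarrow> real \<Rightarrow> real \<Rightarrow> real \<Rightarrow> real \<Rightarrow> real" where
  "cM3 S \<beta> D hf p q = 1 - \<beta>\<^sup>2 * (cF S \<beta> D hf p q - cG S \<beta> D hf p q)"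

definition cM :: "nat \<Rightarrow> real \<Rightarrow> real \<Rightarrow> real \<Rightarrow> real \<Rightarrow> real \<Rightarrow> real" where
  "cM S \<beta> D hf p q = cM1 S \<beta> D hf p q * cM2 S \<beta> D hf p q + \<beta> ^ 4 * (cE S \<beta> D hf p q)\<^sup>2"

text \<open>A_1^2, B_1^2, C_1^2 (entries of Sigma_1; "C_1^2" is just a name, it may be negative).\<close>
definition A1sq :: "nat \<Rightarrow> real \<Rightarrow> real \<Rightarrow> real \<Rightarrow> real \<Rightarrow> real \<Rightarrow> nat \<Rightarrow> real" where
  "A1sq S \<beta> D hf p q N =
     (cG S \<beta> D hf p q * cM2 S \<beta> D hf p q + \<beta>\<^sup>2 / 2 * (cE S \<beta> D hf p q)\<^sup>2)
     / (real N * cM S \<beta> D hf p q * cM3 S \<beta> D hf p q)"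

definition B1sq :: "nat \<Rightarrow> real \<Rightarrow> real \<Rightarrow> real \<Rightarrow> real \<Rightarrow> real \<Rightarrow> nat \<Rightarrow> real" where
  "B1sq S \<beta> D hf p q N =
     (cD S \<beta> D hf p q * cM1 S \<beta> D hf p q - 2 * \<beta>\<^sup>2 * (cE S \<beta> D hf p q)\<^sup>2)
     / (real N * cM S \<beta> D hf p q)"

definition C1sq :: "nat \<Rightarrow> real \<Rightarrow> real \<Rightarrow> real \<Rightarrow> real \<Rightarrow> real \<Rightarrow> nat \<Rightarrow> real" where
  "C1sq S \<beta> D hf p q N = cE S \<beta> D hf p q / (real N * cM S \<beta> D hf p q)"

text \<open>(X,Y) is a centered Gaussian vector with covariance matrix [[s11,s12],[s12,s22]]:
  every linear combination uX+vY is centered normal with variance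
  u^2 s11 + 2uv s12 + v^2 s22 (degenerate variance 0 meaning a.s. equal to 0).\<close>
definition centered_gaussian_pair ::
  "'a measure \<Rightarrow> ('a \<Rightarrow> real) \<Rightarrow> ('a \<Rightarrow> real) \<Rightarrow> real \<Rightarrow> real \<Rightarrow> real \<Rightarrow> bool" where
  "centered_gaussian_pair M X Y s11 s12 s22 \<longleftrightarrow>
     prob_space M \<and> X \<in> borel_measurable M \<and> Y \<in> borel_measurable M \<and>
     (\<forall>u v. let s = u\<^sup>2 * s11 + 2 * u * v * s12 + v\<^sup>2 * s22 in
        s \<ge> 0 \<and>
        (if s = 0 then (AE \<omega> in M. u * X \<omega> + v * Y \<omega> = 0)
         else distributed M lborel (\<lambda>\<omega>. u * X \<omega> + v * Y \<omega>) (normal_density 0 (sqrt s))))"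

end

theory Submission
  imports Defs "HOL-Computational_Algebra.Polynomial"
begin

text \<open>
  The proof is by the cavity method. Replacing the quenched averages in \<open>T\<^sub>k\<close>, \<open>S\<^sub>k\<close>, \<open>T\<close>, \<open>S\<close> by fresh
  replicas turns the moment into the expectation of a product of site averages of functions of a few
  replicated spins. By symmetry between the sites, one factor may be evaluated at a single site \<open>i\<close>.
  The couplings of site \<open>i\<close> are interpolated to an independent Gaussian field of variance \<open>\<beta>\<^sup>2 q\<close>,
  and Gaussian integration by parts expresses the derivatives through the overlaps. For small \<open>\<beta>\<close>
  the interpolation first gives \<open>\<nu>(\<bar>R\<^sub>k\<^sub>l - E R\<^sub>k\<^sub>l\<bar>\<^sup>2\<^sup>m) = O(N\<^sup>-\<^sup>m)\<close> by induction on \<open>m\<close>. Then a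
  first-order expansion at the decoupled end shows that \<open>\<nu>(T\<^sub>k P)\<close> and \<open>\<nu>(S\<^sub>k P)\<close>, for a product \<open>P\<close>
  of the other factors, solve up to \<open>O(N powr (-(deg P + 2)/2))\<close> a linear system with determinants \<open>M\<close>
  and \<open>M\<^sub>3\<close>. Its solution is the Wick recursion for the covariance \<open>\<Sigma>\<^sub>1\<close>, so induction on the number
  of factors gives the claim.
\<close>

section \<open>Averages over replicas\<close>

text \<open>Overlaps are centred at \<open>p\<close> and \<open>q\<close>, so the fixed-point
  equations say exactly that a centred spin product has mean zero at the decoupled site; this
  removes the zeroth-order term of every expansion. What remains in the concentration step contains
  a moment of the same order again, with a factor \<beta>^2 times a constant depending on
  \<open>S\<close> only. Smallness of \<beta> lets it be absorbed, and the constant is the same for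
  all orders. In the expansion of a mixed moment, differentiation creates overlaps with replicas
  that already occur in the other factors. The obstacle is that these cannot be exchanged with a
  fresh auxiliary replica. Their discrepancies are kept as further unknowns \<open>Z l\<close>, each
  with a scalar equation of its own with coefficient \<open>cM3\<close>; the moments with a T-factor
  and with an S-factor then obey a 2 by 2 system with determinant \<open>cM\<close>. Antisymmetry of
  each such factor between the observed replica and an auxiliary one makes most other coefficients
  vanish.\<close>

definition depends_on :: "'r set \<Rightarrow> (('r \<Rightarrow> 'c) \<Rightarrow> 'b) \<Rightarrow> bool" where
  "depends_on I F \<longleftrightarrow> (\<forall>\<rho> \<rho>'. (\<forall>k\<in>I. \<rho> k = \<rho>' k) \<longrightarrow> F \<rho> = F \<rho>')"

lemma depends_onD: "depends_on I F \<Longrightarrow> (\<And>k. k \<in> I \<Longrightarrow> \<rho> k = \<rho>' k) \<Longrightarrow> F \<rho> = F \<rho>'"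
  unfolding depends_on_def by blast

lemma depends_onI: "(\<And>\<rho> \<rho>'. (\<And>k. k \<in> I \<Longrightarrow> \<rho> k = \<rho>' k) \<Longrightarrow> F \<rho> = F \<rho>') \<Longrightarrow> depends_on I F"
  unfolding depends_on_def by blast

lemma depends_on_mono: "depends_on I F \<Longrightarrow> I \<subseteq> J \<Longrightarrow> depends_on J F"
  unfolding depends_on_def by blast

lemma depends_on_upd: "depends_on I F \<Longrightarrow> k \<notin> I \<Longrightarrow> F (\<rho>(k := \<sigma>)) = F \<rho>"
  by (rule depends_onD) auto

lemma depends_on_const [simp]: "depends_on I (\<lambda>_. c)"
  unfolding depends_on_def by simp

lemma depends_on_comp1: "depends_on I F \<Longrightarrow> depends_on I (\<lambda>\<rho>. u (F \<rho>))"
  unfolding depends_on_def by metis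

lemma depends_on_comp2:
  "depends_on I F \<Longrightarrow> depends_on I F' \<Longrightarrow> depends_on I (\<lambda>\<rho>. u (F \<rho>) (F' \<rho>))"
  unfolding depends_on_def by metis

lemma depends_on_coord: "k \<in> I \<Longrightarrow> depends_on I (\<lambda>\<rho>. u (\<rho> k))"
  unfolding depends_on_def by metis

lemma depends_on_sum:
  "(\<And>j. j \<in> J \<Longrightarrow> depends_on I (F j)) \<Longrightarrow> depends_on I (\<lambda>\<rho>. \<Sum>j\<in>J. F j \<rho>)"
  by (intro depends_onI sum.cong refl) (blast intro: depends_onD)

lemma depends_on_prod:
  "(\<And>j. j \<in> J \<Longrightarrow> depends_on I (F j)) \<Longrightarrow> depends_on I (\<lambda>\<rho>. \<Prod>j\<in>J. F j \<rho>)"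
  by (intro depends_onI prod.cong refl) (blast intro: depends_onD)

lemmas depends_on_times = depends_on_comp2[where u = "(*)"]
lemmas depends_on_plus = depends_on_comp2[where u = "(+)"]
lemmas depends_on_minus = depends_on_comp2[where u = "(-)"]
lemmas depends_on_divide = depends_on_comp2[where u = "(/)"]

lemmas depends_on_intros = depends_on_const depends_on_coord depends_on_sum depends_on_prod
  depends_on_times depends_on_plus depends_on_minus
  depends_on_divide depends_on_comp1[where u="\<lambda>x. x ^ n" for n]
  depends_on_comp1[where u=abs]

lemma sum_PiE_insert:
  fixes h :: "('r \<Rightarrow> 'c) \<Rightarrow> 'b::comm_monoid_add"
  assumes "k \<notin> I"
  shows "(\<Sum>\<rho>\<in>PiE (insert k I) \<Omega>. h \<rho>) = (\<Sum>\<sigma>\<in>\<Omega> k. \<Sum>\<rho>\<in>PiE I \<Omega>. h (\<rho>(k := \<sigma>)))"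
proof -
  have inj: "inj_on (\<lambda>(y, g). g(k := y)) (\<Omega> k \<times> PiE I \<Omega>)"
  proof (rule inj_onI, clarify)
    fix y g y' g' assume a: "g \<in> PiE I \<Omega>" "g' \<in> PiE I \<Omega>" "g(k := y) = g'(k := y')"
    from a(3) have "y = y'" by (metis fun_upd_same)
    moreover have "g = g'"
    proof
      fix x show "g x = g' x"
        using a assms by (cases "x = k") (auto simp: PiE_def extensional_def dest: fun_cong[of _ _ x])
    qed
    ultimately show "y = y' \<and> g = g'" by simp
  qed
  show ?thesis
    unfolding PiE_insert_eq by (subst sum.reindex[OF inj]) (simp add: sum.cartesian_product case_prod_unfold)
qed

text \<open>Replica labels and configurations have arbitrary types, so one notion serves for whole
  configurations, for cavity configurations and for the spins at a single site. Outside
  \<open>I\<close> a map in \<open>PiE\<close> is \<open>undefined\<close>; the condition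
  \<open>depends_on I F\<close> keeps that value out of play when replicas are added or
  renamed.\<close>

definition rep_avg :: "'c set \<Rightarrow> ('c \<Rightarrow> real) \<Rightarrow> 'r set \<Rightarrow> (('r \<Rightarrow> 'c) \<Rightarrow> real) \<Rightarrow> real" where
  "rep_avg \<Omega> G I F = (\<Sum>\<rho>\<in>PiE I (\<lambda>_. \<Omega>). (\<Prod>k\<in>I. G (\<rho> k)) * F \<rho>)"

lemma rep_avg_empty: "rep_avg \<Omega> G {} F = F (\<lambda>_. undefined)"
  by (simp add: rep_avg_def)

lemma rep_avg_insert:
  assumes "finite I" "k \<notin> I"
  shows "rep_avg \<Omega> G (insert k I) F = (\<Sum>\<sigma>\<in>\<Omega>. G \<sigma> * rep_avg \<Omega> G I (\<lambda>\<rho>. F (\<rho>(k := \<sigma>))))"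
  unfolding rep_avg_def sum_PiE_insert[OF assms(2)] sum_distrib_left
proof (intro sum.cong refl)
  fix \<sigma> \<rho> assume "\<rho> \<in> PiE I (\<lambda>_. \<Omega>)"
  have "(\<Prod>j\<in>I. G ((\<rho>(k := \<sigma>)) j)) = (\<Prod>j\<in>I. G (\<rho> j))"
    using assms(2) by (intro prod.cong) auto
  thus "(\<Prod>j\<in>insert k I. G ((\<rho>(k := \<sigma>)) j)) * F (\<rho>(k := \<sigma>)) = G \<sigma> * ((\<Prod>j\<in>I. G (\<rho> j)) * F (\<rho>(k := \<sigma>)))"
    using assms by simp
qed

lemma rep_avg_cong:
  assumes "\<And>\<rho>. \<rho> \<in> PiE I (\<lambda>_. \<Omega>) \<Longrightarrow> F \<rho> = F' \<rho>"
  shows "rep_avg \<Omega> G I F = rep_avg \<Omega> G I F'"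
  unfolding rep_avg_def using assms by (intro sum.cong) auto

lemma rep_avg_add: "rep_avg \<Omega> G I (\<lambda>\<rho>. F \<rho> + F' \<rho>) = rep_avg \<Omega> G I F + rep_avg \<Omega> G I F'"
  unfolding rep_avg_def by (simp add: algebra_simps sum.distrib)

lemma rep_avg_diff: "rep_avg \<Omega> G I (\<lambda>\<rho>. F \<rho> - F' \<rho>) = rep_avg \<Omega> G I F - rep_avg \<Omega> G I F'"
  unfolding rep_avg_def by (simp add: algebra_simps sum_subtractf)

lemma rep_avg_cmult: "rep_avg \<Omega> G I (\<lambda>\<rho>. c * F \<rho>) = c * rep_avg \<Omega> G I F"
  unfolding rep_avg_def by (simp add: algebra_simps sum_distrib_left)

lemma rep_avg_sum: "rep_avg \<Omega> G I (\<lambda>\<rho>. \<Sum>j\<in>J. F j \<rho>) = (\<Sum>j\<in>J. rep_avg \<Omega> G I (F j))"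
  unfolding rep_avg_def by (subst sum.swap) (simp add: sum_distrib_left)

lemma rep_avg_minus: "rep_avg \<Omega> G I (\<lambda>\<rho>. - F \<rho>) = - rep_avg \<Omega> G I F"
  using rep_avg_cmult[of \<Omega> G I "-1" F] by simp

locale prob_weights =
  fixes \<Omega> :: "'c set" and G :: "'c \<Rightarrow> real"
  assumes fin: "finite \<Omega>" and nonneg: "\<And>\<sigma>. \<sigma> \<in> \<Omega> \<Longrightarrow> G \<sigma> \<ge> 0" and total: "(\<Sum>\<sigma>\<in>\<Omega>. G \<sigma>) = 1"
begin

abbreviation "avg \<equiv> rep_avg \<Omega> G"

lemma avg_mono:
  assumes "\<And>\<rho>. \<rho> \<in> PiE I (\<lambda>_. \<Omega>) \<Longrightarrow> F \<rho> \<le> F' \<rho>"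
  shows "avg I F \<le> avg I F'"
  unfolding rep_avg_def using assms
  by (intro sum_mono mult_left_mono prod_nonneg) (auto intro!: nonneg)

text \<open>Replicas are independent given the disorder, so replica \<open>k\<close> may be drawn
  again without changing the average. Redrawing auxiliary replicas is what later turns them back
  into quenched averages.\<close>

lemma avg_resample:
  assumes "finite I" "k \<in> I"
  shows "avg I F = avg I (\<lambda>\<rho>. \<Sum>\<sigma>\<in>\<Omega>. G \<sigma> * F (\<rho>(k := \<sigma>)))"
proof -
  define I' where "I' = I - {k}"
  have I: "I = insert k I'" "k \<notin> I'" "finite I'" using assms by (auto simp: I'_def)
  show ?thesis
    unfolding I(1) rep_avg_insert[OF I(3,2)]
    by (simp add: rep_avg_sum rep_avg_cmult flip: sum_distrib_right sum_distrib_left) (simp add: total)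
qed

lemma avg_const: "finite I \<Longrightarrow> avg I (\<lambda>_. c) = c"
proof (induction I rule: finite_induct)
  case empty thus ?case by (simp add: rep_avg_empty)
next
  case (insert k I)
  thus ?case by (simp add: rep_avg_insert total flip: sum_distrib_right)
qed

lemma avg_abs: "\<bar>avg I F\<bar> \<le> avg I (\<lambda>\<rho>. \<bar>F \<rho>\<bar>)"
  unfolding rep_avg_def
  by (intro order_trans[OF sum_abs] sum_mono) (auto simp: abs_mult PiE_def intro!: mult_right_mono prod_nonneg
      nonneg abs_of_nonneg[THEN eq_refl])

lemma avg_bound:
  assumes "finite I" "\<And>\<rho>. \<rho> \<in> PiE I (\<lambda>_. \<Omega>) \<Longrightarrow> \<bar>F \<rho>\<bar> \<le> B"
  shows "\<bar>avg I F\<bar> \<le> B"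
  using avg_abs[of I F] avg_mono[of I "\<lambda>\<rho>. \<bar>F \<rho>\<bar>" "\<lambda>_. B"] avg_const[of I B] assms by simp

lemma avg_pull:
  assumes "finite I" "k \<in> I" "\<And>\<rho> \<sigma>. f (\<rho>(k := \<sigma>)) = f \<rho>"
  shows "avg I (\<lambda>\<rho>. h (\<rho> k) * f \<rho>) = (\<Sum>\<sigma>\<in>\<Omega>. G \<sigma> * h \<sigma>) * avg I f"
  by (subst avg_resample[OF assms(1,2)])
     (simp add: assms(3) mult.assoc[symmetric] rep_avg_cmult flip: sum_distrib_right)

text \<open>Induction on \<open>I\<close> peels off a replica together with its image; labels
  outside the image of \<open>\<pi>\<close> integrate to 1. Injections cover permutations, which
  give the symmetry arguments, as well as enlargements of the set of replicas.\<close>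

lemma avg_reindex:
  assumes "finite I" "finite J" "inj_on \<pi> I" "\<pi> ` I \<subseteq> J" "depends_on I F"
  shows "avg J (\<lambda>\<rho>. F (\<lambda>k. \<rho> (\<pi> k))) = avg I F"
  using assms
proof (induction I arbitrary: J F rule: finite_induct)
  case empty
  have "F = (\<lambda>_. F (\<lambda>_. undefined))"
    using empty(4) by (intro ext) (auto simp: depends_on_def)
  hence "avg J (\<lambda>\<rho>. F (\<lambda>k. \<rho> (\<pi> k))) = avg J (\<lambda>_. F (\<lambda>_. undefined))"
    by metis
  thus ?case using empty by (simp add: avg_const rep_avg_empty)
next
  case (insert k I)
  define J' where "J' = J - {\<pi> k}"
  have J: "J = insert (\<pi> k) J'" "\<pi> k \<notin> J'" "finite J'" using insert.prems by (auto simp: J'_def)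
  have *: "avg J' (\<lambda>\<rho>. F (\<lambda>j. (\<rho>(\<pi> k := \<sigma>)) (\<pi> j))) = avg I (\<lambda>\<rho>. F (\<rho>(k := \<sigma>)))" for \<sigma>
  proof -
    have "F (\<lambda>j. (\<rho>(\<pi> k := \<sigma>)) (\<pi> j)) = F ((\<lambda>j. \<rho> (\<pi> j))(k := \<sigma>))" for \<rho>
      using insert.prems(2) insert.hyps(2) by (intro depends_onD[OF insert.prems(4)]) (auto simp: inj_on_def)
    moreover have "avg J' (\<lambda>\<rho>. F ((\<lambda>j. \<rho> (\<pi> j))(k := \<sigma>))) = avg I (\<lambda>\<rho>. F (\<rho>(k := \<sigma>)))"
    proof (rule insert.IH)
      show "\<pi> ` I \<subseteq> J'" using insert.prems(2,3) insert.hyps(2) by (auto simp: J'_def inj_on_def)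
      show "depends_on I (\<lambda>\<rho>. F (\<rho>(k := \<sigma>)))"
        by (intro depends_onI depends_onD[OF insert.prems(4)]) auto
    qed (use insert.prems J in auto)
    ultimately show ?thesis by simp
  qed
  show ?case
    unfolding J(1) rep_avg_insert[OF J(3,2)] rep_avg_insert[OF insert.hyps(1,2)] by (simp only: *)
qed

lemma avg_extend:
  assumes "finite J" "I \<subseteq> J" "depends_on I F"
  shows "avg J F = avg I F"
  using avg_reindex[of I J "\<lambda>x. x" F] assms finite_subset[OF assms(2,1)] by simp

end

definition gibbs_weight :: "'c set \<Rightarrow> ('c \<Rightarrow> real) \<Rightarrow> 'c \<Rightarrow> real" where
  "gibbs_weight \<Omega> H \<sigma> = exp (H \<sigma>) / (\<Sum>\<tau>\<in>\<Omega>. exp (H \<tau>))"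

lemma sum_exp_pos: "finite \<Omega> \<Longrightarrow> \<Omega> \<noteq> {} \<Longrightarrow> (\<Sum>\<tau>\<in>\<Omega>. exp (H \<tau> :: real)) > 0"
  by (intro sum_pos) auto

lemma prob_weights_gibbs:
  assumes "finite \<Omega>" "\<Omega> \<noteq> {}"
  shows "prob_weights \<Omega> (gibbs_weight \<Omega> H)"
proof
  show "(\<Sum>\<sigma>\<in>\<Omega>. gibbs_weight \<Omega> H \<sigma>) = 1"
    using sum_exp_pos[OF assms, of H] by (simp add: gibbs_weight_def flip: sum_divide_distrib)
qed (use assms in \<open>auto simp: gibbs_weight_def intro!: divide_nonneg_nonneg sum_nonneg\<close>)

text \<open>The derivative of an average over \<open>n\<close> replicas is an average over \<open>n + 1\<close> replicas, in which
  the new replica \<open>n\<close> carries the weight \<open>-n\<close> that comes from differentiating the partition functions.\<close>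

definition rsgn :: "nat \<Rightarrow> nat \<Rightarrow> real" where
  "rsgn n k = (if k < n then 1 else if k = n then - real n else 0)"

lemma rep_avg_gibbs_deriv:
  fixes H H' :: "real \<Rightarrow> 'c \<Rightarrow> real"
  assumes \<Omega>: "finite \<Omega>" "\<Omega> \<noteq> {}"
    and H: "\<And>\<sigma>. \<sigma> \<in> \<Omega> \<Longrightarrow> ((\<lambda>t. H t \<sigma>) has_real_derivative h \<sigma>) (at t)"
    and F: "depends_on {..<n} F"
  shows "((\<lambda>t. rep_avg \<Omega> (gibbs_weight \<Omega> (H t)) {..<n} F) has_real_derivative
     rep_avg \<Omega> (gibbs_weight \<Omega> (H t)) {..<Suc n} (\<lambda>\<rho>. F \<rho> * (\<Sum>k<Suc n. rsgn n k * h (\<rho> k)))) (at t)"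
proof -
  let ?G = "gibbs_weight \<Omega> (H t)"
  interpret prob_weights \<Omega> ?G by (rule prob_weights_gibbs[OF \<Omega>])
  define m where "m = (\<Sum>\<sigma>\<in>\<Omega>. ?G \<sigma> * h \<sigma>)"
  have dG: "((\<lambda>t. gibbs_weight \<Omega> (H t) \<sigma>) has_real_derivative ?G \<sigma> * (h \<sigma> - m)) (at t)" if "\<sigma> \<in> \<Omega>" for \<sigma>
  proof -
    define Z where "Z = (\<Sum>\<tau>\<in>\<Omega>. exp (H t \<tau>))"
    have Z: "Z > 0" unfolding Z_def by (rule sum_exp_pos[OF \<Omega>])
    have dZ: "((\<lambda>t. \<Sum>\<tau>\<in>\<Omega>. exp (H t \<tau>)) has_real_derivative (\<Sum>\<tau>\<in>\<Omega>. exp (H t \<tau>) * h \<tau>)) (at t)"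
      by (intro DERIV_sum DERIV_fun_exp H)
    have mZ: "(\<Sum>\<tau>\<in>\<Omega>. exp (H t \<tau>) * h \<tau>) = m * Z"
      using Z by (simp add: m_def gibbs_weight_def Z_def[symmetric] sum_divide_distrib[symmetric])
    have "((\<lambda>t. exp (H t \<sigma>) / (\<Sum>\<tau>\<in>\<Omega>. exp (H t \<tau>))) has_real_derivative
       (exp (H t \<sigma>) * h \<sigma> * Z - exp (H t \<sigma>) * (m * Z)) / (Z * Z)) (at t)"
      using DERIV_divide[OF DERIV_fun_exp[OF H[OF that]] dZ] Z unfolding mZ Z_def[symmetric] by simp
    also have "(exp (H t \<sigma>) * h \<sigma> * Z - exp (H t \<sigma>) * (m * Z)) / (Z * Z) = ?G \<sigma> * (h \<sigma> - m)"
      using Z unfolding gibbs_weight_def Z_def[symmetric] by (simp add: field_simps)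
    finally show ?thesis by (simp add: gibbs_weight_def)
  qed
  have dprod: "((\<lambda>t. \<Prod>k<n. gibbs_weight \<Omega> (H t) (\<rho> k)) has_real_derivative
      (\<Prod>k<n. ?G (\<rho> k)) * (\<Sum>k<n. h (\<rho> k) - m)) (at t)" if "\<rho> \<in> PiE {..<n} (\<lambda>_. \<Omega>)" for \<rho>
  proof -
    have \<rho>: "\<rho> k \<in> \<Omega>" if "k < n" for k using \<open>\<rho> \<in> _\<close> that by auto
    have "((\<lambda>t. \<Prod>k<j. gibbs_weight \<Omega> (H t) (\<rho> k)) has_real_derivative
      (\<Prod>k<j. ?G (\<rho> k)) * (\<Sum>k<j. h (\<rho> k) - m)) (at t)" if "j \<le> n" for j
      using that
    proof (induction j)
      case 0 thus ?case by simp
    next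
      case (Suc j)
      have j: "\<rho> j \<in> \<Omega>" using Suc.prems by (intro \<rho>) simp
      have "(\<Prod>k<Suc j. ?G (\<rho> k)) * (\<Sum>k<Suc j. h (\<rho> k) - m) =
        (\<Prod>k<j. ?G (\<rho> k)) * (\<Sum>k<j. h (\<rho> k) - m) * ?G (\<rho> j) + ?G (\<rho> j) * (h (\<rho> j) - m) * (\<Prod>k<j. ?G (\<rho> k))"
        unfolding prod.lessThan_Suc sum.lessThan_Suc by (simp only: ring_distribs mult_ac)
      with DERIV_mult[OF Suc.IH dG[OF j]] Suc.prems show ?case
        unfolding prod.lessThan_Suc by simp
    qed
    thus ?thesis by blast
  qed
  have "((\<lambda>t. rep_avg \<Omega> (gibbs_weight \<Omega> (H t)) {..<n} F) has_real_derivative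
      avg {..<n} (\<lambda>\<rho>. (\<Sum>k<n. h (\<rho> k) - m) * F \<rho>)) (at t)"
    unfolding rep_avg_def mult.assoc[symmetric]
    by (intro DERIV_sum DERIV_cmult_right dprod)
  also have "avg {..<n} (\<lambda>\<rho>. (\<Sum>k<n. h (\<rho> k) - m) * F \<rho>) =
     avg {..<n} (\<lambda>\<rho>. (\<Sum>k<n. h (\<rho> k)) * F \<rho>) - real n * m * avg {..<n} F"
    by (simp add: sum_subtractf left_diff_distrib rep_avg_diff rep_avg_cmult)
  also have "avg {..<n} (\<lambda>\<rho>. (\<Sum>k<n. h (\<rho> k)) * F \<rho>) = avg {..<Suc n} (\<lambda>\<rho>. (\<Sum>k<n. h (\<rho> k)) * F \<rho>)"
    by (rule avg_extend[symmetric]) (auto intro!: depends_on_intros F)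
  also have "avg {..<n} F = avg {..<Suc n} F"
    by (rule avg_extend[symmetric]) (auto intro!: depends_on_intros F)
  also have "real n * m * avg {..<Suc n} F = avg {..<Suc n} (\<lambda>\<rho>. (real n * h (\<rho> n)) * F \<rho>)"
    using avg_pull[of "{..<Suc n}" n F "\<lambda>\<sigma>. real n * h \<sigma>"] depends_on_upd[OF F]
    by (simp add: m_def sum_distrib_left algebra_simps)
  also have "avg {..<Suc n} (\<lambda>\<rho>. (\<Sum>k<n. h (\<rho> k)) * F \<rho>) - avg {..<Suc n} (\<lambda>\<rho>. (real n * h (\<rho> n)) * F \<rho>)
     = avg {..<Suc n} (\<lambda>\<rho>. F \<rho> * (\<Sum>k<Suc n. rsgn n k * h (\<rho> k)))"
    by (simp add: rsgn_def algebra_simps flip: rep_avg_diff)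
  finally show ?thesis .
qed

lemma prob_space_std_normal: "prob_space std_normal"
  unfolding std_normal_def by (rule prob_space_normal_density) simp

section \<open>Gaussian integration by parts\<close>

lemma sets_std_normal [measurable_cong, simp]: "sets std_normal = sets borel"
  by (simp add: std_normal_def)

lemma space_std_normal [simp]: "space std_normal = UNIV"
  by (simp add: std_normal_def)

lemma integrable_std_normal_ident: "integrable std_normal (\<lambda>y. y)"
  unfolding std_normal_def using integrable_std_normal_moment[of 1]
  by (subst integrable_density) (auto simp: mult.commute)

lemma DERIV_std_normal_density:
  "(std_normal_density has_real_derivative - x * std_normal_density x) (at x)"
  unfolding std_normal_density_def by (auto intro!: derivative_eq_intros simp: field_simps)

lemma std_normal_density_at_infinity:
  "(std_normal_density \<longlongrightarrow> 0) at_top" "(std_normal_density \<longlongrightarrow> 0) at_bot"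
proof -
  have top: "filterlim (\<lambda>x::real. x\<^sup>2 / 2) at_top at_top"
    by (intro filterlim_at_top_mono[OF filterlim_ident] eventually_mono[OF eventually_ge_at_top[of 2]])
       (auto simp: power2_eq_square)
  have bot: "filterlim (\<lambda>x::real. x\<^sup>2 / 2) at_top at_bot"
    using filterlim_compose[OF top filterlim_uminus_at_top_at_bot] by simp
  have *: "(std_normal_density \<longlongrightarrow> 0) F" if "filterlim (\<lambda>x::real. x\<^sup>2 / 2) at_top F" for F
  proof -
    have "filterlim (\<lambda>x::real. - (x\<^sup>2 / 2)) at_bot F"
      using that by (simp add: filterlim_uminus_at_bot)
    hence "((\<lambda>x::real. exp (- (x\<^sup>2 / 2))) \<longlongrightarrow> 0) F"
      by (rule filterlim_compose[OF exp_at_bot])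
    hence "((\<lambda>x::real. (1 / sqrt (2 * pi)) * exp (- (x\<^sup>2 / 2))) \<longlongrightarrow> (1 / sqrt (2 * pi)) * 0) F"
      by (rule tendsto_mult[OF tendsto_const])
    thus ?thesis unfolding std_normal_density_def by simp
  qed
  show "(std_normal_density \<longlongrightarrow> 0) at_top" "(std_normal_density \<longlongrightarrow> 0) at_bot"
    by (rule *[OF top], rule *[OF bot])
qed

text \<open>The derivative of \<open>h\<close> times the density is the density times
  \<open>h' y - y * h y\<close>. Its integral over the line is the difference of the limits at the
  two ends, and both are 0 because \<open>h\<close> is bounded.\<close>

lemma gaussian_ibp:
  fixes h h' :: "real \<Rightarrow> real"
  assumes h: "\<And>y. (h has_real_derivative h' y) (at y)"
    and cont: "\<And>y. isCont h' y"
    and B: "\<And>y. \<bar>h y\<bar> \<le> B" and B': "\<And>y. \<bar>h' y\<bar> \<le> B'"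
  shows "(\<integral>y. y * h y \<partial>std_normal) = (\<integral>y. h' y \<partial>std_normal)"
proof -
  interpret prob_space std_normal by (rule prob_space_std_normal)
  have ch: "isCont h y" for y using h by (rule DERIV_isCont)
  have [measurable]: "h \<in> borel_measurable borel" "h' \<in> borel_measurable borel"
    using ch cont by (auto intro!: borel_measurable_continuous_onI continuous_at_imp_continuous_on)
  have i1: "integrable lborel (\<lambda>y. std_normal_density y * (y * h y))"
  proof (rule Bochner_Integration.integrable_bound)
    show "integrable lborel (\<lambda>y. B * (std_normal_density y * \<bar>y\<bar>))"
      using integrable_std_normal_moment_abs[of 1] by simp
    show "AE y in lborel. norm (std_normal_density y * (y * h y)) \<le> norm (B * (std_normal_density y * \<bar>y\<bar>))"
    proof (rule AE_I2)
      fix y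
      have "\<bar>h y\<bar> \<le> \<bar>B\<bar>" using B[of y] by linarith
      from mult_right_mono[OF this, of "\<bar>y\<bar> * std_normal_density y"]
      show "norm (std_normal_density y * (y * h y)) \<le> norm (B * (std_normal_density y * \<bar>y\<bar>))"
          by (simp add: abs_mult mult_ac)
    qed
  qed simp
  have i2: "integrable lborel (\<lambda>y. std_normal_density y * h' y)"
  proof (rule Bochner_Integration.integrable_bound)
    show "integrable lborel (\<lambda>y. B' * std_normal_density y)" by simp
    show "AE y in lborel. norm (std_normal_density y * h' y) \<le> norm (B' * std_normal_density y)"
    proof (rule AE_I2)
      fix y
      have "\<bar>h' y\<bar> \<le> \<bar>B'\<bar>" using B'[of y] by linarith
      from mult_right_mono[OF this, of "std_normal_density y"]
      show "norm (std_normal_density y * h' y) \<le> norm (B' * std_normal_density y)"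
          by (simp add: abs_mult mult_ac)
    qed
  qed simp
  let ?f = "\<lambda>y. std_normal_density y * h' y - std_normal_density y * (y * h y)"
  have lim: "((\<lambda>y. h y * std_normal_density y) \<longlongrightarrow> 0) F" if "(std_normal_density \<longlongrightarrow> 0) F" for F
  proof (rule Lim_null_comparison)
    show "\<forall>\<^sub>F y in F. norm (h y * std_normal_density y) \<le> B * std_normal_density y"
      using B by (intro always_eventually) (auto simp: abs_mult intro!: mult_right_mono)
    show "((\<lambda>y. B * std_normal_density y) \<longlongrightarrow> 0) F"
      using tendsto_mult[OF tendsto_const that, of B] by simp
  qed
  have "(LBINT y=-\<infinity>..\<infinity>. ?f y) = 0 - 0"
  proof (rule interval_integral_FTC_integrable[where F = "\<lambda>y. h y * std_normal_density y"])
    fix x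
    show "((\<lambda>y. h y * std_normal_density y) has_vector_derivative ?f x) (at x)"
      unfolding has_real_derivative_iff_has_vector_derivative[symmetric]
      using DERIV_mult[OF h[of x] DERIV_std_normal_density[of x]] by (simp add: algebra_simps)
    have "isCont std_normal_density x" by (rule DERIV_isCont[OF DERIV_std_normal_density])
    thus "isCont ?f x" using ch cont by (intro continuous_intros) auto
  next
    show "set_integrable lborel (einterval (-\<infinity>) \<infinity>) ?f"
      using i1 i2 by (simp add: set_integrable_def einterval_def)
  qed (auto simp: ereal_tendsto_simps intro!: lim std_normal_density_at_infinity)
  hence "(\<integral>y. ?f y \<partial>lborel) = 0"
    by (simp add: interval_lebesgue_integral_def set_lebesgue_integral_def einterval_def)
  hence "(\<integral>y. std_normal_density y * h' y \<partial>lborel) = (\<integral>y. std_normal_density y * (y * h y) \<partial>lborel)"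
    using i1 i2 by simp
  thus ?thesis unfolding std_normal_def
    by (subst (1 2) integral_density) auto
qed

text \<open>The mean value inequality bounds every difference quotient by the same \<open>B\<close>
  that dominates the derivative, so dominated convergence applies along each sequence tending to
  \<open>t0\<close>.\<close>

lemma DERIV_integral_dominated:
  fixes f f' :: "real \<Rightarrow> 'g \<Rightarrow> real"
  assumes t0: "t0 \<in> {a<..<b}"
    and int: "\<And>t. t \<in> {a<..<b} \<Longrightarrow> integrable M (f t)"
    and meas: "f' t0 \<in> borel_measurable M"
    and deriv: "\<And>t g. t \<in> {a<..<b} \<Longrightarrow> g \<in> space M \<Longrightarrow> ((\<lambda>t. f t g) has_real_derivative f' t g) (at t)"
    and bound: "\<And>t g. t \<in> {a<..<b} \<Longrightarrow> g \<in> space M \<Longrightarrow> \<bar>f' t g\<bar> \<le> B g"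
    and B: "integrable M B"
  shows "((\<lambda>t. \<integral>g. f t g \<partial>M) has_real_derivative (\<integral>g. f' t0 g \<partial>M)) (at t0)"
proof -
  have "((\<lambda>t. ((\<integral>g. f t g \<partial>M) - (\<integral>g. f t0 g \<partial>M)) / (t - t0)) \<longlongrightarrow> (\<integral>g. f' t0 g \<partial>M)) (at t0 within {a<..<b})"
    unfolding tendsto_at_iff_sequentially comp_def
  proof (intro allI impI)
    fix X :: "nat \<Rightarrow> real" assume X: "\<forall>i. X i \<in> {a<..<b} - {t0}" and lim: "X \<longlonglongrightarrow> t0"
    have eq: "((\<integral>g. f (X i) g \<partial>M) - (\<integral>g. f t0 g \<partial>M)) / (X i - t0) = (\<integral>g. (f (X i) g - f t0 g) / (X i - t0) \<partial>M)"
        for i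
      using X int[of "X i"] int[OF t0] by simp
    have "(\<lambda>i. \<integral>g. (f (X i) g - f t0 g) / (X i - t0) \<partial>M) \<longlonglongrightarrow> (\<integral>g. f' t0 g \<partial>M)"
    proof (rule integral_dominated_convergence[where w = B])
      show "(\<lambda>g. (f (X i) g - f t0 g) / (X i - t0)) \<in> borel_measurable M" for i
        using int[of "X i"] int[OF t0] X by auto
      show "AE g in M. (\<lambda>i. (f (X i) g - f t0 g) / (X i - t0)) \<longlonglongrightarrow> f' t0 g"
      proof (rule AE_I2)
        fix g assume "g \<in> space M"
        from deriv[OF t0 this] have "((\<lambda>t. (f t g - f t0 g) / (t - t0)) \<longlongrightarrow> f' t0 g) (at t0)"
          by (simp add: has_field_derivative_iff)
        hence "((\<lambda>t. (f t g - f t0 g) / (t - t0)) \<longlongrightarrow> f' t0 g) (at t0 within {a<..<b})"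
          by (simp add: at_within_open[OF t0 open_greaterThanLessThan])
        thus "(\<lambda>i. (f (X i) g - f t0 g) / (X i - t0)) \<longlonglongrightarrow> f' t0 g"
          unfolding tendsto_at_iff_sequentially comp_def using X lim by blast
      qed
      show "AE g in M. norm ((f (X i) g - f t0 g) / (X i - t0)) \<le> B g" for i
      proof (rule AE_I2)
        fix g assume g: "g \<in> space M"
        have "norm (f (X i) g - f t0 g) \<le> B g * norm (X i - t0)"
        proof (rule field_differentiable_bound[where S = "{a<..<b}" and f' = "\<lambda>t. f' t g"])
          show "((\<lambda>t. f t g) has_field_derivative f' t g) (at t within {a<..<b})" if "t \<in> {a<..<b}" for t
            using deriv[OF that g] by (rule has_field_derivative_at_within)
        qed (use X t0 bound g in auto)
        moreover have "X i - t0 \<noteq> 0" using X by auto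
        ultimately show "norm ((f (X i) g - f t0 g) / (X i - t0)) \<le> B g"
          by (simp add: divide_le_eq)
      qed
    qed (use meas B in auto)
    thus "(\<lambda>i. ((\<integral>g. f (X i) g \<partial>M) - (\<integral>g. f t0 g \<partial>M)) / (X i - t0)) \<longlonglongrightarrow> (\<integral>g. f' t0 g \<partial>M)"
      unfolding eq .
  qed
  thus ?thesis by (simp add: has_field_derivative_iff at_within_open[OF t0 open_greaterThanLessThan])
qed

lemma continuous_on_integral_bounded:
  fixes f :: "real \<Rightarrow> 'g \<Rightarrow> real"
  assumes "finite_measure M" and meas: "\<And>t. t \<in> T \<Longrightarrow> f t \<in> borel_measurable M"
    and cont: "\<And>g. g \<in> space M \<Longrightarrow> continuous_on T (\<lambda>t. f t g)"
    and bound: "\<And>t g. t \<in> T \<Longrightarrow> g \<in> space M \<Longrightarrow> \<bar>f t g\<bar> \<le> B"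
  shows "continuous_on T (\<lambda>t. \<integral>g. f t g \<partial>M)"
  unfolding continuous_on_def
proof
  fix t assume t: "t \<in> T"
  interpret finite_measure M by fact
  show "((\<lambda>t. \<integral>g. f t g \<partial>M) \<longlongrightarrow> (\<integral>g. f t g \<partial>M)) (at t within T)"
    unfolding tendsto_at_iff_sequentially comp_def
  proof (intro allI impI)
    fix X assume X: "\<forall>i. X i \<in> T - {t}" and lim: "X \<longlonglongrightarrow> t"
    show "(\<lambda>i. \<integral>g. f (X i) g \<partial>M) \<longlonglongrightarrow> (\<integral>g. f t g \<partial>M)"
    proof (rule integral_dominated_convergence[where w = "\<lambda>_. B"])
      show "AE g in M. (\<lambda>i. f (X i) g) \<longlonglongrightarrow> f t g"
      proof (rule AE_I2)
        fix g assume "g \<in> space M"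
        from cont[OF this] t have "((\<lambda>t. f t g) \<longlongrightarrow> f t g) (at t within T)"
          by (auto simp: continuous_on_def)
        thus "(\<lambda>i. f (X i) g) \<longlonglongrightarrow> f t g"
          unfolding tendsto_at_iff_sequentially comp_def using X lim by blast
      qed
    qed (use X t meas bound in \<open>auto intro!: AE_I2\<close>)
  qed
qed

section \<open>Gibbs averages under Hamiltonians linear in Gaussian variables\<close>

abbreviation gauss_prod :: "'k set \<Rightarrow> ('k \<Rightarrow> real) measure" where
  "gauss_prod K \<equiv> PiM K (\<lambda>_. std_normal)"

interpretation gauss: product_sigma_finite "\<lambda>_::'k. std_normal"
  by (simp add: product_sigma_finite_def prob_space_imp_sigma_finite prob_space_std_normal)

lemma prob_space_gauss_prod: "prob_space (gauss_prod K)"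
  by (intro prob_space_PiM prob_space_std_normal)

lemma integrable_gauss_prod_coord:
  assumes "finite K" "\<kappa> \<in> K" shows "integrable (gauss_prod K) (\<lambda>g. g \<kappa>)"
proof -
  have "distr (gauss_prod K) std_normal (\<lambda>g. g \<kappa>) = std_normal"
    using distr_PiM_component[of K "\<lambda>_. std_normal" \<kappa>] assms by (auto intro: prob_space_std_normal)
  moreover have "integrable (distr (gauss_prod K) std_normal (\<lambda>g. g \<kappa>)) (\<lambda>y. y) \<longleftrightarrow>
      integrable (gauss_prod K) (\<lambda>g. g \<kappa>)"
    using assms by (intro integrable_distr_eq) auto
  ultimately show ?thesis using integrable_std_normal_ident by simp
qed

lemma measurable_gauss_coord [measurable (raw)]:
  "\<kappa> \<in> K \<Longrightarrow> (\<lambda>g. g \<kappa>) \<in> borel_measurable (gauss_prod K)"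
  using measurable_component_singleton[of \<kappa> K "\<lambda>_. std_normal"] by (simp cong: measurable_cong_sets)

text \<open>Both the model and its interpolation have this shape: \<open>c\<close> carries
  everything multiplied by a Gaussian variable, \<open>d\<close> the deterministic fields. The
  derivative can thus be computed before the couplings are specified.\<close>

definition lin_ham :: "'k set \<Rightarrow> ('k \<Rightarrow> 'c \<Rightarrow> real) \<Rightarrow> ('c \<Rightarrow> real) \<Rightarrow> ('k \<Rightarrow> real) \<Rightarrow> 'c \<Rightarrow> real" where
  "lin_ham K c d g \<sigma> = (\<Sum>\<kappa>\<in>K. g \<kappa> * c \<kappa> \<sigma>) + d \<sigma>"

lemma measurable_lin_ham [measurable]: "(\<lambda>g. lin_ham K c d g \<sigma>) \<in> borel_measurable (gauss_prod K)"
  unfolding lin_ham_def by (intro borel_measurable_add borel_measurable_sum borel_measurable_times) auto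

lemma measurable_rep_avg_gibbs [measurable]:
  "(\<lambda>g. rep_avg \<Omega> (gibbs_weight \<Omega> (lin_ham K c d g)) I F) \<in> borel_measurable (gauss_prod K)"
  unfolding rep_avg_def gibbs_weight_def by measurable

lemma depends_on_bounded:
  fixes F :: "('r \<Rightarrow> 'c) \<Rightarrow> real"
  assumes "finite I" "finite \<Omega>" "depends_on I F"
  obtains B where "B \<ge> 0" "\<And>\<rho>. (\<And>k. k \<in> I \<Longrightarrow> \<rho> k \<in> \<Omega>) \<Longrightarrow> \<bar>F \<rho>\<bar> \<le> B"
proof
  let ?A = "(\<lambda>\<rho>. \<bar>F \<rho>\<bar>) ` PiE I (\<lambda>_. \<Omega>)"
  have fin: "finite ?A" using assms by (intro finite_imageI finite_PiE) auto
  show "Max (insert 0 ?A) \<ge> 0" using fin by simp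
  fix \<rho> assume \<rho>: "\<And>k. k \<in> I \<Longrightarrow> \<rho> k \<in> \<Omega>"
  have "F \<rho> = F (restrict \<rho> I)" by (rule depends_onD[OF assms(3)]) auto
  moreover have "restrict \<rho> I \<in> PiE I (\<lambda>_. \<Omega>)" using \<rho> by auto
  ultimately have "\<bar>F \<rho>\<bar> \<in> ?A" by auto
  thus "\<bar>F \<rho>\<bar> \<le> Max (insert 0 ?A)" using fin by (intro Max_ge) auto
qed

text \<open>The bound does not depend on \<open>H\<close>, since every Gibbs average is a convex
  combination of finitely many values. It therefore supplies constants for integration over the
  unbounded disorder.\<close>

lemma rep_avg_gibbs_bound:
  assumes "finite \<Omega>" "\<Omega> \<noteq> {}" "finite I" "depends_on I F"
  obtains B where "B \<ge> 0" "\<And>H. \<bar>rep_avg \<Omega> (gibbs_weight \<Omega> H) I F\<bar> \<le> B"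
proof -
  obtain B where B: "B \<ge> 0" "\<And>\<rho>. (\<And>k. k \<in> I \<Longrightarrow> \<rho> k \<in> \<Omega>) \<Longrightarrow> \<bar>F \<rho>\<bar> \<le> B"
    using depends_on_bounded assms by metis
  show ?thesis
  proof (rule that[OF B(1)])
    fix H
    interpret prob_weights \<Omega> "gibbs_weight \<Omega> H" by (rule prob_weights_gibbs) fact+
    show "\<bar>rep_avg \<Omega> (gibbs_weight \<Omega> H) I F\<bar> \<le> B"
      by (rule avg_bound) (use assms B in \<open>auto simp: PiE_def\<close>)
  qed
qed

lemma isCont_gibbs_avg:
  fixes H :: "real \<Rightarrow> 'c \<Rightarrow> real"
  assumes "finite \<Omega>" "\<Omega> \<noteq> {}" "\<And>\<sigma>. \<sigma> \<in> \<Omega> \<Longrightarrow> continuous_on T (\<lambda>t. H t \<sigma>)"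
  shows "continuous_on T (\<lambda>t. rep_avg \<Omega> (gibbs_weight \<Omega> (H t)) I F)"
  unfolding rep_avg_def gibbs_weight_def using assms sum_exp_pos[OF assms(1,2)]
  by (intro continuous_intros) (auto simp: less_le intro: finite_PiE)

definition gauss_gibbs :: "'k set \<Rightarrow> 'c set \<Rightarrow> ('k \<Rightarrow> 'c \<Rightarrow> real) \<Rightarrow> ('c \<Rightarrow> real) \<Rightarrow> nat \<Rightarrow> ((nat \<Rightarrow> 'c) \<Rightarrow> real) \<Rightarrow> real"
    where
  "gauss_gibbs K \<Omega> c d n F = (\<integral>g. rep_avg \<Omega> (gibbs_weight \<Omega> (lin_ham K c d g)) {..<n} F \<partial>gauss_prod K)"

lemma integrable_gibbs_avg:
  fixes n :: nat
  assumes "finite \<Omega>" "\<Omega> \<noteq> {}" "depends_on {..<n} F"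
  shows "integrable (gauss_prod K) (\<lambda>g. rep_avg \<Omega> (gibbs_weight \<Omega> (lin_ham K c d g)) {..<n} F)"
proof -
  interpret prob_space "gauss_prod K" by (rule prob_space_gauss_prod)
  obtain B where "\<And>H. \<bar>rep_avg \<Omega> (gibbs_weight \<Omega> H) {..<n} F\<bar> \<le> B"
    using rep_avg_gibbs_bound[OF assms(1,2) finite_lessThan assms(3)] by metis
  thus ?thesis by (intro integrable_const_bound[where B = B]) auto
qed

lemma integrable_coord_gibbs_avg:
  fixes n :: nat
  assumes "finite \<Omega>" "\<Omega> \<noteq> {}" "depends_on {..<n} F" "finite K" "\<kappa> \<in> K"
  shows "integrable (gauss_prod K) (\<lambda>g. g \<kappa> * rep_avg \<Omega> (gibbs_weight \<Omega> (lin_ham K c d g)) {..<n} F)"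
proof -
  obtain B where B: "B \<ge> 0" "\<And>H. \<bar>rep_avg \<Omega> (gibbs_weight \<Omega> H) {..<n} F\<bar> \<le> B"
    using rep_avg_gibbs_bound[OF assms(1,2) finite_lessThan assms(3)] by metis
  show ?thesis
  proof (rule Bochner_Integration.integrable_bound)
    show "integrable (gauss_prod K) (\<lambda>g. B * g \<kappa>)"
      using integrable_gauss_prod_coord[OF assms(4,5)] by simp
    show "AE g in gauss_prod K. norm (g \<kappa> * rep_avg \<Omega> (gibbs_weight \<Omega> (lin_ham K c d g)) {..<n} F) \<le>
        norm (B * g \<kappa>)"
      using B by (auto simp: abs_mult mult.commute[of B] intro!: AE_I2 mult_left_mono)
  qed (use assms in measurable)
qed

lemma depends_on_rsgn_sum:
  assumes "depends_on {..<n} F" shows "depends_on {..<Suc n} (\<lambda>\<rho>. F \<rho> * (\<Sum>k<Suc n. rsgn n k * h (\<rho> k)))"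
  by (intro depends_on_times depends_on_mono[OF assms] depends_on_sum)
     (auto intro: depends_on_coord)

text \<open>Fubini isolates the variable \<open>\<kappa>\<close>, and \<open>gaussian_ibp\<close>
  applies with the others frozen. Along this variable the Hamiltonian has slope
  \<open>c \<kappa>\<close>, so \<open>rep_avg_gibbs_deriv\<close> gives the derivative at the price
  of one more replica.\<close>

lemma gauss_gibbs_ibp:
  assumes \<Omega>: "finite \<Omega>" "\<Omega> \<noteq> {}" and F: "depends_on {..<n} F" and K: "finite K" "\<kappa> \<in> K"
  shows "(\<integral>g. g \<kappa> * rep_avg \<Omega> (gibbs_weight \<Omega> (lin_ham K c d g)) {..<n} F \<partial>gauss_prod K)
     = gauss_gibbs K \<Omega> c d (Suc n) (\<lambda>\<rho>. F \<rho> * (\<Sum>k<Suc n. rsgn n k * c \<kappa> (\<rho> k)))" (is "?lhs = ?rhs")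
proof -
  define K' where "K' = K - {\<kappa>}"
  have K': "K = insert \<kappa> K'" "\<kappa> \<notin> K'" "finite K'" using K by (auto simp: K'_def)
  let ?F' = "\<lambda>\<rho>. F \<rho> * (\<Sum>k<Suc n. rsgn n k * c \<kappa> (\<rho> k))"
  have F': "depends_on {..<Suc n} ?F'" by (rule depends_on_rsgn_sum[OF F])
  define A where "A x y = rep_avg \<Omega> (gibbs_weight \<Omega> (lin_ham K c d (x(\<kappa> := y)))) {..<n} F" for x y
  define A' where "A' x y = rep_avg \<Omega> (gibbs_weight \<Omega> (lin_ham K c d (x(\<kappa> := y)))) {..<Suc n} ?F'" for x y
  obtain B where B: "\<And>H. \<bar>rep_avg \<Omega> (gibbs_weight \<Omega> H) {..<n} F\<bar> \<le> B"
    using rep_avg_gibbs_bound[OF \<Omega> finite_lessThan F] by metis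
  obtain B' where B': "\<And>H. \<bar>rep_avg \<Omega> (gibbs_weight \<Omega> H) {..<Suc n} ?F'\<bar> \<le> B'"
    using rep_avg_gibbs_bound[OF \<Omega> finite_lessThan F'] by metis
  have dH: "((\<lambda>y. lin_ham K c d (x(\<kappa> := y)) \<sigma>) has_real_derivative c \<kappa> \<sigma>) (at y)" for x y \<sigma>
  proof -
    have "lin_ham K c d (x(\<kappa> := y)) \<sigma> = y * c \<kappa> \<sigma> + ((\<Sum>j\<in>K'. x j * c j \<sigma>) + d \<sigma>)" for y
    proof -
      have "(\<Sum>j\<in>K'. (x(\<kappa> := y)) j * c j \<sigma>) = (\<Sum>j\<in>K'. x j * c j \<sigma>)"
        using K'(2) by (intro sum.cong) auto
      thus ?thesis unfolding lin_ham_def K'(1) using K' by simp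
    qed
    thus ?thesis by (auto intro!: derivative_eq_intros)
  qed
  have "?lhs = (\<integral>x. (\<integral>y. y * A x y \<partial>std_normal) \<partial>gauss_prod K')"
    using gauss.product_integral_insert[OF K'(3,2), of "\<lambda>g. g \<kappa> * rep_avg \<Omega> (gibbs_weight \<Omega> (lin_ham K c d g))
        {..<n} F"]
      integrable_coord_gibbs_avg[OF \<Omega> F K, of c d] unfolding A_def K'(1)[symmetric] by simp
  also have "\<dots> = (\<integral>x. (\<integral>y. A' x y \<partial>std_normal) \<partial>gauss_prod K')"
  proof (rule Bochner_Integration.integral_cong[OF refl], rule gaussian_ibp[where B = B and B' = B'])
    fix x y
    show "(A x has_real_derivative A' x y) (at y)"
      unfolding A_def A'_def by (rule rep_avg_gibbs_deriv[OF \<Omega> dH F])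
    have "continuous_on UNIV (A' x)"
      unfolding A'_def by (intro isCont_gibbs_avg \<Omega> continuous_at_imp_continuous_on ballI DERIV_isCont[OF dH])
    thus "isCont (A' x) y" by (simp add: continuous_on_eq_continuous_at)
    show "\<bar>A x y\<bar> \<le> B" "\<bar>A' x y\<bar> \<le> B'" unfolding A_def A'_def by (rule B B')+
  qed
  also have "\<dots> = ?rhs"
    using gauss.product_integral_insert[OF K'(3,2), of "\<lambda>g. rep_avg \<Omega> (gibbs_weight \<Omega> (lin_ham K c d g)) {..<Suc
        n} ?F'"]
      integrable_gibbs_avg[OF \<Omega> F', of K c d] unfolding A'_def K'(1)[symmetric] gauss_gibbs_def by simp
  finally show ?thesis .
qed

text \<open>Differentiating the Hamiltonian adds one replica and leaves factors
  \<open>g \<kappa>\<close>; integrating these by parts adds a second replica, whereas the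
  deterministic field needs only the first. The hypotheses are local, on an interval around
  \<open>t0\<close>, because the slopes of the cavity couplings blow up at the ends of the
  interpolation.\<close>

lemma gauss_gibbs_deriv:
  fixes c c' :: "real \<Rightarrow> 'k \<Rightarrow> 'c \<Rightarrow> real" and d d' :: "real \<Rightarrow> 'c \<Rightarrow> real"
  assumes \<Omega>: "finite \<Omega>" "\<Omega> \<noteq> {}" and F: "depends_on {..<n} F" and K: "finite K"
    and t0: "t0 \<in> {a<..<b}"
    and c: "\<And>t \<kappa> \<sigma>. t \<in> {a<..<b} \<Longrightarrow> \<kappa> \<in> K \<Longrightarrow> \<sigma> \<in> \<Omega> \<Longrightarrow> ((\<lambda>t. c t \<kappa> \<sigma>) has_real_derivative c' t \<kappa> \<sigma>) (at t)"
    and d: "\<And>t \<sigma>. t \<in> {a<..<b} \<Longrightarrow> \<sigma> \<in> \<Omega> \<Longrightarrow> ((\<lambda>t. d t \<sigma>) has_real_derivative d' t \<sigma>) (at t)"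
    and C: "\<And>t \<kappa> \<sigma>. t \<in> {a<..<b} \<Longrightarrow> \<kappa> \<in> K \<Longrightarrow> \<sigma> \<in> \<Omega> \<Longrightarrow> \<bar>c' t \<kappa> \<sigma>\<bar> \<le> C"
    and C': "\<And>t \<sigma>. t \<in> {a<..<b} \<Longrightarrow> \<sigma> \<in> \<Omega> \<Longrightarrow> \<bar>d' t \<sigma>\<bar> \<le> C"
  shows "((\<lambda>t. gauss_gibbs K \<Omega> (c t) (d t) n F) has_real_derivative
     (\<Sum>\<kappa>\<in>K. gauss_gibbs K \<Omega> (c t0) (d t0) (Suc (Suc n)) (\<lambda>\<rho>. F \<rho> * (\<Sum>k<Suc n. rsgn n k * c' t0 \<kappa> (\<rho> k))
            * (\<Sum>l<Suc (Suc n). rsgn (Suc n) l * c t0 \<kappa> (\<rho> l))))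
     + gauss_gibbs K \<Omega> (c t0) (d t0) (Suc n) (\<lambda>\<rho>. F \<rho> * (\<Sum>k<Suc n. rsgn n k * d' t0 (\<rho> k)))) (at t0)"
proof -
  let ?av = "\<lambda>t g. rep_avg \<Omega> (gibbs_weight \<Omega> (lin_ham K (c t) (d t) g))"
  define h where "h t g \<sigma> = (\<Sum>\<kappa>\<in>K. g \<kappa> * c' t \<kappa> \<sigma>) + d' t \<sigma>" for t g \<sigma>
  define f' where "f' t g = ?av t g {..<Suc n} (\<lambda>\<rho>. F \<rho> * (\<Sum>k<Suc n. rsgn n k * h t g (\<rho> k)))" for t g
  have Fk: "depends_on {..<Suc n} (\<lambda>\<rho>. F \<rho> * (\<Sum>k<Suc n. rsgn n k * w (\<rho> k)))" for w
    by (rule depends_on_rsgn_sum[OF F])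
  have f'_eq: "f' t g = (\<Sum>\<kappa>\<in>K. g \<kappa> * ?av t g {..<Suc n} (\<lambda>\<rho>. F \<rho> * (\<Sum>k<Suc n. rsgn n k * c' t \<kappa> (\<rho> k))))
      + ?av t g {..<Suc n} (\<lambda>\<rho>. F \<rho> * (\<Sum>k<Suc n. rsgn n k * d' t (\<rho> k)))" for t g
  proof -
    have s: "F \<rho> * (\<Sum>k<Suc n. rsgn n k * h t g (\<rho> k)) =
       (\<Sum>\<kappa>\<in>K. g \<kappa> * (F \<rho> * (\<Sum>k<Suc n. rsgn n k * c' t \<kappa> (\<rho> k)))) + F \<rho> * (\<Sum>k<Suc n. rsgn n k * d' t (\<rho> k))" for
           \<rho>
    proof -
      have "(\<Sum>k<Suc n. rsgn n k * h t g (\<rho> k)) = (\<Sum>k<Suc n. \<Sum>\<kappa>\<in>K. g \<kappa> * (rsgn n k * c' t \<kappa> (\<rho> k))) +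
          (\<Sum>k<Suc n. rsgn n k * d' t (\<rho> k))"
        unfolding h_def by (simp only: distrib_left sum.distrib sum_distrib_left mult.left_commute)
      also have "(\<Sum>k<Suc n. \<Sum>\<kappa>\<in>K. g \<kappa> * (rsgn n k * c' t \<kappa> (\<rho> k))) =
          (\<Sum>\<kappa>\<in>K. g \<kappa> * (\<Sum>k<Suc n. rsgn n k * c' t \<kappa> (\<rho> k)))"
        by (subst sum.swap) (simp only: sum_distrib_left)
      finally show ?thesis by (simp only: distrib_left sum_distrib_left mult.left_commute)
    qed
    show ?thesis unfolding f'_def s rep_avg_add rep_avg_sum rep_avg_cmult ..
  qed
  obtain B where B: "B \<ge> 0" "\<And>\<rho>. (\<And>k. k \<in> {..<n} \<Longrightarrow> \<rho> k \<in> \<Omega>) \<Longrightarrow> \<bar>F \<rho>\<bar> \<le> B"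
    using depends_on_bounded[OF finite_lessThan \<Omega>(1) F] by metis
  define S where "S = (\<Sum>k<Suc n. \<bar>rsgn n k\<bar>)"
  have S0: "S \<ge> 0" unfolding S_def by (intro sum_nonneg) auto
  have avb: "\<bar>?av t g {..<Suc n} (\<lambda>\<rho>. F \<rho> * (\<Sum>k<Suc n. rsgn n k * w (\<rho> k)))\<bar> \<le> B * (S * C)"
    if w: "\<And>\<sigma>. \<sigma> \<in> \<Omega> \<Longrightarrow> \<bar>w \<sigma>\<bar> \<le> C" for t g w
  proof -
    interpret prob_weights \<Omega> "gibbs_weight \<Omega> (lin_ham K (c t) (d t) g)" by (rule prob_weights_gibbs[OF \<Omega>])
    show ?thesis
    proof (rule avg_bound)
      fix \<rho> :: "nat \<Rightarrow> 'c" assume \<rho>: "\<rho> \<in> PiE {..<Suc n} (\<lambda>_. \<Omega>)"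
      have "\<bar>\<Sum>k<Suc n. rsgn n k * w (\<rho> k)\<bar> \<le> (\<Sum>k<Suc n. \<bar>rsgn n k\<bar> * C)"
        by (rule order_trans[OF sum_abs], rule sum_mono) (use \<rho> w in \<open>auto simp: abs_mult PiE_def Pi_def intro!:
            mult_left_mono\<close>)
      also have "\<dots> = S * C" unfolding S_def by (simp only: sum_distrib_right)
      finally have *: "\<bar>\<Sum>k<Suc n. rsgn n k * w (\<rho> k)\<bar> \<le> S * C" .
      have "\<rho> k \<in> \<Omega>" if "k \<in> {..<n}" for k
        using PiE_mem[OF \<rho>, of k] that by simp
      hence FB: "\<bar>F \<rho>\<bar> \<le> B" by (rule B(2))
      from FB * show "\<bar>F \<rho> * (\<Sum>k<Suc n. rsgn n k * w (\<rho> k))\<bar> \<le> B * (S * C)"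
        unfolding abs_mult by (rule mult_mono) (use B in auto)
    qed simp
  qed
  have "((\<lambda>t. \<integral>g. ?av t g {..<n} F \<partial>gauss_prod K) has_real_derivative (\<integral>g. f' t0 g \<partial>gauss_prod K)) (at t0)"
  proof (rule DERIV_integral_dominated[OF t0, where B = "\<lambda>g. (\<Sum>\<kappa>\<in>K. \<bar>g \<kappa>\<bar> * (B * (S * C))) + B * (S * C)"])
    show "integrable (gauss_prod K) (\<lambda>g. ?av t g {..<n} F)" for t
      by (rule integrable_gibbs_avg[OF \<Omega> F])
    show "f' t0 \<in> borel_measurable (gauss_prod K)"
      unfolding f'_eq[abs_def] by measurable
    show "((\<lambda>t. ?av t g {..<n} F) has_real_derivative f' t g) (at t)" if t: "t \<in> {a<..<b}" for t g
      unfolding f'_def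
    proof (rule rep_avg_gibbs_deriv[OF \<Omega> _ F])
      fix \<sigma> assume "\<sigma> \<in> \<Omega>"
      show "((\<lambda>t. lin_ham K (c t) (d t) g \<sigma>) has_real_derivative h t g \<sigma>) (at t)"
        unfolding lin_ham_def h_def
        by (intro DERIV_add DERIV_sum DERIV_cmult c d t) (use \<open>\<sigma> \<in> \<Omega>\<close> in auto)
    qed
    show "\<bar>f' t g\<bar> \<le> (\<Sum>\<kappa>\<in>K. \<bar>g \<kappa>\<bar> * (B * (S * C))) + B * (S * C)" if t: "t \<in> {a<..<b}" for t g
      unfolding f'_eq
      by (intro order_trans[OF abs_triangle_ineq] add_mono order_trans[OF sum_abs] sum_mono)
         (auto simp: abs_mult simp del: sum.lessThan_Suc intro!: mult_left_mono avb C C' t)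
    show "integrable (gauss_prod K) (\<lambda>g. (\<Sum>\<kappa>\<in>K. \<bar>g \<kappa>\<bar> * (B * (S * C))) + B * (S * C))"
    proof -
      interpret prob_space "gauss_prod K" by (rule prob_space_gauss_prod)
      show ?thesis using K
        by (intro Bochner_Integration.integrable_add Bochner_Integration.integrable_sum integrable_mult_left
            integrable_abs integrable_gauss_prod_coord) auto
    qed
  qed
  moreover have "(\<integral>g. f' t0 g \<partial>gauss_prod K) =
     (\<Sum>\<kappa>\<in>K. gauss_gibbs K \<Omega> (c t0) (d t0) (Suc (Suc n)) (\<lambda>\<rho>. F \<rho> * (\<Sum>k<Suc n. rsgn n k * c' t0 \<kappa> (\<rho> k))
            * (\<Sum>l<Suc (Suc n). rsgn (Suc n) l * c t0 \<kappa> (\<rho> l))))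
     + gauss_gibbs K \<Omega> (c t0) (d t0) (Suc n) (\<lambda>\<rho>. F \<rho> * (\<Sum>k<Suc n. rsgn n k * d' t0 (\<rho> k)))"
    unfolding f'_eq
    by (subst Bochner_Integration.integral_add, intro Bochner_Integration.integrable_sum
          integrable_coord_gibbs_avg \<Omega> Fk K, assumption, rule integrable_gibbs_avg[OF \<Omega> Fk],
        subst Bochner_Integration.integral_sum, rule integrable_coord_gibbs_avg[OF \<Omega> Fk K(1)], assumption)
       (simp only: gauss_gibbs_ibp[OF \<Omega> Fk K] gauss_gibbs_def[of _ _ _ _ "Suc n"] cong: sum.cong)
  ultimately show ?thesis unfolding gauss_gibbs_def[of _ _ _ _ n] by (simp only:)
qed

lemma gauss_gibbs_continuous:
  fixes c :: "real \<Rightarrow> 'k \<Rightarrow> 'c \<Rightarrow> real" and d :: "real \<Rightarrow> 'c \<Rightarrow> real"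
  assumes \<Omega>: "finite \<Omega>" "\<Omega> \<noteq> {}" and F: "depends_on {..<n} F"
    and c: "\<And>\<kappa> \<sigma>. continuous_on T (\<lambda>t. c t \<kappa> \<sigma>)"
    and d: "\<And>\<sigma>. continuous_on T (\<lambda>t. d t \<sigma>)"
  shows "continuous_on T (\<lambda>t. gauss_gibbs K \<Omega> (c t) (d t) n F)"
proof -
  interpret prob_space "gauss_prod K" by (rule prob_space_gauss_prod)
  obtain B where B: "\<And>H. \<bar>rep_avg \<Omega> (gibbs_weight \<Omega> H) {..<n} F\<bar> \<le> B"
    using rep_avg_gibbs_bound[OF \<Omega> finite_lessThan F] by metis
  show ?thesis unfolding gauss_gibbs_def
    by (rule continuous_on_integral_bounded[where B = B])
       (auto intro!: B isCont_gibbs_avg \<Omega> continuous_intros c d finite_measure_axioms simp: lin_ham_def)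
qed

context
  fixes K :: "'k set" and \<Omega> :: "'c set" and c :: "'k \<Rightarrow> 'c \<Rightarrow> real" and d :: "'c \<Rightarrow> real"
  assumes \<Omega>: "finite \<Omega>" "\<Omega> \<noteq> {}"
begin

lemma gauss_gibbs_add:
  assumes "depends_on {..<n} F" "depends_on {..<n} F'"
  shows "gauss_gibbs K \<Omega> c d n (\<lambda>\<rho>. F \<rho> + F' \<rho>) = gauss_gibbs K \<Omega> c d n F + gauss_gibbs K \<Omega> c d n F'"
  unfolding gauss_gibbs_def rep_avg_add
  by (intro Bochner_Integration.integral_add integrable_gibbs_avg \<Omega> assms)

lemma gauss_gibbs_cmult: "gauss_gibbs K \<Omega> c d n (\<lambda>\<rho>. r * F \<rho>) = r * gauss_gibbs K \<Omega> c d n F"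
  unfolding gauss_gibbs_def rep_avg_cmult by simp

lemma gauss_gibbs_diff:
  assumes "depends_on {..<n} F" "depends_on {..<n} F'"
  shows "gauss_gibbs K \<Omega> c d n (\<lambda>\<rho>. F \<rho> - F' \<rho>) = gauss_gibbs K \<Omega> c d n F - gauss_gibbs K \<Omega> c d n F'"
  unfolding gauss_gibbs_def rep_avg_diff
  by (intro Bochner_Integration.integral_diff integrable_gibbs_avg \<Omega> assms)

lemma gauss_gibbs_sum:
  assumes "\<And>j. j \<in> J \<Longrightarrow> depends_on {..<n} (F j)"
  shows "gauss_gibbs K \<Omega> c d n (\<lambda>\<rho>. \<Sum>j\<in>J. F j \<rho>) = (\<Sum>j\<in>J. gauss_gibbs K \<Omega> c d n (F j))"
  unfolding gauss_gibbs_def rep_avg_sum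
  by (intro Bochner_Integration.integral_sum integrable_gibbs_avg \<Omega> assms)

lemma gauss_gibbs_const: "gauss_gibbs K \<Omega> c d n (\<lambda>_. r) = r"
proof -
  interpret prob_space "gauss_prod K" by (rule prob_space_gauss_prod)
  show ?thesis unfolding gauss_gibbs_def
    by (simp add: prob_weights.avg_const[OF prob_weights_gibbs[OF \<Omega>]] prob_space)
qed

lemma gauss_gibbs_mono:
  assumes "depends_on {..<n} F" "depends_on {..<n} F'"
    and "\<And>\<rho>. \<rho> \<in> PiE {..<n} (\<lambda>_. \<Omega>) \<Longrightarrow> F \<rho> \<le> F' \<rho>"
  shows "gauss_gibbs K \<Omega> c d n F \<le> gauss_gibbs K \<Omega> c d n F'"
  unfolding gauss_gibbs_def
  by (intro integral_mono integrable_gibbs_avg \<Omega> assms prob_weights.avg_mono prob_weights_gibbs)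

lemma gauss_gibbs_cong:
  assumes "\<And>\<rho>. \<rho> \<in> PiE {..<n} (\<lambda>_. \<Omega>) \<Longrightarrow> F \<rho> = F' \<rho>"
  shows "gauss_gibbs K \<Omega> c d n F = gauss_gibbs K \<Omega> c d n F'"
  unfolding gauss_gibbs_def
  by (intro Bochner_Integration.integral_cong refl rep_avg_cong assms)

lemma gauss_gibbs_abs:
  assumes "depends_on {..<n} F"
  shows "\<bar>gauss_gibbs K \<Omega> c d n F\<bar> \<le> gauss_gibbs K \<Omega> c d n (\<lambda>\<rho>. \<bar>F \<rho>\<bar>)"
proof -
  have "- gauss_gibbs K \<Omega> c d n F \<le> gauss_gibbs K \<Omega> c d n (\<lambda>\<rho>. \<bar>F \<rho>\<bar>)"
    using gauss_gibbs_mono[of n "\<lambda>\<rho>. (-1) * F \<rho>" "\<lambda>\<rho>. \<bar>F \<rho>\<bar>"] gauss_gibbs_cmult[of n "-1" F]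
      depends_on_comp1[OF assms, of abs] depends_on_comp1[OF assms, of "\<lambda>x. (-1) * x"] by simp
  moreover have "gauss_gibbs K \<Omega> c d n F \<le> gauss_gibbs K \<Omega> c d n (\<lambda>\<rho>. \<bar>F \<rho>\<bar>)"
    by (intro gauss_gibbs_mono assms depends_on_comp1[OF assms, of abs]) auto
  ultimately show ?thesis by linarith
qed

lemma gauss_gibbs_reindex:
  assumes "inj_on \<pi> {..<n}" "\<pi> ` {..<n} \<subseteq> {..<m}" "depends_on {..<n} F"
  shows "gauss_gibbs K \<Omega> c d m (\<lambda>\<rho>. F (\<lambda>k. \<rho> (\<pi> k))) = gauss_gibbs K \<Omega> c d n F"
  unfolding gauss_gibbs_def
  by (intro Bochner_Integration.integral_cong refl prob_weights.avg_reindex[OF prob_weights_gibbs[OF \<Omega>]] assms)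
      auto

lemma gauss_gibbs_extend:
  assumes "n \<le> m" "depends_on {..<n} F"
  shows "gauss_gibbs K \<Omega> c d m F = gauss_gibbs K \<Omega> c d n F"
  using gauss_gibbs_reindex[of "\<lambda>x. x" n m F] assms by simp

end

section \<open>The spin model in the abstract setting\<close>

lemma finite_spins [simp]: "finite (spins S)"
  by (simp add: spins_def)

lemma zero_in_spins [simp]: "0 \<in> spins S"
  unfolding spins_def by (rule image_eqI[of _ _ 0]) auto

lemma spins_ne [simp]: "spins S \<noteq> {}"
  using zero_in_spins by blast

lemma spins_abs_le: "s \<in> spins S \<Longrightarrow> \<bar>s\<bar> \<le> real S"
  unfolding spins_def by auto

lemma finite_configs [simp]: "finite (configs S N)"
  unfolding configs_def by (intro finite_PiE) auto

lemma configs_ne [simp]: "configs S N \<noteq> {}"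
  unfolding configs_def by (simp add: PiE_eq_empty_iff)

lemma configs_spin: "\<sigma> \<in> configs S N \<Longrightarrow> i < N \<Longrightarrow> \<sigma> i \<in> spins S"
  unfolding configs_def by auto

lemma configs_abs_le: "\<sigma> \<in> configs S N \<Longrightarrow> i < N \<Longrightarrow> \<bar>\<sigma> i\<bar> \<le> real S"
  by (intro spins_abs_le configs_spin)

lemma finite_pairs [simp]: "finite (pairs N)"
  by (rule finite_subset[of _ "{..<N} \<times> {..<N}"]) (auto simp: pairs_def)

lemma disorder_eq: "disorder N = gauss_prod (pairs N)"
  by (simp add: disorder_def std_normal_def)

lemma gibbs_eq: "gibbs S \<beta> D hf N g = gibbs_weight (configs S N) (hamiltonian \<beta> D hf N g)"
  by (rule ext) (simp add: gibbs_def gibbs_weight_def)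

section \<open>The cavity interpolation\<close>

definition lav :: "((nat \<Rightarrow> real) \<Rightarrow> real) \<Rightarrow> nat \<Rightarrow> (nat \<Rightarrow> nat \<Rightarrow> real) \<Rightarrow> real" where
  "lav \<phi> N \<rho> = (\<Sum>j<N. \<phi> (\<lambda>k. \<rho> k j)) / real N"

definition site_free :: "nat \<Rightarrow> ((nat \<Rightarrow> nat \<Rightarrow> real) \<Rightarrow> real) \<Rightarrow> bool" where
  "site_free i F \<longleftrightarrow> (\<forall>\<rho> \<rho>'. (\<forall>k j. j \<noteq> i \<longrightarrow> \<rho> k j = \<rho>' k j) \<longrightarrow> F \<rho> = F \<rho>')"

lemma site_freeD: "site_free i F \<Longrightarrow> (\<And>k j. j \<noteq> i \<Longrightarrow> \<rho> k j = \<rho>' k j) \<Longrightarrow> F \<rho> = F \<rho>'"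
  unfolding site_free_def by blast

lemma depends_on_site: "depends_on I \<phi> \<Longrightarrow> depends_on I (\<lambda>\<rho>. \<phi> (\<lambda>k. \<rho> k j))"
  unfolding depends_on_def by simp

lemma depends_on_lav: "depends_on I \<phi> \<Longrightarrow> depends_on I (lav \<phi> N)"
  unfolding lav_def[abs_def] by (intro depends_on_divide depends_on_sum depends_on_site depends_on_const)

locale gs_model =
  fixes S :: nat and \<beta> D hf p q :: real
  assumes fp: "fixed_point S \<beta> D hf p q" and \<beta>_pos: "0 < \<beta>" and \<beta>_le1: "\<beta> \<le> 1"
begin

lemma q_nonneg: "q \<ge> 0"
proof -
  have "q = (\<integral>\<eta>. (meta S \<beta> D hf p q 1 \<eta>)\<^sup>2 \<partial>std_normal)" using fp by (simp add: fixed_point_def)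
  also have "\<dots> \<ge> 0" by (rule Bochner_Integration.integral_nonneg) simp
  finally show ?thesis .
qed

definition cpl :: "nat \<Rightarrow> nat \<Rightarrow> real \<Rightarrow> nat \<times> nat \<Rightarrow> (nat \<Rightarrow> real) \<Rightarrow> real" where
  "cpl N i t \<kappa> \<sigma> = (if fst \<kappa> = snd \<kappa> then \<beta> * sqrt q * sqrt (1 - t) * \<sigma> i
     else \<beta> / sqrt (real N) * (if fst \<kappa> = i \<or> snd \<kappa> = i then sqrt t else 1) * \<sigma> (fst \<kappa>) * \<sigma> (snd \<kappa>))"

text \<open>The last term corrects the diagonal: the auxiliary Gaussian field accounts for an
  overlap \<open>q\<close>, while a replica has overlap close to \<open>p\<close> with itself. With
  the correction the derivative in \<open>t\<close> contains self-overlaps centred at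
  \<open>p\<close>, and at \<open>t = 0\<close> the exponent at site \<open>i\<close> is that of
  \<open>weta\<close>.\<close>

definition fld :: "nat \<Rightarrow> nat \<Rightarrow> real \<Rightarrow> (nat \<Rightarrow> real) \<Rightarrow> real" where
  "fld N i t \<sigma> = D * (\<Sum>j<N. (\<sigma> j)\<^sup>2) + hf * (\<Sum>j<N. \<sigma> j) + (1 - t) * (\<beta>\<^sup>2 / 2 * (p - q) * (\<sigma> i)\<^sup>2)"

text \<open>The cavity interpolation at site \<open>i\<close>. The index \<open>(i, i)\<close>, which is not a pair, carries the
  Gaussian variable of the external field that replaces the couplings of site \<open>i\<close> as \<open>t\<close> decreases to 0.\<close>

definition nui :: "nat \<Rightarrow> nat \<Rightarrow> real \<Rightarrow> nat \<Rightarrow> ((nat \<Rightarrow> nat \<Rightarrow> real) \<Rightarrow> real) \<Rightarrow> real" where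
  "nui N i t = gauss_gibbs (insert (i, i) (pairs N)) (configs S N) (cpl N i t) (fld N i t)"

definition nun :: "nat \<Rightarrow> nat \<Rightarrow> ((nat \<Rightarrow> nat \<Rightarrow> real) \<Rightarrow> real) \<Rightarrow> real" where
  "nun N = gauss_gibbs (pairs N) (configs S N) (\<lambda>\<kappa> \<sigma>. \<beta> / sqrt (real N) * \<sigma> (fst \<kappa>) * \<sigma> (snd \<kappa>))
     (\<lambda>\<sigma>. D * (\<Sum>j<N. (\<sigma> j)\<^sup>2) + hf * (\<Sum>j<N. \<sigma> j))"

lemma ham_eq: "hamiltonian \<beta> D hf N g = lin_ham (pairs N) (\<lambda>\<kappa> \<sigma>. \<beta> / sqrt (real N) * \<sigma> (fst \<kappa>) * \<sigma> (snd \<kappa>))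
     (\<lambda>\<sigma>. D * (\<Sum>j<N. (\<sigma> j)\<^sup>2) + hf * (\<Sum>j<N. \<sigma> j)) g"
  by (rule ext) (simp add: hamiltonian_def lin_ham_def case_prod_beta sum_distrib_left mult_ac)

lemma nun_eq: "nun N n F = (\<integral>g. rep_avg (configs S N) (gibbs S \<beta> D hf N g) {..<n} F \<partial>disorder N)"
  unfolding nun_def gauss_gibbs_def disorder_eq gibbs_eq ham_eq ..

lemma diag_notin_pairs: "(i, i) \<notin> pairs N"
  by (simp add: pairs_def)

text \<open>The auxiliary variable enters with the factor \<open>sqrt (1 - t)\<close>. At
  \<open>t = 1\<close> the integrand is constant in it, and it integrates out.\<close>

lemma nui_1:
  assumes "depends_on {..<n} F"
  shows "nui N i 1 n F = nun N n F"
proof -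
  let ?f = "\<lambda>g. rep_avg (configs S N) (gibbs_weight (configs S N) (lin_ham (insert (i, i) (pairs N)) (cpl N i 1)
      (fld N i 1) g)) {..<n} F"
  have H: "lin_ham (insert (i, i) (pairs N)) (cpl N i 1) (fld N i 1) (x((i, i) := y)) = hamiltonian \<beta> D hf N x"
      for x y
  proof
    fix \<sigma>
    have "(\<Sum>\<kappa>\<in>pairs N. (x((i, i) := y)) \<kappa> * cpl N i 1 \<kappa> \<sigma>) =
        (\<Sum>\<kappa>\<in>pairs N. x \<kappa> * (\<beta> / sqrt (real N) * \<sigma> (fst \<kappa>) * \<sigma> (snd \<kappa>)))"
      by (intro sum.cong) (auto simp: cpl_def pairs_def)
    thus "lin_ham (insert (i, i) (pairs N)) (cpl N i 1) (fld N i 1) (x((i, i) := y)) \<sigma> =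
        hamiltonian \<beta> D hf N x \<sigma>"
      unfolding ham_eq lin_ham_def by (simp add: diag_notin_pairs cpl_def fld_def)
  qed
  interpret std: prob_space std_normal by (rule prob_space_std_normal)
  have "nui N i 1 n F = (\<integral>x. (\<integral>y. ?f (x((i, i) := y)) \<partial>std_normal) \<partial>gauss_prod (pairs N))"
    unfolding nui_def gauss_gibbs_def
    by (rule gauss.product_integral_insert) (auto intro!: integrable_gibbs_avg assms simp: diag_notin_pairs)
  also have "\<dots> = nun N n F"
    unfolding H nun_def gauss_gibbs_def ham_eq by (simp add: std.prob_space[simplified])
  finally show ?thesis .
qed

section \<open>The decoupled end of the interpolation\<close>

definition lexp :: "real \<Rightarrow> real \<Rightarrow> real" where
  "lexp \<eta> s = \<beta> * sqrt q * \<eta> * s + hf * s + (D + \<beta>\<^sup>2 / 2 * (p - q)) * s\<^sup>2"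

definition lw :: "real \<Rightarrow> real \<Rightarrow> real" where
  "lw \<eta> = gibbs_weight (spins S) (lexp \<eta>)"

text \<open>All \<open>n\<close> replicas of the spin share the same \<open>\<eta>\<close>, which is
  averaged last. Distinct replicas are thus independent only given \<open>\<eta>\<close>, and
  monomials turn into expectations of products of the moments \<open>m_j\<close>.\<close>

definition cc :: "nat \<Rightarrow> ((nat \<Rightarrow> real) \<Rightarrow> real) \<Rightarrow> real" where
  "cc n \<zeta> = (\<integral>\<eta>. rep_avg (spins S) (lw \<eta>) {..<n} \<zeta> \<partial>std_normal)"

text \<open>At \<open>t = 0\<close> every coupling of site \<open>i\<close> carries the factor
  \<open>sqrt 0\<close>, so the energy is the sum of a single-site part and a cavity part. The value
  0 put at \<open>(i, i)\<close> and at \<open>i\<close> only normalises the cavity part.\<close>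

lemma lin_ham_0_split:
  assumes "i < N"
  shows "lin_ham (insert (i, i) (pairs N)) (cpl N i 0) (fld N i 0) g (\<sigma>(i := s)) =
    lin_ham (insert (i, i) (pairs N)) (cpl N i 0) (fld N i 0) (g((i, i) := 0)) (\<sigma>(i := 0)) + lexp (g (i, i)) s"
proof -
  have 1: "(\<Sum>\<kappa>\<in>pairs N. g \<kappa> * cpl N i 0 \<kappa> (\<sigma>(i := s))) =
      (\<Sum>\<kappa>\<in>pairs N. (g((i, i) := 0)) \<kappa> * cpl N i 0 \<kappa> (\<sigma>(i := 0)))"
    by (intro sum.cong) (auto simp: cpl_def pairs_def)
  have 2: "(\<Sum>j<N. ((\<sigma>(i := s)) j)\<^sup>2) = s\<^sup>2 + (\<Sum>j\<in>{..<N} - {i}. (\<sigma> j)\<^sup>2)" for s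
    using assms by (subst sum.remove[of _ i]) auto
  have 3: "(\<Sum>j<N. (\<sigma>(i := s)) j) = s + (\<Sum>j\<in>{..<N} - {i}. \<sigma> j)" for s
    using assms by (subst sum.remove[of _ i]) auto
  show ?thesis
    unfolding lin_ham_def fld_def 2 3 sum.insert[OF finite_pairs diag_notin_pairs] 1
    by (simp add: cpl_def lexp_def algebra_simps)
qed

definition cav_sites :: "nat \<Rightarrow> nat \<Rightarrow> (nat \<Rightarrow> real) set" where
  "cav_sites N i = PiE ({..<N} - {i}) (\<lambda>_. spins S)"

definition cav_weight :: "nat \<Rightarrow> nat \<Rightarrow> (nat \<times> nat \<Rightarrow> real) \<Rightarrow> (nat \<Rightarrow> real) \<Rightarrow> real" where
  "cav_weight N i g = gibbs_weight (cav_sites N i)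
     (\<lambda>\<tau>. lin_ham (insert (i, i) (pairs N)) (cpl N i 0) (fld N i 0) (g((i, i) := 0)) (\<tau>(i := 0)))"

abbreviation G0 :: "nat \<Rightarrow> nat \<Rightarrow> (nat \<times> nat \<Rightarrow> real) \<Rightarrow> (nat \<Rightarrow> real) \<Rightarrow> real" where
  "G0 N i g \<equiv> gibbs_weight (configs S N) (lin_ham (insert (i, i) (pairs N)) (cpl N i 0) (fld N i 0) g)"

lemma sum_configs_split:
  assumes "i < N"
  shows "(\<Sum>\<sigma>\<in>configs S N. h \<sigma> :: real) = (\<Sum>s\<in>spins S. \<Sum>\<tau>\<in>cav_sites N i. h (\<tau>(i := s)))"
proof -
  have "configs S N = PiE (insert i ({..<N} - {i})) (\<lambda>_. spins S)"
    using assms by (simp add: configs_def insert_absorb)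
  thus ?thesis unfolding cav_sites_def by (simp only:) (rule sum_PiE_insert, simp)
qed

lemma G0_avg:
  assumes "i < N"
  shows "(\<Sum>\<sigma>\<in>configs S N. G0 N i g \<sigma> * f \<sigma>) =
    (\<Sum>s\<in>spins S. \<Sum>\<tau>\<in>cav_sites N i. lw (g (i, i)) s * cav_weight N i g \<tau> * f (\<tau>(i := s)))"
proof -
  define U where "U = (\<lambda>\<tau>. lin_ham (insert (i, i) (pairs N)) (cpl N i 0) (fld N i 0) (g((i, i) := 0)) (\<tau>(i :=
      0)))"
  let ?v = "lexp (g (i, i))" and ?H = "lin_ham (insert (i, i) (pairs N)) (cpl N i 0) (fld N i 0) g"
  have H: "exp (?H (\<tau>(i := s))) = exp (?v s) * exp (U \<tau>)" for \<tau> s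
    using lin_ham_0_split[OF assms, of g \<tau> s] by (simp add: U_def exp_add mult.commute)
  have Z: "(\<Sum>\<sigma>\<in>configs S N. exp (?H \<sigma>)) = (\<Sum>s\<in>spins S. exp (?v s)) * (\<Sum>\<tau>\<in>cav_sites N i. exp (U \<tau>))"
    unfolding sum_configs_split[OF assms] H by (simp only: sum_product)
  show ?thesis
    unfolding gibbs_weight_def Z lw_def cav_weight_def U_def[symmetric] unfolding sum_configs_split[OF assms] H
    by (simp only: times_divide_eq_left times_divide_eq_right divide_divide_eq_left mult_ac)
qed

text \<open>By \<open>G0_avg\<close> each replica has a product law, so the claim follows one
  replica at a time. Cavity configurations have no spin at \<open>i\<close>; the 0 written there is
  arbitrary because \<open>F\<close> is \<open>site_free\<close>.\<close>

lemma rep_avg_G0_factor: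
  assumes "i < N" "finite I" "depends_on I \<phi>" "depends_on I F" "site_free i F"
  shows "rep_avg (configs S N) (G0 N i g) I (\<lambda>\<rho>. \<phi> (\<lambda>k. \<rho> k i) * F \<rho>) =
    rep_avg (spins S) (lw (g (i, i))) I \<phi> * rep_avg (cav_sites N i) (cav_weight N i g) I
        (\<lambda>\<rho>. F (\<lambda>k. (\<rho> k)(i := 0)))"
  using assms(2-)
proof (induction I arbitrary: \<phi> F rule: finite_induct)
  case empty
  have "\<phi> (\<lambda>k. undefined i) = \<phi> (\<lambda>_. undefined)" "F (\<lambda>k. undefined(i := 0)) = F (\<lambda>_. undefined)"
    using empty by (auto simp: depends_on_def)
  thus ?case unfolding rep_avg_empty by (simp only:)
next
  case (insert k I)
  let ?L = "\<lambda>s. rep_avg (spins S) (lw (g (i, i))) I (\<lambda>\<epsilon>. \<phi> (\<epsilon>(k := s)))"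
  let ?R = "\<lambda>\<sigma>. rep_avg (cav_sites N i) (cav_weight N i g) I (\<lambda>\<rho>. F ((\<lambda>j. (\<rho> j)(i := 0))(k := \<sigma>)))"
  have IH: "rep_avg (configs S N) (G0 N i g) I (\<lambda>\<rho>. \<phi> (\<lambda>j. (\<rho>(k := \<sigma>)) j i) * F (\<rho>(k := \<sigma>))) = ?L (\<sigma> i) * ?R \<sigma>"
      for \<sigma>
  proof -
    have 1: "(\<lambda>j. (\<rho>(k := \<sigma>)) j i) = (\<lambda>j. \<rho> j i)(k := \<sigma> i)" for \<rho> :: "nat \<Rightarrow> nat \<Rightarrow> real" by auto
    have 2: "depends_on I (\<lambda>\<epsilon>. \<phi> (\<epsilon>(k := \<sigma> i)))"
      by (intro depends_onI depends_onD[OF insert.prems(1)]) auto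
    have 3: "depends_on I (\<lambda>\<rho>. F (\<rho>(k := \<sigma>)))"
      by (intro depends_onI depends_onD[OF insert.prems(2)]) auto
    have 4: "site_free i (\<lambda>\<rho>. F (\<rho>(k := \<sigma>)))"
      unfolding site_free_def by (intro allI impI site_freeD[OF insert.prems(3)]) auto
    show ?thesis unfolding 1 by (rule insert.IH[OF 2 3 4])
  qed
  have R: "?R (\<tau>(i := s)) = rep_avg (cav_sites N i) (cav_weight N i g) I (\<lambda>\<rho>. F (\<lambda>j. ((\<rho>(k := \<tau>)) j)(i := 0)))"
      for \<tau> s
    by (intro rep_avg_cong site_freeD[OF insert.prems(3)]) auto
  show ?case
    unfolding rep_avg_insert[OF insert.hyps] IH G0_avg[OF assms(1)] R
    by (simp add: sum_product mult_ac)
qed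

text \<open>The single-site factor involves only the variable at \<open>(i, i)\<close> and the
  cavity factor only the others, so their expectations multiply. The same identity with the constant
  1 in place of \<open>\<phi>\<close> identifies the second factor as
  \<open>nui N i 0 n F\<close>.\<close>

lemma nui_0_factor:
  assumes i: "i < N" and \<phi>: "depends_on {..<n} \<phi>" and F: "depends_on {..<n} F" "site_free i F"
  shows "nui N i 0 n (\<lambda>\<rho>. \<phi> (\<lambda>k. \<rho> k i) * F \<rho>) = cc n \<phi> * nui N i 0 n F"
proof -
  let ?L = "\<lambda>y. rep_avg (spins S) (lw y) {..<n} \<phi>"
  let ?R = "\<lambda>g. rep_avg (cav_sites N i) (cav_weight N i g) {..<n} (\<lambda>\<rho>. F (\<lambda>k. (\<rho> k)(i := 0)))"
  interpret std: prob_space std_normal by (rule prob_space_std_normal)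
  have av: "rep_avg (configs S N) (G0 N i g) {..<n} (\<lambda>\<rho>. \<zeta> (\<lambda>k. \<rho> k i) * F \<rho>) =
      rep_avg (spins S) (lw (g (i, i))) {..<n} \<zeta> * ?R g"
    if "depends_on {..<n} \<zeta>" for \<zeta> g
    by (rule rep_avg_G0_factor[OF i finite_lessThan that F])
  have Rx: "?R (x((i, i) := y)) = ?R x" for x y
    unfolding cav_weight_def by simp
  have *: "nui N i 0 n (\<lambda>\<rho>. \<zeta> (\<lambda>k. \<rho> k i) * F \<rho>) = cc n \<zeta> * (\<integral>x. ?R x \<partial>gauss_prod (pairs N))"
    if \<zeta>: "depends_on {..<n} \<zeta>" for \<zeta>
  proof -
    have "nui N i 0 n (\<lambda>\<rho>. \<zeta> (\<lambda>k. \<rho> k i) * F \<rho>) =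
       (\<integral>x. (\<integral>y. rep_avg (configs S N) (G0 N i (x((i, i) := y))) {..<n} (\<lambda>\<rho>. \<zeta> (\<lambda>k. \<rho> k i) * F \<rho>) \<partial>std_normal)
           \<partial>gauss_prod (pairs N))"
      unfolding nui_def gauss_gibbs_def
      by (rule gauss.product_integral_insert)
         (auto intro!: integrable_gibbs_avg depends_on_times F depends_on_site \<zeta> simp: diag_notin_pairs)
    also have "\<dots> = cc n \<zeta> * (\<integral>x. ?R x \<partial>gauss_prod (pairs N))"
      unfolding av[OF \<zeta>] Rx cc_def by simp
    finally show ?thesis .
  qed
  have "cc n (\<lambda>_. 1) = 1"
    unfolding cc_def lw_def
        by (simp add: prob_weights.avg_const[OF prob_weights_gibbs] std.prob_space[simplified])
  with *[of "\<lambda>_. 1"] *[OF \<phi>] show ?thesis by simp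
qed

text \<open>\<open>lav (ee k l) N\<close> is the fluctuation of an overlap around the value
  predicted by the fixed-point equations, \<open>p\<close> for a self-overlap and \<open>q\<close>
  otherwise.\<close>

definition ee :: "nat \<Rightarrow> nat \<Rightarrow> (nat \<Rightarrow> real) \<Rightarrow> real" where
  "ee k l s = s k * s l - (if k = l then p else q)"

definition cpl' :: "nat \<Rightarrow> nat \<Rightarrow> real \<Rightarrow> nat \<times> nat \<Rightarrow> (nat \<Rightarrow> real) \<Rightarrow> real" where
  "cpl' N i t \<kappa> \<sigma> = (if fst \<kappa> = snd \<kappa> then - (\<beta> * sqrt q / (2 * sqrt (1 - t)) * \<sigma> i)
     else \<beta> / sqrt (real N) * (if fst \<kappa> = i \<or> snd \<kappa> = i then 1 / (2 * sqrt t) else 0) * \<sigma> (fst \<kappa>) * \<sigma> (snd \<kappa>))"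

lemma sum_pairs_site:
  fixes f :: "nat \<Rightarrow> nat \<Rightarrow> real"
  assumes "i < N" and sym: "\<And>a b. f a b = f b a"
  shows "(\<Sum>\<kappa>\<in>pairs N. if fst \<kappa> = i \<or> snd \<kappa> = i then f (fst \<kappa>) (snd \<kappa>) else 0) = (\<Sum>j\<in>{..<N} - {i}. f i j)"
proof -
  have "(\<Sum>\<kappa>\<in>pairs N. if fst \<kappa> = i \<or> snd \<kappa> = i then f (fst \<kappa>) (snd \<kappa>) else 0)
     = (\<Sum>\<kappa>\<in>{\<kappa>\<in>pairs N. fst \<kappa> = i \<or> snd \<kappa> = i}. f (fst \<kappa>) (snd \<kappa>))"
    by (simp add: sum.inter_filter)
  also have "\<dots> = (\<Sum>j\<in>{..<N} - {i}. f i j)"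
    by (rule sum.reindex_bij_witness[where i = "\<lambda>j. (min i j, max i j)" and j =
        "\<lambda>\<kappa>. if fst \<kappa> = i then snd \<kappa> else fst \<kappa>"])
       (use assms(1) in \<open>auto simp: pairs_def min_def max_def sym\<close>)
  finally show ?thesis .
qed

text \<open>The factor \<open>sqrt t\<close> of a coupling cancels the singular
  \<open>1 / sqrt t\<close> of its derivative, and likewise at the other end for the auxiliary
  field, so no \<open>t\<close> remains. The variance of the field is proportional to
  \<open>1 - t\<close>, whence the sign of \<open>q\<close>.\<close>

lemma cpl_kernel:
  assumes i: "i < N" and t: "0 < t" "t < 1"
  shows "(\<Sum>\<kappa>\<in>insert (i, i) (pairs N). cpl' N i t \<kappa> \<sigma> * cpl N i t \<kappa> \<tau>) =
     \<beta>\<^sup>2 / 2 * (\<sigma> i * \<tau> i * ((\<Sum>j\<in>{..<N} - {i}. \<sigma> j * \<tau> j) / real N - q))"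
proof -
  have N: "real N > 0" using i by simp
  have 1: "(\<Sum>\<kappa>\<in>pairs N. cpl' N i t \<kappa> \<sigma> * cpl N i t \<kappa> \<tau>) =
    (\<Sum>\<kappa>\<in>pairs N. if fst \<kappa> = i \<or> snd \<kappa> = i then \<beta>\<^sup>2 / (2 * N) * (\<sigma> (fst \<kappa>) * \<sigma> (snd \<kappa>) * (\<tau> (fst \<kappa>) * \<tau> (snd \<kappa>)))
        else 0)"
  proof (rule sum.cong[OF refl])
    fix \<kappa> assume "\<kappa> \<in> pairs N"
    hence ne: "fst \<kappa> \<noteq> snd \<kappa>" by (auto simp: pairs_def)
    have st: "sqrt t * sqrt t = t" "sqrt (real N) * sqrt (real N) = N" using t N by auto
    show "cpl' N i t \<kappa> \<sigma> * cpl N i t \<kappa> \<tau> = (if fst \<kappa> = i \<or> snd \<kappa> =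
        i then \<beta>\<^sup>2 / (2 * N) * (\<sigma> (fst \<kappa>) * \<sigma> (snd \<kappa>) * (\<tau> (fst \<kappa>) * \<tau> (snd \<kappa>))) else 0)"
      using t N ne unfolding cpl'_def cpl_def
      by (simp add: field_simps power2_eq_square real_sqrt_mult_self)
  qed
  have 2: "cpl' N i t (i, i) \<sigma> * cpl N i t (i, i) \<tau> = - (\<beta>\<^sup>2 / 2 * q * (\<sigma> i * \<tau> i))"
    using t q_nonneg unfolding cpl'_def cpl_def by (simp add: field_simps power2_eq_square)
  have "(\<Sum>\<kappa>\<in>pairs N. if fst \<kappa> = i \<or> snd \<kappa> =
      i then \<beta>\<^sup>2 / (2 * N) * (\<sigma> (fst \<kappa>) * \<sigma> (snd \<kappa>) * (\<tau> (fst \<kappa>) * \<tau> (snd \<kappa>))) else 0)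
    = (\<Sum>j\<in>{..<N} - {i}. \<beta>\<^sup>2 / (2 * N) * (\<sigma> i * \<sigma> j * (\<tau> i * \<tau> j)))"
    by (rule sum_pairs_site[OF i, of "\<lambda>a b. \<beta>\<^sup>2 / (2 * N) * (\<sigma> a * \<sigma> b * (\<tau> a * \<tau> b))"]) (simp add: mult_ac)
  also have "\<dots> = \<beta>\<^sup>2 / 2 * (\<sigma> i * \<tau> i * ((\<Sum>j\<in>{..<N} - {i}. \<sigma> j * \<tau> j) / real N))"
    by (simp add: sum_divide_distrib sum_distrib_left mult_ac)
  finally show ?thesis
    unfolding sum.insert[OF finite_pairs diag_notin_pairs] 1 2 by (simp add: algebra_simps)
qed

lemma cavity_overlap:
  assumes "i < N"
  shows "(\<Sum>j\<in>{..<N} - {i}. \<rho> k j * \<rho> l j) / real N - (if k = l then p else q) = lav (ee k l) N \<rho> -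
      \<rho> k i * \<rho> l i / real N"
proof -
  have "(\<Sum>j\<in>{..<N} - {i}. \<rho> k j * \<rho> l j) = (\<Sum>j<N. \<rho> k j * \<rho> l j) - \<rho> k i * \<rho> l i"
    using assms by (subst sum.remove[of "{..<N}" i]) auto
  moreover have "lav (ee k l) N \<rho> = (\<Sum>j<N. \<rho> k j * \<rho> l j) / real N - (if k = l then p else q)"
    using assms unfolding lav_def ee_def by (simp add: sum_subtractf diff_divide_distrib)
  ultimately show ?thesis by (simp add: diff_divide_distrib)
qed

lemma depends_on_ee: "k \<in> I \<Longrightarrow> l \<in> I \<Longrightarrow> depends_on I (ee k l)"
  unfolding ee_def[abs_def] depends_on_def by auto

text \<open>The contribution of the pair of replicas \<open>k\<close>, \<open>l\<close> to the
  derivative: spins at \<open>i\<close> times a centred overlap of the other sites. The term divided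
  by \<open>N\<close> is there because site \<open>i\<close> is not coupled to itself.\<close>

definition dev :: "nat \<Rightarrow> nat \<Rightarrow> nat \<Rightarrow> nat \<Rightarrow> (nat \<Rightarrow> nat \<Rightarrow> real) \<Rightarrow> real" where
  "dev N i k l \<rho> = \<rho> k i * \<rho> l i * (lav (ee k l) N \<rho> - \<rho> k i * \<rho> l i / real N)"

lemma depends_on_dev: "k \<in> I \<Longrightarrow> l \<in> I \<Longrightarrow> depends_on I (dev N i k l)"
  unfolding dev_def[abs_def]
  by (intro depends_on_times depends_on_minus depends_on_divide
      depends_on_const depends_on_lav depends_on_ee) (auto intro: depends_on_coord)

text \<open>\<open>gauss_gibbs_deriv\<close> gives a double sum over replicas of products of
  coefficients; summing over the disorder variables turns each product into the kernel of
  \<open>cpl_kernel\<close>, and the field term supplies the missing \<open>p - q\<close> on the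
  diagonal.\<close>

lemma nui_deriv:
  assumes i: "i < N" and t0: "0 < t" "t < 1" and F: "depends_on {..<n} F"
  shows "((\<lambda>t. nui N i t n F) has_real_derivative
    \<beta>\<^sup>2 / 2 * (\<Sum>k<n+2. \<Sum>l<n+2. rsgn n k * rsgn (n+1) l * nui N i t (n+2) (\<lambda>\<rho>. F \<rho> * dev N i k l \<rho>))) (at t)"
proof -
  \<comment> \<open>Away from both ends of the unit interval the square roots in the denominators of
    \<open>cpl'\<close> are bounded below, which yields the uniform constant
    \<open>C\<close>.\<close>
  define a where "a = t / 2"
  define b where "b = (1 + t) / 2"
  have ab: "t \<in> {a<..<b}" "0 < a" "b < 1" using t0 by (auto simp: a_def b_def field_simps)
  let ?K = "insert (i, i) (pairs N)"
  have N: "real N > 0" using i by simp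
  let ?d' = "\<lambda>\<sigma>. - (\<beta>\<^sup>2 / 2 * (p - q) * (\<sigma> i)\<^sup>2)"
  define C where "C = \<beta> * sqrt q / (2 * sqrt (1 - b)) * S + \<beta> / sqrt (real N) * (1 / (2 * sqrt a)) * S * S +
      \<bar>\<beta>\<^sup>2 / 2 * (p - q)\<bar> * S\<^sup>2"
  have nn: "\<beta> * sqrt q / (2 * sqrt (1 - b)) * S \<ge> 0" "\<beta> / sqrt (real N) * (1 / (2 * sqrt a)) * S * S \<ge> 0"
      "\<bar>\<beta>\<^sup>2 / 2 * (p - q)\<bar> * S\<^sup>2 \<ge> 0"
    using \<beta>_pos ab q_nonneg by (auto intro!: mult_nonneg_nonneg divide_nonneg_nonneg)
  have der: "((\<lambda>t. gauss_gibbs ?K (configs S N) (cpl N i t) (fld N i t) n F) has_real_derivative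
     (\<Sum>\<kappa>\<in>?K. gauss_gibbs ?K (configs S N) (cpl N i t) (fld N i t) (Suc (Suc n))
         (\<lambda>\<rho>. F \<rho> * (\<Sum>k<Suc n. rsgn n k * cpl' N i t \<kappa> (\<rho> k))
            * (\<Sum>l<Suc (Suc n). rsgn (Suc n) l * cpl N i t \<kappa> (\<rho> l))))
     + gauss_gibbs ?K (configs S N) (cpl N i t) (fld N i t) (Suc n) (\<lambda>\<rho>. F \<rho> * (\<Sum>k<Suc n. rsgn n k * ?d'
         (\<rho> k)))) (at t)"
  proof (rule gauss_gibbs_deriv[OF finite_configs configs_ne F _ ab(1), where C = C])
    fix s \<kappa> \<sigma> assume s: "s \<in> {a<..<b}" and \<kappa>: "\<kappa> \<in> ?K" and \<sigma>: "\<sigma> \<in> configs S N"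
    have s01: "0 < s" "s < 1" using s ab by auto
    show "((\<lambda>t. cpl N i t \<kappa> \<sigma>) has_real_derivative cpl' N i s \<kappa> \<sigma>) (at s)"
    proof -
      have d1: "(sqrt has_real_derivative 1 / (2 * sqrt s)) (at s)"
        using DERIV_real_sqrt[OF s01(1)] by (simp add: field_simps)
      have d2: "((\<lambda>t. sqrt (1 - t)) has_real_derivative - (1 / (2 * sqrt (1 - s)))) (at s)"
        using s01 by (auto intro!: derivative_eq_intros simp: field_simps)
      have "((\<lambda>t. \<beta> * sqrt q * sqrt (1 - t) * \<sigma> i) has_real_derivative \<beta> * sqrt q * (- (1 / (2 * sqrt (1 - s))))
          * \<sigma> i) (at s)"
        by (intro DERIV_cmult DERIV_cmult_right d2)
      moreover have "((\<lambda>t. \<beta> / sqrt (real N) * sqrt t * \<sigma> (fst \<kappa>) * \<sigma> (snd \<kappa>)) has_real_derivative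
         \<beta> / sqrt (real N) * (1 / (2 * sqrt s)) * \<sigma> (fst \<kappa>) * \<sigma> (snd \<kappa>)) (at s)"
        by (intro DERIV_cmult DERIV_cmult_right d1)
      ultimately show ?thesis
        unfolding cpl_def cpl'_def by (cases "fst \<kappa> = snd \<kappa>"; cases "fst \<kappa> = i \<or> snd \<kappa> = i") simp_all
    qed
    show "\<bar>cpl' N i s \<kappa> \<sigma>\<bar> \<le> C"
    proof (cases "fst \<kappa> = snd \<kappa>")
      case True
      have "\<bar>cpl' N i s \<kappa> \<sigma>\<bar> = \<beta> * sqrt q / (2 * sqrt (1 - s)) * \<bar>\<sigma> i\<bar>"
        using True \<beta>_pos q_nonneg s01 by (simp add: cpl'_def abs_mult)
      also have "\<dots> \<le> \<beta> * sqrt q / (2 * sqrt (1 - b)) * S"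
        using \<beta>_pos q_nonneg s ab configs_abs_le[OF \<sigma> i] by (intro mult_mono divide_left_mono) auto
      finally show ?thesis using nn unfolding C_def by linarith
    next
      case False
      hence lt: "fst \<kappa> < N" "snd \<kappa> < N" using \<kappa> by (auto simp: pairs_def)
      have "\<bar>cpl' N i s \<kappa> \<sigma>\<bar> = \<beta> / sqrt (real N) * (if fst \<kappa> = i \<or> snd \<kappa> = i then 1 / (2 * sqrt s) else 0) * \<bar>\<sigma>
          (fst \<kappa>)\<bar> * \<bar>\<sigma> (snd \<kappa>)\<bar>"
        using False \<beta>_pos s01 by (simp add: cpl'_def abs_mult)
      also have "\<dots> \<le> \<beta> / sqrt (real N) * (1 / (2 * sqrt a)) * S * S"
      proof (intro mult_mono configs_abs_le[OF \<sigma>] lt)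
        show "(if fst \<kappa> = i \<or> snd \<kappa> = i then 1 / (2 * sqrt s) else 0) \<le> 1 / (2 * sqrt a)"
          using s ab s01 by (auto intro!: divide_left_mono)
      qed (use \<beta>_pos ab s01 in auto)
      finally show ?thesis using nn unfolding C_def by linarith
    qed
  next
    fix s \<sigma> assume s: "s \<in> {a<..<b}" and \<sigma>: "\<sigma> \<in> configs S N"
    show "((\<lambda>t. fld N i t \<sigma>) has_real_derivative ?d' \<sigma>) (at s)"
      unfolding fld_def by (auto intro!: derivative_eq_intros)
    have "\<bar>?d' \<sigma>\<bar> = \<bar>\<beta>\<^sup>2 / 2 * (p - q)\<bar> * \<bar>\<sigma> i\<bar>\<^sup>2" by (simp add: abs_mult)
    also have "\<dots> \<le> \<bar>\<beta>\<^sup>2 / 2 * (p - q)\<bar> * S\<^sup>2"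
      using power_mono[OF configs_abs_le[OF \<sigma> i], of 2] by (intro mult_left_mono) auto
    finally show "\<bar>?d' \<sigma>\<bar> \<le> C" using nn unfolding C_def by linarith
  qed simp
  let ?W = "\<lambda>\<rho>. \<Sum>k<n+2. \<Sum>l<n+2. rsgn n k * rsgn (n+1) l * (F \<rho> * dev N i k l \<rho>)"
  have F2: "depends_on {..<n+2} F" by (rule depends_on_mono[OF F]) auto
  have dl: "depends_on {..<Suc (Suc n)} (\<lambda>\<rho>. \<Sum>k<m. w k * u (\<rho> k))" if "m \<le> Suc (Suc n)" for m w
      and u :: "(nat \<Rightarrow> real) \<Rightarrow> real"
    by (intro depends_on_sum) (use that in \<open>auto intro: depends_on_coord\<close>)
  have r0: "rsgn n (Suc n) = 0" by (simp add: rsgn_def)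
  have "(\<Sum>\<kappa>\<in>?K. gauss_gibbs ?K (configs S N) (cpl N i t) (fld N i t) (Suc (Suc n))
      (\<lambda>\<rho>. F \<rho> * (\<Sum>k<Suc n. rsgn n k * cpl' N i t \<kappa> (\<rho> k))
            * (\<Sum>l<Suc (Suc n). rsgn (Suc n) l * cpl N i t \<kappa> (\<rho> l))))
     + gauss_gibbs ?K (configs S N) (cpl N i t) (fld N i t) (Suc n) (\<lambda>\<rho>. F \<rho> * (\<Sum>k<Suc n. rsgn n k * ?d' (\<rho> k)))
    = nui N i t (Suc (Suc n)) (\<lambda>\<rho>. (\<Sum>\<kappa>\<in>?K. F \<rho> * (\<Sum>k<Suc n. rsgn n k * cpl' N i t \<kappa> (\<rho> k))
            * (\<Sum>l<Suc (Suc n). rsgn (Suc n) l * cpl N i t \<kappa> (\<rho> l))) + F \<rho> * (\<Sum>k<Suc n. rsgn n k * ?d' (\<rho> k)))"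
  proof -
    have "gauss_gibbs ?K (configs S N) (cpl N i t) (fld N i t) (Suc n) (\<lambda>\<rho>. F \<rho> * (\<Sum>k<Suc n. rsgn n k * ?d'
        (\<rho> k)))
      = gauss_gibbs ?K (configs S N) (cpl N i t) (fld N i t) (Suc (Suc n)) (\<lambda>\<rho>. F \<rho> * (\<Sum>k<Suc n. rsgn n k * ?d'
          (\<rho> k)))"
      by (rule gauss_gibbs_extend[OF finite_configs configs_ne _ depends_on_rsgn_sum[OF F], symmetric]) simp
    moreover have "depends_on {..<Suc (Suc n)} (\<lambda>\<rho>. F \<rho> * (\<Sum>k<Suc n. rsgn n k * cpl' N i t \<kappa> (\<rho> k))
            * (\<Sum>l<Suc (Suc n). rsgn (Suc n) l * cpl N i t \<kappa> (\<rho> l)))" for \<kappa>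
      using F2 by (intro depends_on_times dl) auto
    moreover have "depends_on {..<Suc (Suc n)} (\<lambda>\<rho>. F \<rho> * (\<Sum>k<Suc n. rsgn n k * ?d' (\<rho> k)))"
      using F2 by (intro depends_on_times dl) auto
    ultimately show ?thesis
      unfolding nui_def
      by (simp only: gauss_gibbs_add[OF finite_configs configs_ne] gauss_gibbs_sum[OF finite_configs configs_ne]
          depends_on_sum)
  qed
  also have "\<dots> = nui N i t (Suc (Suc n)) (\<lambda>\<rho>. \<beta>\<^sup>2 / 2 * ?W \<rho>)"
    unfolding nui_def
  proof (rule gauss_gibbs_cong[OF finite_configs configs_ne])
    fix \<rho> :: "nat \<Rightarrow> nat \<Rightarrow> real"
    have A: "(\<Sum>\<kappa>\<in>?K. (\<Sum>k<Suc n. rsgn n k * cpl' N i t \<kappa> (\<rho> k)) * (\<Sum>l<Suc (Suc n). rsgn (Suc n) l * cpl N i t \<kappa>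
        (\<rho> l)))
      = (\<Sum>k<n+2. \<Sum>l<n+2. rsgn n k * rsgn (n+1) l * (\<Sum>\<kappa>\<in>?K. cpl' N i t \<kappa> (\<rho> k) * cpl N i t \<kappa> (\<rho> l)))"
    proof -
      have "(\<Sum>k<Suc n. rsgn n k * cpl' N i t \<kappa> (\<rho> k)) * (\<Sum>l<Suc (Suc n). rsgn (Suc n) l * cpl N i t \<kappa> (\<rho> l))
         = (\<Sum>k<n+2. \<Sum>l<n+2. rsgn n k * rsgn (n+1) l * (cpl' N i t \<kappa> (\<rho> k) * cpl N i t \<kappa> (\<rho> l)))" for \<kappa>
      proof -
        have ext: "(\<Sum>k<Suc n. rsgn n k * cpl' N i t \<kappa> (\<rho> k)) = (\<Sum>k<n+2. rsgn n k * cpl' N i t \<kappa> (\<rho> k))"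
          by (simp add: r0)
        show ?thesis unfolding ext sum_product by (simp add: mult_ac del: sum.lessThan_Suc)
      qed
      hence "(\<Sum>\<kappa>\<in>?K. (\<Sum>k<Suc n. rsgn n k * cpl' N i t \<kappa> (\<rho> k)) * (\<Sum>l<Suc (Suc n). rsgn (Suc n) l * cpl N i t \<kappa>
          (\<rho> l)))
        = (\<Sum>\<kappa>\<in>?K. \<Sum>k<n+2. \<Sum>l<n+2. rsgn n k * rsgn (n+1) l * (cpl' N i t \<kappa> (\<rho> k) * cpl N i t \<kappa> (\<rho> l)))"
        by (simp only:)
      also have "\<dots> = (\<Sum>k<n+2. \<Sum>\<kappa>\<in>?K. \<Sum>l<n+2. rsgn n k * rsgn (n+1) l * (cpl' N i t \<kappa> (\<rho> k) * cpl N i t \<kappa>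
          (\<rho> l)))"
        by (rule sum.swap)
      also have "\<dots> = (\<Sum>k<n+2. \<Sum>l<n+2. rsgn n k * rsgn (n+1) l * (\<Sum>\<kappa>\<in>?K. cpl' N i t \<kappa> (\<rho> k) * cpl N i t \<kappa>
          (\<rho> l)))"
        by (subst sum.swap) (simp only: sum_distrib_left)
      finally show ?thesis .
    qed
    \<comment> \<open>A diagonal weight \<open>rsgn n k * rsgn (n+1) k\<close> equals
      \<open>rsgn n k\<close>: the second sign is 1 for \<open>k \<le> n\<close>, and the first is 0
      for \<open>k = n + 1\<close>.\<close>
    have B: "(\<Sum>k<Suc n. rsgn n k * ?d' (\<rho> k)) = (\<Sum>k<n+2. \<Sum>l<n+2. rsgn n k * rsgn (n+1) l * (if k =
        l then ?d' (\<rho> k) else 0))"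
    proof -
      have "(\<Sum>l<n+2. rsgn n k * rsgn (n+1) l * (if k = l then ?d' (\<rho> k) else 0)) = rsgn n k * ?d' (\<rho> k)"
          if "k < n+2" for k
      proof -
        have "(\<Sum>l<n+2. rsgn n k * rsgn (n+1) l * (if k = l then ?d' (\<rho> k) else 0)) =
            (\<Sum>l<n+2. if k = l then rsgn n k * rsgn (n+1) k * ?d' (\<rho> k) else 0)"
          by (intro sum.cong) auto
        also have "\<dots> = rsgn n k * rsgn (n+1) k * ?d' (\<rho> k)" using that by (subst sum.delta') auto
        also have "\<dots> = rsgn n k * ?d' (\<rho> k)" by (simp add: rsgn_def)
        finally show ?thesis .
      qed
      hence "(\<Sum>k<n+2. \<Sum>l<n+2. rsgn n k * rsgn (n+1) l * (if k = l then ?d' (\<rho> k) else 0)) =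
          (\<Sum>k<n+2. rsgn n k * ?d' (\<rho> k))"
        by (intro sum.cong) auto
      also have "\<dots> = (\<Sum>k<Suc n. rsgn n k * ?d' (\<rho> k))" by (simp add: r0)
      finally show ?thesis by simp
    qed
    have C: "(\<Sum>\<kappa>\<in>?K. cpl' N i t \<kappa> (\<rho> k) * cpl N i t \<kappa> (\<rho> l)) + (if k = l then ?d' (\<rho> k) else 0) =
        \<beta>\<^sup>2 / 2 * dev N i k l \<rho>" for k l
      unfolding cpl_kernel[OF i t0] dev_def cavity_overlap[OF i, symmetric]
      by (cases "k = l") (simp_all add: field_simps power2_eq_square)
    have "(\<Sum>\<kappa>\<in>?K. F \<rho> * (\<Sum>k<Suc n. rsgn n k * cpl' N i t \<kappa> (\<rho> k))
            * (\<Sum>l<Suc (Suc n). rsgn (Suc n) l * cpl N i t \<kappa> (\<rho> l))) + F \<rho> * (\<Sum>k<Suc n. rsgn n k * ?d' (\<rho> k))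
       = F \<rho> * (\<Sum>k<n+2. \<Sum>l<n+2. rsgn n k * rsgn (n+1) l * ((\<Sum>\<kappa>\<in>?K. cpl' N i t \<kappa> (\<rho> k) * cpl N i t \<kappa> (\<rho> l)) +
           (if k = l then ?d' (\<rho> k) else 0)))"
      unfolding mult.assoc[of "F \<rho>"] sum_distrib_left[symmetric] A B distrib_left sum.distrib ..
    also have "\<dots> = \<beta>\<^sup>2 / 2 * ?W \<rho>"
      unfolding C sum_distrib_left by (intro sum.cong refl) (simp only: mult_ac)
    finally show "(\<Sum>\<kappa>\<in>?K. F \<rho> * (\<Sum>k<Suc n. rsgn n k * cpl' N i t \<kappa> (\<rho> k))
            * (\<Sum>l<Suc (Suc n). rsgn (Suc n) l * cpl N i t \<kappa> (\<rho> l))) + F \<rho> * (\<Sum>k<Suc n. rsgn n k * ?d' (\<rho> k)) =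
                \<beta>\<^sup>2 / 2 * ?W \<rho>" .
  qed
  also have "\<dots> = \<beta>\<^sup>2 / 2 * (\<Sum>k<n+2. \<Sum>l<n+2. rsgn n k * rsgn (n+1) l * nui N i t (n+2) (\<lambda>\<rho>. F \<rho> * dev N i k l
      \<rho>))"
  proof -
    have dd: "depends_on {..<n+2} (\<lambda>\<rho>. r * (F \<rho> * dev N i k l \<rho>))" if "k < n+2" "l < n+2" for k l r
      by (intro depends_on_times F2 depends_on_dev depends_on_const) (use that in auto)
    have "nui N i t (n+2) ?W =
        (\<Sum>k<n+2. nui N i t (n+2) (\<lambda>\<rho>. \<Sum>l<n+2. rsgn n k * rsgn (n+1) l * (F \<rho> * dev N i k l \<rho>)))"
      unfolding nui_def by (intro gauss_gibbs_sum[OF finite_configs configs_ne] depends_on_sum dd) auto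
    also have "\<dots> = (\<Sum>k<n+2. \<Sum>l<n+2. nui N i t (n+2) (\<lambda>\<rho>. rsgn n k * rsgn (n+1) l * (F \<rho> * dev N i k l \<rho>)))"
      unfolding nui_def by (intro sum.cong refl gauss_gibbs_sum[OF finite_configs configs_ne] dd) auto
    finally have "nui N i t (n+2) ?W = (\<Sum>k<n+2. \<Sum>l<n+2. rsgn n k * rsgn (n+1) l * nui N i t (n+2)
        (\<lambda>\<rho>. F \<rho> * dev N i k l \<rho>))"
      unfolding nui_def gauss_gibbs_cmult[OF finite_configs configs_ne] .
    moreover have "Suc (Suc n) = n + 2" by simp
    ultimately show ?thesis
      unfolding nui_def gauss_gibbs_cmult[OF finite_configs configs_ne] by (simp only:)
  qed
  finally show ?thesis using der unfolding nui_def by (simp only:)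
qed

text \<open>The square roots are not differentiable at the ends of the interval; continuity there is
  what lets the mean value theorem reach \<open>t = 0\<close> and \<open>t = 1\<close>.\<close>

lemma nui_continuous:
  assumes "i < N" "depends_on {..<n} F"
  shows "continuous_on {0..1} (\<lambda>t. nui N i t n F)"
  unfolding nui_def
proof (rule gauss_gibbs_continuous[OF finite_configs configs_ne assms(2)])
  show "continuous_on {0..1} (\<lambda>t. cpl N i t \<kappa> \<sigma>)" for \<kappa> \<sigma>
    unfolding cpl_def using assms(1)
    by (cases "fst \<kappa> = snd \<kappa>"; cases "fst \<kappa> = i \<or> snd \<kappa> = i") (auto intro!: continuous_intros)
  show "continuous_on {0..1} (\<lambda>t. fld N i t \<sigma>)" for \<sigma>
    unfolding fld_def by (intro continuous_intros)
qed

end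

section \<open>Bounds along the interpolation\<close>

definition wn :: "nat \<Rightarrow> real" where
  "wn n = (\<Sum>k<n+2. \<Sum>l<n+2. \<bar>rsgn n k * rsgn (n+1) l\<bar>)"

lemma wn_nonneg: "wn n \<ge> 0"
  unfolding wn_def by (intro sum_nonneg) auto

context gs_model
begin

lemma meta_abs_le: "\<bar>meta S \<beta> D hf p q j \<eta>\<bar> \<le> real S ^ j"
proof -
  have pos: "(\<Sum>s\<in>spins S. weta \<beta> D hf p q \<eta> s) > 0"
    unfolding weta_def by (rule sum_exp_pos) auto
  have "\<bar>\<Sum>s\<in>spins S. s ^ j * weta \<beta> D hf p q \<eta> s\<bar> \<le> (\<Sum>s\<in>spins S. real S ^ j * weta \<beta> D hf p q \<eta> s)"
  proof (rule order_trans[OF sum_abs], rule sum_mono)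
    fix s assume "s \<in> spins S"
    hence "\<bar>s\<bar> ^ j \<le> real S ^ j" by (intro power_mono spins_abs_le) auto
    thus "\<bar>s ^ j * weta \<beta> D hf p q \<eta> s\<bar> \<le> real S ^ j * weta \<beta> D hf p q \<eta> s"
      by (auto simp: abs_mult power_abs weta_def intro!: mult_right_mono)
  qed
  thus ?thesis using pos unfolding meta_def
    by (simp add: divide_le_eq sum_distrib_left[symmetric])
qed

lemma restrict_replicas:
  fixes n m :: nat
  shows "\<rho> \<in> PiE {..<m} (\<lambda>_. A) \<Longrightarrow> n \<le> m \<Longrightarrow> restrict \<rho> {..<n} \<in> PiE {..<n} (\<lambda>_. A)"
  unfolding restrict_PiE_iff by (intro ballI) (erule PiE_mem, simp)

text \<open>A non-integrable function has integral 0 by convention, and 0 is within the bound as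
  well. So the estimates of \<open>p\<close>, \<open>q\<close> and the constants require no
  integrability argument.\<close>

lemma std_integral_abs_le:
  fixes f :: "real \<Rightarrow> real"
  assumes "\<And>\<eta>. \<bar>f \<eta>\<bar> \<le> B"
  shows "\<bar>\<integral>\<eta>. f \<eta> \<partial>std_normal\<bar> \<le> B"
proof -
  interpret prob_space std_normal by (rule prob_space_std_normal)
  have B: "B \<ge> 0" using assms[of 0] by linarith
  show ?thesis
  proof (cases "integrable std_normal f")
    case True
    have "\<bar>\<integral>\<eta>. f \<eta> \<partial>std_normal\<bar> \<le> (\<integral>\<eta>. \<bar>f \<eta>\<bar> \<partial>std_normal)" by (rule integral_abs_bound)
    also have "\<dots> \<le> (\<integral>\<eta>. B \<partial>std_normal)"
      using True assms by (intro integral_mono integrable_abs) auto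
    finally show ?thesis using prob_space by simp
  qed (use B in \<open>simp add: not_integrable_integral_eq\<close>)
qed

lemma q_le: "q \<le> real S ^ 2"
proof -
  have "q = (\<integral>\<eta>. (meta S \<beta> D hf p q 1 \<eta>)\<^sup>2 \<partial>std_normal)" using fp by (simp add: fixed_point_def)
  moreover have "\<bar>(meta S \<beta> D hf p q 1 \<eta>)\<^sup>2\<bar> \<le> real S ^ 2" for \<eta>
    using power_mono[OF meta_abs_le[of 1 \<eta>] abs_ge_zero, of 2] by simp
  ultimately show ?thesis using std_integral_abs_le by (metis abs_le_D1)
qed

lemma p_abs_le: "\<bar>p\<bar> \<le> real S ^ 2"
proof -
  have eq: "(\<integral>\<eta>. meta S \<beta> D hf p q 2 \<eta> \<partial>std_normal) = p" using fp by (simp add: fixed_point_def)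
  have "\<bar>\<integral>\<eta>. meta S \<beta> D hf p q 2 \<eta> \<partial>std_normal\<bar> \<le> real S ^ 2"
    by (rule std_integral_abs_le, rule meta_abs_le)
  thus ?thesis unfolding eq .
qed

lemma nui_cmult: "nui N i t n (\<lambda>\<rho>. r * F \<rho>) = r * nui N i t n F"
  unfolding nui_def by (rule gauss_gibbs_cmult[OF finite_configs configs_ne])

lemma nui_mono: "depends_on {..<n} F \<Longrightarrow> depends_on {..<n} F' \<Longrightarrow>
    (\<And>\<rho>. \<rho> \<in> PiE {..<n} (\<lambda>_. configs S N) \<Longrightarrow> F \<rho> \<le> F' \<rho>) \<Longrightarrow> nui N i t n F \<le> nui N i t n F'"
  unfolding nui_def by (rule gauss_gibbs_mono[OF finite_configs configs_ne])

lemma nui_abs: "depends_on {..<n} F \<Longrightarrow> \<bar>nui N i t n F\<bar> \<le> nui N i t n (\<lambda>\<rho>. \<bar>F \<rho>\<bar>)"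
  unfolding nui_def by (rule gauss_gibbs_abs[OF finite_configs configs_ne])

lemma nui_const: "nui N i t n (\<lambda>_. r) = r"
  unfolding nui_def by (rule gauss_gibbs_const[OF finite_configs configs_ne])

lemma nui_extend: "n \<le> m \<Longrightarrow> depends_on {..<n} F \<Longrightarrow> nui N i t m F = nui N i t n F"
  unfolding nui_def by (rule gauss_gibbs_extend[OF finite_configs configs_ne])

lemma nun_add: "depends_on {..<n} F \<Longrightarrow> depends_on {..<n} F' \<Longrightarrow>
    nun N n (\<lambda>\<rho>. F \<rho> + F' \<rho>) = nun N n F + nun N n F'"
  unfolding nun_def by (rule gauss_gibbs_add[OF finite_configs configs_ne])

lemma nun_cmult: "nun N n (\<lambda>\<rho>. r * F \<rho>) = r * nun N n F"
  unfolding nun_def by (rule gauss_gibbs_cmult[OF finite_configs configs_ne])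

lemma nun_diff: "depends_on {..<n} F \<Longrightarrow> depends_on {..<n} F' \<Longrightarrow>
    nun N n (\<lambda>\<rho>. F \<rho> - F' \<rho>) = nun N n F - nun N n F'"
  unfolding nun_def by (rule gauss_gibbs_diff[OF finite_configs configs_ne])

lemma nun_sum: "(\<And>j. j \<in> J \<Longrightarrow> depends_on {..<n} (F j)) \<Longrightarrow>
    nun N n (\<lambda>\<rho>. \<Sum>j\<in>J. F j \<rho>) = (\<Sum>j\<in>J. nun N n (F j))"
  unfolding nun_def by (rule gauss_gibbs_sum[OF finite_configs configs_ne])

lemma nun_mono: "depends_on {..<n} F \<Longrightarrow> depends_on {..<n} F' \<Longrightarrow>
    (\<And>\<rho>. \<rho> \<in> PiE {..<n} (\<lambda>_. configs S N) \<Longrightarrow> F \<rho> \<le> F' \<rho>) \<Longrightarrow> nun N n F \<le> nun N n F'"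
  unfolding nun_def by (rule gauss_gibbs_mono[OF finite_configs configs_ne])

lemma nun_cong: "(\<And>\<rho>. \<rho> \<in> PiE {..<n} (\<lambda>_. configs S N) \<Longrightarrow> F \<rho> = F' \<rho>) \<Longrightarrow> nun N n F = nun N n F'"
  unfolding nun_def by (rule gauss_gibbs_cong[OF finite_configs configs_ne])

lemma nun_abs: "depends_on {..<n} F \<Longrightarrow> \<bar>nun N n F\<bar> \<le> nun N n (\<lambda>\<rho>. \<bar>F \<rho>\<bar>)"
  unfolding nun_def by (rule gauss_gibbs_abs[OF finite_configs configs_ne])

lemma nun_const: "nun N n (\<lambda>_. r) = r"
  unfolding nun_def by (rule gauss_gibbs_const[OF finite_configs configs_ne])

lemma nun_reindex: "inj_on \<pi> {..<n} \<Longrightarrow> \<pi> ` {..<n} \<subseteq> {..<m} \<Longrightarrow> depends_on {..<n} F \<Longrightarrow>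
    nun N m (\<lambda>\<rho>. F (\<lambda>k. \<rho> (\<pi> k))) = nun N n F"
  unfolding nun_def by (rule gauss_gibbs_reindex[OF finite_configs configs_ne])

lemma nun_extend: "n \<le> m \<Longrightarrow> depends_on {..<n} F \<Longrightarrow> nun N m F = nun N n F"
  unfolding nun_def by (rule gauss_gibbs_extend[OF finite_configs configs_ne])

lemma nun_nonneg: "depends_on {..<n} F \<Longrightarrow>
    (\<And>\<rho>. \<rho> \<in> PiE {..<n} (\<lambda>_. configs S N) \<Longrightarrow> 0 \<le> F \<rho>) \<Longrightarrow> 0 \<le> nun N n F"
  using nun_mono[of n "\<lambda>_. 0" F N] by (simp add: nun_const)

lemma rep_spin_abs_le: "\<rho> \<in> PiE {..<n} (\<lambda>_. configs S N) \<Longrightarrow> k < n \<Longrightarrow> i < N \<Longrightarrow> \<bar>\<rho> k i\<bar> \<le> real S"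
  by (rule configs_abs_le) auto

lemma spin_prod_le:
  assumes "\<bar>x\<bar> \<le> real S" "\<bar>y\<bar> \<le> real S" shows "\<bar>x * y\<bar> \<le> real S ^ 2"
  unfolding abs_mult power2_eq_square using assms by (intro mult_mono) auto

lemma ee_abs_le:
  assumes "\<rho> \<in> PiE {..<n} (\<lambda>_. configs S N)" "k < n" "l < n" "i < N"
  shows "\<bar>ee k l (\<lambda>k. \<rho> k i)\<bar> \<le> 2 * real S ^ 2"
proof -
  have "\<bar>\<rho> k i * \<rho> l i\<bar> \<le> real S ^ 2"
    by (intro spin_prod_le rep_spin_abs_le[OF assms(1)] assms)
  moreover have "\<bar>if k = l then p else q\<bar> \<le> real S ^ 2" using p_abs_le q_le q_nonneg by auto
  ultimately show ?thesis unfolding ee_def by linarith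
qed

lemma lav_abs_le:
  assumes "N > 0" "\<And>i. i < N \<Longrightarrow> \<bar>\<phi> (\<lambda>k. \<rho> k i)\<bar> \<le> B"
  shows "\<bar>lav \<phi> N \<rho>\<bar> \<le> B"
proof -
  have "\<bar>\<Sum>j<N. \<phi> (\<lambda>k. \<rho> k j)\<bar> \<le> (\<Sum>j<N. B)"
    by (rule order_trans[OF sum_abs], rule sum_mono) (use assms in auto)
  thus ?thesis using assms(1) unfolding lav_def by (simp add: divide_le_eq mult.commute)
qed

lemma dev_abs_le:
  assumes "\<rho> \<in> PiE {..<n} (\<lambda>_. configs S N)" "k < n" "l < n" "i < N"
  shows "\<bar>dev N i k l \<rho>\<bar> \<le> 2 * real S ^ 4"
proof -
  have N: "real N > 0" using assms by simp
  have spin: "\<bar>\<rho> k j * \<rho> l j\<bar> \<le> real S ^ 2" if "j < N" for j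
    by (intro spin_prod_le rep_spin_abs_le[OF assms(1)] assms that)
  have "\<bar>\<Sum>j\<in>{..<N} - {i}. \<rho> k j * \<rho> l j\<bar> \<le> (\<Sum>j\<in>{..<N} - {i}. real S ^ 2)"
    by (rule order_trans[OF sum_abs], rule sum_mono) (use spin in auto)
  also have "\<dots> \<le> (\<Sum>j<N. real S ^ 2)" by (rule sum_mono2) auto
  finally have "\<bar>(\<Sum>j\<in>{..<N} - {i}. \<rho> k j * \<rho> l j) / real N\<bar> \<le> real S ^ 2"
    using N by (simp add: divide_le_eq mult.commute)
  moreover have "\<bar>if k = l then p else q\<bar> \<le> real S ^ 2" using p_abs_le q_le q_nonneg by auto
  ultimately have "\<bar>lav (ee k l) N \<rho> - \<rho> k i * \<rho> l i / real N\<bar> \<le> 2 * real S ^ 2"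
    unfolding cavity_overlap[OF assms(4), symmetric] by linarith
  hence "\<bar>dev N i k l \<rho>\<bar> \<le> real S ^ 2 * (2 * real S ^ 2)"
    unfolding dev_def abs_mult[of "\<rho> k i * \<rho> l i"] using spin[OF assms(4)] by (intro mult_mono) auto
  thus ?thesis by (simp add: power_numeral_reduce)
qed

lemma depends_on_dev_prod:
  assumes "depends_on {..<n} F" "k < n + 2" "l < n + 2"
  shows "depends_on {..<n+2} (\<lambda>\<rho>. F \<rho> * dev N i k l \<rho>)"
  by (intro depends_on_times depends_on_mono[OF assms(1)] depends_on_dev) (use assms in auto)

lemma \<beta>_half: "\<bar>\<beta>\<^sup>2 / 2\<bar> = \<beta>\<^sup>2 / 2"
  by simp

text \<open>A Gronwall argument. For nonnegative \<open>F\<close> the bound on \<open>dev\<close>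
  gives \<open>\<bar>d s\<bar> \<le> C * nui N i s n F\<close>, so
  \<open>exp (C * s) * nui N i s n F\<close> increases with \<open>s\<close>. Averages at any
  \<open>t\<close> are thereby controlled by those of the model, with a constant independent of
  \<open>N\<close>.\<close>

lemma nui_le_nun:
  assumes i: "i < N" and t: "0 \<le> t" "t \<le> 1" and F: "depends_on {..<n} F"
    and pos: "\<And>\<rho>. \<rho> \<in> PiE {..<n} (\<lambda>_. configs S N) \<Longrightarrow> 0 \<le> F \<rho>"
  shows "nui N i t n F \<le> exp (wn n * real S ^ 4) * nun N n F"
proof -
  define C where "C = wn n * real S ^ 4"
  have C: "C \<ge> 0" unfolding C_def using wn_nonneg by simp
  have F0: "nui N i s n F \<ge> 0" for s using nui_mono[of n "\<lambda>_. 0" F N i s] F pos by (simp add: nui_const)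
  define d where "d s = \<beta>\<^sup>2 / 2 * (\<Sum>k<n+2. \<Sum>l<n+2. rsgn n k * rsgn (n+1) l * nui N i s (n+2) (\<lambda>\<rho>. F \<rho> * dev N i
      k l \<rho>))" for s
  have d: "\<bar>d s\<bar> \<le> C * nui N i s n F" for s
  proof -
    have 1: "\<bar>nui N i s (n+2) (\<lambda>\<rho>. F \<rho> * dev N i k l \<rho>)\<bar> \<le> 2 * real S ^ 4 * nui N i s n F"
        if kl: "k < n+2" "l < n+2" for k l
    proof -
      have "\<bar>nui N i s (n+2) (\<lambda>\<rho>. F \<rho> * dev N i k l \<rho>)\<bar> \<le> nui N i s (n+2) (\<lambda>\<rho>. \<bar>F \<rho> * dev N i k l \<rho>\<bar>)"
        by (rule nui_abs[OF depends_on_dev_prod[OF F kl]])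
      also have "\<dots> \<le> nui N i s (n+2) (\<lambda>\<rho>. 2 * real S ^ 4 * F \<rho>)"
      proof (rule nui_mono)
        show "depends_on {..<n+2} (\<lambda>\<rho>. \<bar>F \<rho> * dev N i k l \<rho>\<bar>)"
          by (rule depends_on_comp1[OF depends_on_dev_prod[OF F kl]])
        show "depends_on {..<n+2} (\<lambda>\<rho>. 2 * real S ^ 4 * F \<rho>)"
          by (intro depends_on_times depends_on_const depends_on_mono[OF F]) auto
        fix \<rho> assume \<rho>: "\<rho> \<in> PiE {..<n+2} (\<lambda>_. configs S N)"
        have "F \<rho> = F (restrict \<rho> {..<n})" by (rule depends_onD[OF F]) auto
        moreover have "restrict \<rho> {..<n} \<in> PiE {..<n} (\<lambda>_. configs S N)"
          by (rule restrict_replicas[OF \<rho>]) simp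
        ultimately have "F \<rho> \<ge> 0" using pos by metis
        thus "\<bar>F \<rho> * dev N i k l \<rho>\<bar> \<le> 2 * real S ^ 4 * F \<rho>"
          using dev_abs_le[OF \<rho> kl i] by (simp add: abs_mult mult.commute mult_left_mono)
      qed
      also have "\<dots> = 2 * real S ^ 4 * nui N i s n F"
        by (subst nui_cmult, subst nui_extend[OF _ F]) auto
      finally show ?thesis .
    qed
    have "\<bar>\<Sum>k<n+2. \<Sum>l<n+2. rsgn n k * rsgn (n+1) l * nui N i s (n+2) (\<lambda>\<rho>. F \<rho> * dev N i k l \<rho>)\<bar>
      \<le> (\<Sum>k<n+2. \<Sum>l<n+2. \<bar>rsgn n k * rsgn (n+1) l\<bar> * (2 * real S ^ 4 * nui N i s n F))"
    proof (rule order_trans[OF sum_abs], rule sum_mono, rule order_trans[OF sum_abs], rule sum_mono)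
      fix k l assume "k \<in> {..<n+2}" "l \<in> {..<n+2}"
      hence "k < n+2" "l < n+2" by auto
      from mult_left_mono[OF 1[OF this] abs_ge_zero]
      show "\<bar>rsgn n k * rsgn (n+1) l * nui N i s (n+2) (\<lambda>\<rho>. F \<rho> * dev N i k l \<rho>)\<bar> \<le>
          \<bar>rsgn n k * rsgn (n+1) l\<bar> * (2 * real S ^ 4 * nui N i s n F)"
        unfolding abs_mult[of "rsgn n k * rsgn (n+1) l"] by blast
    qed
    also have "\<dots> = wn n * (2 * real S ^ 4 * nui N i s n F)"
      unfolding wn_def sum_distrib_right ..
    finally have "\<bar>d s\<bar> \<le> \<beta>\<^sup>2 / 2 * (wn n * (2 * real S ^ 4 * nui N i s n F))"
      unfolding d_def abs_mult[of "\<beta>\<^sup>2 / 2"] \<beta>_half by (rule mult_left_mono) simp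
    also have "\<dots> = \<beta>\<^sup>2 * (C * nui N i s n F)" by (simp add: C_def)
    also have "\<dots> \<le> 1 * (C * nui N i s n F)"
      using \<beta>_pos \<beta>_le1 C F0 by (intro mult_right_mono) (auto intro: power_le_one)
    finally show ?thesis by simp
  qed
  let ?g = "\<lambda>s. exp (C * s) * nui N i s n F"
  have "?g t \<le> ?g 1"
  proof (cases "t = 1")
    case False
    hence t1: "t < 1" using t by simp
    have der: "(?g has_real_derivative C * exp (C * s) * nui N i s n F + exp (C * s) * d s) (at s)"
        if "t < s" "s < 1" for s
    proof -
      have "(nui N i s n F * (C * exp (C * s)) + d s * exp (C * s)) = C * exp (C * s) * nui N i s n F +
          exp (C * s) * d s" by simp
      moreover have "((\<lambda>s. exp (C * s)) has_real_derivative C * exp (C * s)) (at s)"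
          by (auto intro!: derivative_eq_intros)
      moreover have "((\<lambda>t. nui N i t n F) has_real_derivative d s) (at s)"
        unfolding d_def using that t by (intro nui_deriv i F) auto
      ultimately show ?thesis using DERIV_mult[of "\<lambda>s. exp (C * s)" "C * exp (C * s)" s UNIV "\<lambda>t. nui N i t n F"
          "d s"]
        by (simp add: mult.commute)
    qed
    have "continuous_on {t..1} ?g"
      by (intro continuous_intros continuous_on_subset[OF nui_continuous[OF i F]]) (use t in auto)
    moreover have "?g differentiable (at s)" if "t < s" "s < 1" for s
      using der[OF that] real_differentiable_def by blast
    ultimately obtain l z where z: "t < z" "z < 1" "DERIV ?g z :> l" "?g 1 - ?g t = (1 - t) * l"
      using MVT[OF t1, of ?g] by blast
    have "l = C * exp (C * z) * nui N i z n F + exp (C * z) * d z"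
      using DERIV_unique[OF z(3) der[OF z(1,2)]] .
    also have "\<dots> = exp (C * z) * (C * nui N i z n F + d z)" by (simp add: algebra_simps)
    also have "\<dots> \<ge> 0" using d[of z] by (intro mult_nonneg_nonneg) auto
    finally have "(1 - t) * l \<ge> 0" using t1 by simp
    thus ?thesis using z(4) by linarith
  qed simp
  moreover have "nui N i t n F \<le> ?g t"
    using F0[of t] t C by (simp add: mult_le_cancel_right1)
  ultimately show ?thesis using nui_1[OF F, of N i] by (simp add: C_def)
qed

text \<open>Times \<open>\<beta>\<^sup>2\<close>, this bounds the derivative of
  \<open>nui N i t n F\<close> in \<open>t\<close> through the original measure. That factor is left
  out so that its smallness stays visible in the estimates; the 1/2 is that of the derivative
  formula, and the exponential comes from \<open>nui_le_nun\<close> with \<open>n + 2\<close>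
  replicas.\<close>

definition dbd :: "nat \<Rightarrow> nat \<Rightarrow> nat \<Rightarrow> ((nat \<Rightarrow> nat \<Rightarrow> real) \<Rightarrow> real) \<Rightarrow> real" where
  "dbd N i n F = exp (wn (n+2) * real S ^ 4) / 2 *
     (\<Sum>k<n+2. \<Sum>l<n+2. \<bar>rsgn n k * rsgn (n+1) l\<bar> * nun N (n+2) (\<lambda>\<rho>. \<bar>F \<rho> * dev N i k l \<rho>\<bar>))"

lemma nui_first_order:
  assumes i: "i < N" and t: "0 \<le> t" "t \<le> 1" and F: "depends_on {..<n} F"
  shows "\<bar>nui N i t n F - nui N i 0 n F\<bar> \<le> \<beta>\<^sup>2 * dbd N i n F"
proof (cases "t = 0")
  case True
  have "dbd N i n F \<ge> 0" unfolding dbd_def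
    by (intro mult_nonneg_nonneg sum_nonneg nun_nonneg depends_on_comp1[OF depends_on_dev_prod[OF F]]) auto
  thus ?thesis using True by simp
next
  case False
  hence t0: "0 < t" using t by simp
  define d where "d s = \<beta>\<^sup>2 / 2 * (\<Sum>k<n+2. \<Sum>l<n+2. rsgn n k * rsgn (n+1) l * nui N i s (n+2) (\<lambda>\<rho>. F \<rho> * dev N i
      k l \<rho>))" for s
  have der: "((\<lambda>t. nui N i t n F) has_real_derivative d s) (at s)" if "0 < s" "s < t" for s
    unfolding d_def using that t by (intro nui_deriv i F) auto
  have "continuous_on {0..t} (\<lambda>t. nui N i t n F)"
    by (intro continuous_on_subset[OF nui_continuous[OF i F]]) (use t in auto)
  moreover have "(\<lambda>t. nui N i t n F) differentiable (at s)" if "0 < s" "s < t" for s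
    using der[OF that] real_differentiable_def by blast
  ultimately obtain l z where z: "0 < z" "z < t" "DERIV (\<lambda>t. nui N i t n F) z :> l"
      "nui N i t n F - nui N i 0 n F = (t - 0) * l"
    using MVT[OF t0, of "\<lambda>t. nui N i t n F"] by blast
  have l: "l = d z" using DERIV_unique[OF z(3) der[OF z(1,2)]] .
  have 1: "\<bar>nui N i z (n+2) (\<lambda>\<rho>. F \<rho> * dev N i k l \<rho>)\<bar> \<le> exp (wn (n+2) * real S ^ 4) * nun N (n+2)
      (\<lambda>\<rho>. \<bar>F \<rho> * dev N i k l \<rho>\<bar>)"
    if kl: "k < n+2" "l < n+2" for k l
    by (rule order_trans[OF nui_abs[OF depends_on_dev_prod[OF F kl]]], rule nui_le_nun[OF i])
       (use z t in \<open>auto intro!: depends_on_comp1[OF depends_on_dev_prod[OF F kl, unfolded add_2_eq_Suc']]\<close>)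
  have "\<bar>\<Sum>k<n+2. \<Sum>l<n+2. rsgn n k * rsgn (n+1) l * nui N i z (n+2) (\<lambda>\<rho>. F \<rho> * dev N i k l \<rho>)\<bar>
      \<le> (\<Sum>k<n+2. \<Sum>l<n+2. \<bar>rsgn n k * rsgn (n+1) l\<bar> * (exp (wn (n+2) * real S ^ 4) * nun N (n+2)
          (\<lambda>\<rho>. \<bar>F \<rho> * dev N i k l \<rho>\<bar>)))"
  proof (rule order_trans[OF sum_abs], rule sum_mono, rule order_trans[OF sum_abs], rule sum_mono)
    fix k l assume "k \<in> {..<n+2}" "l \<in> {..<n+2}"
    hence "k < n+2" "l < n+2" by auto
    from mult_left_mono[OF 1[OF this] abs_ge_zero]
    show "\<bar>rsgn n k * rsgn (n+1) l * nui N i z (n+2) (\<lambda>\<rho>. F \<rho> * dev N i k l \<rho>)\<bar> \<le>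
        \<bar>rsgn n k * rsgn (n+1) l\<bar> * (exp (wn (n+2) * real S ^ 4) * nun N (n+2) (\<lambda>\<rho>. \<bar>F \<rho> * dev N i k l \<rho>\<bar>))"
      unfolding abs_mult[of "rsgn n k * rsgn (n+1) l"] by blast
  qed
  also have "\<dots> = 2 * dbd N i n F"
    unfolding dbd_def sum_distrib_left by (simp only: mult_ac times_divide_eq_left times_divide_eq_right) simp
  finally have "\<bar>d z\<bar> \<le> \<beta>\<^sup>2 / 2 * (2 * dbd N i n F)"
    unfolding d_def abs_mult[of "\<beta>\<^sup>2 / 2"] \<beta>_half by (rule mult_left_mono) simp
  moreover have "\<bar>nui N i t n F - nui N i 0 n F\<bar> \<le> 1 * \<bar>d z\<bar>"
    unfolding z(4) l abs_mult using t by (intro mult_right_mono) auto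
  ultimately show ?thesis by simp
qed

text \<open>The mean value theorem yields the derivative at some \<open>z\<close> between 0 and 1.
  Each of its terms is again an interpolated average, and \<open>nui_first_order\<close> compares it
  with its value at 0, so no second derivative has to be computed.\<close>

lemma nun_second_order:
  assumes i: "i < N" and F: "depends_on {..<n} F"
  shows "\<bar>nun N n F - nui N i 0 n F - \<beta>\<^sup>2 / 2 * (\<Sum>k<n+2. \<Sum>l<n+2. rsgn n k * rsgn (n+1) l * nui N i 0 (n+2)
      (\<lambda>\<rho>. F \<rho> * dev N i k l \<rho>))\<bar>
     \<le> \<beta>\<^sup>2 / 2 * (\<Sum>k<n+2. \<Sum>l<n+2. \<bar>rsgn n k * rsgn (n+1) l\<bar> * (\<beta>\<^sup>2 * dbd N i (n+2) (\<lambda>\<rho>. F \<rho> * dev N i k l \<rho>)))"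
proof -
  define d where "d s = \<beta>\<^sup>2 / 2 * (\<Sum>k<n+2. \<Sum>l<n+2. rsgn n k * rsgn (n+1) l * nui N i s (n+2) (\<lambda>\<rho>. F \<rho> * dev N i
      k l \<rho>))" for s
  have der: "((\<lambda>t. nui N i t n F) has_real_derivative d s) (at s)" if "0 < s" "s < 1" for s
    unfolding d_def using that by (intro nui_deriv i F) auto
  have "(\<lambda>t. nui N i t n F) differentiable (at s)" if "0 < s" "s < 1" for s
    using der[OF that] real_differentiable_def by blast
  then obtain l z where z: "0 < z" "z < 1" "DERIV (\<lambda>t. nui N i t n F) z :> l" "nui N i 1 n F - nui N i 0 n F =
      (1 - 0) * l"
    using MVT[OF zero_less_one, of "\<lambda>t. nui N i t n F"] nui_continuous[OF i F] by blast
  have l: "l = d z" using DERIV_unique[OF z(3) der[OF z(1,2)]] .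
  have dd: "d z - d 0 = \<beta>\<^sup>2 / 2 * (\<Sum>k<n+2. \<Sum>l<n+2. rsgn n k * rsgn (n+1) l *
      (nui N i z (n+2) (\<lambda>\<rho>. F \<rho> * dev N i k l \<rho>) - nui N i 0 (n+2) (\<lambda>\<rho>. F \<rho> * dev N i k l \<rho>)))"
    unfolding d_def right_diff_distrib sum_subtractf ..
  have A: "\<bar>d z - d 0\<bar> \<le> \<beta>\<^sup>2 / 2 * (\<Sum>k<n+2. \<Sum>l<n+2. \<bar>rsgn n k * rsgn (n+1) l\<bar> * (\<beta>\<^sup>2 * dbd N i (n+2)
      (\<lambda>\<rho>. F \<rho> * dev N i k l \<rho>)))"
    unfolding dd abs_mult[of "\<beta>\<^sup>2 / 2"] \<beta>_half
  proof (rule mult_left_mono)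
    show "\<bar>\<Sum>k<n+2. \<Sum>l<n+2. rsgn n k * rsgn (n+1) l *
      (nui N i z (n+2) (\<lambda>\<rho>. F \<rho> * dev N i k l \<rho>) - nui N i 0 (n+2) (\<lambda>\<rho>. F \<rho> * dev N i k l \<rho>))\<bar>
      \<le> (\<Sum>k<n+2. \<Sum>l<n+2. \<bar>rsgn n k * rsgn (n+1) l\<bar> * (\<beta>\<^sup>2 * dbd N i (n+2) (\<lambda>\<rho>. F \<rho> * dev N i k l \<rho>)))"
    proof (rule order_trans[OF sum_abs], rule sum_mono, rule order_trans[OF sum_abs], rule sum_mono)
      fix k l assume "k \<in> {..<n+2}" "l \<in> {..<n+2}"
      hence kl: "k < n+2" "l < n+2" by auto
      from z have z': "0 \<le> z" "z \<le> 1" by auto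
      from mult_left_mono[OF nui_first_order[OF i z' depends_on_dev_prod[OF F kl]] abs_ge_zero]
      show "\<bar>rsgn n k * rsgn (n+1) l * (nui N i z (n+2) (\<lambda>\<rho>. F \<rho> * dev N i k l \<rho>) - nui N i 0 (n+2)
          (\<lambda>\<rho>. F \<rho> * dev N i k l \<rho>))\<bar>
        \<le> \<bar>rsgn n k * rsgn (n+1) l\<bar> * (\<beta>\<^sup>2 * dbd N i (n+2) (\<lambda>\<rho>. F \<rho> * dev N i k l \<rho>))"
        unfolding dd abs_mult[of "rsgn n k * rsgn (n+1) l"] by blast
    qed
  qed simp
  have e: "nun N n F - nui N i 0 n F = d z"
    using z(4) unfolding l nui_1[OF F] diff_0_right mult_1 .
  show ?thesis using A unfolding e d_def[of 0] .
qed

text \<open>The site average without site \<open>i\<close>, but still normalised by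
  \<open>N\<close>, so that it differs from \<open>lav\<close> by a single term of order
  \<open>1 / N\<close>.\<close>

definition lavm :: "((nat \<Rightarrow> real) \<Rightarrow> real) \<Rightarrow> nat \<Rightarrow> nat \<Rightarrow> (nat \<Rightarrow> nat \<Rightarrow> real) \<Rightarrow> real" where
  "lavm \<phi> N i \<rho> = lav \<phi> N \<rho> - \<phi> (\<lambda>k. \<rho> k i) / real N"

lemma lavm_eq: "i < N \<Longrightarrow> lavm \<phi> N i \<rho> = (\<Sum>j\<in>{..<N} - {i}. \<phi> (\<lambda>k. \<rho> k j)) / real N"
  unfolding lavm_def lav_def by (subst sum.remove[of "{..<N}" i]) (auto simp: add_divide_distrib)

lemma site_free_lavm: "i < N \<Longrightarrow> site_free i (lavm \<phi> N i)"
  unfolding site_free_def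
proof (intro allI impI)
  fix \<rho> \<rho>' :: "nat \<Rightarrow> nat \<Rightarrow> real" assume "i < N" and eq: "\<forall>k j. j \<noteq> i \<longrightarrow> \<rho> k j = \<rho>' k j"
  have "(\<lambda>k. \<rho> k j) = (\<lambda>k. \<rho>' k j)" if "j \<noteq> i" for j using eq that by auto
  thus "lavm \<phi> N i \<rho> = lavm \<phi> N i \<rho>'"
    unfolding lavm_eq[OF \<open>i < N\<close>] by (metis (mono_tags, lifting) DiffD2 singletonI sum.cong)
qed

lemma depends_on_lavm: "depends_on I \<phi> \<Longrightarrow> depends_on I (lavm \<phi> N i)"
  unfolding lavm_def[abs_def]
  by (intro depends_on_minus depends_on_divide depends_on_lav depends_on_site depends_on_const)

lemma site_free_comp1: "site_free i F \<Longrightarrow> site_free i (\<lambda>\<rho>. u (F \<rho>))"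
  unfolding site_free_def by metis

lemma site_free_mult: "site_free i F \<Longrightarrow> site_free i F' \<Longrightarrow> site_free i (\<lambda>\<rho>. F \<rho> * F' \<rho> :: real)"
  unfolding site_free_def by metis

lemma site_free_prod: "(\<And>j. j \<in> J \<Longrightarrow> site_free i (F j)) \<Longrightarrow> site_free i (\<lambda>\<rho>. \<Prod>j\<in>J. F j \<rho> :: real)"
  unfolding site_free_def by (intro allI impI prod.cong) auto

text \<open>Only the coordinates of one replica enter the following averages, so they are moments of
  the single-site measure.\<close>

lemma prob_weights_lw: "prob_weights (spins S) (lw \<eta>)"
  unfolding lw_def by (rule prob_weights_gibbs) auto

lemma lw_moment: "(\<Sum>s\<in>spins S. lw \<eta> s * s ^ j) = meta S \<beta> D hf p q j \<eta>"
proof -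
  have "weta \<beta> D hf p q \<eta> s = exp (lexp \<eta> s)" for s by (simp add: weta_def lexp_def)
  thus ?thesis unfolding meta_def lw_def gibbs_weight_def
    by (simp add: sum_divide_distrib mult.commute)
qed

abbreviation "mm \<equiv> meta S \<beta> D hf p q"

lemma mm_0 [simp]: "mm 0 \<eta> = 1"
  using prob_weights.total[OF prob_weights_lw] lw_moment[of \<eta> 0] by simp

text \<open>This is where the fixed-point equations enter. Given \<open>\<eta>\<close>, two distinct
  replicas give \<open>m_1\<^sup>2\<close> and a repeated one gives \<open>m_2\<close>; the averages
  over \<open>\<eta>\<close> are \<open>q\<close> and \<open>p\<close>.\<close>

lemma cc_ee:
  assumes "k < n" "l < n" shows "cc n (ee k l) = 0"
proof -
  interpret std: prob_space std_normal by (rule prob_space_std_normal)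
  have av: "rep_avg (spins S) (lw \<eta>) {..<n} (ee k l) = (if k = l then mm 2 \<eta> - p else (mm 1 \<eta>)\<^sup>2 - q)" for \<eta>
  proof -
    interpret prob_weights "spins S" "lw \<eta>" by (rule prob_weights_lw)
    have c: "avg {..<n} (\<lambda>_. c) = c" for c by (rule avg_const) simp
    have 1: "avg {..<n} (\<lambda>s. s m) = mm 1 \<eta>" if "m < n" for m
      using avg_pull[of "{..<n}" m "\<lambda>_. 1" "\<lambda>x. x"] that lw_moment[of \<eta> 1] by (simp add: c)
    show ?thesis
    proof (cases "k = l")
      case True
      have "avg {..<n} (\<lambda>s. (s k)\<^sup>2) = mm 2 \<eta>"
        using avg_pull[of "{..<n}" k "\<lambda>_. 1" "\<lambda>x. x\<^sup>2"] assms lw_moment[of \<eta> 2] by (simp add: c)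
      thus ?thesis using True unfolding ee_def[abs_def] by (simp add: rep_avg_diff c power2_eq_square)
    next
      case False
      have "avg {..<n} (\<lambda>s. s k * s l) = mm 1 \<eta> * mm 1 \<eta>"
        using avg_pull[of "{..<n}" k "\<lambda>s. s l" "\<lambda>x. x"] assms False lw_moment[of \<eta> 1] 1[of l] by simp
      thus ?thesis using False unfolding ee_def[abs_def] by (simp add: rep_avg_diff c power2_eq_square)
    qed
  qed
  show ?thesis
  proof (cases "k = l")
    case True
    have "integrable std_normal (\<lambda>\<eta>. mm 2 \<eta>)"
    proof (rule std.integrable_const_bound[where B = "real S ^ 2"])
      show "AE \<eta> in std_normal. norm (mm 2 \<eta>) \<le> real S ^ 2" using meta_abs_le[of 2] by auto
      show "mm 2 \<in> borel_measurable std_normal" unfolding meta_def[abs_def] weta_def by measurable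
    qed
    thus ?thesis unfolding cc_def av using True fp by (simp add: fixed_point_def std.prob_space[simplified])
  next
    case False
    have "integrable std_normal (\<lambda>\<eta>. (mm 1 \<eta>)\<^sup>2)"
    proof (rule std.integrable_const_bound[where B = "real S ^ 2"])
      show "AE \<eta> in std_normal. norm ((mm 1 \<eta>)\<^sup>2) \<le> real S ^ 2"
        using power_mono[OF meta_abs_le[of 1] abs_ge_zero, of _ 2] by simp
      show "(\<lambda>\<eta>. (mm 1 \<eta>)\<^sup>2) \<in> borel_measurable std_normal" unfolding meta_def[abs_def] weta_def by measurable
    qed
    thus ?thesis unfolding cc_def av using False fp by (simp add: fixed_point_def std.prob_space[simplified])
  qed
qed

end

section \<open>Elementary inequalities\<close>

lemma abs_power_diff_le:
  fixes a b M :: real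
  assumes "\<bar>a\<bar> \<le> M" "\<bar>b\<bar> \<le> M"
  shows "\<bar>a ^ Suc k - b ^ Suc k\<bar> \<le> real (Suc k) * \<bar>a - b\<bar> * M ^ k"
proof (induction k)
  case (Suc k)
  have M: "M \<ge> 0" using assms(1) by linarith
  have "\<bar>a ^ Suc (Suc k) - b ^ Suc (Suc k)\<bar> = \<bar>a * (a ^ Suc k - b ^ Suc k) + (a - b) * b ^ Suc k\<bar>"
    by (simp add: algebra_simps)
  also have "\<dots> \<le> \<bar>a\<bar> * \<bar>a ^ Suc k - b ^ Suc k\<bar> + \<bar>a - b\<bar> * \<bar>b\<bar> ^ Suc k"
    by (rule order_trans[OF abs_triangle_ineq]) (simp add: abs_mult power_abs)
  also have "\<dots> \<le> M * (real (Suc k) * \<bar>a - b\<bar> * M ^ k) + \<bar>a - b\<bar> * M ^ Suc k"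
    using M assms by (intro add_mono mult_mono Suc.IH power_mono) auto
  also have "\<dots> = real (Suc (Suc k)) * \<bar>a - b\<bar> * M ^ Suc k"
    by (simp add: algebra_simps)
  finally show ?case .
qed simp

lemma power_add_le:
  fixes x y :: real
  assumes "x \<ge> 0" "y \<ge> 0" shows "(x + y) ^ k \<le> 2 ^ k * (x ^ k + y ^ k)"
proof -
  have "(x + y) ^ k \<le> (2 * max x y) ^ k" using assms by (intro power_mono) auto
  also have "\<dots> = 2 ^ k * max x y ^ k" by (rule power_mult_distrib)
  also have "max x y ^ k \<le> x ^ k + y ^ k" using assms by (simp add: max_def)
  finally show ?thesis by simp
qed

lemma power_mult_le_add:
  fixes x y :: real
  assumes "x \<ge> 0" "y \<ge> 0" shows "x ^ k * y \<le> x ^ Suc k + y ^ Suc k"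
proof (cases "x \<le> y")
  case True
  hence "x ^ k * y \<le> y ^ k * y" using assms by (intro mult_right_mono power_mono) auto
  also have "\<dots> \<le> x ^ Suc k + y ^ Suc k" using assms by simp
  finally show ?thesis .
next
  case False
  hence "x ^ k * y \<le> x ^ k * x" using assms by (intro mult_left_mono) auto
  also have "\<dots> \<le> x ^ Suc k + y ^ Suc k" using assms by simp
  finally show ?thesis .
qed

lemma mult_le_squares: "a * b \<le> a\<^sup>2 + (b::real)\<^sup>2"
proof -
  have "2 * (a * b) \<le> a\<^sup>2 + b\<^sup>2" using sum_squares_bound[of a b] by simp
  moreover have "0 \<le> a\<^sup>2 + b\<^sup>2" by simp
  ultimately show ?thesis by linarith
qed

section \<open>Concentration of the overlaps\<close>

text \<open>Origin of the 8: with \<open>t\<close> for \<open>\<beta>\<^sup>2\<close> times the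
  bracket, each of the two kinds of overlap reproduces \<open>2 * t\<close> times their joint
  moment, and \<open>8 * t \<le> 1\<close> makes the total at most one half. \<open>wn 2\<close> and
  \<open>wn 4\<close> occur because two replicas become four after differentiation. The order of the
  moment does not enter, so one \<beta> serves for all orders.\<close>

locale gs_small = gs_model +
  assumes small: "8 * \<beta>\<^sup>2 * (exp (wn 4 * real S ^ 4) * wn 2 * real S ^ 4) \<le> 1"
begin

lemma nun_ee_moment:
  assumes "k < n" "l < n"
  shows "nun N n (\<lambda>\<rho>. lav (ee k l) N \<rho> ^ j) = nun N 2 (\<lambda>\<rho>. lav (if k = l then ee 0 0 else ee 0 1) N \<rho> ^ j)"
proof (cases "k = l")
  case True
  let ?F = "\<lambda>\<rho>. lav (ee 0 0) N \<rho> ^ j"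
  have F: "depends_on {..<1} ?F"
    by (intro depends_on_comp1[where u = "\<lambda>x. x ^ j"] depends_on_lav depends_on_ee) auto
  have "nun N n (\<lambda>\<rho>. lav (ee k k) N \<rho> ^ j) = nun N n (\<lambda>\<rho>. ?F (\<lambda>x. \<rho> ((\<lambda>_. k) x)))"
    by (simp add: lav_def ee_def)
  also have "\<dots> = nun N 1 ?F"
    by (rule nun_reindex[OF _ _ F]) (use assms in \<open>auto simp: inj_on_def\<close>)
  also have "\<dots> = nun N 2 ?F"
    by (rule nun_extend[OF _ F, symmetric]) simp
  finally show ?thesis using True by simp
next
  case False
  let ?F = "\<lambda>\<rho>. lav (ee 0 1) N \<rho> ^ j"
  let ?\<pi> = "\<lambda>x::nat. if x = 0 then k else l"
  have F: "depends_on {..<2} ?F"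
    by (intro depends_on_comp1[where u = "\<lambda>x. x ^ j"] depends_on_lav depends_on_ee) auto
  have "nun N n (\<lambda>\<rho>. lav (ee k l) N \<rho> ^ j) = nun N n (\<lambda>\<rho>. ?F (\<lambda>x. \<rho> (?\<pi> x)))"
    using False by (simp add: lav_def ee_def)
  also have "\<dots> = nun N 2 ?F"
    by (rule nun_reindex[OF _ _ F]) (use assms False in \<open>auto simp: inj_on_def\<close>)
  finally show ?thesis using False by simp
qed

text \<open>The two kinds of overlap are estimated together, since the derivative of a moment of
  either kind produces both.\<close>

definition xmom :: "nat \<Rightarrow> nat \<Rightarrow> real" where
  "xmom m N = nun N 2 (\<lambda>\<rho>. lav (ee 0 1) N \<rho> ^ (2*m)) + nun N 2 (\<lambda>\<rho>. lav (ee 0 0) N \<rho> ^ (2*m))"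

lemma depends_on_lav_power: "k < n \<Longrightarrow> l < n \<Longrightarrow> depends_on {..<n} (\<lambda>\<rho>. lav (ee k l) N \<rho> ^ j)"
  by (intro depends_on_comp1[where u = "\<lambda>x. x ^ j"] depends_on_lav depends_on_ee) auto

lemma even_moment_nonneg: "k < n \<Longrightarrow> l < n \<Longrightarrow> 0 \<le> nun N n (\<lambda>\<rho>. lav (ee k l) N \<rho> ^ (2*m))"
  by (intro nun_nonneg depends_on_lav_power) (auto simp: power_mult)

lemma even_moment_le_xmom:
  assumes "k < n" "l < n" shows "nun N n (\<lambda>\<rho>. lav (ee k l) N \<rho> ^ (2*m)) \<le> xmom m N"
  unfolding nun_ee_moment[OF assms] xmom_def
  using even_moment_nonneg[of 0 2 1 N m] even_moment_nonneg[of 0 2 0 N m] by auto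

text \<open>One of the \<open>2 * Suc m\<close> factors is written as an average over sites and
  evaluated at a single site \<open>i\<close>. With the other factors freed of site
  \<open>i\<close>, the decoupled value is 0 by \<open>cc_ee\<close>. The derivative brings one
  further overlap, hence a moment of the same order times \<beta>^2, and removing site
  \<open>i\<close> costs only terms of lower order.\<close>

lemma overlap_moment_site:
  fixes l :: nat
  assumes l2: "l < 2"
  shows "\<exists>K\<ge>0. \<forall>N\<ge>2. nun N 2 (\<lambda>\<rho>. lav (ee 0 l) N \<rho> ^ (2 * Suc m))
     \<le> 2 * \<beta>\<^sup>2 * (exp (wn 4 * real S ^ 4) * wn 2 * real S ^ 4) * xmom (Suc m) N +
         K * ((xmom m N + 1 / real N ^ (2*m)) / real N)"
proof -
  define B where "B = 2 * real S ^ 2"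
  \<comment> \<open>\<open>B\<close> bounds an overlap fluctuation at one site. \<open>c0\<close> is
    the cost of removing site \<open>i\<close> from a power of degree \<open>2 * m + 1\<close>, via
    \<open>abs_power_diff_le\<close> and \<open>power_add_le\<close>; \<open>c1\<close> collects the
    lower-order part of the derivative terms, and \<open>c2\<close> is its weight in the first-order
    estimate.\<close>
  define c0 where "c0 = real (Suc (2*m)) * B * (2 ^ (2*m) * (1 + B ^ (2*m)))"
  define c1 where "c1 = B * (real S ^ 4 * B + 2 * real S ^ 4 * c0)"
  define c2 where "c2 = \<beta>\<^sup>2 * (exp (wn 4 * real S ^ 4) / 2 * (wn 2 * c1))"
  define K where "K = c2 + B * c0"
  have B0: "B \<ge> 0" by (simp add: B_def)
  have c0: "c0 \<ge> 0" unfolding c0_def using B0 by (intro mult_nonneg_nonneg) auto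
  have c1: "c1 \<ge> 0" unfolding c1_def using B0 c0 by (intro mult_nonneg_nonneg add_nonneg_nonneg) auto
  have c2: "c2 \<ge> 0" unfolding c2_def using c1 wn_nonneg by (intro mult_nonneg_nonneg) auto
  have K: "K \<ge> 0" unfolding K_def using c2 B0 c0 by simp
  show ?thesis
  proof (intro exI[of _ K] conjI K allI impI)
    fix N :: nat assume N2: "2 \<le> N"
    hence N: "real N > 0" by simp
    let ?A = "lav (ee 0 l) N"
    \<comment> \<open>Shape of the error made by replacing \<open>?A\<close> by its version without
      site \<open>i\<close>: the difference of the two is at most \<open>B / N\<close>, and it
      multiplies a power of degree \<open>2 * m\<close> of the overlap plus \<open>B / N\<close>.
      The mean involves only the moment of the previous order.\<close>
    define R where "R \<rho> = (?A \<rho> ^ (2*m) + 1 / real N ^ (2*m)) / real N" for \<rho>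
    define r where "r = (xmom m N + 1 / real N ^ (2*m)) / real N"
    have R0: "R \<rho> \<ge> 0" for \<rho> unfolding R_def by (intro divide_nonneg_nonneg add_nonneg_nonneg)
        (auto simp: power_mult)
    have dR: "depends_on {..<n} R" if "2 \<le> n" for n
      unfolding R_def[abs_def] using l2 that
      by (intro depends_on_divide depends_on_plus depends_on_const depends_on_lav_power) auto
    have nR: "nun N n R \<le> r" if "2 \<le> n" for n
    proof -
      have "nun N n R = nun N n (\<lambda>\<rho>. (1 / real N) * (?A \<rho> ^ (2*m) + 1 / real N ^ (2*m)))"
        by (simp add: R_def[abs_def] field_simps)
      also have "\<dots> = (1 / real N) * (nun N n (\<lambda>\<rho>. ?A \<rho> ^ (2*m)) + 1 / real N ^ (2*m))"
        unfolding nun_cmult using l2 that by (subst nun_add) (auto intro!: depends_on_lav_power simp: nun_const)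
      also have "\<dots> \<le> (1 / real N) * (xmom m N + 1 / real N ^ (2*m))"
        using l2 that N by (intro mult_left_mono add_mono even_moment_le_xmom) auto
      finally show ?thesis by (simp add: r_def)
    qed
    have site: "nun N 2 (\<lambda>\<rho>. ee 0 l (\<lambda>k. \<rho> k i) * ?A \<rho> ^ Suc (2*m)) \<le>
        2 * \<beta>\<^sup>2 * (exp (wn 4 * real S ^ 4) * wn 2 * real S ^ 4) * xmom (Suc m) N + K * r" if i: "i < N" for i
    proof -
      let ?f = "\<lambda>\<rho>::nat \<Rightarrow> nat \<Rightarrow> real. ee 0 l (\<lambda>k. \<rho> k i)"
      let ?Ai = "lavm (ee 0 l) N i"
      let ?F = "\<lambda>\<rho>. ?f \<rho> * ?Ai \<rho> ^ Suc (2*m)"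
      have fB: "\<bar>?f \<rho>\<bar> \<le> B" if "\<rho> \<in> PiE {..<n} (\<lambda>_. configs S N)" "2 \<le> n" for \<rho> n
        unfolding B_def by (rule ee_abs_le[OF that(1)]) (use that l2 i in auto)
      have AB: "\<bar>?A \<rho>\<bar> \<le> B" if "\<rho> \<in> PiE {..<n} (\<lambda>_. configs S N)" "2 \<le> n" for \<rho> n
        unfolding B_def by (rule lav_abs_le[where B = "2 * real S ^ 2"]) (use N2 ee_abs_le[OF that(1)] that l2
            in auto)
      have diff: "\<bar>?A \<rho> ^ Suc (2*m) - ?Ai \<rho> ^ Suc (2*m)\<bar> \<le> c0 * R \<rho>" if \<rho>: "\<rho> \<in> PiE {..<n} (\<lambda>_. configs S N)"
          "2 \<le> n" for \<rho> n
      proof -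
        have d: "\<bar>?A \<rho> - ?Ai \<rho>\<bar> \<le> B / real N"
          using fB[OF \<rho>] N by (simp add: lavm_def divide_right_mono)
        have BN: "B / real N \<ge> 0" using B0 by simp
        have cN: "real (Suc (2*m)) * (B / real N) \<ge> 0" by (rule mult_nonneg_nonneg[OF of_nat_0_le_iff BN])
        have "\<bar>?Ai \<rho>\<bar> \<le> \<bar>?A \<rho>\<bar> + B / real N" using d by linarith
        hence "\<bar>?A \<rho> ^ Suc (2*m) - ?Ai \<rho> ^ Suc (2*m)\<bar> \<le> real (Suc (2*m)) * \<bar>?A \<rho> - ?Ai \<rho>\<bar> * (\<bar>?A \<rho>\<bar> +
            B / real N) ^ (2*m)"
          using BN by (intro abs_power_diff_le) auto
        also have "\<dots> \<le> real (Suc (2*m)) * (B / real N) * (2 ^ (2*m) * (\<bar>?A \<rho>\<bar> ^ (2*m) + (B / real N) ^ (2*m)))"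
          by (rule mult_mono[OF mult_left_mono[OF d of_nat_0_le_iff] power_add_le[OF abs_ge_zero BN] cN])
             (use BN in \<open>auto intro!: zero_le_power\<close>)
        also have "\<bar>?A \<rho>\<bar> ^ (2*m) = ?A \<rho> ^ (2*m)" by (simp add: power_even_abs)
        also have "(B / real N) ^ (2*m) = B ^ (2*m) * (1 / real N ^ (2*m))" by (simp add: power_divide)
        also have "real (Suc (2*m)) * (B / real N) * (2 ^ (2*m) * (?A \<rho> ^ (2*m) +
            B ^ (2*m) * (1 / real N ^ (2*m))))
          \<le> real (Suc (2*m)) * (B / real N) * (2 ^ (2*m) * ((1 + B ^ (2*m)) * (?A \<rho> ^ (2*m) +
              1 / real N ^ (2*m))))"
        proof (intro mult_left_mono)
          have gen: "x + w * y \<le> (1 + w) * (x + y)" if "x \<ge> 0" "y \<ge> 0" "w \<ge> 0" for x y w :: real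
            using that by (simp add: algebra_simps)
          have "0 \<le> ?A \<rho> ^ (2*m)" "0 \<le> 1 / real N ^ (2*m)" "0 \<le> B ^ (2*m)" using B0 by (auto simp: power_mult)
          thus "?A \<rho> ^ (2*m) + B ^ (2*m) * (1 / real N ^ (2*m)) \<le>
              (1 + B ^ (2*m)) * (?A \<rho> ^ (2*m) + 1 / real N ^ (2*m))"
            by (rule gen)
        qed (use cN in auto)
        also have "\<dots> = c0 * R \<rho>" by (simp add: c0_def R_def)
        finally show ?thesis .
      qed
      have F: "depends_on {..<2} ?F"
        using l2 by (intro depends_on_times depends_on_comp1[where u =
            "\<lambda>x. x ^ Suc (2*m)"] depends_on_lavm depends_on_site depends_on_ee) auto
      have FA: "depends_on {..<2} (\<lambda>\<rho>. ?f \<rho> * ?A \<rho> ^ Suc (2*m))"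
        using l2 by (intro depends_on_times depends_on_lav_power depends_on_site depends_on_ee) auto
      have "nui N i 0 2 ?F = cc 2 (ee 0 l) * nui N i 0 2 (\<lambda>\<rho>. ?Ai \<rho> ^ Suc (2*m))"
        using l2 by (intro nui_0_factor i depends_on_ee depends_on_comp1[where u =
            "\<lambda>x. x ^ Suc (2*m)"] depends_on_lavm
            site_free_comp1[where u = "\<lambda>x. x ^ Suc (2*m)"] site_free_lavm) auto
      hence F0: "nui N i 0 2 ?F = 0" using cc_ee[of 0 2 l] l2 by simp
      have "dbd N i 2 ?F \<le> exp (wn 4 * real S ^ 4) / 2 * (wn 2 * (B * real S ^ 2 * (2 * xmom (Suc m) N) +
          c1 * r))"
      proof -
        have trm: "nun N 4 (\<lambda>\<rho>. \<bar>?F \<rho> * dev N i k j \<rho>\<bar>) \<le> B * real S ^ 2 * (2 * xmom (Suc m) N) + c1 * r"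
          if kj: "k < 4" "j < 4" for k j
        proof -
          let ?Akj = "lav (ee k j) N"
          have dA1: "depends_on {..<4} (\<lambda>\<rho>. ?A \<rho> ^ (2 * Suc m))"
            by (rule depends_on_lav_power) (use l2 in auto)
          have dA2: "depends_on {..<4} (\<lambda>\<rho>. ?Akj \<rho> ^ (2 * Suc m))"
            by (rule depends_on_lav_power) (use kj in auto)
          note dA = dA1 dA2
          have dsum: "depends_on {..<4} (\<lambda>\<rho>. ?A \<rho> ^ (2 * Suc m) + ?Akj \<rho> ^ (2 * Suc m))"
            by (intro depends_on_plus dA)
          have d1: "depends_on {..<4} (\<lambda>\<rho>. (B * real S ^ 2) * (?A \<rho> ^ (2 * Suc m) + ?Akj \<rho> ^ (2 * Suc m)))"
            by (intro depends_on_times depends_on_const dsum)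
          have d2: "depends_on {..<4} (\<lambda>\<rho>. c1 * R \<rho>)"
            by (intro depends_on_times depends_on_const dR) auto
          have "nun N 4 (\<lambda>\<rho>. \<bar>?F \<rho> * dev N i k j \<rho>\<bar>) \<le>
             nun N 4 (\<lambda>\<rho>. (B * real S ^ 2) * (?A \<rho> ^ (2 * Suc m) + ?Akj \<rho> ^ (2 * Suc m)) + c1 * R \<rho>)"
          proof (rule nun_mono)
            show "depends_on {..<4} (\<lambda>\<rho>. \<bar>?F \<rho> * dev N i k j \<rho>\<bar>)"
              using depends_on_dev_prod[OF F, of k j N i] kj by (auto intro: depends_on_comp1[where u = abs])
            show "depends_on {..<4} (\<lambda>\<rho>. (B * real S ^ 2) * (?A \<rho> ^ (2 * Suc m) + ?Akj \<rho> ^ (2 * Suc m)) +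
                c1 * R \<rho>)"
              by (intro depends_on_plus d1 d2)
            fix \<rho> :: "nat \<Rightarrow> nat \<Rightarrow> real" assume \<rho>: "\<rho> \<in> PiE {..<4} (\<lambda>_. configs S N)"
            have fBr: "\<bar>?f \<rho>\<bar> \<le> B" by (rule fB[OF \<rho>]) simp
            have diffr: "\<bar>?A \<rho> ^ Suc (2*m) - ?Ai \<rho> ^ Suc (2*m)\<bar> \<le> c0 * R \<rho>" by (rule diff[OF \<rho>]) simp
            have ABr: "\<bar>?A \<rho>\<bar> \<le> B" by (rule AB[OF \<rho>]) simp
            define a where "a = \<bar>?A \<rho>\<bar>"
            define b where "b = \<bar>?Akj \<rho>\<bar>"
            have ab: "a \<ge> 0" "b \<ge> 0" "a \<le> B" using ABr by (auto simp: a_def b_def)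
            have eA: "?A \<rho> ^ (2 * Suc m) = a ^ (2 * Suc m)" "?A \<rho> ^ (2 * m) = a ^ (2 * m)"
                "?Akj \<rho> ^ (2 * Suc m) = b ^ (2 * Suc m)"
              unfolding a_def b_def by (simp_all only: power_even_abs even_mult_iff dvd_refl simp_thms)
            have spin: "\<bar>\<rho> k i * \<rho> j i\<bar> \<le> real S ^ 2"
              by (intro spin_prod_le rep_spin_abs_le[OF \<rho>] kj i)
            have "\<bar>?Akj \<rho> - \<rho> k i * \<rho> j i / real N\<bar> \<le> b + real S ^ 2 / real N"
            proof -
              have "\<bar>\<rho> k i * \<rho> j i / real N\<bar> \<le> real S ^ 2 / real N"
                using spin N by (simp add: divide_right_mono)
              thus ?thesis unfolding b_def by linarith
            qed
            hence dv1: "\<bar>dev N i k j \<rho>\<bar> \<le> real S ^ 2 * (b + real S ^ 2 / real N)"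
              unfolding dev_def abs_mult[of "\<rho> k i * \<rho> j i"] using spin by (intro mult_mono) auto
            have dv2: "\<bar>dev N i k j \<rho>\<bar> \<le> 2 * real S ^ 4" by (rule dev_abs_le[OF \<rho> kj i])
            have Ai: "\<bar>?Ai \<rho> ^ Suc (2*m)\<bar> \<le> a ^ Suc (2*m) + c0 * R \<rho>"
            proof -
              have "\<bar>?A \<rho> ^ Suc (2*m)\<bar> = a ^ Suc (2*m)" by (simp add: a_def power_abs abs_mult)
              thus ?thesis using diffr by linarith
            qed
            have "\<bar>?Ai \<rho> ^ Suc (2*m)\<bar> * \<bar>dev N i k j \<rho>\<bar> \<le> (a ^ Suc (2*m) + c0 * R \<rho>) * \<bar>dev N i k j \<rho>\<bar>"
              by (intro mult_right_mono Ai) auto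
            also have "\<dots> = a ^ Suc (2*m) * \<bar>dev N i k j \<rho>\<bar> + c0 * R \<rho> * \<bar>dev N i k j \<rho>\<bar>"
              by (rule distrib_right)
            also have "\<dots> \<le> a ^ Suc (2*m) * (real S ^ 2 * (b + real S ^ 2 / real N)) +
                c0 * R \<rho> * (2 * real S ^ 4)"
              using ab c0 R0 by (intro add_mono mult_left_mono dv1 dv2) auto
            also have "a ^ Suc (2*m) * (real S ^ 2 * (b + real S ^ 2 / real N)) =
                real S ^ 2 * (a ^ Suc (2*m) * b) + real S ^ 4 * (a * (a ^ (2*m) / real N))"
              by (simp add: algebra_simps power_numeral_reduce)
            \<comment> \<open>The overlap from \<open>dev\<close> may belong to another pair of
              replicas. The mixed product is split into even powers, whose means are bounded by
              \<open>xmom (Suc m) N\<close>.\<close>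
            also have "real S ^ 2 * (a ^ Suc (2*m) * b) \<le> real S ^ 2 * (a ^ (2 * Suc m) + b ^ (2 * Suc m))"
              using power_mult_le_add[OF ab(1,2), of "Suc (2*m)"] by (intro mult_left_mono) auto
            also have "real S ^ 4 * (a * (a ^ (2*m) / real N)) \<le> real S ^ 4 * (B * R \<rho>)"
            proof (intro mult_left_mono mult_mono)
              show "a ^ (2*m) / real N \<le> R \<rho>" unfolding R_def eA using N by (intro divide_right_mono) auto
            qed (use ab N B0 in auto)
            finally have *: "\<bar>?Ai \<rho> ^ Suc (2*m)\<bar> * \<bar>dev N i k j \<rho>\<bar> \<le>
              real S ^ 2 * (a ^ (2 * Suc m) + b ^ (2 * Suc m)) + (real S ^ 4 * (B * R \<rho>) +
                  c0 * R \<rho> * (2 * real S ^ 4))" by simp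
            have "\<bar>?F \<rho> * dev N i k j \<rho>\<bar> = \<bar>?f \<rho>\<bar> * (\<bar>?Ai \<rho> ^ Suc (2*m)\<bar> * \<bar>dev N i k j \<rho>\<bar>)"
              by (simp only: abs_mult mult.assoc)
            also have "\<dots> \<le> B * (real S ^ 2 * (a ^ (2 * Suc m) + b ^ (2 * Suc m)) + (real S ^ 4 * (B * R \<rho>) +
                c0 * R \<rho> * (2 * real S ^ 4)))"
              by (rule mult_mono[OF fBr *]) (use B0 in auto)
            also have "\<dots> = (B * real S ^ 2) * (?A \<rho> ^ (2 * Suc m) + ?Akj \<rho> ^ (2 * Suc m)) + c1 * R \<rho>"
              unfolding eA c1_def by (simp only: ring_distribs mult_ac)
            finally show "\<bar>?F \<rho> * dev N i k j \<rho>\<bar> \<le> (B * real S ^ 2) * (?A \<rho> ^ (2 * Suc m) +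
                ?Akj \<rho> ^ (2 * Suc m)) + c1 * R \<rho>" .
          qed
          also have "\<dots> = (B * real S ^ 2) * (nun N 4 (\<lambda>\<rho>. ?A \<rho> ^ (2 * Suc m)) +
              nun N 4 (\<lambda>\<rho>. ?Akj \<rho> ^ (2 * Suc m))) + c1 * nun N 4 R"
            by (simp only: nun_add[OF d1 d2] nun_cmult nun_add[OF dA])
          also have "\<dots> \<le> (B * real S ^ 2) * (xmom (Suc m) N + xmom (Suc m) N) + c1 * r"
            using B0 c1 l2 kj by (intro add_mono mult_left_mono even_moment_le_xmom nR) auto
          finally show ?thesis by simp
        qed
        have "(\<Sum>k<2+2. \<Sum>j<2+2. \<bar>rsgn 2 k * rsgn (2+1) j\<bar> * nun N (2+2) (\<lambda>\<rho>. \<bar>?F \<rho> * dev N i k j \<rho>\<bar>))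
          \<le> (\<Sum>k<2+2. \<Sum>j<2+2. \<bar>rsgn 2 k * rsgn (2+1) j\<bar> * (B * real S ^ 2 * (2 * xmom (Suc m) N) + c1 * r))"
        proof (intro sum_mono mult_left_mono)
          fix k j :: nat assume "k \<in> {..<2+2}" "j \<in> {..<2+2}"
          hence kj: "k < 4" "j < 4" by auto
          have "(2::nat) + 2 = 4" by simp
          thus "nun N (2+2) (\<lambda>\<rho>. \<bar>?F \<rho> * dev N i k j \<rho>\<bar>) \<le> B * real S ^ 2 * (2 * xmom (Suc m) N) + c1 * r"
            using trm[OF kj] by (simp only:)
        qed auto
        also have "\<dots> = wn 2 * (B * real S ^ 2 * (2 * xmom (Suc m) N) + c1 * r)"
          unfolding wn_def sum_distrib_right ..
        finally have s: "(\<Sum>k<2+2. \<Sum>j<2+2. \<bar>rsgn 2 k * rsgn (2+1) j\<bar> * nun N (2+2) (\<lambda>\<rho>. \<bar>?F \<rho> * dev N i k j \<rho>\<bar>))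
            \<le> \<dots>" .
        have "wn (2+2) = wn 4" by simp
        thus ?thesis unfolding dbd_def using mult_left_mono[OF s, of "exp (wn 4 * real S ^ 4) / 2"]
            by (simp only:) simp
      qed
      hence "\<beta>\<^sup>2 * dbd N i 2 ?F \<le>
          \<beta>\<^sup>2 * (exp (wn 4 * real S ^ 4) / 2 * (wn 2 * (B * real S ^ 2 * (2 * xmom (Suc m) N) + c1 * r)))"
        by (rule mult_left_mono) simp
      also have "\<dots> = 2 * \<beta>\<^sup>2 * (exp (wn 4 * real S ^ 4) * wn 2 * real S ^ 4) * xmom (Suc m) N + c2 * r"
        unfolding c2_def B_def by (simp add: algebra_simps power_numeral_reduce)
      finally have b1: "\<bar>nun N 2 ?F\<bar> \<le> 2 * \<beta>\<^sup>2 * (exp (wn 4 * real S ^ 4) * wn 2 * real S ^ 4) * xmom (Suc m) N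
          + c2 * r"
        using nui_first_order[OF i _ _ F, of 1] unfolding F0 nui_1[OF F] by simp
      have "nun N 2 (\<lambda>\<rho>. ?f \<rho> * ?A \<rho> ^ Suc (2*m)) - nun N 2 ?F = nun N 2 (\<lambda>\<rho>. ?f \<rho> * ?A \<rho> ^ Suc (2*m) - ?F \<rho>)"
        by (rule nun_diff[OF FA F, symmetric])
      also have "\<dots> \<le> nun N 2 (\<lambda>\<rho>. (B * c0) * R \<rho>)"
      proof (rule nun_mono)
        show "depends_on {..<2} (\<lambda>\<rho>. ?f \<rho> * ?A \<rho> ^ Suc (2*m) - ?F \<rho>)"
          by (rule depends_on_comp2[OF FA F])
        show "depends_on {..<2} (\<lambda>\<rho>. (B * c0) * R \<rho>)"
          by (intro depends_on_times depends_on_const dR) auto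
        fix \<rho> :: "nat \<Rightarrow> nat \<Rightarrow> real" assume \<rho>: "\<rho> \<in> PiE {..<2} (\<lambda>_. configs S N)"
            have fBr: "\<bar>?f \<rho>\<bar> \<le> B" by (rule fB[OF \<rho>]) simp
            have diffr: "\<bar>?A \<rho> ^ Suc (2*m) - ?Ai \<rho> ^ Suc (2*m)\<bar> \<le> c0 * R \<rho>" by (rule diff[OF \<rho>]) simp
            have ABr: "\<bar>?A \<rho>\<bar> \<le> B" by (rule AB[OF \<rho>]) simp
        have "?f \<rho> * ?A \<rho> ^ Suc (2*m) - ?F \<rho> \<le> \<bar>?f \<rho>\<bar> * \<bar>?A \<rho> ^ Suc (2*m) - ?Ai \<rho> ^ Suc (2*m)\<bar>"
          unfolding abs_mult[symmetric] right_diff_distrib[symmetric] by simp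
        also have "\<dots> \<le> B * (c0 * R \<rho>)"
          by (intro mult_mono fBr diffr) (use B0 in auto)
        finally show "?f \<rho> * ?A \<rho> ^ Suc (2*m) - ?F \<rho> \<le> (B * c0) * R \<rho>" by simp
      qed
      also have "\<dots> \<le> (B * c0) * r"
        unfolding nun_cmult using B0 c0 by (intro mult_left_mono nR) auto
      finally have b2: "nun N 2 (\<lambda>\<rho>. ?f \<rho> * ?A \<rho> ^ Suc (2*m)) - nun N 2 ?F \<le> (B * c0) * r" .
      show ?thesis using b1 b2 unfolding K_def by (simp add: algebra_simps)
    qed
    have "nun N 2 (\<lambda>\<rho>. ?A \<rho> ^ (2 * Suc m)) = nun N 2 (\<lambda>\<rho>. (1 / real N) * (\<Sum>i<N. ee 0 l (\<lambda>k. \<rho> k i) * ?A \<rho> ^ Suc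
        (2*m)))"
    proof (rule nun_cong)
      fix \<rho> :: "nat \<Rightarrow> nat \<Rightarrow> real"
      have "?A \<rho> ^ (2 * Suc m) = ?A \<rho> * ?A \<rho> ^ Suc (2*m)" by simp
      also have "\<dots> = (1 / real N) * (\<Sum>i<N. ee 0 l (\<lambda>k. \<rho> k i) * ?A \<rho> ^ Suc (2*m))"
        unfolding sum_distrib_right[symmetric] by (subst lav_def) simp
      finally show "?A \<rho> ^ (2 * Suc m) = (1 / real N) * (\<Sum>i<N. ee 0 l (\<lambda>k. \<rho> k i) * ?A \<rho> ^ Suc (2*m))" .
    qed
    also have "\<dots> = (1 / real N) * (\<Sum>i<N. nun N 2 (\<lambda>\<rho>. ee 0 l (\<lambda>k. \<rho> k i) * ?A \<rho> ^ Suc (2*m)))"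
      unfolding nun_cmult using l2
      by (subst nun_sum) (auto intro!: depends_on_times depends_on_lav_power[where j =
          "Suc (2*m)", simplified] depends_on_site depends_on_ee depends_on_lav depends_on_comp1[where u =
          "\<lambda>x. x ^ (2*m)"])
    also have "\<dots> \<le> (1 / real N) * (\<Sum>i<N. 2 * \<beta>\<^sup>2 * (exp (wn 4 * real S ^ 4) * wn 2 * real S ^ 4) * xmom (Suc m)
        N + K * r)"
      using N by (intro mult_left_mono sum_mono site) auto
    also have "\<dots> = 2 * \<beta>\<^sup>2 * (exp (wn 4 * real S ^ 4) * wn 2 * real S ^ 4) * xmom (Suc m) N + K * r"
      using N by simp
    finally show "nun N 2 (\<lambda>\<rho>. ?A \<rho> ^ (2 * Suc m)) \<le> 2 * \<beta>\<^sup>2 * (exp (wn 4 * real S ^ 4) * wn 2 * real S ^ 4) *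
        xmom (Suc m) N
       + K * ((xmom m N + 1 / real N ^ (2*m)) / real N)" unfolding r_def .
  qed
qed

text \<open>Induction on \<open>m\<close>. By \<open>small\<close>, at most half of
  \<open>xmom (Suc m) N\<close> reappears on the right-hand side and is absorbed; the rest is of the
  size of \<open>xmom m N / N\<close> plus an admissible power of \<open>1 / N\<close>.\<close>

lemma overlap_moments: "\<exists>K. \<forall>N\<ge>2. real N ^ m * xmom m N \<le> K"
proof (induction m)
  case 0
  show ?case by (intro exI[of _ 2]) (simp add: xmom_def nun_const)
next
  case (Suc m)
  then obtain K where K: "\<And>N. N \<ge> 2 \<Longrightarrow> real N ^ m * xmom m N \<le> K" by blast
  define t where "t = \<beta>\<^sup>2 * (exp (wn 4 * real S ^ 4) * wn 2 * real S ^ 4)"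
  obtain K0 where K0: "K0 \<ge> 0" "\<And>N. N \<ge> 2 \<Longrightarrow> nun N 2 (\<lambda>\<rho>. lav (ee 0 0) N \<rho> ^ (2 * Suc m)) \<le>
      2 * t * xmom (Suc m) N + K0 * ((xmom m N + 1 / real N ^ (2*m)) / real N)"
    using overlap_moment_site[of 0 m] unfolding t_def by (auto simp: mult.assoc)
  obtain K1 where K1: "K1 \<ge> 0" "\<And>N. N \<ge> 2 \<Longrightarrow> nun N 2 (\<lambda>\<rho>. lav (ee 0 1) N \<rho> ^ (2 * Suc m)) \<le>
      2 * t * xmom (Suc m) N + K1 * ((xmom m N + 1 / real N ^ (2*m)) / real N)"
    using overlap_moment_site[of 1 m] unfolding t_def by (auto simp: mult.assoc)
  have t: "8 * t \<le> 1" using small unfolding t_def by simp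
  show ?case
  proof (intro exI[of _ "2 * (K0 + K1) * (K + 1)"] allI impI)
    fix N :: nat assume N: "2 \<le> N"
    hence N0: "real N > 0" by simp
    let ?r = "(xmom m N + 1 / real N ^ (2*m)) / real N"
    have x0: "xmom (Suc m) N \<ge> 0" unfolding xmom_def by (intro add_nonneg_nonneg even_moment_nonneg) auto
    have alg: "(2 * t * x + K1 * r) + (2 * t * x + K0 * r) = 4 * t * x + (K0 + K1) * r" for x r :: real
      by (simp add: algebra_simps)
    have "xmom (Suc m) N \<le> (2 * t * xmom (Suc m) N + K1 * ?r) + (2 * t * xmom (Suc m) N + K0 * ?r)"
      using add_mono[OF K1(2)[OF N] K0(2)[OF N]] unfolding xmom_def[of "Suc m" N, symmetric] .
    also have "\<dots> = 4 * t * xmom (Suc m) N + (K0 + K1) * ?r"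
      by (rule alg)
    finally have "xmom (Suc m) N \<le> 4 * t * xmom (Suc m) N + (K0 + K1) * ?r" .
    moreover have "4 * t * xmom (Suc m) N \<le> (1/2) * xmom (Suc m) N"
      using t x0 by (intro mult_right_mono) auto
    moreover have "x \<le> 2 * k * r" if "x \<le> 4 * t * x + k * r" "4 * t * x \<le> (1/2) * x" for x k r :: real
      using that by linarith
    ultimately have "xmom (Suc m) N \<le> 2 * (K0 + K1) * ?r" by blast
    hence "real N ^ Suc m * xmom (Suc m) N \<le> real N ^ Suc m * (2 * (K0 + K1) * ?r)"
      using N0 by (intro mult_left_mono) auto
    also have "\<dots> = 2 * (K0 + K1) * (real N ^ m * xmom m N + 1 / real N ^ m)"
    proof -
      have gen: "(z * y) * (2 * k * ((x + 1 / (y * y)) / z)) = 2 * k * (y * x + 1 / y)" if "y > 0" "z > 0"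
          for x y z k :: real
        using that by (simp add: field_simps)
      have "real N ^ (2 * m) = real N ^ m * real N ^ m" by (simp add: mult_2 power_add)
      thus ?thesis using gen[of "real N ^ m" "real N" "K0 + K1" "xmom m N"] N0
          by (simp only: power_Suc zero_less_power)
    qed
    also have "\<dots> \<le> 2 * (K0 + K1) * (K + 1)"
      using K[OF N] K0(1) K1(1) N by (intro mult_left_mono add_mono) auto
    finally show "real N ^ Suc m * xmom (Suc m) N \<le> 2 * (K0 + K1) * (K + 1)" .
  qed
qed

end

section \<open>Orders of magnitude\<close>

text \<open>Exponents count half powers of \<open>N\<close>. A site index is carried along even for
  quantities that do not depend on it, so that estimates at a site and averaged estimates obey the
  same rules.\<close>

definition uord :: "nat \<Rightarrow> (nat \<Rightarrow> nat \<Rightarrow> real) \<Rightarrow> bool" where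
  "uord r Z \<longleftrightarrow> (\<exists>K. \<forall>N\<ge>2. \<forall>i<N. \<bar>Z N i\<bar> \<le> K / sqrt (real N) ^ r)"

lemma uordE:
  assumes "uord r Z"
  obtains K where "K \<ge> 0" "\<And>N i. N \<ge> 2 \<Longrightarrow> i < N \<Longrightarrow> \<bar>Z N i\<bar> \<le> K / sqrt (real N) ^ r"
proof -
  from assms obtain K where K: "\<And>N i. N \<ge> 2 \<Longrightarrow> i < N \<Longrightarrow> \<bar>Z N i\<bar> \<le> K / sqrt (real N) ^ r"
    unfolding uord_def by blast
  have "K / sqrt (real 2) ^ r \<ge> 0" using K[of 2 0]
      by (metis abs_ge_zero order.trans order_refl zero_less_numeral)
  moreover have "sqrt (real 2) ^ r > 0" by simp
  ultimately have "K \<ge> 0" by (simp add: zero_le_divide_iff not_le[symmetric])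
  thus ?thesis using that K by blast
qed

lemma uordI: "(\<And>N i. N \<ge> 2 \<Longrightarrow> i < N \<Longrightarrow> \<bar>Z N i\<bar> \<le> K / sqrt (real N) ^ r) \<Longrightarrow> uord r Z"
  unfolding uord_def by blast

lemma uord_le:
  assumes "uord r Z'" "\<And>N i. N \<ge> 2 \<Longrightarrow> i < N \<Longrightarrow> \<bar>Z N i\<bar> \<le> C * \<bar>Z' N i\<bar>" "C \<ge> 0"
  shows "uord r Z"
proof -
  obtain K where K: "\<And>N i. N \<ge> 2 \<Longrightarrow> i < N \<Longrightarrow> \<bar>Z' N i\<bar> \<le> K / sqrt (real N) ^ r"
    using assms(1) uordE by metis
  show ?thesis
  proof (rule uordI)
    fix N i :: nat assume N: "N \<ge> 2" "i < N"
    have "\<bar>Z N i\<bar> \<le> C * (K / sqrt (real N) ^ r)"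
      by (rule order_trans[OF assms(2)[OF N]], rule mult_left_mono[OF K[OF N] assms(3)])
    thus "\<bar>Z N i\<bar> \<le> C * K / sqrt (real N) ^ r" by simp
  qed
qed

lemma uord_cong: "uord r Z' \<Longrightarrow> (\<And>N i. N \<ge> 2 \<Longrightarrow> i < N \<Longrightarrow> Z N i = Z' N i) \<Longrightarrow> uord r Z"
  by (erule uord_le[where C = 1]) auto

lemma uord_cmult: "uord r Z \<Longrightarrow> uord r (\<lambda>N i. c * Z N i)"
  by (erule uord_le[where C = "\<bar>c\<bar>"]) (auto simp: abs_mult)

lemma uord_add:
  assumes "uord r Z" "uord r Z'" shows "uord r (\<lambda>N i. Z N i + Z' N i)"
proof -
  obtain K where K: "\<And>N i. N \<ge> 2 \<Longrightarrow> i < N \<Longrightarrow> \<bar>Z N i\<bar> \<le> K / sqrt (real N) ^ r"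
    using assms(1) uordE by metis
  obtain K' where K': "\<And>N i. N \<ge> 2 \<Longrightarrow> i < N \<Longrightarrow> \<bar>Z' N i\<bar> \<le> K' / sqrt (real N) ^ r"
    using assms(2) uordE by metis
  show ?thesis
  proof (rule uordI)
    fix N i :: nat assume N: "N \<ge> 2" "i < N"
    show "\<bar>Z N i + Z' N i\<bar> \<le> (K + K') / sqrt (real N) ^ r"
      using K[OF N] K'[OF N] by (simp add: add_divide_distrib)
  qed
qed

lemma uord_diff: "uord r Z \<Longrightarrow> uord r Z' \<Longrightarrow> uord r (\<lambda>N i. Z N i - Z' N i)"
  using uord_add[of r Z "\<lambda>N i. (-1) * Z' N i"] uord_cmult[of r Z' "-1"] by simp

lemma uord_zero: "uord r (\<lambda>_ _. 0)"
  by (rule uordI[where K = 0]) simp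

lemma uord_sum: "(\<And>j. j \<in> J \<Longrightarrow> uord r (Z j)) \<Longrightarrow> uord r (\<lambda>N i. \<Sum>j\<in>J. Z j N i)"
  by (induction J rule: infinite_finite_induct) (auto simp: uord_zero intro: uord_add)

lemma uord_divN:
  assumes "uord r Z" shows "uord (r + 2) (\<lambda>N i. Z N i / real N)"
proof -
  obtain K where K: "\<And>N i. N \<ge> 2 \<Longrightarrow> i < N \<Longrightarrow> \<bar>Z N i\<bar> \<le> K / sqrt (real N) ^ r"
    using assms(1) uordE by metis
  show ?thesis
  proof (rule uordI)
    fix N i :: nat assume N: "N \<ge> 2" "i < N"
    have le: "\<bar>Z N i\<bar> / real N \<le> (K / sqrt (real N) ^ r) / real N"
      by (rule divide_right_mono[OF K[OF N]]) simp
    have e: "sqrt (real N) ^ (r + 2) = sqrt (real N) ^ r * real N" unfolding power_add by simp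
    show "\<bar>Z N i / real N\<bar> \<le> K / sqrt (real N) ^ (r + 2)"
      using le unfolding e by (simp only: abs_divide abs_of_nat divide_divide_eq_left)
  qed
qed

text \<open>Uniformity in the site is what allows averaging over \<open>N\<close> sites without
  loss.\<close>

lemma uord_average:
  assumes "uord r (\<lambda>N i. f N i - T N)"
  shows "uord r (\<lambda>N _. (\<Sum>i<N. f N i) / real N - T N)"
proof -
  from assms obtain K where "\<forall>N\<ge>2. \<forall>i<N. \<bar>f N i - T N\<bar> \<le> K / sqrt (real N) ^ r"
    unfolding uord_def by (elim exE)
  note K = this[rule_format]
  show ?thesis
  proof (rule uordI)
    fix N i :: nat assume N: "N \<ge> 2" "i < N"
    have "(\<Sum>i<N. f N i) / real N - T N = (\<Sum>i<N. f N i - T N) / real N"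
      using N by (simp add: sum_subtractf diff_divide_distrib)
    also have "\<bar>(\<Sum>i<N. f N i - T N) / real N\<bar> \<le> (\<Sum>i<N. K / sqrt (real N) ^ r) / real N"
      unfolding abs_divide using N K by (intro divide_mono order_trans[OF sum_abs] sum_mono) auto
    also have "\<dots> = K / sqrt (real N) ^ r" using N by simp
    finally show "\<bar>(\<Sum>i<N. f N i) / real N - T N\<bar> \<le> K / sqrt (real N) ^ r" .
  qed
qed

context gs_model
begin

text \<open>\<open>BO n r X\<close>: the function \<open>X N i\<close> of the first \<open>n\<close> replicas is of order \<open>N\<close> to the power
  \<open>-r/2\<close> in every \<open>L\<^sup>m\<close>, uniformly in the site \<open>i\<close>. Bounding all moments makes the class closed
  under products.\<close>

definition BO :: "nat \<Rightarrow> nat \<Rightarrow> (nat \<Rightarrow> nat \<Rightarrow> (nat \<Rightarrow> nat \<Rightarrow> real) \<Rightarrow> real) \<Rightarrow> bool" where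
  "BO n r X \<longleftrightarrow> (\<forall>N i. depends_on {..<n} (X N i)) \<and>
     (\<forall>m. \<exists>K. \<forall>N\<ge>2. \<forall>i<N. sqrt (real N) ^ (r*m) * nun N n (\<lambda>\<rho>. \<bar>X N i \<rho>\<bar> ^ m) \<le> K)"

lemma BO_dep: "BO n r X \<Longrightarrow> depends_on {..<n} (X N i)"
  unfolding BO_def by blast

lemma BOE:
  assumes "BO n r X"
  obtains K where "K \<ge> 0" "\<And>N i. N \<ge> 2 \<Longrightarrow> i < N \<Longrightarrow> sqrt (real N) ^ (r*m) * nun N n (\<lambda>\<rho>. \<bar>X N i \<rho>\<bar> ^ m) \<le> K"
proof -
  have "\<exists>K. \<forall>N\<ge>2. \<forall>i<N. sqrt (real N) ^ (r*m) * nun N n (\<lambda>\<rho>. \<bar>X N i \<rho>\<bar> ^ m) \<le> K"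
    using assms unfolding BO_def by (elim conjE) (erule spec)
  then obtain K where "\<forall>N\<ge>2. \<forall>i<N. sqrt (real N) ^ (r*m) * nun N n (\<lambda>\<rho>. \<bar>X N i \<rho>\<bar> ^ m) \<le> K"
    by (elim exE)
  note K = this[rule_format]
  have "0 \<le> sqrt (real 2) ^ (r*m) * nun 2 n (\<lambda>\<rho>. \<bar>X 2 0 \<rho>\<bar> ^ m)"
    by (intro mult_nonneg_nonneg nun_nonneg depends_on_comp1[OF BO_dep[OF assms], of "\<lambda>x. \<bar>x\<bar> ^ m"]) auto
  hence "K \<ge> 0" using K[of 2 0] by linarith
  thus ?thesis using that K by blast
qed

lemma BO_I:
  assumes dep: "\<And>N i. depends_on {..<n} (X N i)"
    and "\<And>m. \<exists>C U V. (\<forall>N\<ge>2. \<forall>i<N. depends_on {..<n} (U N i) \<and> nun N n (U N i) \<le> V \<and>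
        (\<forall>\<rho>\<in>PiE {..<n} (\<lambda>_. configs S N). sqrt (real N) ^ (r*m) * \<bar>X N i \<rho>\<bar> ^ m \<le> C + U N i \<rho>))"
  shows "BO n r X"
  unfolding BO_def
proof (intro conjI allI dep)
  fix m
  from assms(2)[of m] obtain C U V where "\<forall>N\<ge>2. \<forall>i<N. depends_on {..<n} (U N i) \<and> nun N n (U N i) \<le> V \<and>
        (\<forall>\<rho>\<in>PiE {..<n} (\<lambda>_. configs S N). sqrt (real N) ^ (r*m) * \<bar>X N i \<rho>\<bar> ^ m \<le> C + U N i \<rho>)"
    by (elim exE)
  note * = this[rule_format]
  show "\<exists>K. \<forall>N\<ge>2. \<forall>i<N. sqrt (real N) ^ (r*m) * nun N n (\<lambda>\<rho>. \<bar>X N i \<rho>\<bar> ^ m) \<le> K"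
  proof (intro exI[of _ "C + V"] allI impI)
    fix N i :: nat assume N: "N \<ge> 2" "i < N"
    have dX: "depends_on {..<n} (\<lambda>\<rho>. sqrt (real N) ^ (r*m) * \<bar>X N i \<rho>\<bar> ^ m)"
      by (intro depends_on_times depends_on_const depends_on_comp1[OF dep, of "\<lambda>x. \<bar>x\<bar> ^ m"])
    have dU: "depends_on {..<n} (U N i)" using *[OF N] by blast
    have "sqrt (real N) ^ (r*m) * nun N n (\<lambda>\<rho>. \<bar>X N i \<rho>\<bar> ^ m) = nun N n (\<lambda>\<rho>. sqrt (real N) ^ (r*m) * \<bar>X N i \<rho>\<bar> ^
        m)"
      by (rule nun_cmult[symmetric])
    also have "\<dots> \<le> nun N n (\<lambda>\<rho>. C + U N i \<rho>)"
      by (rule nun_mono[OF dX depends_on_comp2[OF depends_on_const dU]]) (use *[OF N] in blast)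
    also have "\<dots> = C + nun N n (U N i)"
      by (subst nun_add[OF depends_on_const dU]) (simp add: nun_const)
    finally show "sqrt (real N) ^ (r*m) * nun N n (\<lambda>\<rho>. \<bar>X N i \<rho>\<bar> ^ m) \<le> C + V" using *[OF N] by linarith
  qed
qed

lemma BO_det:
  assumes dep: "\<And>N i. depends_on {..<n} (X N i)"
    and "\<And>N i \<rho>. N \<ge> 2 \<Longrightarrow> i < N \<Longrightarrow> \<rho> \<in> PiE {..<n} (\<lambda>_. configs S N) \<Longrightarrow> \<bar>X N i \<rho>\<bar> \<le> B / sqrt (real N) ^ r"
  shows "BO n r X"
proof (rule BO_I[OF dep])
  fix m
  show "\<exists>C U V. \<forall>N\<ge>2. \<forall>i<N. depends_on {..<n} (U N i) \<and> nun N n (U N i) \<le> V \<and>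
        (\<forall>\<rho>\<in>PiE {..<n} (\<lambda>_. configs S N). sqrt (real N) ^ (r*m) * \<bar>X N i \<rho>\<bar> ^ m \<le> C + U N i \<rho>)"
  proof (rule exI[of _ "B ^ m"], rule exI[of _ "\<lambda>_ _ _. 0"], rule exI[of _ 0], intro allI impI conjI ballI)
    fix N i :: nat and \<rho> assume N: "2 \<le> N" "i < N" and \<rho>: "\<rho> \<in> PiE {..<n} (\<lambda>_. configs S N)"
    have "sqrt (real N) ^ (r*m) * \<bar>X N i \<rho>\<bar> ^ m \<le> sqrt (real N) ^ (r*m) * (B / sqrt (real N) ^ r) ^ m"
      using assms(2)[OF N \<rho>] by (intro mult_left_mono power_mono) auto
    also have "\<dots> = B ^ m + 0" using N by (simp add: power_divide power_mult)
    finally show "sqrt (real N) ^ (r*m) * \<bar>X N i \<rho>\<bar> ^ m \<le> B ^ m + 0" .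
  qed (auto simp: nun_const)
qed

lemma BO_mult:
  assumes X: "BO n r X" and Y: "BO n r' Y"
  shows "BO n (r + r') (\<lambda>N i \<rho>. X N i \<rho> * Y N i \<rho>)"
proof (rule BO_I)
  show "depends_on {..<n} (\<lambda>\<rho>. X N i \<rho> * Y N i \<rho>)" for N i
    by (rule depends_on_comp2[OF BO_dep[OF X] BO_dep[OF Y]])
  fix m
  obtain K where K: "\<And>N i. N \<ge> 2 \<Longrightarrow> i < N \<Longrightarrow> sqrt (real N) ^ (r*(2*m)) * nun N n (\<lambda>\<rho>. \<bar>X N i \<rho>\<bar> ^ (2*m)) \<le> K"
    using BOE[OF X, of "2*m"] by metis
  obtain K' where K': "\<And>N i. N \<ge> 2 \<Longrightarrow> i < N \<Longrightarrow> sqrt (real N) ^ (r'*(2*m)) * nun N n (\<lambda>\<rho>. \<bar>Y N i \<rho>\<bar> ^ (2*m)) \<le> K'"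
    using BOE[OF Y, of "2*m"] by metis
  let ?U1 = "\<lambda>N i \<rho>. sqrt (real N) ^ (r*(2*m)) * \<bar>X N i \<rho>\<bar> ^ (2*m)" and ?U2 =
      "\<lambda>N i \<rho>. sqrt (real N) ^ (r'*(2*m)) * \<bar>Y N i \<rho>\<bar> ^ (2*m)"
  have d1: "depends_on {..<n} (?U1 N i)" for N i
    by (intro depends_on_times depends_on_const depends_on_comp1[OF BO_dep[OF X], of "\<lambda>x. \<bar>x\<bar> ^ (2*m)"])
  have d2: "depends_on {..<n} (?U2 N i)" for N i
    by (intro depends_on_times depends_on_const depends_on_comp1[OF BO_dep[OF Y], of "\<lambda>x. \<bar>x\<bar> ^ (2*m)"])
  show "\<exists>C U V. \<forall>N\<ge>2. \<forall>i<N. depends_on {..<n} (U N i) \<and> nun N n (U N i) \<le> V \<and>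
        (\<forall>\<rho>\<in>PiE {..<n} (\<lambda>_. configs S N). sqrt (real N) ^ ((r + r')*m) * \<bar>X N i \<rho> * Y N i \<rho>\<bar> ^ m \<le> C + U N i \<rho>)"
  proof (rule exI[of _ 0], rule exI[of _ "\<lambda>N i \<rho>. ?U1 N i \<rho> + ?U2 N i \<rho>"], rule exI[of _ "K + K'"], intro allI
      impI conjI ballI)
    fix N i :: nat assume N: "2 \<le> N" "i < N"
    show "depends_on {..<n} (\<lambda>\<rho>. ?U1 N i \<rho> + ?U2 N i \<rho>)" by (rule depends_on_comp2[OF d1 d2])
    show "nun N n (\<lambda>\<rho>. ?U1 N i \<rho> + ?U2 N i \<rho>) \<le> K + K'"
      unfolding nun_add[OF d1 d2] nun_cmult using K[OF N] K'[OF N] by linarith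
    fix \<rho> assume "\<rho> \<in> PiE {..<n} (\<lambda>_. configs S N)"
    let ?a = "sqrt (real N) ^ (r*m) * \<bar>X N i \<rho>\<bar> ^ m" and ?b = "sqrt (real N) ^ (r'*m) * \<bar>Y N i \<rho>\<bar> ^ m"
    have "sqrt (real N) ^ ((r + r')*m) * \<bar>X N i \<rho> * Y N i \<rho>\<bar> ^ m = ?a * ?b"
      unfolding distrib_right power_add abs_mult power_mult_distrib by (simp only: mult_ac)
    \<comment> \<open>This takes the place of the Cauchy-Schwarz inequality: moments of order
      \<open>m\<close> of a product are bounded by moments of order \<open>2 * m\<close> of the
      factors.\<close>
    also have "\<dots> \<le> ?a\<^sup>2 + ?b\<^sup>2" by (rule mult_le_squares)
    also have "\<dots> = ?U1 N i \<rho> + ?U2 N i \<rho>"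
      by (simp only: power_mult_distrib power_mult[symmetric] mult_ac)
    finally show "sqrt (real N) ^ ((r + r')*m) * \<bar>X N i \<rho> * Y N i \<rho>\<bar> ^ m \<le> 0 + (?U1 N i \<rho> + ?U2 N i \<rho>)" by simp
  qed
qed

lemma BO_add:
  assumes X: "BO n r X" and Y: "BO n r Y"
  shows "BO n r (\<lambda>N i \<rho>. X N i \<rho> + Y N i \<rho>)"
proof (rule BO_I)
  show "depends_on {..<n} (\<lambda>\<rho>. X N i \<rho> + Y N i \<rho>)" for N i
    by (rule depends_on_comp2[OF BO_dep[OF X] BO_dep[OF Y]])
  fix m
  obtain K where K: "\<And>N i. N \<ge> 2 \<Longrightarrow> i < N \<Longrightarrow> sqrt (real N) ^ (r*m) * nun N n (\<lambda>\<rho>. \<bar>X N i \<rho>\<bar> ^ m) \<le> K"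
    using BOE[OF X, of m] by metis
  obtain K' where K': "\<And>N i. N \<ge> 2 \<Longrightarrow> i < N \<Longrightarrow> sqrt (real N) ^ (r*m) * nun N n (\<lambda>\<rho>. \<bar>Y N i \<rho>\<bar> ^ m) \<le> K'"
    using BOE[OF Y, of m] by metis
  let ?U1 = "\<lambda>N i \<rho>. sqrt (real N) ^ (r*m) * \<bar>X N i \<rho>\<bar> ^ m" and ?U2 =
      "\<lambda>N i \<rho>. sqrt (real N) ^ (r*m) * \<bar>Y N i \<rho>\<bar> ^ m"
  have d1: "depends_on {..<n} (?U1 N i)" for N i
    by (intro depends_on_times depends_on_const depends_on_comp1[OF BO_dep[OF X], of "\<lambda>x. \<bar>x\<bar> ^ m"])
  have d2: "depends_on {..<n} (?U2 N i)" for N i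
    by (intro depends_on_times depends_on_const depends_on_comp1[OF BO_dep[OF Y], of "\<lambda>x. \<bar>x\<bar> ^ m"])
  show "\<exists>C U V. \<forall>N\<ge>2. \<forall>i<N. depends_on {..<n} (U N i) \<and> nun N n (U N i) \<le> V \<and>
        (\<forall>\<rho>\<in>PiE {..<n} (\<lambda>_. configs S N). sqrt (real N) ^ (r*m) * \<bar>X N i \<rho> + Y N i \<rho>\<bar> ^ m \<le> C + U N i \<rho>)"
  proof (rule exI[of _ 0], rule exI[of _ "\<lambda>N i \<rho>. 2 ^ m * (?U1 N i \<rho> + ?U2 N i \<rho>)"], rule exI[of _
      "2 ^ m * (K + K')"], intro allI impI conjI ballI)
    fix N i :: nat assume N: "2 \<le> N" "i < N"
    show "depends_on {..<n} (\<lambda>\<rho>. 2 ^ m * (?U1 N i \<rho> + ?U2 N i \<rho>))"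
      by (rule depends_on_comp2[OF depends_on_const depends_on_comp2[OF d1 d2]])
    show "nun N n (\<lambda>\<rho>. 2 ^ m * (?U1 N i \<rho> + ?U2 N i \<rho>)) \<le> 2 ^ m * (K + K')"
      using K[OF N] K'[OF N] by (simp add: nun_cmult nun_add[OF d1 d2])
    fix \<rho> assume "\<rho> \<in> PiE {..<n} (\<lambda>_. configs S N)"
    have "\<bar>X N i \<rho> + Y N i \<rho>\<bar> ^ m \<le> (\<bar>X N i \<rho>\<bar> + \<bar>Y N i \<rho>\<bar>) ^ m"
      by (intro power_mono abs_triangle_ineq) auto
    also have "\<dots> \<le> 2 ^ m * (\<bar>X N i \<rho>\<bar> ^ m + \<bar>Y N i \<rho>\<bar> ^ m)" by (intro power_add_le) auto
    finally have "sqrt (real N) ^ (r*m) * \<bar>X N i \<rho> + Y N i \<rho>\<bar> ^ m \<le>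
        sqrt (real N) ^ (r*m) * (2 ^ m * (\<bar>X N i \<rho>\<bar> ^ m + \<bar>Y N i \<rho>\<bar> ^ m))"
      by (intro mult_left_mono) auto
    thus "sqrt (real N) ^ (r*m) * \<bar>X N i \<rho> + Y N i \<rho>\<bar> ^ m \<le> 0 + 2 ^ m * (?U1 N i \<rho> + ?U2 N i \<rho>)"
      by (simp add: algebra_simps)
  qed
qed

lemma BO_mono:
  assumes X: "BO n r X" and r: "r' \<le> r" shows "BO n r' X"
  unfolding BO_def
proof (intro conjI allI)
  show "depends_on {..<n} (X N i)" for N i by (rule BO_dep[OF X])
  fix m
  obtain K where K: "\<And>N i. N \<ge> 2 \<Longrightarrow> i < N \<Longrightarrow> sqrt (real N) ^ (r*m) * nun N n (\<lambda>\<rho>. \<bar>X N i \<rho>\<bar> ^ m) \<le> K"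
    using BOE[OF X, of m] by metis
  show "\<exists>K. \<forall>N\<ge>2. \<forall>i<N. sqrt (real N) ^ (r'*m) * nun N n (\<lambda>\<rho>. \<bar>X N i \<rho>\<bar> ^ m) \<le> K"
  proof (intro exI[of _ K] allI impI)
    fix N i :: nat assume N: "2 \<le> N" "i < N"
    have "nun N n (\<lambda>\<rho>. \<bar>X N i \<rho>\<bar> ^ m) \<ge> 0"
      by (intro nun_nonneg depends_on_comp1[OF BO_dep[OF X], of "\<lambda>x. \<bar>x\<bar> ^ m"]) auto
    hence "sqrt (real N) ^ (r'*m) * nun N n (\<lambda>\<rho>. \<bar>X N i \<rho>\<bar> ^ m) \<le> sqrt (real N) ^ (r*m) * nun N n
        (\<lambda>\<rho>. \<bar>X N i \<rho>\<bar> ^ m)"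
      using N r by (intro mult_right_mono power_increasing) auto
    thus "sqrt (real N) ^ (r'*m) * nun N n (\<lambda>\<rho>. \<bar>X N i \<rho>\<bar> ^ m) \<le> K" using K[OF N] by linarith
  qed
qed

lemma BO_const: "BO n 0 (\<lambda>_ _ _. c)"
  by (rule BO_det[where B = "\<bar>c\<bar>"]) auto

lemma BO_invN: "BO n 2 (\<lambda>N _ _. 1 / real N)"
  by (rule BO_det[where B = 1]) auto

lemma BO_cmult: "BO n r X \<Longrightarrow> BO n r (\<lambda>N i \<rho>. c * X N i \<rho>)"
  using BO_mult[OF BO_const, of n r X c] by simp

lemma BO_divN: "BO n r X \<Longrightarrow> BO n (r + 2) (\<lambda>N i \<rho>. X N i \<rho> / real N)"
  using BO_mult[OF _ BO_invN, of n r X] by simp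

lemma BO_diff: "BO n r X \<Longrightarrow> BO n r Y \<Longrightarrow> BO n r (\<lambda>N i \<rho>. X N i \<rho> - Y N i \<rho>)"
  using BO_add[of n r X "\<lambda>N i \<rho>. (-1) * Y N i \<rho>"] BO_cmult[of n r Y "-1"] by simp

lemma BO_zero: "BO n r (\<lambda>_ _ _. 0)"
  by (rule BO_det[where B = 0]) auto

lemma BO_prod: "finite J \<Longrightarrow> (\<And>j. j \<in> J \<Longrightarrow> BO n 1 (X j)) \<Longrightarrow> BO n (card J) (\<lambda>N i \<rho>. \<Prod>j\<in>J. X j N i \<rho>)"
proof (induction J rule: finite_induct)
  case empty thus ?case using BO_const[of n 1] by simp
next
  case (insert x J)
  have "BO n 1 (X x)" using insert by auto
  moreover have "BO n (card J) (\<lambda>N i \<rho>. \<Prod>j\<in>J. X j N i \<rho>)" using insert by auto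
  ultimately show ?case using BO_mult insert by fastforce
qed

lemma BO_extend:
  assumes X: "BO n r X" and "n \<le> n'" shows "BO n' r X"
  unfolding BO_def
proof (intro conjI allI)
  show "depends_on {..<n'} (X N i)" for N i
    by (rule depends_on_mono[OF BO_dep[OF X]]) (use assms in auto)
  fix m
  have "nun N n' (\<lambda>\<rho>. \<bar>X N i \<rho>\<bar> ^ m) = nun N n (\<lambda>\<rho>. \<bar>X N i \<rho>\<bar> ^ m)" for N i
    by (rule nun_extend[OF assms(2) depends_on_comp1[OF BO_dep[OF X], of "\<lambda>x. \<bar>x\<bar> ^ m"]])
  thus "\<exists>K. \<forall>N\<ge>2. \<forall>i<N. sqrt (real N) ^ (r*m) * nun N n' (\<lambda>\<rho>. \<bar>X N i \<rho>\<bar> ^ m) \<le> K"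
    using X unfolding BO_def by simp
qed

lemma BO_local:
  assumes "depends_on {..<n} \<phi>" shows "BO n 0 (\<lambda>N i \<rho>. \<phi> (\<lambda>k. \<rho> k i))"
proof -
  obtain B where B: "\<And>s. (\<And>k. k \<in> {..<n} \<Longrightarrow> s k \<in> spins S) \<Longrightarrow> \<bar>\<phi> s\<bar> \<le> B"
    using depends_on_bounded[OF finite_lessThan finite_spins assms] by metis
  show ?thesis
  proof (rule BO_det[where B = B])
    fix N i :: nat and \<rho> :: "nat \<Rightarrow> nat \<Rightarrow> real" assume "i < N" and \<rho>: "\<rho> \<in> PiE {..<n} (\<lambda>_. configs S N)"
    have "\<rho> k i \<in> spins S" if "k \<in> {..<n}" for k
      by (rule configs_spin[OF PiE_mem[OF \<rho> that] \<open>i < N\<close>])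
    from B[OF this] show "\<bar>\<phi> (\<lambda>k. \<rho> k i)\<bar> \<le> B / sqrt (real N) ^ 0" by simp
  qed (rule depends_on_site[OF assms])
qed

lemma BO_lavm_diff:
  assumes "depends_on {..<n} \<phi>" shows "BO n 2 (\<lambda>N i \<rho>. lav \<phi> N \<rho> - lavm \<phi> N i \<rho>)"
  using BO_divN[OF BO_local[OF assms]] by (simp add: lavm_def numeral_2_eq_2)

lemma BO_lavm:
  assumes "depends_on {..<n} \<phi>" "BO n 1 (\<lambda>N i. lav \<phi> N)" shows "BO n 1 (\<lambda>N i. lavm \<phi> N i)"
  using BO_diff[OF assms(2) BO_mono[OF BO_lavm_diff[OF assms(1)], of 1]] by simp

lemma BO_nun: "BO n r X \<Longrightarrow> uord r (\<lambda>N i. nun N n (\<lambda>\<rho>. \<bar>X N i \<rho>\<bar>))"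
proof -
  assume X: "BO n r X"
  obtain K where K: "\<And>N i. N \<ge> 2 \<Longrightarrow> i < N \<Longrightarrow> sqrt (real N) ^ (r*1) * nun N n (\<lambda>\<rho>. \<bar>X N i \<rho>\<bar> ^ 1) \<le> K"
    using BOE[OF X, of 1] by metis
  show ?thesis
  proof (rule uordI[where K = K])
    fix N i :: nat assume N: "N \<ge> 2" "i < N"
    have "nun N n (\<lambda>\<rho>. \<bar>X N i \<rho>\<bar>) \<ge> 0" by (intro nun_nonneg depends_on_comp1[OF BO_dep[OF X]]) auto
    thus "\<bar>nun N n (\<lambda>\<rho>. \<bar>X N i \<rho>\<bar>)\<bar> \<le> K / sqrt (real N) ^ r"
      using K[OF N] N by (simp add: le_divide_eq mult.commute)
  qed
qed

lemma BO_nun': "BO n r X \<Longrightarrow> uord r (\<lambda>N i. nun N n (X N i))"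
  by (rule uord_le[OF BO_nun, where C = 1]) (use nun_abs BO_dep in \<open>auto intro: order_trans[OF _ abs_ge_self]\<close>)

end

context gs_small
begin

text \<open>\<open>overlap_moments\<close> controls even powers only. Moments of every order follow
  from \<open>y \<le> y\<^sup>2 + 1\<close> for the scaled power \<open>y\<close>.\<close>

lemma BO_ee:
  assumes "k < n" "l < n" shows "BO n 1 (\<lambda>N i. lav (ee k l) N)"
proof (rule BO_I)
  show "depends_on {..<n} (lav (ee k l) N)" for N
    by (intro depends_on_lav depends_on_ee) (use assms in auto)
  fix m
  obtain K where K: "\<And>N. N \<ge> 2 \<Longrightarrow> real N ^ m * xmom m N \<le> K" using overlap_moments[of m] by blast
  let ?U = "\<lambda>N i \<rho>. real N ^ m * lav (ee k l) N \<rho> ^ (2*m)"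
  show "\<exists>C U V. \<forall>N\<ge>2. \<forall>i<N. depends_on {..<n} (U N i) \<and> nun N n (U N i) \<le> V \<and>
        (\<forall>\<rho>\<in>PiE {..<n} (\<lambda>_. configs S N). sqrt (real N) ^ (1*m) * \<bar>lav (ee k l) N \<rho>\<bar> ^ m \<le> C + U N i \<rho>)"
  proof (rule exI[of _ 1], rule exI[of _ ?U], rule exI[of _ K], intro allI impI conjI ballI)
    fix N i :: nat assume N: "2 \<le> N" "i < N"
    show "depends_on {..<n} (?U N i)"
      by (intro depends_on_times depends_on_const depends_on_lav_power assms)
    have "nun N n (?U N i) \<le> real N ^ m * xmom m N"
      unfolding nun_cmult by (intro mult_left_mono even_moment_le_xmom assms) auto
    thus "nun N n (?U N i) \<le> K" using K[OF N(1)] by linarith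
    fix \<rho> :: "nat \<Rightarrow> nat \<Rightarrow> real"
    define y where "y = sqrt (real N) ^ m * \<bar>lav (ee k l) N \<rho>\<bar> ^ m"
    have "y = y * 1" by simp
    also have "\<dots> \<le> y\<^sup>2 + 1\<^sup>2" by (rule mult_le_squares)
    also have "y\<^sup>2 = ?U N i \<rho>"
    proof -
      have "y\<^sup>2 = (sqrt (real N) ^ 2) ^ m * (\<bar>lav (ee k l) N \<rho>\<bar> ^ 2) ^ m"
        unfolding y_def power_mult_distrib power_mult[symmetric] by (simp only: mult.commute)
      thus ?thesis by (simp add: power_mult)
    qed
    finally show "sqrt (real N) ^ (1*m) * \<bar>lav (ee k l) N \<rho>\<bar> ^ m \<le> 1 + ?U N i \<rho>" by (simp add: y_def)
  qed
qed

lemma BO_dev: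
  assumes "k < n" "l < n" shows "BO n 1 (\<lambda>N i. dev N i k l)"
proof -
  have s: "BO n 0 (\<lambda>N i \<rho>. \<rho> k i * \<rho> l i)"
    by (rule BO_local[where \<phi> = "\<lambda>s. s k * s l"]) (use assms in \<open>auto simp: depends_on_def\<close>)
  have "BO n 1 (\<lambda>N i \<rho>. lav (ee k l) N \<rho> - \<rho> k i * \<rho> l i / real N)"
    by (rule BO_diff[OF BO_ee[OF assms] BO_mono[OF BO_divN[OF s]]]) simp
  from BO_mult[OF s this] show ?thesis by (simp add: dev_def[abs_def])
qed

lemma BO_dev_mult:
  assumes "BO n r X" "k < n + 2" "l < n + 2"
  shows "BO (n+2) (r+1) (\<lambda>N i \<rho>. X N i \<rho> * dev N i k l \<rho>)"
  by (intro BO_mult BO_extend[OF assms(1)] BO_dev assms) auto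

lemma uord_dbd:
  assumes "BO n r X" shows "uord (r+1) (\<lambda>N i. dbd N i n (X N i))"
  unfolding dbd_def
  by (intro uord_cmult uord_sum BO_nun BO_dev_mult assms) auto

text \<open>Each derivative in \<open>t\<close> inserts a factor \<open>dev\<close>, which is of
  order 1 by \<open>BO_dev\<close>; the interpolation therefore gains half a power of
  \<open>N\<close> per derivative.\<close>

lemma BO_first_order:
  assumes X: "BO n r X" shows "uord (r+1) (\<lambda>N i. nun N n (X N i) - nui N i 0 n (X N i))"
proof (rule uord_le[OF uord_dbd[OF X], where C = "\<beta>\<^sup>2"])
  fix N i :: nat assume "2 \<le> N" "i < N"
  have "\<bar>nun N n (X N i) - nui N i 0 n (X N i)\<bar> \<le> \<beta>\<^sup>2 * dbd N i n (X N i)"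
    using nui_first_order[OF \<open>i < N\<close> _ _ BO_dep[OF X], of 1 N i] nui_1[OF BO_dep[OF X], of N i N i] by simp
  also have "\<dots> \<le> \<beta>\<^sup>2 * \<bar>dbd N i n (X N i)\<bar>" by (intro mult_left_mono) auto
  finally show "\<bar>nun N n (X N i) - nui N i 0 n (X N i)\<bar> \<le> \<beta>\<^sup>2 * \<bar>dbd N i n (X N i)\<bar>" .
qed simp

lemma BO_second_order:
  assumes X: "BO n r X"
  shows "uord (r+2) (\<lambda>N i. nun N n (X N i) - nui N i 0 n (X N i) -
     \<beta>\<^sup>2 / 2 * (\<Sum>k<n+2. \<Sum>l<n+2. rsgn n k * rsgn (n+1) l * nui N i 0 (n+2) (\<lambda>\<rho>. X N i \<rho> * dev N i k l \<rho>)))"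
proof (rule uord_le[where C = 1])
  show "uord (r+2) (\<lambda>N i. \<beta>\<^sup>2 / 2 * (\<Sum>k<n+2. \<Sum>l<n+2. \<bar>rsgn n k * rsgn (n+1) l\<bar> *
      (\<beta>\<^sup>2 * dbd N i (n+2) (\<lambda>\<rho>. X N i \<rho> * dev N i k l \<rho>))))"
  proof (intro uord_cmult uord_sum)
    fix k l assume kl: "k \<in> {..<n+2}" "l \<in> {..<n+2}"
    have "uord (r+1+1) (\<lambda>N i. dbd N i (n+2) (\<lambda>\<rho>. X N i \<rho> * dev N i k l \<rho>))"
      by (rule uord_dbd[OF BO_dev_mult[OF X]]) (use kl in auto)
    thus "uord (r+2) (\<lambda>N i. dbd N i (n+2) (\<lambda>\<rho>. X N i \<rho> * dev N i k l \<rho>))" by simp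
  qed
  fix N i :: nat assume "2 \<le> N" "i < N"
  show "\<bar>nun N n (X N i) - nui N i 0 n (X N i) -
     \<beta>\<^sup>2 / 2 * (\<Sum>k<n+2. \<Sum>l<n+2. rsgn n k * rsgn (n+1) l * nui N i 0 (n+2) (\<lambda>\<rho>. X N i \<rho> * dev N i k l \<rho>))\<bar>
    \<le> 1 * \<bar>\<beta>\<^sup>2 / 2 * (\<Sum>k<n+2. \<Sum>l<n+2. \<bar>rsgn n k * rsgn (n+1) l\<bar> *
      (\<beta>\<^sup>2 * dbd N i (n+2) (\<lambda>\<rho>. X N i \<rho> * dev N i k l \<rho>)))\<bar>"
    unfolding mult_1 by (rule order_trans[OF nun_second_order[OF \<open>i < N\<close> BO_dep[OF X]] abs_ge_self])
qed simp

end

section \<open>The cavity expansion\<close>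

definition lprod :: "nat set \<Rightarrow> (nat \<Rightarrow> (nat \<Rightarrow> real) \<Rightarrow> real) \<Rightarrow> nat \<Rightarrow> (nat \<Rightarrow> nat \<Rightarrow> real) \<Rightarrow> real" where
  "lprod J \<phi> N \<rho> = (\<Prod>j\<in>J. lav (\<phi> j) N \<rho>)"

lemma depends_on_lprod: "(\<And>j. j \<in> J \<Longrightarrow> depends_on I (\<phi> j)) \<Longrightarrow> depends_on I (lprod J \<phi> N)"
  unfolding lprod_def[abs_def] by (intro depends_on_prod depends_on_lav)

lemma depends_on_spin2: "k \<in> I \<Longrightarrow> l \<in> I \<Longrightarrow> depends_on I (\<lambda>s. s k * s l :: real)"
  unfolding depends_on_def by auto

context gs_small
begin

definition cprod :: "nat set \<Rightarrow> (nat \<Rightarrow> (nat \<Rightarrow> real) \<Rightarrow> real) \<Rightarrow> nat \<Rightarrow> nat \<Rightarrow> (nat \<Rightarrow> nat \<Rightarrow> real) \<Rightarrow> real" where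
  "cprod J \<phi> N i \<rho> = (\<Prod>j\<in>J. lavm (\<phi> j) N i \<rho>)"

definition good :: "nat \<Rightarrow> ((nat \<Rightarrow> real) \<Rightarrow> real) \<Rightarrow> bool" where
  "good n \<phi> \<longleftrightarrow> depends_on {..<n} \<phi> \<and> BO n 1 (\<lambda>N i. lav \<phi> N)"

lemma goodD: "good n \<phi> \<Longrightarrow> depends_on {..<n} \<phi>" "good n \<phi> \<Longrightarrow> BO n 1 (\<lambda>N i. lav \<phi> N)"
  unfolding good_def by auto

lemma good_lavm: "good n \<phi> \<Longrightarrow> BO n 1 (\<lambda>N i. lavm \<phi> N i)"
  unfolding good_def by (intro BO_lavm) auto

lemma good_ee: "k < n \<Longrightarrow> l < n \<Longrightarrow> good n (ee k l)"
  unfolding good_def by (intro conjI BO_ee depends_on_ee) auto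

lemma lav_diff: "lav (\<lambda>s. \<phi> s - \<psi> s) N \<rho> = lav \<phi> N \<rho> - lav \<psi> N \<rho>"
  unfolding lav_def by (simp add: sum_subtractf diff_divide_distrib)

lemma good_diff:
  assumes "good n \<phi>" "good n \<psi>" shows "good n (\<lambda>s. \<phi> s - \<psi> s)"
  unfolding good_def
proof
  show "depends_on {..<n} (\<lambda>s. \<phi> s - \<psi> s)"
    by (rule depends_on_comp2[OF goodD(1)[OF assms(1)] goodD(1)[OF assms(2)]])
  show "BO n 1 (\<lambda>N i. lav (\<lambda>s. \<phi> s - \<psi> s) N)"
    using BO_diff[OF goodD(2)[OF assms(1)] goodD(2)[OF assms(2)]] by (simp add: lav_diff[abs_def])
qed

lemma good_extend: "good n \<phi> \<Longrightarrow> n \<le> n' \<Longrightarrow> good n' \<phi>"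
  unfolding good_def by (auto intro: BO_extend elim: depends_on_mono)

lemma BO_lprod: "finite J \<Longrightarrow> (\<And>j. j \<in> J \<Longrightarrow> good n (\<phi> j)) \<Longrightarrow> BO n (card J) (\<lambda>N i. lprod J \<phi> N)"
  unfolding lprod_def[abs_def] by (rule BO_prod, assumption, rule goodD(2), blast)

lemma BO_cprod: "finite J \<Longrightarrow> (\<And>j. j \<in> J \<Longrightarrow> good n (\<phi> j)) \<Longrightarrow> BO n (card J) (\<lambda>N i. cprod J \<phi> N i)"
  unfolding cprod_def[abs_def] by (rule BO_prod, assumption, rule good_lavm, blast)

lemma site_free_cprod: "i < N \<Longrightarrow> site_free i (cprod J \<phi> N i)"
  unfolding cprod_def[abs_def] by (intro site_free_prod site_free_lavm)

lemma lprod_cprod_1: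
  assumes "finite J" "\<And>j. j \<in> J \<Longrightarrow> good n (\<phi> j)"
  shows "BO n (card J + 1) (\<lambda>N i \<rho>. lprod J \<phi> N \<rho> - cprod J \<phi> N i \<rho>)"
  using assms
proof (induction J rule: finite_induct)
  case empty
  show ?case using BO_zero[of n 1] by (simp add: lprod_def cprod_def)
next
  case (insert x J)
  have gx: "good n (\<phi> x)" and gJ: "\<And>j. j \<in> J \<Longrightarrow> good n (\<phi> j)" using insert.prems by auto
  have "BO n (1 + (card J + 1)) (\<lambda>N i \<rho>. lavm (\<phi> x) N i \<rho> * (lprod J \<phi> N \<rho> - cprod J \<phi> N i \<rho>))"
    by (rule BO_mult[OF good_lavm[OF gx] insert.IH[OF gJ]])
  moreover have "BO n (2 + card J) (\<lambda>N i \<rho>. (lav (\<phi> x) N \<rho> - lavm (\<phi> x) N i \<rho>) * lprod J \<phi> N \<rho>)"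
    by (rule BO_mult[OF BO_lavm_diff[OF goodD(1)[OF gx]] BO_lprod[OF insert.hyps(1) gJ]])
  ultimately have "BO n (card J + 2) (\<lambda>N i \<rho>. lavm (\<phi> x) N i \<rho> * (lprod J \<phi> N \<rho> - cprod J \<phi> N i \<rho>)
      + (lav (\<phi> x) N \<rho> - lavm (\<phi> x) N i \<rho>) * lprod J \<phi> N \<rho>)"
    by (intro BO_add) (simp_all add: add.commute)
  moreover have "lavm (\<phi> x) N i \<rho> * (lprod J \<phi> N \<rho> - cprod J \<phi> N i \<rho>)
      + (lav (\<phi> x) N \<rho> - lavm (\<phi> x) N i \<rho>) * lprod J \<phi> N \<rho> = lprod (insert x J) \<phi> N \<rho> - cprod (insert x J) \<phi> N i
          \<rho>" for N i \<rho>
    using insert.hyps by (simp add: lprod_def cprod_def algebra_simps)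
  ultimately show ?case using insert.hyps by simp
qed

text \<open>First-order expansion of the product in the terms \<open>\<phi> j / N\<close> that
  \<open>lav\<close> has in excess of \<open>lavm\<close>. The remainder contains at least two such
  terms, each replacing a factor of order 1 by one of order 2, which gives
  \<open>card J + 2\<close>.\<close>

lemma lprod_cprod_2:
  assumes "finite J" "\<And>j. j \<in> J \<Longrightarrow> good n (\<phi> j)"
  shows "BO n (card J + 2) (\<lambda>N i \<rho>. lprod J \<phi> N \<rho> - cprod J \<phi> N i \<rho> -
     (\<Sum>j\<in>J. \<phi> j (\<lambda>k. \<rho> k i) * cprod (J - {j}) \<phi> N i \<rho>) / real N)"
  using assms
proof (induction J rule: finite_induct)
  case empty
  show ?case using BO_zero[of n 2] by (simp add: lprod_def cprod_def numeral_2_eq_2)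
next
  case (insert x J)
  have gx: "good n (\<phi> x)" and gJ: "\<And>j. j \<in> J \<Longrightarrow> good n (\<phi> j)" using insert.prems by auto
  let ?e = "\<lambda>N i \<rho>. lprod J \<phi> N \<rho> - cprod J \<phi> N i \<rho> - (\<Sum>j\<in>J. \<phi> j (\<lambda>k. \<rho> k i) * cprod (J - {j}) \<phi> N i \<rho>) / real
      N"
  have "BO n (1 + (card J + 2)) (\<lambda>N i \<rho>. lavm (\<phi> x) N i \<rho> * ?e N i \<rho>)"
    by (rule BO_mult[OF good_lavm[OF gx] insert.IH[OF gJ]])
  moreover have "BO n (2 + (card J + 1)) (\<lambda>N i \<rho>. (lav (\<phi> x) N \<rho> - lavm (\<phi> x) N i \<rho>) * (lprod J \<phi> N \<rho> -
      cprod J \<phi> N i \<rho>))"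
    by (rule BO_mult[OF BO_lavm_diff[OF goodD(1)[OF gx]] lprod_cprod_1[OF insert.hyps(1) gJ]])
  ultimately have "BO n (card J + 3) (\<lambda>N i \<rho>. lavm (\<phi> x) N i \<rho> * ?e N i \<rho>
      + (lav (\<phi> x) N \<rho> - lavm (\<phi> x) N i \<rho>) * (lprod J \<phi> N \<rho> - cprod J \<phi> N i \<rho>))"
    by (intro BO_add) (simp_all add: add.commute numeral_3_eq_3)
  moreover have "lavm (\<phi> x) N i \<rho> * ?e N i \<rho> + (lav (\<phi> x) N \<rho> - lavm (\<phi> x) N i \<rho>) * (lprod J \<phi> N \<rho> -
      cprod J \<phi> N i \<rho>)
     = lprod (insert x J) \<phi> N \<rho> - cprod (insert x J) \<phi> N i \<rho> -
     (\<Sum>j\<in>insert x J. \<phi> j (\<lambda>k. \<rho> k i) * cprod (insert x J - {j}) \<phi> N i \<rho>) / real N" for N i \<rho>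
  proof -
    have "(\<Sum>j\<in>J. \<phi> j (\<lambda>k. \<rho> k i) * cprod (insert x J - {j}) \<phi> N i \<rho>) =
        (\<Sum>j\<in>J. lavm (\<phi> x) N i \<rho> * (\<phi> j (\<lambda>k. \<rho> k i) * cprod (J - {j}) \<phi> N i \<rho>))"
    proof (rule sum.cong[OF refl])
      fix j assume "j \<in> J"
      hence "insert x J - {j} = insert x (J - {j})" using insert.hyps by auto
      thus "\<phi> j (\<lambda>k. \<rho> k i) * cprod (insert x J - {j}) \<phi> N i \<rho> =
          lavm (\<phi> x) N i \<rho> * (\<phi> j (\<lambda>k. \<rho> k i) * cprod (J - {j}) \<phi> N i \<rho>)"
        using insert.hyps by (simp add: cprod_def)
    qed
    moreover have "insert x J - {x} = J" using insert.hyps by auto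
    ultimately have sum: "(\<Sum>j\<in>insert x J. \<phi> j (\<lambda>k. \<rho> k i) * cprod (insert x J - {j}) \<phi> N i \<rho>) =
       \<phi> x (\<lambda>k. \<rho> k i) * cprod J \<phi> N i \<rho> + lavm (\<phi> x) N i \<rho> * (\<Sum>j\<in>J. \<phi> j (\<lambda>k. \<rho> k i) * cprod (J - {j}) \<phi> N i \<rho>)"
      using insert.hyps by (simp add: sum_distrib_left)
    have lp: "lprod (insert x J) \<phi> N \<rho> = lav (\<phi> x) N \<rho> * lprod J \<phi> N \<rho>" "cprod (insert x J) \<phi> N i \<rho> =
        lavm (\<phi> x) N i \<rho> * cprod J \<phi> N i \<rho>"
      using insert.hyps by (simp_all add: lprod_def cprod_def)
    have u: "lav (\<phi> x) N \<rho> = lavm (\<phi> x) N i \<rho> + \<phi> x (\<lambda>k. \<rho> k i) / real N" by (simp add: lavm_def)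
    show ?thesis unfolding sum lp u by (simp add: algebra_simps add_divide_distrib)
  qed
  ultimately show ?case using insert.hyps by (simp add: numeral_3_eq_3)
qed

text \<open>The part of \<open>dev\<close> that ignores site \<open>i\<close>. Unlike
  \<open>lavm (ee k l) N i\<close> it removes only the spin product, so the full constant
  \<open>p\<close> or \<open>q\<close> stays subtracted.\<close>

definition ovl :: "nat \<Rightarrow> nat \<Rightarrow> nat \<Rightarrow> nat \<Rightarrow> (nat \<Rightarrow> nat \<Rightarrow> real) \<Rightarrow> real" where
  "ovl N i k l \<rho> = lav (ee k l) N \<rho> - \<rho> k i * \<rho> l i / real N"

lemma site_free_ovl: "i < N \<Longrightarrow> site_free i (ovl N i k l)"
  unfolding site_free_def
proof (intro allI impI)
  fix \<rho> \<rho>' :: "nat \<Rightarrow> nat \<Rightarrow> real" assume i: "i < N" and eq: "\<forall>k j. j \<noteq> i \<longrightarrow> \<rho> k j = \<rho>' k j"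
  have "(\<Sum>j\<in>{..<N} - {i}. \<rho> k j * \<rho> l j) = (\<Sum>j\<in>{..<N} - {i}. \<rho>' k j * \<rho>' l j)"
    using eq by (intro sum.cong) auto
  thus "ovl N i k l \<rho> = ovl N i k l \<rho>'"
    unfolding ovl_def cavity_overlap[OF i, symmetric] by simp
qed

lemma BO_ovl_diff:
  assumes "k < n" "l < n" shows "BO n 2 (\<lambda>N i \<rho>. lav (ee k l) N \<rho> - ovl N i k l \<rho>)"
proof -
  have "BO n 0 (\<lambda>N i \<rho>. \<rho> k i * \<rho> l i)"
    by (rule BO_local[where \<phi> = "\<lambda>s. s k * s l"], rule depends_on_spin2) (use assms in auto)
  from BO_divN[OF this] show ?thesis by (simp add: ovl_def numeral_2_eq_2)
qed

lemma BO_ovl: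
  assumes "k < n" "l < n" shows "BO n 1 (\<lambda>N i. ovl N i k l)"
  using BO_diff[OF BO_ee[OF assms] BO_mono[OF BO_ovl_diff[OF assms], of 1]] by simp

text \<open>Since \<open>cc n \<phi> = 0\<close>, the product of \<open>\<phi>\<close> at a site
  with a function free of that site vanishes at the decoupled end. Two terms of the same order
  survive: the contribution \<open>1 / N\<close> of that site to the other factors, and the first
  derivative of the interpolation. In both, the decoupled value factorises, and restoring the
  original measure and the full site averages costs another half power of \<open>N\<close>.\<close>

theorem cavity_expansion:
  assumes J: "finite J" "\<And>j. j \<in> J \<Longrightarrow> good n (\<psi> j)"
    and \<phi>: "depends_on {..<n} \<phi>" "cc n \<phi> = 0"
  shows "uord (card J + 2) (\<lambda>N _. nun N n (\<lambda>\<rho>. lav \<phi> N \<rho> * lprod J \<psi> N \<rho>)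
     - ((\<Sum>j\<in>J. cc n (\<lambda>s. \<phi> s * \<psi> j s) * nun N n (lprod (J - {j}) \<psi> N)) / real N
     + \<beta>\<^sup>2 / 2 * (\<Sum>k<n+2. \<Sum>l<n+2. rsgn n k * rsgn (n+1) l *
         (cc (n+2) (\<lambda>s. \<phi> s * (s k * s l)) * nun N (n+2) (\<lambda>\<rho>. lav (ee k l) N \<rho> * lprod J \<psi> N \<rho>)))))"
proof -
  let ?m = "card J"
  let ?f = "\<lambda>(i::nat) (\<rho>::nat \<Rightarrow> nat \<Rightarrow> real). \<phi> (\<lambda>k. \<rho> k i)"
  define T1 where "T1 j N = cc n (\<lambda>s. \<phi> s * \<psi> j s) * nun N n (lprod (J - {j}) \<psi> N)" for j N
  define T2 where "T2 k l N = cc (n+2) (\<lambda>s. \<phi> s * (s k * s l)) * nun N (n+2) (\<lambda>\<rho>. lav (ee k l) N \<rho> * lprod J \<psi> N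
      \<rho>)" for k l N
  define W where "W N = (\<Sum>j\<in>J. T1 j N) / real N + \<beta>\<^sup>2 / 2 * (\<Sum>k<n+2. \<Sum>l<n+2. rsgn n k * rsgn (n+1) l * T2 k l
      N)" for N
  have d\<psi>: "depends_on {..<n} (\<psi> j)" if "j \<in> J" for j by (rule goodD(1)[OF J(2)[OF that]])
  have f0: "BO n 0 (\<lambda>N i. ?f i)" by (rule BO_local[OF \<phi>(1)])
  have n2: "{..<n} \<subseteq> {..<n+2}" by auto
  \<comment> \<open>Order \<open>?m\<close> is enough, because this term is divided by
    \<open>N\<close> afterwards: \<open>?m - 1\<close> factors remain, and one comparison with the
    decoupled end gains the last half power.\<close>
  have E2: "uord ?m (\<lambda>N i. nun N n (\<lambda>\<rho>. ?f i \<rho> * (\<psi> j (\<lambda>k. \<rho> k i) * cprod (J - {j}) \<psi> N i \<rho>)) - T1 j N)"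
      if j: "j \<in> J" for j
  proof -
    have J': "finite (J - {j})" "\<And>x. x \<in> J - {j} \<Longrightarrow> good n (\<psi> x)" using J by auto
    have m: "card (J - {j}) + 1 = ?m" using card_Suc_Diff1[OF J(1) j] unfolding Suc_eq_plus1 .
    have d: "depends_on {..<n} (\<lambda>s. \<phi> s * \<psi> j s)" by (rule depends_on_comp2[OF \<phi>(1) d\<psi>[OF j]])
    have X: "BO n (0 + card (J - {j})) (\<lambda>N i \<rho>. (\<lambda>s. \<phi> s * \<psi> j s) (\<lambda>k. \<rho> k i) * cprod (J - {j}) \<psi> N i \<rho>)"
      by (rule BO_mult[OF BO_local[OF d] BO_cprod[OF J']])
    have 1: "uord ?m (\<lambda>N i. nun N n (\<lambda>\<rho>. (\<phi> (\<lambda>k. \<rho> k i) * \<psi> j (\<lambda>k. \<rho> k i)) * cprod (J - {j}) \<psi> N i \<rho>)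
        - nui N i 0 n (\<lambda>\<rho>. (\<phi> (\<lambda>k. \<rho> k i) * \<psi> j (\<lambda>k. \<rho> k i)) * cprod (J - {j}) \<psi> N i \<rho>))"
      using BO_first_order[OF X] m by simp
    have 2: "uord ?m (\<lambda>N i. nun N n (cprod (J - {j}) \<psi> N i) - nui N i 0 n (cprod (J - {j}) \<psi> N i))"
      using BO_first_order[OF BO_cprod[OF J']] m by simp
    have 3: "uord ?m (\<lambda>N i. nun N n (\<lambda>\<rho>. lprod (J - {j}) \<psi> N \<rho> - cprod (J - {j}) \<psi> N i \<rho>))"
      using BO_nun'[OF lprod_cprod_1[OF J']] m by simp
    let ?c = "cc n (\<lambda>s. \<phi> s * \<psi> j s)"
    show ?thesis
    proof (rule uord_cong[OF uord_diff[OF uord_diff[OF 1 uord_cmult[OF 2, of ?c]] uord_cmult[OF 3, of ?c]]])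
      fix N i :: nat assume i: "i < N"
      have a: "nui N i 0 n (\<lambda>\<rho>. (\<phi> (\<lambda>k. \<rho> k i) * \<psi> j (\<lambda>k. \<rho> k i)) * cprod (J - {j}) \<psi> N i \<rho>) =
          ?c * nui N i 0 n (cprod (J - {j}) \<psi> N i)"
        by (rule nui_0_factor[OF i d BO_dep[OF BO_cprod[OF J']] site_free_cprod[OF i]])
      have b: "nun N n (\<lambda>\<rho>. lprod (J - {j}) \<psi> N \<rho> - cprod (J - {j}) \<psi> N i \<rho>) = nun N n (lprod (J - {j}) \<psi> N) -
          nun N n (cprod (J - {j}) \<psi> N i)"
        by (rule nun_diff[OF BO_dep[OF BO_lprod[OF J']] BO_dep[OF BO_cprod[OF J']]])
      show "nun N n (\<lambda>\<rho>. ?f i \<rho> * (\<psi> j (\<lambda>k. \<rho> k i) * cprod (J - {j}) \<psi> N i \<rho>)) - T1 j N =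
        nun N n (\<lambda>\<rho>. (\<phi> (\<lambda>k. \<rho> k i) * \<psi> j (\<lambda>k. \<rho> k i)) * cprod (J - {j}) \<psi> N i \<rho>)
        - nui N i 0 n (\<lambda>\<rho>. (\<phi> (\<lambda>k. \<rho> k i) * \<psi> j (\<lambda>k. \<rho> k i)) * cprod (J - {j}) \<psi> N i \<rho>)
        - ?c * (nun N n (cprod (J - {j}) \<psi> N i) - nui N i 0 n (cprod (J - {j}) \<psi> N i))
        - ?c * nun N n (\<lambda>\<rho>. lprod (J - {j}) \<psi> N \<rho> - cprod (J - {j}) \<psi> N i \<rho>)"
        unfolding a b T1_def by (simp add: algebra_simps)
    qed
  qed
  \<comment> \<open>\<open>cprod\<close> and \<open>ovl\<close> together have order
    \<open>?m + 1\<close>; the two comparisons, of the measures and of the site averages, each leave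
    an error of one order more.\<close>
  have E3': "uord (?m + 2) (\<lambda>N i. nui N i 0 (n+2) (\<lambda>\<rho>. ?f i \<rho> * cprod J \<psi> N i \<rho> * dev N i k l \<rho>) - T2 k l N)"
    if kl: "k < n + 2" "l < n + 2" for k l
  proof -
    have J2: "\<And>j. j \<in> J \<Longrightarrow> good (n+2) (\<psi> j)" using J(2) good_extend by (metis le_add1)
    have d: "depends_on {..<n+2} (\<lambda>s. \<phi> s * (s k * s l))"
      by (intro depends_on_times depends_on_mono[OF \<phi>(1) n2] depends_on_spin2) (use kl in auto)
    let ?c = "cc (n+2) (\<lambda>s. \<phi> s * (s k * s l))"
    have X: "BO (n+2) (?m + 1) (\<lambda>N i \<rho>. cprod J \<psi> N i \<rho> * ovl N i k l \<rho>)"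
      by (rule BO_mult[OF BO_cprod[OF J(1) J2] BO_ovl[OF kl]])
    have 1: "uord (?m + 2) (\<lambda>N i. nun N (n+2) (\<lambda>\<rho>. cprod J \<psi> N i \<rho> * ovl N i k l \<rho>) - nui N i 0 (n+2)
        (\<lambda>\<rho>. cprod J \<psi> N i \<rho> * ovl N i k l \<rho>))"
      using BO_first_order[OF X] by simp
    have "BO (n+2) (1 + (?m + 1)) (\<lambda>N i \<rho>. lav (ee k l) N \<rho> * (lprod J \<psi> N \<rho> - cprod J \<psi> N i \<rho>))"
      by (rule BO_mult[OF BO_ee[OF kl] lprod_cprod_1[OF J(1) J2]])
    moreover have "BO (n+2) (?m + 2) (\<lambda>N i \<rho>. cprod J \<psi> N i \<rho> * (lav (ee k l) N \<rho> - ovl N i k l \<rho>))"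
      by (rule BO_mult[OF BO_cprod[OF J(1) J2] BO_ovl_diff[OF kl]])
    ultimately have Y: "BO (n+2) (?m + 2) (\<lambda>N i \<rho>. lav (ee k l) N \<rho> * (lprod J \<psi> N \<rho> - cprod J \<psi> N i \<rho>) +
        cprod J \<psi> N i \<rho> * (lav (ee k l) N \<rho> - ovl N i k l \<rho>))"
      by (intro BO_add) simp_all
    have PA: "depends_on {..<n+2} (\<lambda>\<rho>. lav (ee k l) N \<rho> * lprod J \<psi> N \<rho>)" for N
      by (rule BO_dep[OF BO_mult[OF BO_ee[OF kl] BO_lprod[OF J(1) J2]]])
    show ?thesis
    proof (rule uord_cong[OF uord_cmult[OF uord_add[OF 1 BO_nun'[OF Y]], of "- ?c"]])
      fix N i :: nat assume i: "i < N"
      have "(\<lambda>\<rho>. ?f i \<rho> * cprod J \<psi> N i \<rho> * dev N i k l \<rho>) =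
          (\<lambda>\<rho>. (\<lambda>s. \<phi> s * (s k * s l)) (\<lambda>k. \<rho> k i) * (cprod J \<psi> N i \<rho> * ovl N i k l \<rho>))"
        unfolding dev_def ovl_def by (rule ext) (simp only: mult_ac)
      hence a: "nui N i 0 (n+2) (\<lambda>\<rho>. ?f i \<rho> * cprod J \<psi> N i \<rho> * dev N i k l \<rho>) =
          ?c * nui N i 0 (n+2) (\<lambda>\<rho>. cprod J \<psi> N i \<rho> * ovl N i k l \<rho>)"
        using nui_0_factor[OF i d BO_dep[OF X] site_free_mult[OF site_free_cprod[OF i] site_free_ovl[OF i]]]
            by simp
      have "nun N (n+2) (\<lambda>\<rho>. lav (ee k l) N \<rho> * (lprod J \<psi> N \<rho> - cprod J \<psi> N i \<rho>) + cprod J \<psi> N i \<rho> *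
          (lav (ee k l) N \<rho> - ovl N i k l \<rho>))
        = nun N (n+2) (\<lambda>\<rho>. lav (ee k l) N \<rho> * lprod J \<psi> N \<rho> - cprod J \<psi> N i \<rho> * ovl N i k l \<rho>)"
        by (rule nun_cong) (simp add: algebra_simps)
      also have "\<dots> = nun N (n+2) (\<lambda>\<rho>. lav (ee k l) N \<rho> * lprod J \<psi> N \<rho>) - nun N (n+2) (\<lambda>\<rho>. cprod J \<psi> N i \<rho> * ovl
          N i k l \<rho>)"
        by (rule nun_diff[OF PA BO_dep[OF X]])
      finally have b: "nun N (n+2) (\<lambda>\<rho>. lav (ee k l) N \<rho> * (lprod J \<psi> N \<rho> - cprod J \<psi> N i \<rho>) + cprod J \<psi> N i \<rho> *
          (lav (ee k l) N \<rho> - ovl N i k l \<rho>)) = \<dots>" .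
      show "nui N i 0 (n+2) (\<lambda>\<rho>. ?f i \<rho> * cprod J \<psi> N i \<rho> * dev N i k l \<rho>) - T2 k l N =
        - ?c * (nun N (n+2) (\<lambda>\<rho>. cprod J \<psi> N i \<rho> * ovl N i k l \<rho>) - nui N i 0 (n+2) (\<lambda>\<rho>. cprod J \<psi> N i \<rho> * ovl N
            i k l \<rho>)
        + nun N (n+2) (\<lambda>\<rho>. lav (ee k l) N \<rho> * (lprod J \<psi> N \<rho> - cprod J \<psi> N i \<rho>) + cprod J \<psi> N i \<rho> *
            (lav (ee k l) N \<rho> - ovl N i k l \<rho>)))"
        unfolding a b T2_def by (simp add: algebra_simps)
    qed
  qed
  have X: "BO n ?m (\<lambda>N i \<rho>. ?f i \<rho> * cprod J \<psi> N i \<rho>)"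
    using BO_mult[OF f0 BO_cprod[OF J]] by simp
  have E3: "uord (?m + 2) (\<lambda>N i. nun N n (\<lambda>\<rho>. ?f i \<rho> * cprod J \<psi> N i \<rho>) - \<beta>\<^sup>2 / 2 * (\<Sum>k<n+2. \<Sum>l<n+2. rsgn n k *
      rsgn (n+1) l * T2 k l N))"
  proof -
    have "uord (?m + 2) (\<lambda>N i. \<beta>\<^sup>2 / 2 * (\<Sum>k<n+2. \<Sum>l<n+2. rsgn n k * rsgn (n+1) l *
        (nui N i 0 (n+2) (\<lambda>\<rho>. ?f i \<rho> * cprod J \<psi> N i \<rho> * dev N i k l \<rho>) - T2 k l N)))"
      by (intro uord_cmult uord_sum E3') auto
    from uord_add[OF BO_second_order[OF X] this] show ?thesis
    proof (rule uord_cong)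
      fix N i :: nat assume i: "i < N"
      have "nui N i 0 n (\<lambda>\<rho>. ?f i \<rho> * cprod J \<psi> N i \<rho>) = 0"
        using nui_0_factor[OF i \<phi>(1) BO_dep[OF BO_cprod[OF J]] site_free_cprod[OF i]] \<phi>(2) by simp
      thus "nun N n (\<lambda>\<rho>. ?f i \<rho> * cprod J \<psi> N i \<rho>) - \<beta>\<^sup>2 / 2 * (\<Sum>k<n+2. \<Sum>l<n+2. rsgn n k * rsgn (n+1) l * T2 k l
          N) =
        nun N n (\<lambda>\<rho>. ?f i \<rho> * cprod J \<psi> N i \<rho>) - nui N i 0 n (\<lambda>\<rho>. ?f i \<rho> * cprod J \<psi> N i \<rho>)
        - \<beta>\<^sup>2 / 2 * (\<Sum>k<n+2. \<Sum>l<n+2. rsgn n k * rsgn (n+1) l * nui N i 0 (n+2) (\<lambda>\<rho>. ?f i \<rho> * cprod J \<psi> N i \<rho> *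
            dev N i k l \<rho>))
        + \<beta>\<^sup>2 / 2 * (\<Sum>k<n+2. \<Sum>l<n+2. rsgn n k * rsgn (n+1) l *
        (nui N i 0 (n+2) (\<lambda>\<rho>. ?f i \<rho> * cprod J \<psi> N i \<rho> * dev N i k l \<rho>) - T2 k l N))"
        by (simp only: right_diff_distrib sum_subtractf)
    qed
  qed
  let ?rem = "\<lambda>N i \<rho>. lprod J \<psi> N \<rho> - cprod J \<psi> N i \<rho> - (\<Sum>j\<in>J. \<psi> j (\<lambda>k. \<rho> k i) * cprod (J - {j}) \<psi> N i \<rho>) / real
      N"
  have R: "BO n (?m + 2) (\<lambda>N i \<rho>. ?f i \<rho> * ?rem N i \<rho>)"
    using BO_mult[OF f0 lprod_cprod_2[OF J]] by simp
  have site: "uord (?m + 2) (\<lambda>N i. nun N n (\<lambda>\<rho>. ?f i \<rho> * lprod J \<psi> N \<rho>) - W N)"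
  proof (rule uord_cong[OF uord_add[OF uord_add[OF BO_nun'[OF R] uord_divN[OF uord_sum[OF E2]]] E3]])
    fix N i :: nat assume i: "i < N"
    have D2: "depends_on {..<n} (\<lambda>\<rho>. ?f i \<rho> * (\<psi> j (\<lambda>k. \<rho> k i) * cprod (J - {j}) \<psi> N i \<rho>))" if "j \<in> J" for j
      by (intro depends_on_times depends_on_site \<phi>(1) d\<psi> that BO_dep[OF BO_cprod]) (use J in auto)
    have D3: "depends_on {..<n} (\<lambda>\<rho>. (1 / real N) * (\<Sum>j\<in>J. ?f i \<rho> * (\<psi> j (\<lambda>k. \<rho> k i) * cprod (J - {j}) \<psi> N i
        \<rho>)))"
      by (intro depends_on_times depends_on_const depends_on_sum D2)
    have "nun N n (\<lambda>\<rho>. ?f i \<rho> * lprod J \<psi> N \<rho>) =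
       nun N n (\<lambda>\<rho>. (?f i \<rho> * ?rem N i \<rho> + (1 / real N) * (\<Sum>j\<in>J. ?f i \<rho> * (\<psi> j (\<lambda>k. \<rho> k i) * cprod (J - {j}) \<psi> N
           i \<rho>)))
         + ?f i \<rho> * cprod J \<psi> N i \<rho>)"
      by (rule nun_cong) (simp add: sum_distrib_left[symmetric] algebra_simps)
    also have "\<dots> = nun N n (\<lambda>\<rho>. ?f i \<rho> * ?rem N i \<rho>)
       + (1 / real N) * (\<Sum>j\<in>J. nun N n (\<lambda>\<rho>. ?f i \<rho> * (\<psi> j (\<lambda>k. \<rho> k i) * cprod (J - {j}) \<psi> N i \<rho>)))
       + nun N n (\<lambda>\<rho>. ?f i \<rho> * cprod J \<psi> N i \<rho>)"
      by (simp only: nun_add[OF depends_on_comp2[OF BO_dep[OF R] D3] BO_dep[OF X]] nun_add[OF BO_dep[OF R] D3]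
          nun_cmult nun_sum[OF D2])
    finally show "nun N n (\<lambda>\<rho>. ?f i \<rho> * lprod J \<psi> N \<rho>) - W N =
      nun N n (\<lambda>\<rho>. ?f i \<rho> * ?rem N i \<rho>) +
      (\<Sum>j\<in>J. nun N n (\<lambda>\<rho>. ?f i \<rho> * (\<psi> j (\<lambda>k. \<rho> k i) * cprod (J - {j}) \<psi> N i \<rho>)) - T1 j N) / real N +
      (nun N n (\<lambda>\<rho>. ?f i \<rho> * cprod J \<psi> N i \<rho>) - \<beta>\<^sup>2 / 2 * (\<Sum>k<n+2. \<Sum>l<n+2. rsgn n k * rsgn (n+1) l * T2 k l N))"
      unfolding W_def by (simp add: sum_subtractf diff_divide_distrib)
  qed
  have avg: "nun N n (\<lambda>\<rho>. lav \<phi> N \<rho> * lprod J \<psi> N \<rho>) = (\<Sum>i<N. nun N n (\<lambda>\<rho>. ?f i \<rho> * lprod J \<psi> N \<rho>)) / real N"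
      for N
  proof -
    have D: "depends_on {..<n} (\<lambda>\<rho>. ?f i \<rho> * lprod J \<psi> N \<rho>)" for i
      by (intro depends_on_times depends_on_site \<phi>(1) depends_on_lprod d\<psi>)
    have "nun N n (\<lambda>\<rho>. lav \<phi> N \<rho> * lprod J \<psi> N \<rho>) = nun N n (\<lambda>\<rho>. (1 / real N) * (\<Sum>i<N. ?f i \<rho> * lprod J \<psi> N \<rho>))"
      by (rule nun_cong) (simp add: lav_def sum_distrib_right[symmetric])
    also have "\<dots> = (1 / real N) * (\<Sum>i<N. nun N n (\<lambda>\<rho>. ?f i \<rho> * lprod J \<psi> N \<rho>))"
      by (simp only: nun_cmult nun_sum[OF D])
    finally show ?thesis by simp
  qed
  show ?thesis using uord_average[OF site] unfolding avg W_def T1_def T2_def .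
qed

end

section \<open>Antisymmetric functions under the single-site law\<close>

context gs_model
begin

lemma measurable_lw [measurable]: "(\<lambda>\<eta>. lw \<eta> s) \<in> borel_measurable std_normal"
  unfolding lw_def gibbs_weight_def lexp_def by measurable

lemma integrable_local:
  fixes n :: nat
  assumes "depends_on {..<n} \<chi>'"
  shows "integrable std_normal (\<lambda>\<eta>. rep_avg (spins S) (lw \<eta>) {..<n} \<chi>')"
proof -
  interpret prob_space std_normal by (rule prob_space_std_normal)
  obtain B where B: "\<And>H. \<bar>rep_avg (spins S) (gibbs_weight (spins S) H) {..<n} \<chi>'\<bar> \<le> B"
    using rep_avg_gibbs_bound[OF finite_spins spins_ne finite_lessThan assms] by metis
  show ?thesis
  proof (rule integrable_const_bound[where B = B])
    show "AE \<eta> in std_normal. norm (rep_avg (spins S) (lw \<eta>) {..<n} \<chi>') \<le> B"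
      using B unfolding lw_def by simp
    show "(\<lambda>\<eta>. rep_avg (spins S) (lw \<eta>) {..<n} \<chi>') \<in> borel_measurable std_normal"
      unfolding rep_avg_def by measurable
  qed
qed

lemma cc_diff: "depends_on {..<n} f \<Longrightarrow> depends_on {..<n} h \<Longrightarrow> cc n (\<lambda>s. f s - h s) = cc n f - cc n h"
  unfolding cc_def rep_avg_diff by (intro Bochner_Integration.integral_diff integrable_local)

lemma cc_cmult: "cc n (\<lambda>s. r * f s) = r * cc n f"
  unfolding cc_def rep_avg_cmult by simp

lemma cc_extend: "n \<le> m \<Longrightarrow> depends_on {..<n} f \<Longrightarrow> cc m f = cc n f"
  unfolding cc_def by (subst prob_weights.avg_extend[OF prob_weights_lw, of "{..<m}" "{..<n}"]) auto

definition swp :: "nat \<Rightarrow> nat \<Rightarrow> nat \<Rightarrow> nat" where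
  "swp k u x = (if x = k then u else if x = u then k else x)"

lemma swp_simps [simp]: "swp k u k = u" "swp k u u = k" "x \<noteq> k \<Longrightarrow> x \<noteq> u \<Longrightarrow> swp k u x = x"
  by (auto simp: swp_def)

lemma swp_inj: "inj_on (swp k u) A"
  by (auto simp: inj_on_def swp_def split: if_splits)

lemma swp_image: "k < n \<Longrightarrow> u < n \<Longrightarrow> swp k u ` {..<n} \<subseteq> {..<n}"
  by (auto simp: swp_def)

definition anti :: "nat \<Rightarrow> nat \<Rightarrow> ((nat \<Rightarrow> real) \<Rightarrow> real) \<Rightarrow> bool" where
  "anti k u f \<longleftrightarrow> (\<forall>s. f (\<lambda>x. s (swp k u x)) = - f s)"

text \<open>Exchanging two replicas preserves the average and reverses the sign. This supplies the
  vanishing mean required by \<open>cavity_expansion\<close>.\<close>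

lemma cc_anti:
  assumes "k < n" "u < n" "depends_on {..<n} f" "anti k u f"
  shows "cc n f = 0"
proof -
  have "rep_avg (spins S) (lw \<eta>) {..<n} f = 0" for \<eta>
  proof -
    interpret prob_weights "spins S" "lw \<eta>" by (rule prob_weights_lw)
    have "avg {..<n} f = avg {..<n} (\<lambda>s. f (\<lambda>x. s (swp k u x)))"
      by (rule avg_reindex[symmetric]) (use assms swp_inj swp_image in auto)
    also have "\<dots> = - avg {..<n} f"
      using assms(4) by (simp add: anti_def rep_avg_minus)
    finally show ?thesis by simp
  qed
  thus ?thesis by (simp add: cc_def)
qed

text \<open>The coefficient with which the overlap of replicas \<open>a\<close> and \<open>b\<close>
  enters the expansion of a moment containing \<open>f\<close>.\<close>

definition Cf :: "nat \<Rightarrow> ((nat \<Rightarrow> real) \<Rightarrow> real) \<Rightarrow> nat \<Rightarrow> nat \<Rightarrow> real" where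
  "Cf n f a b = cc n (\<lambda>s. f s * (s a * s b))"

lemma Cf_sym: "Cf n f a b = Cf n f b a"
  unfolding Cf_def by (simp add: mult.commute)

lemma depends_on_Cf:
  assumes "depends_on {..<n} f" "a < n" "b < n"
  shows "depends_on {..<n} (\<lambda>s. f s * (s a * s b))"
proof (rule depends_on_times[OF assms(1)])
  show "depends_on {..<n} (\<lambda>s. s a * s b)"
    using assms unfolding depends_on_def by simp
qed

lemma Cf_extend:
  assumes "n \<le> m" "depends_on {..<n} f" "a < n" "b < n"
  shows "Cf m f a b = Cf n f a b"
  unfolding Cf_def by (rule cc_extend[OF assms(1) depends_on_Cf[OF assms(2-)]])

text \<open>The swap fixes the pair either pointwise, when it avoids \<open>k\<close> and
  \<open>u\<close>, or as a set, when it is the pair of \<open>k\<close> and \<open>u\<close>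
  itself. The product with \<open>f\<close> is then still antisymmetric.\<close>

lemma Cf_anti_0:
  assumes f: "depends_on {..<n} f" "anti k u f" and lt: "k < n" "u < n" "a < n" "b < n"
    and inv: "swp k u a = a \<and> swp k u b = b \<or> swp k u a = b \<and> swp k u b = a"
  shows "Cf n f a b = 0"
  unfolding Cf_def
proof (rule cc_anti[OF lt(1,2) depends_on_Cf[OF f(1) lt(3,4)]])
  show "anti k u (\<lambda>s. f s * (s a * s b))"
    using f(2) inv unfolding anti_def by (auto simp: mult.commute)
qed

lemma Cf_anti_swp:
  assumes f: "depends_on {..<n} f" "anti k u f" and lt: "k < n" "u < n" "a < n" "b < n"
  shows "Cf n f (swp k u a) (swp k u b) = - Cf n f a b"
proof -
  have swp2: "swp k u (swp k u x) = x" for x by (auto simp: swp_def)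
  have lt': "swp k u a < n" "swp k u b < n" using lt by (auto simp: swp_def)
  have "cc n (\<lambda>s. f s * (s (swp k u a) * s (swp k u b)) - (-1) * (f s * (s a * s b))) = 0"
  proof (rule cc_anti[OF lt(1,2)])
    show "depends_on {..<n} (\<lambda>s. f s * (s (swp k u a) * s (swp k u b)) - (-1) * (f s * (s a * s b)))"
      by (intro depends_on_minus depends_on_times depends_on_const f depends_on_spin2) (use lt lt' in auto)
    show "anti k u (\<lambda>s. f s * (s (swp k u a) * s (swp k u b)) - (-1) * (f s * (s a * s b)))"
      using f(2) unfolding anti_def by (simp add: swp2)
  qed
  also have "cc n (\<lambda>s. f s * (s (swp k u a) * s (swp k u b)) - (-1) * (f s * (s a * s b))) =
      Cf n f (swp k u a) (swp k u b) - (-1) * Cf n f a b"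
    unfolding Cf_def cc_cmult[symmetric]
    by (intro cc_diff depends_on_times depends_on_const f depends_on_spin2) (use lt lt' in auto)
  finally show ?thesis by simp
qed

text \<open>The centring constant multiplies \<open>cc n f\<close> and drops out, so coefficients
  against \<open>ee\<close> and against the bare spin product agree.\<close>

lemma cc_ee_mult:
  assumes f: "depends_on {..<n} f" "cc n f = 0" and lt: "a < n" "b < n"
  shows "cc n (\<lambda>s. f s * ee a b s) = Cf n f a b"
proof -
  let ?r = "if a = b then p else q"
  have "cc n (\<lambda>s. f s * ee a b s) = cc n (\<lambda>s. f s * (s a * s b) - ?r * f s)"
    unfolding ee_def by (simp add: algebra_simps)
  also have "\<dots> = Cf n f a b - cc n (\<lambda>s. ?r * f s)"
    unfolding Cf_def by (intro cc_diff depends_on_Cf depends_on_times depends_on_const f lt)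
  finally show ?thesis by (simp add: cc_cmult f(2))
qed

text \<open>Given \<open>\<eta>\<close> the replicas are independent. Four of them are the most that
  occur below: \<open>k\<close>, \<open>u\<close>, \<open>v\<close> and one further replica
  \<open>l\<close>.\<close>

lemma local_mono4:
  fixes n :: nat
  assumes "distinct [k1, k2, k3, k4]" "k1 < n" "k2 < n" "k3 < n" "k4 < n"
  shows "rep_avg (spins S) (lw \<eta>) {..<n} (\<lambda>s. s k1 ^ a1 * (s k2 ^ a2 * (s k3 ^ a3 * s k4 ^ a4)))
    = mm a1 \<eta> * (mm a2 \<eta> * (mm a3 \<eta> * mm a4 \<eta>))"
proof -
  interpret prob_weights "spins S" "lw \<eta>" by (rule prob_weights_lw)
  have pull: "avg {..<n} (\<lambda>s. s k ^ a * f s) = mm a \<eta> * avg {..<n} f" if "k < n" "\<And>s x. f (s(k := x)) = f s"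
      for k a f
    using avg_pull[of "{..<n}" k f "\<lambda>x. x ^ a"] that by (simp add: lw_moment)
  have "avg {..<n} (\<lambda>s. s k4 ^ a4 * 1) = mm a4 \<eta> * avg {..<n} (\<lambda>_. 1)"
    by (rule pull) (use assms in auto)
  hence 4: "avg {..<n} (\<lambda>s. s k4 ^ a4) = mm a4 \<eta>" by (simp add: avg_const)
  show ?thesis
    by (subst pull, use assms in simp, use assms in simp)+ (simp add: 4)
qed

lemma integrable_mm: "integrable std_normal (\<lambda>\<eta>. mm a \<eta> * (mm b \<eta> * (mm c \<eta> * mm d \<eta>)))"
proof -
  have "depends_on {..<4::nat} (\<lambda>s. s 0 ^ a * (s 1 ^ b * (s 2 ^ c * s 3 ^ d :: real)))"
    unfolding depends_on_def by simp
  from integrable_local[OF this] show ?thesis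
    by (subst (asm) local_mono4) auto
qed

end

section \<open>The linear system for the moments\<close>

text \<open>\<open>k\<close> is the observed replica of a factor \<open>T_k\<close> or
  \<open>S_k\<close>; \<open>u\<close> and \<open>v\<close> are auxiliary replicas standing for the
  quenched averages in it.\<close>

locale cavity_triple = gs_model +
  fixes n k u v :: nat
  assumes dist: "k \<noteq> u" "k \<noteq> v" "u \<noteq> v" and lt: "k < n" "u < n" "v < n"
begin

text \<open>\<open>f1\<close> and \<open>f2\<close> represent \<open>T_k\<close> and
  \<open>S_k\<close>. In \<open>f3 l\<close> the partner replica \<open>v\<close> of
  \<open>f1\<close> is compared with \<open>l\<close>; its antisymmetry under exchanging
  \<open>l\<close> and \<open>v\<close>, besides that of \<open>k\<close> and \<open>u\<close>, is
  what isolates the equation for the corresponding moment.\<close>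

definition f1 :: "(nat \<Rightarrow> real) \<Rightarrow> real" where "f1 s = ee k v s - ee u v s"
definition f2 :: "(nat \<Rightarrow> real) \<Rightarrow> real" where "f2 s = ee k k s - ee u u s"
definition f3 :: "nat \<Rightarrow> (nat \<Rightarrow> real) \<Rightarrow> real" where "f3 l s = (ee k l s - ee u l s) - (ee k v s - ee u v s)"

lemma f1_eq: "f1 s = s k * s v - s u * s v"
  and f2_eq: "f2 s = s k * s k - s u * s u"
  using dist by (auto simp: f1_def f2_def ee_def)

lemma f3_eq: "l \<noteq> k \<Longrightarrow> l \<noteq> u \<Longrightarrow> f3 l s = (s k * s l - s u * s l) - (s k * s v - s u * s v)"
  using dist by (auto simp: f3_def ee_def)

lemma dep_f1: "depends_on {..<n} f1" and dep_f2: "depends_on {..<n} f2"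
  unfolding depends_on_def using lt by (auto simp: f1_eq f2_eq)

lemma dep_f3: "l < n \<Longrightarrow> depends_on {..<n} (f3 l)"
  unfolding depends_on_def f3_def ee_def using lt by auto

lemma anti_f1: "anti k u f1" and anti_f2: "anti k u f2"
  unfolding anti_def using dist by (auto simp: f1_eq f2_eq)

lemma anti_f3: "l \<noteq> k \<Longrightarrow> l \<noteq> u \<Longrightarrow> anti k u (f3 l)"
  unfolding anti_def using dist by (simp add: f3_eq)

lemma anti_f3': "l \<noteq> k \<Longrightarrow> l \<noteq> u \<Longrightarrow> anti l v (f3 l)"
  unfolding anti_def using dist by (cases "l = v") (simp_all add: f3_eq)

abbreviation "Fc \<equiv> cF S \<beta> D hf p q"
abbreviation "Gc \<equiv> cG S \<beta> D hf p q"
abbreviation "Ec \<equiv> cE S \<beta> D hf p q"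
abbreviation "Dc \<equiv> cD S \<beta> D hf p q"

lemma local_mono3:
  fixes m :: nat
  assumes "distinct [k1, k2, k3]" "k1 < m" "k2 < m" "k3 < m"
  shows "rep_avg (spins S) (lw \<eta>) {..<m} (\<lambda>s. s k1 ^ a1 * (s k2 ^ a2 * s k3 ^ a3)) =
      mm a1 \<eta> * (mm a2 \<eta> * mm a3 \<eta>)"
proof -
  interpret prob_weights "spins S" "lw \<eta>" by (rule prob_weights_lw)
  have d: "depends_on {..<m} (\<lambda>s. s k1 ^ a1 * (s k2 ^ a2 * s k3 ^ a3) :: real)"
    unfolding depends_on_def using assms by simp
  have "avg {..<m} (\<lambda>s. s k1 ^ a1 * (s k2 ^ a2 * s k3 ^ a3)) =
      avg {..<Suc m} (\<lambda>s. s k1 ^ a1 * (s k2 ^ a2 * (s k3 ^ a3 * s m ^ 0)))"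
    using avg_extend[OF _ _ d, of "{..<Suc m}"] by simp
  also have "\<dots> = mm a1 \<eta> * (mm a2 \<eta> * (mm a3 \<eta> * mm 0 \<eta>))"
    by (rule local_mono4) (use assms in auto)
  finally show ?thesis by simp
qed

lemma local_mono2:
  fixes m :: nat
  assumes "k1 \<noteq> k2" "k1 < m" "k2 < m"
  shows "rep_avg (spins S) (lw \<eta>) {..<m} (\<lambda>s. s k1 ^ a1 * s k2 ^ a2) = mm a1 \<eta> * mm a2 \<eta>"
proof -
  interpret prob_weights "spins S" "lw \<eta>" by (rule prob_weights_lw)
  have d: "depends_on {..<m} (\<lambda>s. s k1 ^ a1 * s k2 ^ a2 :: real)"
    unfolding depends_on_def using assms by simp
  have "avg {..<m} (\<lambda>s. s k1 ^ a1 * s k2 ^ a2) = avg {..<Suc m} (\<lambda>s. s k1 ^ a1 * (s k2 ^ a2 * s m ^ 0))"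
    using avg_extend[OF _ _ d, of "{..<Suc m}"] by simp
  also have "\<dots> = mm a1 \<eta> * (mm a2 \<eta> * mm 0 \<eta>)"
    by (rule local_mono3) (use assms in auto)
  finally show ?thesis by simp
qed

text \<open>With the evaluations that follow, this is where the constants originate: tested against
  \<open>s k * s l\<close>, the function \<open>f1\<close> yields \<open>Fc\<close> for
  \<open>l = v\<close>, \<open>Ec\<close> for \<open>l = k\<close> and \<open>Gc\<close> for a third
  replica, while \<open>f2\<close> yields \<open>Dc\<close> on the diagonal and \<open>Ec\<close>
  off it.\<close>

lemma Cf_f1_other:
  assumes "l < m" "n \<le> m" "l \<noteq> k" "l \<noteq> u" "l \<noteq> v" shows "Cf m f1 k l = Gc"
proof -
  have e: "(\<lambda>s. f1 s * (s k * s l)) = (\<lambda>s. s k ^ 2 * (s v ^ 1 * s l ^ 1) -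
      s k ^ 1 * (s u ^ 1 * (s v ^ 1 * s l ^ 1)))"
    by (rule ext) (simp add: f1_eq power2_eq_square algebra_simps)
  have "rep_avg (spins S) (lw \<eta>) {..<m} (\<lambda>s. f1 s * (s k * s l)) = (mm 1 \<eta>)\<^sup>2 * (mm 2 \<eta> - (mm 1 \<eta>)\<^sup>2)" for \<eta>
    unfolding e rep_avg_diff using assms dist lt
    by (subst local_mono4, (simp; fail)+, subst local_mono3, (simp; fail)+) (simp add: power2_eq_square
        algebra_simps)
  thus ?thesis unfolding Cf_def cc_def cG_def by simp
qed

lemma Cf_f1_v: "n \<le> m \<Longrightarrow> Cf m f1 k v = Fc"
proof -
  assume m: "n \<le> m"
  have e: "(\<lambda>s. f1 s * (s k * s v)) = (\<lambda>s. s k ^ 2 * s v ^ 2 - s k ^ 1 * (s u ^ 1 * s v ^ 2))"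
    by (rule ext) (simp add: f1_eq power2_eq_square algebra_simps)
  have "rep_avg (spins S) (lw \<eta>) {..<m} (\<lambda>s. f1 s * (s k * s v)) = (mm 2 \<eta>)\<^sup>2 - (mm 1 \<eta>)\<^sup>2 * mm 2 \<eta>" for \<eta>
    unfolding e rep_avg_diff using m dist lt
    by (subst local_mono3, (simp; fail)+, subst local_mono2, (simp; fail)+) (simp add: power2_eq_square
        algebra_simps)
  thus ?thesis unfolding Cf_def cc_def cF_def by simp
qed

lemma Cf_f1_diag: "n \<le> m \<Longrightarrow> Cf m f1 k k = Ec"
proof -
  assume m: "n \<le> m"
  have e: "(\<lambda>s. f1 s * (s k * s k)) = (\<lambda>s. s k ^ 3 * s v ^ 1 - s k ^ 2 * (s u ^ 1 * s v ^ 1))"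
    by (rule ext) (simp add: f1_eq power2_eq_square power3_eq_cube algebra_simps)
  have "rep_avg (spins S) (lw \<eta>) {..<m} (\<lambda>s. f1 s * (s k * s k)) = mm 1 \<eta> * (mm 3 \<eta> - mm 1 \<eta> * mm 2 \<eta>)" for \<eta>
    unfolding e rep_avg_diff using m dist lt
    by (subst local_mono3, (simp; fail)+, subst local_mono2, (simp; fail)+) (simp add: power2_eq_square
        algebra_simps)
  thus ?thesis unfolding Cf_def cc_def cE_def by simp
qed

lemma Cf_f2_other:
  assumes "l < m" "n \<le> m" "l \<noteq> k" "l \<noteq> u" shows "Cf m f2 k l = Ec"
proof -
  have e: "(\<lambda>s. f2 s * (s k * s l)) = (\<lambda>s. s k ^ 3 * s l ^ 1 - s k ^ 1 * (s u ^ 2 * s l ^ 1))"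
    by (rule ext) (simp add: f2_eq power2_eq_square power3_eq_cube algebra_simps)
  have "rep_avg (spins S) (lw \<eta>) {..<m} (\<lambda>s. f2 s * (s k * s l)) = mm 1 \<eta> * (mm 3 \<eta> - mm 1 \<eta> * mm 2 \<eta>)" for \<eta>
    unfolding e rep_avg_diff using assms dist lt
    by (subst local_mono3, (simp; fail)+, subst local_mono2, (simp; fail)+) (simp add: power2_eq_square
        algebra_simps)
  thus ?thesis unfolding Cf_def cc_def cE_def by simp
qed

lemma Cf_f2_diag: "n \<le> m \<Longrightarrow> Cf m f2 k k = Dc"
proof -
  assume m: "n \<le> m"
  have e: "(\<lambda>s. f2 s * (s k * s k)) = (\<lambda>s. s k ^ 4 * s u ^ 0 - s k ^ 2 * s u ^ 2)"
    by (rule ext) (simp add: f2_eq power2_eq_square power_numeral_reduce algebra_simps)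
  have "rep_avg (spins S) (lw \<eta>) {..<m} (\<lambda>s. f2 s * (s k * s k)) = mm 4 \<eta> - (mm 2 \<eta>)\<^sup>2" for \<eta>
    unfolding e rep_avg_diff using m dist lt
    by (subst local_mono2, (simp; fail)+, subst local_mono2, (simp; fail)+) (simp add: power2_eq_square)
  thus ?thesis unfolding Cf_def cc_def cD_def by simp
qed

lemma Cf_f3_l:
  assumes "l < n" "n \<le> m" "l \<noteq> k" "l \<noteq> u" "l \<noteq> v" shows "Cf m (f3 l) k l = Fc - Gc"
proof -
  have e: "(\<lambda>s. f3 l s * (s k * s l)) = (\<lambda>s. (s k ^ 2 * s l ^ 2 - s k ^ 1 * (s u ^ 1 * s l ^ 2)) -
      (s k ^ 2 * (s v ^ 1 * s l ^ 1) - s k ^ 1 * (s u ^ 1 * (s v ^ 1 * s l ^ 1))))"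
    by (rule ext) (simp add: f3_eq assms power2_eq_square algebra_simps)
  have av: "rep_avg (spins S) (lw \<eta>) {..<m} (\<lambda>s. f3 l s * (s k * s l)) =
      ((mm 2 \<eta>)\<^sup>2 - (mm 1 \<eta>)\<^sup>2 * mm 2 \<eta>) - (mm 1 \<eta>)\<^sup>2 * (mm 2 \<eta> - (mm 1 \<eta>)\<^sup>2)" for \<eta>
    unfolding e rep_avg_diff using assms dist lt
    by (subst local_mono4, (simp; fail)+, subst local_mono3, (simp; fail)+, subst local_mono3, (simp; fail)+,
        subst local_mono2, (simp; fail)+)
       (simp add: power2_eq_square algebra_simps)
  have i1: "integrable std_normal (\<lambda>\<eta>. (mm 2 \<eta>)\<^sup>2 - (mm 1 \<eta>)\<^sup>2 * mm 2 \<eta>)"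
    using Bochner_Integration.integrable_diff[OF integrable_mm[of 2 2 0 0] integrable_mm[of 1 1 2 0]]
    by (simp add: power2_eq_square mult.assoc)
  have i2: "integrable std_normal (\<lambda>\<eta>. (mm 1 \<eta>)\<^sup>2 * (mm 2 \<eta> - (mm 1 \<eta>)\<^sup>2))"
    using Bochner_Integration.integrable_diff[OF integrable_mm[of 1 1 2 0] integrable_mm[of 1 1 1 1]]
    by (simp add: power2_eq_square algebra_simps)
  show ?thesis unfolding Cf_def cc_def av cF_def cG_def by (rule Bochner_Integration.integral_diff[OF i1 i2])
qed

lemma Cf_f3_v:
  assumes "l < n" "n \<le> m" "l \<noteq> k" "l \<noteq> u" "l \<noteq> v" shows "Cf m (f3 l) k v = - (Fc - Gc)"
proof -
  have "Cf m (f3 l) (swp l v k) (swp l v l) = - Cf m (f3 l) k l"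
    by (rule Cf_anti_swp[OF depends_on_mono[OF dep_f3[OF assms(1)]] anti_f3'[OF assms(3,4)]]) (use assms dist lt
        in auto)
  moreover have "swp l v k = k" using assms(3) dist by simp
  ultimately show ?thesis using Cf_f3_l[OF assms] by simp
qed

lemma Cf_f3_0:
  assumes "l < n" "n \<le> m" "l \<noteq> k" "l \<noteq> u" "b < m" "b \<noteq> l" "b \<noteq> v" shows "Cf m (f3 l) k b = 0"
  by (rule Cf_anti_0[where k = l and u = v])
     (use assms dist lt anti_f3'[of l] depends_on_mono[OF dep_f3[OF assms(1)], of "{..<m}"] in auto)

end

text \<open>Only pairs with exactly one member in \<open>{k, u}\<close> and the two diagonal pairs
  remain. Antisymmetry joins the rows of \<open>k\<close> and \<open>u\<close> into differences
  \<open>Q k l - Q u l\<close>; each occurs once from \<open>(k, l)\<close> and once from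
  \<open>(l, k)\<close>, whence the weight \<open>a l + b l\<close>.\<close>

lemma antisymmetric_pair_sum:
  fixes a b :: "nat \<Rightarrow> real" and c Q :: "nat \<Rightarrow> nat \<Rightarrow> real"
  assumes ku: "k \<noteq> u" "k < m" "u < m" and ab: "a k = 1" "a u = 1" "b k = 1" "b u = 1"
    and Q: "\<And>x y. Q x y = Q y x" and c: "\<And>x y. c x y = c y x"
    and cu: "\<And>l. l < m \<Longrightarrow> l \<noteq> k \<Longrightarrow> l \<noteq> u \<Longrightarrow> c u l = - c k l" "c u u = - c k k" "c k u = 0"
    and c0: "\<And>x y. x < m \<Longrightarrow> y < m \<Longrightarrow> x \<notin> {k, u} \<Longrightarrow> y \<notin> {k, u} \<Longrightarrow> c x y = 0"
  shows "(\<Sum>x<m. \<Sum>y<m. a x * b y * (c x y * Q x y)) =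
    (\<Sum>l\<in>{..<m} - {k, u}. (a l + b l) * (c k l * (Q k l - Q u l))) + c k k * (Q k k - Q u u)"
proof -
  let ?R = "{..<m} - {k, u}"
  have split: "(\<Sum>x<m. f x) = f k + f u + (\<Sum>x\<in>?R. f x)" for f :: "nat \<Rightarrow> real"
  proof -
    have "(\<Sum>x<m. f x) = f k + (f u + (\<Sum>x\<in>{..<m} - {k} - {u}. f x))"
      using ku by (subst sum.remove[of _ k], simp, simp, subst sum.remove[of _ u]) auto
    moreover have "{..<m} - {k} - {u} = ?R" by auto
    ultimately show ?thesis by simp
  qed
  have row: "(\<Sum>y<m. a x * b y * (c x y * Q x y)) = a x * (c k x * (Q k x - Q u x))" if "x \<in> ?R" for x
  proof -
    have "(\<Sum>y\<in>?R. a x * b y * (c x y * Q x y)) = 0"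
      using that c0 by (intro sum.neutral) auto
    moreover have "c x u = - c k x" using cu(1)[of x] that c[of x u] by auto
    ultimately show ?thesis unfolding split using ab c[of x k] Q[of x k] Q[of x u]
      by (simp add: algebra_simps)
  qed
  have "c u k = 0" using cu(3) c by metis
  hence k_u: "(\<Sum>y<m. a k * b y * (c k y * Q k y)) + (\<Sum>y<m. a u * b y * (c u y * Q u y)) =
      c k k * (Q k k - Q u u) + ((\<Sum>y\<in>?R. b y * (c k y * Q k y)) + (\<Sum>y\<in>?R. b y * (c u y * Q u y)))"
    unfolding split using ab cu(2,3) by (simp add: algebra_simps)
  have "(\<Sum>y\<in>?R. b y * (c k y * Q k y)) + (\<Sum>y\<in>?R. b y * (c u y * Q u y)) =
      (\<Sum>l\<in>?R. b l * (c k l * (Q k l - Q u l)))"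
    unfolding sum.distrib[symmetric] using cu(1) by (intro sum.cong) (auto simp: algebra_simps)
  moreover have "(\<Sum>x\<in>?R. \<Sum>y<m. a x * b y * (c x y * Q x y)) = (\<Sum>l\<in>?R. a l * (c k l * (Q k l - Q u l)))"
    by (rule sum.cong[OF refl row])
  ultimately show ?thesis
    unfolding split[of "\<lambda>x. \<Sum>y<m. a x * b y * (c x y * Q x y)"] using k_u
    by (simp add: distrib_right sum.distrib)
qed

text \<open>Cramer's rule with residuals \<open>e1\<close>, \<open>e2\<close>, \<open>e3\<close>.
  With \<open>Z\<close> moved to the right-hand side and eliminated by the third equation, the
  system for \<open>X\<close> and \<open>Y\<close> has rows \<open>(M1, - b E / 2)\<close> and
  \<open>(2 b E, M2)\<close>, hence determinant \<open>M\<close>. The quotients in front of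
  \<open>T\<close> and \<open>R\<close> are \<open>N\<close> times the entries of the covariance
  matrix.\<close>

lemma solve_cavity_system:
  fixes b D F G E X Y T R Z M1 M2 M3 M :: real
  defines "M1 \<equiv> 1 - b * (F - 3 * G)" and "M2 \<equiv> 1 - b / 2 * D" and "M3 \<equiv> 1 - b * (F - G)"
    and "M \<equiv> M1 * M2 + b\<^sup>2 * E\<^sup>2"
  assumes nz: "M \<noteq> 0" "M3 \<noteq> 0"
    and e1: "e1 = X - (G * T + E * R + b * ((F - 3 * G) * X + G * Z) + b / 2 * E * Y)"
    and e2: "e2 = Y - (E * T + D * R + b * ((E - 3 * E) * X + E * Z) + b / 2 * D * Y)"
    and e3: "e3 = M3 * Z - (F - G) * T"
  shows "X - ((G * M2 + b / 2 * E\<^sup>2) / (M * M3) * T + E / M * R)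
      = M2 / M * e1 + b * E / (2 * M) * e2 + (M2 * b * G + b\<^sup>2 * E\<^sup>2 / 2) / (M * M3) * e3"
    and "Y - (E / M * T + (D * M1 - 2 * b * E\<^sup>2) / M * R) = M1 / M * e2 - 2 * b * E / M * e1 + b * E / M * e3"
proof -
  have Z: "Z = (e3 + (F - G) * T) / M3" using nz e3 by (simp add: field_simps)
  have bF: "b * (F - G) = 1 - M3" by (simp add: M3_def)
  have MX: "M * X = M2 * (e1 + G * T + E * R + b * G * Z) + b * E / 2 * (e2 + E * T + D * R + b * E * Z)"
    unfolding e1 e2 M_def M1_def M2_def by (simp add: field_simps power2_eq_square)
  have MY: "M * Y = M1 * (e2 + E * T + D * R + b * E * Z) - 2 * b * E * (e1 + G * T + E * R + b * G * Z)"
    unfolding e1 e2 M_def M1_def M2_def by (simp add: field_simps power2_eq_square)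
  \<comment> \<open>\<open>T\<close> and \<open>Z\<close> enter both equations only through
    \<open>T + b * Z\<close>, which the third equation evaluates.\<close>
  have M3Z: "M3 * (T + b * Z) = T + b * e3"
  proof -
    have MZ: "M3 * Z = e3 + (F - G) * T" using e3 by simp
    have "M3 * (T + b * Z) = M3 * T + b * (M3 * Z)" by (simp add: algebra_simps)
    also have "\<dots> = T + b * e3" unfolding MZ by (simp add: M3_def algebra_simps)
    finally show ?thesis .
  qed
  have TZ: "T + b * Z = (T + b * e3) / M3" using M3Z nz by (simp add: field_simps)
  have "M * X = M2 * e1 + b * E / 2 * e2 + (G * M2 + b / 2 * E\<^sup>2) * (T + b * Z) + E * (M2 + b / 2 * D) * R"
    unfolding MX by (simp add: algebra_simps power2_eq_square)
  also have "E * (M2 + b / 2 * D) = E" by (simp add: M2_def)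
  finally have "X = (M2 * e1 + b * E / 2 * e2 + (G * M2 + b / 2 * E\<^sup>2) * ((T + b * e3) / M3) + E * R) / M"
    unfolding TZ using nz by (simp add: field_simps)
  thus "X - ((G * M2 + b / 2 * E\<^sup>2) / (M * M3) * T + E / M * R)
      = M2 / M * e1 + b * E / (2 * M) * e2 + (M2 * b * G + b\<^sup>2 * E\<^sup>2 / 2) / (M * M3) * e3"
    using nz by (simp add: add_divide_distrib) (simp add: field_simps power2_eq_square)
  have "M * Y = M1 * e2 - 2 * b * E * e1 + E * (M1 - 2 * b * G) * (T + b * Z) + (D * M1 - 2 * b * E\<^sup>2) * R"
    unfolding MY by (simp add: algebra_simps power2_eq_square)
  \<comment> \<open>This cancels the denominator of \<open>T + b * Z\<close>, which is why
    \<open>M3\<close> survives in the first variance but not in the covariance.\<close>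
  also have "M1 - 2 * b * G = M3" by (simp add: M1_def M3_def algebra_simps)
  also have "E * M3 * (T + b * Z) = E * (T + b * e3)" using M3Z by (simp add: mult.assoc)
  finally have "Y = (M1 * e2 - 2 * b * E * e1 + E * (T + b * e3) + (D * M1 - 2 * b * E\<^sup>2) * R) / M"
    using nz by (simp add: field_simps)
  thus "Y - (E / M * T + (D * M1 - 2 * b * E\<^sup>2) / M * R) = M1 / M * e2 - 2 * b * E / M * e1 + b * E / M * e3"
    using nz by (simp add: add_divide_distrib diff_divide_distrib) (simp add: field_simps)
qed

section \<open>The system for products of the four kinds of factors\<close>

datatype fac = TF nat | SF nat | T0 | S0

locale gs_ht = gs_small +
  assumes M_nz: "cM S \<beta> D hf p q \<noteq> 0" and M3_nz: "cM3 S \<beta> D hf p q \<noteq> 0"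

context gs_model
begin

text \<open>The factors \<open>T\<^sub>k\<close>, \<open>S\<^sub>k\<close>, \<open>T\<close>, \<open>S\<close> as site averages of functions of the replicas, where the
  quenched averages \<open>b\<^sub>i\<close> and their analogues are replaced by two auxiliary replicas \<open>x\<close> and \<open>y\<close>.\<close>

fun ffun :: "fac \<Rightarrow> nat \<Rightarrow> nat \<Rightarrow> (nat \<Rightarrow> real) \<Rightarrow> real" where
  "ffun (TF k) x y = (\<lambda>s. ee k y s - ee x y s)"
| "ffun (SF k) x y = (\<lambda>s. ee k k s - ee x x s)"
| "ffun T0 x y = ee x y"
| "ffun S0 x y = ee x x"

end

lemma (in gs_small) good_ffun:
  assumes "x < n" "y < n" "\<And>k. f = TF k \<or> f = SF k \<Longrightarrow> k < n"
  shows "good n (ffun f x y)"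
  using assms by (cases f) (auto intro!: good_diff good_ee)

text \<open>\<open>J\<close> indexes the remaining factors, whose auxiliary replicas are kept away
  from \<open>k\<close>, \<open>u\<close> and \<open>v\<close>. Their product \<open>P\<close>
  therefore ignores \<open>u\<close> and \<open>v\<close>, but may involve \<open>k\<close> and the
  other replicas below \<open>n\<close>.\<close>

locale cavity = gs_ht S \<beta> D hf p q + cavity_triple S \<beta> D hf p q n k u v
  for S \<beta> D hf p q n k u v +
  fixes J :: "nat set" and ty :: "nat \<Rightarrow> fac" and xx yy :: "nat \<Rightarrow> nat"
  assumes finJ: "finite J"
    and aux: "\<And>j. j \<in> J \<Longrightarrow> xx j < n \<and> yy j < n \<and> xx j \<noteq> yy j \<and> xx j \<notin> {k, u, v} \<and> yy j \<notin> {k, u, v}"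
    and orig: "\<And>j k'. j \<in> J \<Longrightarrow> ty j = TF k' \<or> ty j = SF k' \<Longrightarrow> k' < n \<and> k' \<noteq> u \<and> k' \<noteq> v"
begin

abbreviation "\<psi> \<equiv> \<lambda>j. ffun (ty j) (xx j) (yy j)"
abbreviation "P \<equiv> lprod J \<psi>"

lemma good_psi: "j \<in> J \<Longrightarrow> good n (\<psi> j)"
  using aux orig by (intro good_ffun) auto

lemma dep_psi: "j \<in> J \<Longrightarrow> depends_on ({..<n} - {u, v}) (\<psi> j)"
  using aux[of j] orig[of j] by (cases "ty j") (auto simp: depends_on_def ee_def)

definition X :: "nat \<Rightarrow> real" where "X N = nun N n (\<lambda>\<rho>. lav f1 N \<rho> * P N \<rho>)"
definition Y :: "nat \<Rightarrow> real" where "Y N = nun N n (\<lambda>\<rho>. lav f2 N \<rho> * P N \<rho>)"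
definition Z :: "nat \<Rightarrow> nat \<Rightarrow> real" where "Z l N = nun N n (\<lambda>\<rho>. lav (f3 l) N \<rho> * P N \<rho>)"
definition Q :: "nat \<Rightarrow> nat \<Rightarrow> nat \<Rightarrow> real" where
  "Q a b N = nun N (n+2) (\<lambda>\<rho>. lav (ee a b) N \<rho> * P N \<rho>)"
definition Pm :: "nat \<Rightarrow> nat \<Rightarrow> real" where "Pm j N = nun N n (lprod (J - {j}) \<psi> N)"

lemma dep_P: "depends_on ({..<n} - {u, v}) (P N)"
  by (rule depends_on_lprod[OF dep_psi])

lemma dep_P': "n \<le> m \<Longrightarrow> depends_on {..<m} (P N)"
  by (rule depends_on_mono[OF dep_P]) auto

lemma Q_diff:
  assumes "a < n+2" "b < n+2" "a' < n+2" "b' < n+2"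
  shows "Q a b N - Q a' b' N = nun N (n+2) (\<lambda>\<rho>. lav (\<lambda>s. ee a b s - ee a' b' s) N \<rho> * P N \<rho>)"
  unfolding Q_def lav_diff left_diff_distrib
  by (rule nun_diff[symmetric]; rule depends_on_times[OF depends_on_lav[OF depends_on_ee] dep_P'])
      (use assms in auto)

lemma nun_n2: "depends_on {..<n} f \<Longrightarrow> nun N (n+2) (\<lambda>\<rho>. lav f N \<rho> * P N \<rho>) = nun N n (\<lambda>\<rho>. lav f N \<rho> * P N \<rho>)"
  by (rule nun_extend) (auto intro!: depends_on_times depends_on_lav dep_P')

lemma Q_v: "Q k v N - Q u v N = X N"
  using Q_diff[of k v u v N] lt nun_n2[OF dep_f1, of N] by (simp add: X_def f1_def[abs_def])

lemma Q_diag: "Q k k N - Q u u N = Y N"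
  using Q_diff[of k k u u N] lt nun_n2[OF dep_f2, of N] by (simp add: Y_def f2_def[abs_def])

text \<open>Replica \<open>l\<close> may occur in \<open>P\<close> and cannot in general be
  exchanged with \<open>v\<close>; \<open>Z l\<close> records the defect.\<close>

lemma Q_inner:
  assumes "l < n" "l \<noteq> k" "l \<noteq> u"
  shows "Q k l N - Q u l N = X N + Z l N"
proof -
  have "lav (f3 l) N \<rho> = lav (\<lambda>s. ee k l s - ee u l s) N \<rho> - lav f1 N \<rho>" for \<rho>
    unfolding f3_def[abs_def] f1_def[abs_def] by (rule lav_diff)
  hence e: "lav (\<lambda>s. ee k l s - ee u l s) N \<rho> = lav f1 N \<rho> + lav (f3 l) N \<rho>" for \<rho>
    by simp
  have "nun N n (\<lambda>\<rho>. lav (\<lambda>s. ee k l s - ee u l s) N \<rho> * P N \<rho>) =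
      nun N n (\<lambda>\<rho>. lav f1 N \<rho> * P N \<rho> + lav (f3 l) N \<rho> * P N \<rho>)"
    by (rule nun_cong) (simp only: e distrib_right)
  also have "\<dots> = X N + Z l N"
    unfolding X_def Z_def
    by (rule nun_add; rule depends_on_times[OF depends_on_lav dep_P']) (use assms in \<open>auto intro: dep_f1
        dep_f3\<close>)
  moreover have "depends_on {..<n} (\<lambda>s. ee k l s - ee u l s)"
    unfolding depends_on_def ee_def using lt assms by auto
  ultimately show ?thesis using Q_diff[of k l u l N] lt assms nun_n2 by simp
qed

text \<open>The two replicas created by differentiation do not occur in \<open>P\<close>, so each
  may be exchanged with \<open>v\<close>.\<close>

lemma Q_outer:
  assumes l: "n \<le> l" "l < n + 2"
  shows "Q k l N - Q u l N = X N"
proof -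
  let ?F = "\<lambda>\<rho>. lav (\<lambda>s. ee k v s - ee u v s) N \<rho> * P N \<rho>"
  have F: "depends_on {..<n+2} ?F"
    by (intro depends_on_times depends_on_lav dep_P' depends_on_minus depends_on_ee) (use lt in auto)
  have "?F (\<lambda>x. \<rho> (swp v l x)) = lav (\<lambda>s. ee k l s - ee u l s) N \<rho> * P N \<rho>" for \<rho>
  proof -
    have "P N (\<lambda>x. \<rho> (swp v l x)) = P N \<rho>"
      by (rule depends_onD[OF dep_P]) (use l in auto)
    moreover have "lav (\<lambda>s. ee k v s - ee u v s) N (\<lambda>x. \<rho> (swp v l x)) = lav (\<lambda>s. ee k l s - ee u l s) N \<rho>"
      unfolding lav_def ee_def using dist lt l by simp
    ultimately show ?thesis by simp
  qed
  hence "nun N (n+2) (\<lambda>\<rho>. lav (\<lambda>s. ee k l s - ee u l s) N \<rho> * P N \<rho>) = nun N (n+2) (\<lambda>\<rho>. ?F (\<lambda>x. \<rho> (swp v l x)))"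
    by simp
  also have "\<dots> = nun N (n+2) ?F"
    by (rule nun_reindex[OF swp_inj swp_image F]) (use lt l in auto)
  finally show ?thesis using Q_diff[of k l u l N] Q_diff[of k v u v N] Q_v[of N] lt l by simp
qed

text \<open>Antisymmetry of \<open>f\<close> reduces the double sum of
  \<open>cavity_expansion\<close> to the differences \<open>Q k l - Q u l\<close>, which
  \<open>Q_v\<close>, \<open>Q_inner\<close> and \<open>Q_outer\<close> evaluate.\<close>

lemma expansion:
  assumes f: "depends_on {..<n} f" "anti k u f"
  shows "uord (card J + 2) (\<lambda>N _. nun N n (\<lambda>\<rho>. lav f N \<rho> * P N \<rho>)
     - ((\<Sum>j\<in>J. cc n (\<lambda>s. f s * \<psi> j s) * Pm j N) / real N
       + \<beta>\<^sup>2 / 2 * ((\<Sum>l\<in>{..<n+2} - {k, u}. (rsgn n l + rsgn (n+1) l) * (Cf (n+2) f k l * (Q k l N - Q u l N)))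
         + Cf (n+2) f k k * Y N)))"
proof -
  have fn: "depends_on {..<n+2} f" by (rule depends_on_mono[OF f(1)]) auto
  have sum_eq: "(\<Sum>x<n+2. \<Sum>y<n+2. rsgn n x * rsgn (n+1) y * (Cf (n+2) f x y * Q x y N)) =
    (\<Sum>l\<in>{..<n+2} - {k, u}. (rsgn n l + rsgn (n+1) l) * (Cf (n+2) f k l * (Q k l N - Q u l N))) + Cf (n+2) f k k
        * Y N" for N
    unfolding Q_diag[symmetric]
  proof (rule antisymmetric_pair_sum)
    show "rsgn n k = 1" "rsgn n u = 1" "rsgn (n+1) k = 1" "rsgn (n+1) u = 1" using lt by (auto simp: rsgn_def)
    show "Q x y N = Q y x N" for x y unfolding Q_def ee_def by (simp add: mult.commute eq_commute[of x y])
    show "Cf (n+2) f x y = Cf (n+2) f y x" for x y by (rule Cf_sym)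
    show "Cf (n+2) f u l = - Cf (n+2) f k l" if "l < n+2" "l \<noteq> k" "l \<noteq> u" for l
      using Cf_anti_swp[OF fn f(2), of k l] that lt by simp
    show "Cf (n+2) f u u = - Cf (n+2) f k k"
      using Cf_anti_swp[OF fn f(2), of k k] lt by simp
    show "Cf (n+2) f k u = 0" by (rule Cf_anti_0[OF fn f(2)]) (use lt in auto)
    show "Cf (n+2) f x y = 0" if "x < n+2" "y < n+2" "x \<notin> {k, u}" "y \<notin> {k, u}" for x y
      by (rule Cf_anti_0[OF fn f(2)]) (use lt that in auto)
  qed (use dist lt in auto)
  have "cc n f = 0" by (rule cc_anti[OF lt(1,2) f])
  from cavity_expansion[where \<psi> = \<psi>, OF finJ good_psi f(1) this]
  show ?thesis
    unfolding Cf_def[symmetric] Q_def[symmetric] Pm_def[symmetric] sum_eq .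
qed

definition JT :: "nat set" where "JT = {j \<in> J. ty j = TF k}"
definition JS :: "nat set" where "JS = {j \<in> J. ty j = SF k}"

text \<open>A factor contributes only through replica \<open>k\<close>: every other spin pair in it
  avoids \<open>k\<close> and \<open>u\<close>, and its coefficient vanishes by
  antisymmetry.\<close>

lemma cc_psi:
  assumes f: "depends_on {..<n} f" "anti k u f" and j: "j \<in> J"
  shows "cc n (\<lambda>s. f s * \<psi> j s) = (if j \<in> JT then Cf n f k (yy j) else if j \<in> JS then Cf n f k k else 0)"
proof -
  have c0: "cc n f = 0" by (rule cc_anti[OF lt(1,2) f])
  have z: "Cf n f a b = 0" if "a < n" "b < n" "a \<notin> {k, u}" "b \<notin> {k, u}" for a b
    by (rule Cf_anti_0[OF f lt(1,2)]) (use that in auto)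
  have d: "cc n (\<lambda>s. f s * (ee a b s - ee a' b' s)) = Cf n f a b - Cf n f a' b'"
    if "a < n" "b < n" "a' < n" "b' < n" for a b a' b'
  proof -
    have "cc n (\<lambda>s. f s * ee a b s - f s * ee a' b' s) = cc n (\<lambda>s. f s * ee a b s) -
        cc n (\<lambda>s. f s * ee a' b' s)"
      by (rule cc_diff; rule depends_on_times[OF f(1) depends_on_ee]) (use that in auto)
    thus ?thesis using cc_ee_mult[OF f(1) c0] that by (simp add: right_diff_distrib)
  qed
  show ?thesis
  proof (cases "ty j")
    case (TF k')
    thus ?thesis using aux[OF j] orig[OF j, of k'] j d[of k' "yy j" "xx j" "yy j"] z[of "xx j" "yy j"] z[of k'
        "yy j"]
      by (auto simp: JT_def JS_def)
  next
    case (SF k')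
    thus ?thesis using aux[OF j] orig[OF j, of k'] j d[of k' k' "xx j" "xx j"] z[of "xx j" "xx j"] z[of k' k']
      by (auto simp: JT_def JS_def)
  next
    case T0
    thus ?thesis using aux[OF j] j z[of "xx j" "yy j"] cc_ee_mult[OF f(1) c0, of "xx j" "yy j"]
        by (auto simp: JT_def JS_def)
  next
    case S0
    thus ?thesis using aux[OF j] j z[of "xx j" "xx j"] cc_ee_mult[OF f(1) c0, of "xx j" "xx j"]
        by (auto simp: JT_def JS_def)
  qed
qed

definition ST :: "nat \<Rightarrow> real" where "ST N = (\<Sum>j\<in>JT. Pm j N) / real N"
definition SS :: "nat \<Rightarrow> real" where "SS N = (\<Sum>j\<in>JS. Pm j N) / real N"

lemma sum_psi:
  assumes "\<And>j. j \<in> J \<Longrightarrow> w j = (if j \<in> JT then A else if j \<in> JS then B else 0)"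
  shows "(\<Sum>j\<in>J. w j * Pm j N) / real N = A * ST N + B * SS N"
proof -
  have sub: "JT \<subseteq> J" "JS \<subseteq> J" "JT \<inter> JS = {}" by (auto simp: JT_def JS_def)
  have "(\<Sum>j\<in>J. w j * Pm j N) = (\<Sum>j\<in>J. (if j \<in> JT then A * Pm j N else 0) + (if j \<in> JS then B * Pm j N else 0))"
    using assms sub by (intro sum.cong) auto
  also have "\<dots> = A * (\<Sum>j\<in>JT. Pm j N) + B * (\<Sum>j\<in>JS. Pm j N)"
    unfolding sum.distrib sum_distrib_left using sub finJ
    by (simp add: sum.inter_restrict[symmetric] inf.absorb2)
  finally show ?thesis by (simp add: ST_def SS_def add_divide_distrib)
qed

definition inner :: "nat set" where "inner = {..<n} - {k, u, v}"

lemma inner_sum: "finite inner" "card inner = n - 3"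
proof -
  have "{k, u, v} \<subseteq> {..<n}" "card {k, u, v} = 3" using dist lt by auto
  thus "finite inner" "card inner = n - 3" unfolding inner_def by (auto simp: card_Diff_subset)
qed

lemma three_le: "3 \<le> n"
proof -
  have "card {k, u, v} \<le> card {..<n}" using lt by (intro card_mono) auto
  thus ?thesis using dist by simp
qed

lemma outer_split: "{..<n+2} - {k, u} = insert v (insert n (insert (n+1) inner))"
  using dist lt by (auto simp: inner_def)

text \<open>Only the coefficients for \<open>l\<close> and \<open>v\<close> survive, and they are
  opposite. The two copies of \<open>X\<close> cancel, so \<open>Z l\<close> obeys a scalar equation
  with coefficient \<open>1 - \<beta>\<^sup>2 * (Fc - Gc)\<close>.\<close>

lemma Z_relation:
  assumes l: "l \<in> inner"
  shows "uord (card J + 2) (\<lambda>N _. cM3 S \<beta> D hf p q * Z l N - (\<Sum>j\<in>J. cc n (\<lambda>s. f3 l s * \<psi> j s) * Pm j N) / real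
      N)"
proof -
  have ll: "l < n" "l \<noteq> k" "l \<noteq> u" "l \<noteq> v" using l by (auto simp: inner_def)
  have s: "(\<Sum>l'\<in>{..<n+2} - {k, u}. (rsgn n l' + rsgn (n+1) l') * (Cf (n+2) (f3 l) k l' * (Q k l' N - Q u l' N)))
    = 2 * (Fc - Gc) * Z l N" for N
  proof -
    have "(\<Sum>l'\<in>{..<n+2} - {k, u}. (rsgn n l' + rsgn (n+1) l') * (Cf (n+2) (f3 l) k l' * (Q k l' N - Q u l' N)))
     = (\<Sum>l'\<in>{l, v}. (rsgn n l' + rsgn (n+1) l') * (Cf (n+2) (f3 l) k l' * (Q k l' N - Q u l' N)))"
      by (rule sum.mono_neutral_right) (use ll lt dist Cf_f3_0[of l "n+2"] in auto)
    also have "\<dots> = 2 * ((Fc - Gc) * (X N + Z l N)) + 2 * (- (Fc - Gc) * X N)"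
      using ll lt Cf_f3_l[of l "n+2"] Cf_f3_v[of l "n+2"] Q_inner[of l N] Q_v[of N] by (simp add: rsgn_def)
    finally show ?thesis by (simp add: algebra_simps)
  qed
  have d: "Cf (n+2) (f3 l) k k = 0" by (rule Cf_f3_0) (use ll lt dist in auto)
  show ?thesis
    by (rule uord_cong[OF expansion[OF dep_f3[OF ll(1)] anti_f3[OF ll(2,3)], unfolded Z_def[symmetric] s d]])
       (simp add: cM3_def algebra_simps)
qed

text \<open>In the equations for \<open>X\<close> and \<open>Y\<close> all inner replicas have the
  same coefficient, so only the sum of the \<open>Z l\<close> is needed. A factor \<open>T_k\<close>
  with index \<open>j\<close> correlates with \<open>f3 l\<close> for \<open>l = yy j\<close> alone
  and is counted once.\<close>

lemma Z_total: "uord (card J + 2) (\<lambda>N _. cM3 S \<beta> D hf p q * (\<Sum>l\<in>inner. Z l N) - (Fc - Gc) * ST N)"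
proof -
  have "uord (card J + 2) (\<lambda>N i. \<Sum>l\<in>inner. cM3 S \<beta> D hf p q * Z l N - (\<Sum>j\<in>J. cc n (\<lambda>s. f3 l s * \<psi> j s) * Pm j N)
      / real N)"
    by (rule uord_sum[OF Z_relation])
  moreover have "(\<Sum>l\<in>inner. cM3 S \<beta> D hf p q * Z l N - (\<Sum>j\<in>J. cc n (\<lambda>s. f3 l s * \<psi> j s) * Pm j N) / real N)
     = cM3 S \<beta> D hf p q * (\<Sum>l\<in>inner. Z l N) - (Fc - Gc) * ST N" for N
  proof -
    have w: "(\<Sum>l\<in>inner. cc n (\<lambda>s. f3 l s * \<psi> j s)) = (if j \<in> JT then Fc - Gc else if j \<in> JS then 0 else 0)"
        if j: "j \<in> J" for j
    proof -
      have yj: "yy j \<in> inner" using aux[OF j] by (auto simp: inner_def)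
      have "cc n (\<lambda>s. f3 l s * \<psi> j s) = (if l = yy j then (if j \<in> JT then Fc - Gc else 0) else 0)"
          if l: "l \<in> inner" for l
      proof -
        have ll: "l < n" "l \<noteq> k" "l \<noteq> u" "l \<noteq> v" using l by (auto simp: inner_def)
        have "Cf n (f3 l) k k = 0" by (rule Cf_f3_0) (use ll lt dist in auto)
        moreover have "Cf n (f3 l) k (yy j) = (if l = yy j then Fc - Gc else 0)"
          using Cf_f3_l[of l n] Cf_f3_0[of l n "yy j"] ll aux[OF j] by auto
        ultimately show ?thesis using cc_psi[OF dep_f3[OF ll(1)] anti_f3[OF ll(2,3)] j] by auto
      qed
      hence "(\<Sum>l\<in>inner. cc n (\<lambda>s. f3 l s * \<psi> j s)) = (\<Sum>l\<in>inner. if l = yy j then (if j \<in> JT then Fc - Gc else 0)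
          else 0)"
        by (intro sum.cong) auto
      also have "\<dots> = (if j \<in> JT then Fc - Gc else 0)" using yj inner_sum(1) by simp
      finally show ?thesis by simp
    qed
    have "(\<Sum>l\<in>inner. (\<Sum>j\<in>J. cc n (\<lambda>s. f3 l s * \<psi> j s) * Pm j N) / real N) =
        (\<Sum>j\<in>J. (\<Sum>l\<in>inner. cc n (\<lambda>s. f3 l s * \<psi> j s)) * Pm j N) / real N"
      unfolding sum_divide_distrib[symmetric] by (subst sum.swap) (simp only: sum_distrib_right)
    also have "\<dots> = (Fc - Gc) * ST N + 0 * SS N" by (rule sum_psi[OF w])
    finally show ?thesis by (simp add: sum_subtractf sum_distrib_left)
  qed
  ultimately show ?thesis by simp
qed

lemma main_relation:
  assumes f: "depends_on {..<n} f" "anti k u f"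
    and c: "Cf (n+2) f k v = cv" "\<And>l. l < n+2 \<Longrightarrow> l \<notin> {k, u, v} \<Longrightarrow> Cf (n+2) f k l = co" "Cf (n+2) f k k = cd"
  shows "uord (card J + 2) (\<lambda>N _. nun N n (\<lambda>\<rho>. lav f N \<rho> * P N \<rho>)
     - (co * ST N + cd * SS N + \<beta>\<^sup>2 * ((cv - 3 * co) * X N + co * (\<Sum>l\<in>inner. Z l N)) + \<beta>\<^sup>2 / 2 * cd * Y N))"
proof -
  \<comment> \<open>The weights \<open>rsgn n l + rsgn (n+1) l\<close> are 2 for \<open>v\<close>
    and for each of the \<open>n - 3\<close> inner replicas, and \<open>1 - n\<close> and
    \<open>- (n + 1)\<close> for the two new ones. The multiples of \<open>co * X N\<close> add up
    to -6 whatever \<open>n\<close> is; this is the origin of the 3 in \<open>cM1\<close>.\<close>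
  have s: "(\<Sum>l\<in>{..<n+2} - {k, u}. (rsgn n l + rsgn (n+1) l) * (Cf (n+2) f k l * (Q k l N - Q u l N)))
    = 2 * ((cv - 3 * co) * X N + co * (\<Sum>l\<in>inner. Z l N))" for N
  proof -
    have v: "v \<notin> insert n (insert (n+1) inner)" "n \<notin> insert (n+1) inner" "n + 1 \<notin> inner"
      using lt by (auto simp: inner_def)
    have "(\<Sum>l\<in>{..<n+2} - {k, u}. (rsgn n l + rsgn (n+1) l) * (Cf (n+2) f k l * (Q k l N - Q u l N)))
      = 2 * (cv * X N) + ((1 - real n) * (co * X N) + (- (real n + 1) * (co * X N)
        + (\<Sum>l\<in>inner. (rsgn n l + rsgn (n+1) l) * (Cf (n+2) f k l * (Q k l N - Q u l N)))))"
      unfolding outer_split using v inner_sum(1) lt dist c Q_outer[of n N] Q_outer[of "n+1" N] Q_v[of N]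
      by (simp add: rsgn_def)
    also have "(\<Sum>l\<in>inner. (rsgn n l + rsgn (n+1) l) * (Cf (n+2) f k l * (Q k l N - Q u l N)))
       = (\<Sum>l\<in>inner. 2 * co * X N + 2 * co * Z l N)"
      by (rule sum.cong[OF refl]) (use c(2) Q_inner in \<open>auto simp: inner_def rsgn_def algebra_simps\<close>)
    also have "\<dots> = (real n - 3) * (2 * co * X N) + 2 * co * (\<Sum>l\<in>inner. Z l N)"
      unfolding sum.distrib sum_constant inner_sum sum_distrib_left using three_le by (simp add: of_nat_diff)
    finally show ?thesis by (simp add: algebra_simps)
  qed
  have w: "cc n (\<lambda>s. f s * \<psi> j s) = (if j \<in> JT then co else if j \<in> JS then cd else 0)" if j: "j \<in> J" for j
  proof -
    have "Cf n f k (yy j) = co" "Cf n f k k = cd"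
      using Cf_extend[of n "n+2" f k "yy j"] Cf_extend[of n "n+2" f k k] f(1) lt aux[OF j] c(2)[of "yy j"] c(3)
          by auto
    thus ?thesis using cc_psi[OF f j] by simp
  qed
  have W: "(\<Sum>j\<in>J. cc n (\<lambda>s. f s * \<psi> j s) * Pm j N) / real N = co * ST N + cd * SS N" for N
    by (rule sum_psi[OF w])
  show ?thesis
    by (rule uord_cong[OF expansion[OF f, unfolded s c(3) W]]) (simp add: algebra_simps)
qed

text \<open>\<open>main_relation\<close> for \<open>f1\<close>, with coefficients \<open>Fc\<close>,
  \<open>Gc\<close>, \<open>Ec\<close>, and for \<open>f2\<close>, with \<open>Ec\<close>,
  \<open>Ec\<close>, \<open>Dc\<close>, forms together with \<open>Z_total\<close> the system solved
  by \<open>solve_cavity_system\<close>. The residuals have order \<open>card J + 2\<close>, and so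
  has the error of the solution.\<close>

theorem wick_step:
  "uord (card J + 2) (\<lambda>N _. X N - ((\<Sum>j\<in>JT. A1sq S \<beta> D hf p q N * Pm j N) + (\<Sum>j\<in>JS. C1sq S \<beta> D hf p q N * Pm j
      N)))"
  "uord (card J + 2) (\<lambda>N _. Y N - ((\<Sum>j\<in>JT. C1sq S \<beta> D hf p q N * Pm j N) + (\<Sum>j\<in>JS. B1sq S \<beta> D hf p q N * Pm j
      N)))"
proof -
  let ?SZ = "\<lambda>N. \<Sum>l\<in>inner. Z l N"
  let ?M = "cM S \<beta> D hf p q" and ?M1 = "cM1 S \<beta> D hf p q" and ?M2 = "cM2 S \<beta> D hf p q" and ?M3 =
      "cM3 S \<beta> D hf p q"
  define e1 where "e1 N = X N - (Gc * ST N + Ec * SS N + \<beta>\<^sup>2 * ((Fc - 3 * Gc) * X N + Gc * ?SZ N) +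
      \<beta>\<^sup>2 / 2 * Ec * Y N)" for N
  define e2 where "e2 N = Y N - (Ec * ST N + Dc * SS N + \<beta>\<^sup>2 * ((Ec - 3 * Ec) * X N + Ec * ?SZ N) +
      \<beta>\<^sup>2 / 2 * Dc * Y N)" for N
  define e3 where "e3 N = ?M3 * ?SZ N - (Fc - Gc) * ST N" for N
  have u1: "uord (card J + 2) (\<lambda>N _. e1 N)"
    unfolding e1_def by (subst (1) X_def, rule main_relation[OF dep_f1 anti_f1]) (use Cf_f1_v[of
        "n+2"] Cf_f1_other[of _ "n+2"] Cf_f1_diag[of "n+2"] in auto)
  have u2: "uord (card J + 2) (\<lambda>N _. e2 N)"
    unfolding e2_def by (subst (1) Y_def, rule main_relation[OF dep_f2 anti_f2]) (use Cf_f2_other[of _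
        "n+2"] Cf_f2_diag[of "n+2"] lt dist in auto)
  have u3: "uord (card J + 2) (\<lambda>N _. e3 N)"
    unfolding e3_def by (rule Z_total)
  have M: "?M = ?M1 * ?M2 + (\<beta>\<^sup>2)\<^sup>2 * Ec\<^sup>2" by (simp add: cM_def power_mult[symmetric])
  note sol = solve_cavity_system[of "\<beta>\<^sup>2" Fc Gc Dc Ec, folded cM1_def cM2_def cM3_def, folded M, OF M_nz M3_nz
      e1_def e2_def e3_def]
  have T: "(\<Sum>j\<in>JT. r / real N * Pm j N) = r * ST N" "(\<Sum>j\<in>JS. r / real N * Pm j N) = r * SS N" for r N
    by (simp_all add: ST_def SS_def sum_distrib_left sum_divide_distrib)
  have abc: "A1sq S \<beta> D hf p q N = (Gc * ?M2 + \<beta>\<^sup>2 / 2 * Ec\<^sup>2) / (?M * ?M3) / real N"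
    "C1sq S \<beta> D hf p q N = Ec / ?M / real N"
    "B1sq S \<beta> D hf p q N = (Dc * ?M1 - 2 * \<beta>\<^sup>2 * Ec\<^sup>2) / ?M / real N" for N
    by (simp_all add: A1sq_def B1sq_def C1sq_def mult_ac)
  show "uord (card J + 2) (\<lambda>N _. X N - ((\<Sum>j\<in>JT. A1sq S \<beta> D hf p q N * Pm j N) + (\<Sum>j\<in>JS. C1sq S \<beta> D hf p q N * Pm
      j N)))"
    unfolding abc T sol(1) by (intro uord_add uord_cmult u1 u2 u3)
  show "uord (card J + 2) (\<lambda>N _. Y N - ((\<Sum>j\<in>JT. C1sq S \<beta> D hf p q N * Pm j N) + (\<Sum>j\<in>JS. B1sq S \<beta> D hf p q N * Pm
      j N)))"
    unfolding abc T sol(2) by (intro uord_add uord_diff uord_cmult u1 u2 u3)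
qed

end

section \<open>Moments of Gaussian pairs\<close>

text \<open>The pairing recursion of Isserlis for variances \<open>s\<close>, \<open>r\<close> and
  covariance \<open>t\<close>: one copy of the first variable, or of the second if no first is left,
  is paired with each other copy. Truncation of \<open>a - 1\<close> and \<open>b - 1\<close> at 0
  is harmless because the prefactor vanishes there.\<close>

fun wick :: "real \<Rightarrow> real \<Rightarrow> real \<Rightarrow> nat \<Rightarrow> nat \<Rightarrow> real" where
  "wick s t r 0 0 = 1"
| "wick s t r 0 (Suc b) = real b * r * wick s t r 0 (b - 1)"
| "wick s t r (Suc a) b = real a * s * wick s t r (a - 1) b + real b * t * wick s t r a (b - 1)"

text \<open>The definition pairs a copy of the first variable whenever there is one; here a copy of
  the second is paired instead. Expanding once more on both sides leaves expressions that agree by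
  the induction hypothesis.\<close>

lemma wick_snd: "wick s t r a (Suc b) = real b * r * wick s t r a (b - 1) + real a * t * wick s t r (a - 1) b"
proof (induction a arbitrary: b rule: less_induct)
  case (less a)
  let ?w = "wick s t r"
  show ?case
  proof (cases a)
    case 0
    thus ?thesis by simp
  next
    case (Suc a')
    have 1: "real a' * ?w (a' - 1) (Suc b) = real a' * (real b * r * ?w (a' - 1) (b - 1) + (real a' - 1) * t *
        ?w (a' - 2) b)"
    proof (cases a')
      case (Suc a'')
      have "?w a'' (Suc b) = real b * r * ?w a'' (b - 1) + real a'' * t * ?w (a'' - 1) b"
        by (rule less.IH) (use \<open>a = Suc a'\<close> Suc in simp)
      thus ?thesis using Suc by simp
    qed simp
    have 2: "real a' * ?w a' b = real a' * ((real a' - 1) * s * ?w (a' - 2) b + real b * t * ?w (a' - 1) (b -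
        1))"
      by (cases a') simp_all
    have 3: "real b * ?w a' b = real b * ((real b - 1) * r * ?w a' (b - 2) + real a' * t * ?w (a' - 1) (b - 1))"
    proof (cases b)
      case (Suc b')
      have "?w a' (Suc b') = real b' * r * ?w a' (b' - 1) + real a' * t * ?w (a' - 1) b'"
        by (rule less.IH) (use \<open>a = Suc a'\<close> in simp)
      thus ?thesis using Suc by simp
    qed simp
    have 4: "real b * ?w (Suc a') (b - 1) = real b * (real a' * s * ?w (a' - 1) (b - 1) + (real b - 1) * t * ?w
        a' (b - 2))"
      by (cases b) simp_all
    have "?w (Suc a') (Suc b) = s * (real a' * ?w (a' - 1) (Suc b)) + (real b + 1) * t * ?w a' b"
      by (simp add: algebra_simps)
    also have "\<dots> = r * (real b * ?w (Suc a') (b - 1)) + (real a' + 1) * t * ?w a' b"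
    proof -
      have "t * (real b * ?w a' b) - t * (real a' * ?w a' b) = t * (real b * (real b - 1) * r * ?w a' (b - 2)) -
          t * (real a' * (real a' - 1) * s * ?w (a' - 2) b)"
        unfolding 2 3 by (simp add: algebra_simps)
      thus ?thesis unfolding 1 4 by (simp add: algebra_simps)
    qed
    finally show ?thesis using Suc by (simp add: algebra_simps)
  qed
qed

text \<open>Adding the recursions for all \<open>a + b\<close> choices of the distinguished copy
  gives a form symmetric in the two variables, which is the one obtained from comparing coefficients
  below.\<close>

lemma wick_pair:
  assumes "a + b = m + 2"
  shows "real (m + 2) * wick s t r a b = real a * (real a - 1) * s * wick s t r (a - 2) b
     + 2 * real a * real b * t * wick s t r (a - 1) (b - 1) + real b * (real b - 1) * r * wick s t r a (b - 2)"
proof -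
  let ?w = "wick s t r"
  have 1: "real a * ?w a b = real a * ((real a - 1) * s * ?w (a - 2) b + real b * t * ?w (a - 1) (b - 1))"
    by (cases a) (simp_all add: numeral_2_eq_2)
  have 2: "real b * ?w a b = real b * ((real b - 1) * r * ?w a (b - 2) + real a * t * ?w (a - 1) (b - 1))"
    by (cases b) (simp_all add: wick_snd numeral_2_eq_2 del: wick.simps)
  have "real (m + 2) * ?w a b = real a * ?w a b + real b * ?w a b"
    unfolding assms[symmetric] by (simp add: distrib_right)
  thus ?thesis unfolding 1 2 by (simp add: algebra_simps)
qed

text \<open>The recursion holds for the degenerate law as well, so that it may be used for every
  linear combination of a pair, whatever the rank of the covariance matrix.\<close>

lemma centered_normal_moments:
  assumes "prob_space M" and [measurable]: "Z \<in> borel_measurable M" and "\<sigma>2 \<ge> 0"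
    and Z: "if \<sigma>2 = 0 then AE \<omega> in M. Z \<omega> = 0 else distributed M lborel Z (normal_density 0 (sqrt \<sigma>2))"
  shows "integrable M (\<lambda>\<omega>. Z \<omega> ^ m)" "(\<integral>\<omega>. Z \<omega> ^ 1 \<partial>M) = 0"
    "(\<integral>\<omega>. Z \<omega> ^ (m + 2) \<partial>M) = real (m + 1) * \<sigma>2 * (\<integral>\<omega>. Z \<omega> ^ m \<partial>M)"
proof -
  interpret prob_space M by fact
  have "integrable M (\<lambda>\<omega>. Z \<omega> ^ m) \<and> (\<integral>\<omega>. Z \<omega> ^ 1 \<partial>M) = 0 \<and> (\<integral>\<omega>. Z \<omega> ^ (m + 2) \<partial>M) =
      real (m + 1) * \<sigma>2 * (\<integral>\<omega>. Z \<omega> ^ m \<partial>M)"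
  proof (cases "\<sigma>2 = 0")
    case True
    hence ae: "AE \<omega> in M. Z \<omega> = 0" using Z by simp
    have i: "integrable M (\<lambda>\<omega>. Z \<omega> ^ m)" for m
    proof -
      have "AE \<omega> in M. Z \<omega> ^ m = 0 ^ m" using ae by eventually_elim simp
      moreover have "integrable M (\<lambda>\<omega>. 0 ^ m :: real)" by simp
      ultimately show ?thesis by (subst integrable_cong_AE) auto
    qed
    have z: "(\<integral>\<omega>. Z \<omega> ^ m \<partial>M) = 0 ^ m" for m
    proof -
      have "AE \<omega> in M. Z \<omega> ^ m = 0 ^ m" using ae by eventually_elim simp
      hence "(\<integral>\<omega>. Z \<omega> ^ m \<partial>M) = (\<integral>\<omega>. 0 ^ m \<partial>M)" by (intro integral_cong_AE) auto
      thus ?thesis by (simp add: prob_space)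
    qed
    show ?thesis using True i z[of 1] z[of "m + 2"] by simp
  next
    case False
    hence D: "distributed M lborel Z (normal_density 0 (sqrt \<sigma>2))" and \<sigma>: "\<sigma>2 > 0" using Z assms(3) by auto
    have pos: "sqrt \<sigma>2 > 0" using \<sigma> by simp
    have i: "integrable M (\<lambda>\<omega>. Z \<omega> ^ m)" for m
      using distributed_integrable[OF D, of "\<lambda>x. x ^ m"] integrable_normal_moment[OF pos, of 0 m] by simp
    define f where "f m = (\<integral>\<omega>. Z \<omega> ^ m \<partial>M)" for m
    have f: "f m = (\<integral>x. normal_density 0 (sqrt \<sigma>2) x * (x - 0) ^ m \<partial>lborel)" for m
      unfolding f_def using distributed_integral[OF D, of "\<lambda>x. x ^ m"] by simp
    have odd: "f (2 * k + 1) = 0" for k unfolding f using integral_normal_moment_odd[OF pos, of 0 k] by simp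
    have even: "f (2 * k) = fact (2 * k) / ((2 / \<sigma>2) ^ k * fact k)" for k
      unfolding f using integral_normal_moment_even[OF pos, of 0 k] \<sigma> by simp
    have "f (m + 2) = real (m + 1) * \<sigma>2 * f m"
    proof (cases "even m")
      case True
      then obtain k where k: "m = 2 * k" by blast
      have m2: "m + 2 = 2 * Suc k" using k by simp
      have f2: "fact (2 * Suc k) = 2 * (real k + 1) * (2 * real k + 1) * fact (2 * k)"
        by (simp add: algebra_simps)
      have gen: "(2 * y * w * A) / (2 / \<sigma>2 * B * (y * C)) = w * \<sigma>2 * (A / (B * C))"
        if "y > 0" "B > 0" "C > 0" for A B C y w :: real
        using that \<sigma> by (simp add: field_simps)
      have f1: "(2 / \<sigma>2) ^ Suc k * fact (Suc k) = 2 / \<sigma>2 * (2 / \<sigma>2) ^ k * ((real k + 1) * fact k)"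
        by (simp add: algebra_simps)
      have "real (m + 1) = 2 * real k + 1" using k by simp
      thus ?thesis
        unfolding m2 even f1 f2 unfolding k even using gen[of "real k + 1" "(2 / \<sigma>2) ^ k" "fact k"
            "2 * real k + 1" "fact (2 * k)"] \<sigma> by simp
    next
      case False
      then obtain k where k: "m = 2 * k + 1" using oddE by blast
      have "m + 2 = 2 * Suc k + 1" using k by simp
      thus ?thesis using odd[of k] odd[of "Suc k"] k by simp
    qed
    thus ?thesis using i odd[of 0] unfolding f_def by simp
  qed
  thus "integrable M (\<lambda>\<omega>. Z \<omega> ^ m)" "(\<integral>\<omega>. Z \<omega> ^ 1 \<partial>M) = 0"
    "(\<integral>\<omega>. Z \<omega> ^ (m + 2) \<partial>M) = real (m + 1) * \<sigma>2 * (\<integral>\<omega>. Z \<omega> ^ m \<partial>M)" by blast+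
qed

text \<open>The moments of \<open>u X + Y\<close> are known for every \<open>u\<close>; comparing coefficients of the powers of
  \<open>u\<close> gives a recursion for the mixed moments, which the Wick recursion also satisfies.\<close>

lemma gaussian_pair_moment:
  assumes "centered_gaussian_pair M X Y s t r"
  shows "(\<integral>\<omega>. X \<omega> ^ a * Y \<omega> ^ b \<partial>M) = wick s t r a b"
proof -
  from assms have P: "prob_space M" and [measurable]: "X \<in> borel_measurable M" "Y \<in> borel_measurable M"
    by (auto simp: centered_gaussian_pair_def)
  interpret prob_space M by (rule P)
  define v where "v u w = u\<^sup>2 * s + 2 * u * w * t + w\<^sup>2 * r" for u w :: real
  have Z: "v u w \<ge> 0" "if v u w = 0 then AE \<omega> in M. u * X \<omega> + w * Y \<omega> = 0
      else distributed M lborel (\<lambda>\<omega>. u * X \<omega> + w * Y \<omega>) (normal_density 0 (sqrt (v u w)))" for u w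
    using assms unfolding centered_gaussian_pair_def Let_def v_def by blast+
  have mom: "integrable M (\<lambda>\<omega>. (u * X \<omega> + w * Y \<omega>) ^ m)" "(\<integral>\<omega>. (u * X \<omega> + w * Y \<omega>) ^ 1 \<partial>M) = 0"
    "(\<integral>\<omega>. (u * X \<omega> + w * Y \<omega>) ^ (m + 2) \<partial>M) = real (m + 1) * v u w * (\<integral>\<omega>. (u * X \<omega> + w * Y \<omega>) ^ m \<partial>M)" for u w m
    using centered_normal_moments[OF P _ Z[of u w]] by auto
  have int: "integrable M (\<lambda>\<omega>. X \<omega> ^ a * Y \<omega> ^ b)" for a b
  proof (rule Bochner_Integration.integrable_bound)
    show "integrable M (\<lambda>\<omega>. X \<omega> ^ (2 * a) + Y \<omega> ^ (2 * b))"
      using mom(1)[of 1 0 "2 * a"] mom(1)[of 0 1 "2 * b"] by simp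
    show "AE \<omega> in M. norm (X \<omega> ^ a * Y \<omega> ^ b) \<le> norm (X \<omega> ^ (2 * a) + Y \<omega> ^ (2 * b))"
    proof (rule AE_I2)
      fix \<omega>
      have "\<bar>X \<omega> ^ a\<bar> * \<bar>Y \<omega> ^ b\<bar> \<le> \<bar>X \<omega> ^ a\<bar>\<^sup>2 + \<bar>Y \<omega> ^ b\<bar>\<^sup>2" by (rule mult_le_squares)
      thus "norm (X \<omega> ^ a * Y \<omega> ^ b) \<le> norm (X \<omega> ^ (2 * a) + Y \<omega> ^ (2 * b))"
        by (simp add: abs_mult power_mult[symmetric] mult.commute)
    qed
  qed simp
  define \<gamma> where "\<gamma> a b = (\<integral>\<omega>. X \<omega> ^ a * Y \<omega> ^ b \<partial>M)" for a b
  \<comment> \<open>Dividing by factorials turns the binomial coefficients of the expansion into the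
    single factor \<open>fact m\<close>, so coefficients can be compared without binomial
    identities.\<close>
  define \<delta> where "\<delta> a b = \<gamma> a b / (fact a * fact b)" for a b
  have \<gamma>\<delta>: "\<gamma> a b = fact a * fact b * \<delta> a b" for a b by (simp add: \<delta>_def)
  define p where "p m = (\<Sum>i\<le>m. monom (fact m * \<delta> i (m - i)) i)" for m
  have coeff_p: "coeff (p m) i = (if i \<le> m then fact m * \<delta> i (m - i) else 0)" for m i
    by (simp add: p_def coeff_sum)
  have poly_p: "poly (p m) u = (\<integral>\<omega>. (u * X \<omega> + 1 * Y \<omega>) ^ m \<partial>M)" for m u
  proof -
    have "(\<integral>\<omega>. (u * X \<omega> + 1 * Y \<omega>) ^ m \<partial>M) =
        (\<integral>\<omega>. (\<Sum>i\<le>m. (real (m choose i) * u ^ i) * (X \<omega> ^ i * Y \<omega> ^ (m - i))) \<partial>M)"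
      by (simp add: binomial_ring power_mult_distrib mult_ac)
    also have "\<dots> = (\<Sum>i\<le>m. (real (m choose i) * u ^ i) * \<gamma> i (m - i))"
      unfolding \<gamma>_def by (subst Bochner_Integration.integral_sum) (auto intro: int)
    also have "\<dots> = (\<Sum>i\<le>m. fact m * \<delta> i (m - i) * u ^ i)"
      by (intro sum.cong refl) (simp add: \<delta>_def binomial_fact)
    finally show ?thesis by (simp add: p_def poly_sum poly_monom)
  qed
  have rec: "p (m + 2) = smult (real (m + 1)) ([:r, 2 * t, s:] * p m)" for m
  proof -
    have "poly (p (m + 2)) = poly (smult (real (m + 1)) ([:r, 2 * t, s:] * p m))"
    proof
      fix u
      show "poly (p (m + 2)) u = poly (smult (real (m + 1)) ([:r, 2 * t, s:] * p m)) u"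
        unfolding poly_p[of "m + 2"] mom(3) poly_smult poly_mult poly_p[of m] v_def
        by (simp add: algebra_simps power2_eq_square)
    qed
    thus ?thesis by (simp add: poly_eq_poly_eq_iff)
  qed
  have "\<gamma> a b = wick s t r a b"
  proof (induction "a + b" arbitrary: a b rule: less_induct)
    case less
    have "a + b = 0 \<or> a + b = 1 \<or> (\<exists>m. a + b = m + 2)" by presburger
    then consider "a + b = 0" | "a + b = 1" | m where "a + b = m + 2" by blast
    thus ?case
    proof cases
      case 1
      thus ?thesis by (simp add: \<gamma>_def prob_space)
    next
      case 2
      hence "a = 1 \<and> b = 0 \<or> a = 0 \<and> b = 1" by auto
      thus ?thesis using mom(2)[of 1 0] mom(2)[of 0 1] by (auto simp: \<gamma>_def)
    next
      case 3
      let ?c = "coeff (p m)"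
      have c1: "fact a * fact b * ?c a = fact m * (real b * (real b - 1) * wick s t r a (b - 2))"
      proof (cases "b \<ge> 2")
        case True
        then obtain b' where b': "b = Suc (Suc b')" by (metis add_2_eq_Suc le_Suc_ex)
        hence "m - a = b'" "a \<le> m" using 3 by auto
        moreover have "\<gamma> a b' = wick s t r a b'" by (rule less) (use b' in simp)
        hence "wick s t r a b' = fact a * fact b' * \<delta> a b'" by (simp add: \<gamma>\<delta>)
        ultimately show ?thesis unfolding coeff_p using b' by (simp add: algebra_simps)
      next
        case False
        hence "b = 0 \<or> b = 1" by auto
        thus ?thesis using 3 unfolding coeff_p by auto
      qed
      have c2: "(if a = 0 then 0 else fact a * fact b * ?c (a - 1)) =
          fact m * (real a * real b * wick s t r (a - 1) (b - 1))"
      proof (cases "a = 0 \<or> b = 0")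
        case True
        thus ?thesis using 3 unfolding coeff_p by auto
      next
        case False
        then obtain a' b' where a': "a = Suc a'" "b = Suc b'" by (metis not0_implies_Suc)
        hence "m - a' = b'" "a' \<le> m" using 3 by auto
        moreover have "\<gamma> a' b' = wick s t r a' b'" by (rule less) (use a' in simp)
        hence "wick s t r a' b' = fact a' * fact b' * \<delta> a' b'" by (simp add: \<gamma>\<delta>)
        ultimately show ?thesis unfolding coeff_p using a' by (simp add: algebra_simps)
      qed
      have c3: "(if a < 2 then 0 else fact a * fact b * ?c (a - 2)) =
          fact m * (real a * (real a - 1) * wick s t r (a - 2) b)"
      proof (cases "a < 2")
        case True
        hence "a = 0 \<or> a = 1" by auto
        thus ?thesis by auto
      next
        case False
        then obtain a' where a': "a = Suc (Suc a')" by (metis add_2_eq_Suc le_Suc_ex not_less)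
        hence "m - a' = b" "a' \<le> m" using 3 by auto
        moreover have "\<gamma> a' b = wick s t r a' b" by (rule less) (use a' in simp)
        hence "wick s t r a' b = fact a' * fact b * \<delta> a' b" by (simp add: \<gamma>\<delta>)
        ultimately show ?thesis unfolding coeff_p using a' by (simp add: algebra_simps)
      qed
      have "coeff (p (m + 2)) a = real (m + 1) * (r * ?c a + 2 * t * (if a = 0 then 0 else ?c (a - 1)) +
          s * (if a < 2 then 0 else ?c (a - 2)))"
        unfolding rec by (cases a; cases "a - 1") (auto simp: coeff_pCons algebra_simps)
      moreover have "coeff (p (m + 2)) a = fact (m + 2) * \<delta> a b"
      proof -
        have "m + 2 - a = b" "a \<le> m + 2" using 3 by auto
        thus ?thesis by (simp add: coeff_p del: fact_Suc)
      qed
      ultimately have E: "fact (m + 2) * \<delta> a b = real (m + 1) * (r * ?c a + 2 * t * (if a =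
          0 then 0 else ?c (a - 1)) + s * (if a < 2 then 0 else ?c (a - 2)))"
        by simp
      have c2': "fact a * fact b * (if a = 0 then 0 else ?c (a - 1)) =
          fact m * (real a * real b * wick s t r (a - 1) (b - 1))"
        using c2 by (simp split: if_splits)
      have c3': "fact a * fact b * (if a < 2 then 0 else ?c (a - 2)) =
          fact m * (real a * (real a - 1) * wick s t r (a - 2) b)"
        using c3 by (simp split: if_splits)
      have "fact (m + 2) * \<gamma> a b = (fact a * fact b) * (fact (m + 2) * \<delta> a b)"
        unfolding \<gamma>\<delta> by (simp only: mult_ac)
      also have "\<dots> = real (m + 1) * (r * (fact a * fact b * ?c a) + 2 * t * (fact a * fact b * (if a =
          0 then 0 else ?c (a - 1)))
          + s * (fact a * fact b * (if a < 2 then 0 else ?c (a - 2))))"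
        unfolding E by (simp only: distrib_left mult_ac)
      also have "\<dots> = real (m + 1) * fact m * (real (m + 2) * wick s t r a b)"
        unfolding c1 c2' c3' wick_pair[OF 3] by (simp add: algebra_simps)
      finally have "real (m + 2) * (real (m + 1) * fact m) * \<gamma> a b = real (m + 2) * (real (m + 1) * fact m) *
          wick s t r a b"
        by (simp add: mult_ac)
      moreover have "real (m + 2) * (real (m + 1) * fact m) \<noteq> (0::real)" by (simp del: of_nat_add)
      ultimately show ?thesis using mult_left_cancel by blast
    qed
  qed
  thus ?thesis by (simp add: \<gamma>_def)
qed

section \<open>The central limit theorem\<close>

context gs_model
begin

definition gfac :: "nat \<Rightarrow> (nat \<times> nat \<Rightarrow> real) \<Rightarrow> (nat \<Rightarrow> nat \<Rightarrow> real) \<Rightarrow> fac \<Rightarrow> real" where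
  "gfac N g \<rho> f = (case f of TF k \<Rightarrow> Tk S \<beta> D hf N g \<rho> k | SF k \<Rightarrow> Sk S \<beta> D hf N g \<rho> k
     | T0 \<Rightarrow> Tq S \<beta> D hf q N g | S0 \<Rightarrow> Sp S \<beta> D hf p N g)"

definition is_orig :: "fac \<Rightarrow> bool" where
  "is_orig f \<longleftrightarrow> (case f of TF k \<Rightarrow> True | SF k \<Rightarrow> True | _ \<Rightarrow> False)"

lemma prob_weights_G: "prob_weights (configs S N) (gibbs S \<beta> D hf N g)"
  unfolding gibbs_eq by (rule prob_weights_gibbs) auto

text \<open>Averaging \<open>\<sigma>\<close> and \<open>\<tau>\<close> separately replaces each
  auxiliary spin by its quenched mean. In \<open>T_k\<close> and \<open>T\<close> a product of two
  such means needs two independent replicas, hence \<open>x \<noteq> y\<close>.\<close>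

lemma resample_factor:
  assumes "N > 0" "x \<noteq> y" "\<And>k. f = TF k \<or> f = SF k \<Longrightarrow> k \<noteq> x \<and> k \<noteq> y"
  shows "(\<Sum>\<tau>\<in>configs S N. gibbs S \<beta> D hf N g \<tau> * (\<Sum>\<sigma>\<in>configs S N. gibbs S \<beta> D hf N g \<sigma> *
     lav (ffun f x y) N (\<rho>(y := \<tau>, x := \<sigma>)))) = gfac N g \<rho> f"
proof -
  interpret prob_weights "configs S N" "gibbs S \<beta> D hf N g" by (rule prob_weights_G)
  let ?G = "gibbs S \<beta> D hf N g"
  let ?E = "\<lambda>F. \<Sum>\<sigma>\<in>configs S N. ?G \<sigma> * F \<sigma>"
  have E_const: "?E (\<lambda>_. c) = c" for c by (simp add: total flip: sum_distrib_right)
  have E_diff: "?E (\<lambda>\<sigma>. F \<sigma> - F' \<sigma>) = ?E F - ?E F'" for F F'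
    by (simp add: right_diff_distrib sum_subtractf)
  have E_cmult: "?E (\<lambda>\<sigma>. c * F \<sigma>) = c * ?E F" "?E (\<lambda>\<sigma>. F \<sigma> * c) = ?E F * c" for c F
    by (simp_all add: sum_distrib_left sum_distrib_right mult_ac)
  have E_avg: "?E (\<lambda>\<sigma>. (\<Sum>i<N. F i \<sigma>) / real N) = (\<Sum>i<N. ?E (F i)) / real N" for F
    by (simp add: sum_distrib_left sum_divide_distrib[symmetric]) (subst sum.swap, simp)
  have b: "?E (\<lambda>\<sigma>. \<sigma> i) = bb S \<beta> D hf N g i" "?E (\<lambda>\<sigma>. (\<sigma> i)\<^sup>2) = bt S \<beta> D hf N g i" for i
    by (simp_all add: bb_def bt_def gavg_def)
  have xy: "(\<rho>(y := \<tau>, x := \<sigma>)) x = \<sigma>" "(\<rho>(y := \<tau>, x := \<sigma>)) y = \<tau>" for \<tau> \<sigma> using assms(2) by auto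
  have red: "?E (\<lambda>\<tau>. ?E (\<lambda>\<sigma>. lav (ffun f x y) N (\<rho>(y := \<tau>, x := \<sigma>)))) =
      (\<Sum>i<N. ?E (\<lambda>\<tau>. ?E (\<lambda>\<sigma>. ffun f x y (\<lambda>k. (\<rho>(y := \<tau>, x := \<sigma>)) k i)))) / real N"
    unfolding lav_def E_avg ..
  show ?thesis
  proof (cases f)
    case (TF k)
    hence k: "k \<noteq> x" "k \<noteq> y" using assms(3) by auto
    have "ffun f x y (\<lambda>j. (\<rho>(y := \<tau>, x := \<sigma>)) j i) = (\<rho> k i - \<sigma> i) * \<tau> i" for \<tau> \<sigma> i
      using TF k assms(2) by (simp add: ee_def algebra_simps)
    thus ?thesis unfolding red gfac_def Tk_def using TF
      by (simp only: E_cmult E_diff E_const b fac.case)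
  next
    case (SF k)
    hence k: "k \<noteq> x" "k \<noteq> y" using assms(3) by auto
    have "ffun f x y (\<lambda>j. (\<rho>(y := \<tau>, x := \<sigma>)) j i) = (\<rho> k i)\<^sup>2 - (\<sigma> i)\<^sup>2" for \<tau> \<sigma> i
      using SF k assms(2) by (simp add: ee_def power2_eq_square)
    thus ?thesis unfolding red gfac_def Sk_def using SF
      by (simp only: E_diff E_const b fac.case)
  next
    case T0
    have "ffun f x y (\<lambda>j. (\<rho>(y := \<tau>, x := \<sigma>)) j i) = \<sigma> i * \<tau> i - q" for \<tau> \<sigma> i
      using T0 assms(2) by (simp add: ee_def)
    hence "?E (\<lambda>\<tau>. ?E (\<lambda>\<sigma>. lav (ffun f x y) N (\<rho>(y := \<tau>, x := \<sigma>)))) = (\<Sum>i<N. (bb S \<beta> D hf N g i)\<^sup>2 - q) / real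
        N"
      unfolding red by (simp only: E_cmult E_diff E_const b power2_eq_square)
    thus ?thesis unfolding gfac_def Tq_def using T0 assms(1) by (simp add: sum_subtractf diff_divide_distrib)
  next
    case S0
    have "ffun f x y (\<lambda>j. (\<rho>(y := \<tau>, x := \<sigma>)) j i) = (\<sigma> i)\<^sup>2 - p" for \<tau> \<sigma> i
      using S0 assms(2) by (simp add: ee_def power2_eq_square)
    hence "?E (\<lambda>\<tau>. ?E (\<lambda>\<sigma>. lav (ffun f x y) N (\<rho>(y := \<tau>, x := \<sigma>)))) = (\<Sum>i<N. bt S \<beta> D hf N g i - p) / real N"
      unfolding red by (simp only: E_diff E_const b)
    thus ?thesis unfolding gfac_def Sp_def using S0 assms(1) by (simp add: sum_subtractf diff_divide_distrib)
  qed
qed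

lemma gfac_upd: "(\<And>k. f = TF k \<or> f = SF k \<Longrightarrow> k \<noteq> x) \<Longrightarrow> gfac N g (\<rho>(x := \<sigma>)) f = gfac N g \<rho> f"
  by (cases f) (auto simp: gfac_def Tk_def Sk_def)

lemma replace_factor:
  fixes n :: nat
  assumes "N > 0" "x \<noteq> y" "x < n" "y < n" "\<And>k. f = TF k \<or> f = SF k \<Longrightarrow> k \<noteq> x \<and> k \<noteq> y"
    and A: "\<And>\<rho> \<sigma>. A (\<rho>(x := \<sigma>)) = A \<rho>" "\<And>\<rho> \<sigma>. A (\<rho>(y := \<sigma>)) = A \<rho>"
  shows "rep_avg (configs S N) (gibbs S \<beta> D hf N g) {..<n} (\<lambda>\<rho>. A \<rho> * lav (ffun f x y) N \<rho>) =
    rep_avg (configs S N) (gibbs S \<beta> D hf N g) {..<n} (\<lambda>\<rho>. A \<rho> * gfac N g \<rho> f)"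
proof -
  interpret prob_weights "configs S N" "gibbs S \<beta> D hf N g" by (rule prob_weights_G)
  let ?G = "gibbs S \<beta> D hf N g"
  have "avg {..<n} (\<lambda>\<rho>. A \<rho> * lav (ffun f x y) N \<rho>) =
     avg {..<n} (\<lambda>\<rho>. \<Sum>\<sigma>\<in>configs S N. ?G \<sigma> * (A (\<rho>(x := \<sigma>)) * lav (ffun f x y) N (\<rho>(x := \<sigma>))))"
    by (rule avg_resample) (use assms in auto)
  also have "\<dots> = avg {..<n} (\<lambda>\<rho>. A \<rho> * (\<Sum>\<sigma>\<in>configs S N. ?G \<sigma> * lav (ffun f x y) N (\<rho>(x := \<sigma>))))"
    unfolding A by (simp only: sum_distrib_left mult.left_commute)
  also have
      "\<dots> = avg {..<n} (\<lambda>\<rho>. \<Sum>\<tau>\<in>configs S N. ?G \<tau> * (A (\<rho>(y := \<tau>)) * (\<Sum>\<sigma>\<in>configs S N. ?G \<sigma> * lav (ffun f x y) N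
      (\<rho>(y := \<tau>, x := \<sigma>)))))"
    by (rule avg_resample) (use assms in auto)
  also have "\<dots> = avg {..<n} (\<lambda>\<rho>. A \<rho> * (\<Sum>\<tau>\<in>configs S N. ?G \<tau> * (\<Sum>\<sigma>\<in>configs S N. ?G \<sigma> * lav (ffun f x y) N
      (\<rho>(y := \<tau>, x := \<sigma>)))))"
    unfolding A by (simp only: sum_distrib_left mult.left_commute)
  finally show ?thesis by (simp only: resample_factor[OF assms(1,2,5)])
qed

text \<open>Induction on \<open>J\<close>, with \<open>A\<close> absorbing the factors that are not
  being replaced. Each factor has private auxiliary replicas, so averaging over them leaves all
  other factors untouched.\<close>

lemma replace_factors:
  fixes n :: nat and ty :: "nat \<Rightarrow> fac"
  assumes J: "finite J" and N: "N > 0"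
    and aux: "\<And>j. j \<in> J \<Longrightarrow> xx j < n \<and> yy j < n"
    and dist: "\<And>j j'. xx j \<noteq> yy j'" "inj xx" "inj yy"
    and orig: "\<And>j j' k. j \<in> J \<Longrightarrow> ty j = TF k \<or> ty j = SF k \<Longrightarrow> k \<noteq> xx j' \<and> k \<noteq> yy j'"
    and A: "\<And>j \<rho> \<sigma>. j \<in> J \<Longrightarrow> A (\<rho>(xx j := \<sigma>)) = A \<rho>" "\<And>j \<rho> \<sigma>. j \<in> J \<Longrightarrow> A (\<rho>(yy j := \<sigma>)) = A \<rho>"
  shows "rep_avg (configs S N) (gibbs S \<beta> D hf N g) {..<n} (\<lambda>\<rho>. A \<rho> * lprod J (\<lambda>j. ffun (ty j) (xx j) (yy j)) N
      \<rho>) =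
    rep_avg (configs S N) (gibbs S \<beta> D hf N g) {..<n} (\<lambda>\<rho>. A \<rho> * (\<Prod>j\<in>J. gfac N g \<rho> (ty j)))"
  using J aux orig A
proof (induction J arbitrary: A rule: finite_induct)
  case empty
  show ?case by (simp add: lprod_def)
next
  case (insert j J)
  let ?\<psi> = "\<lambda>j. ffun (ty j) (xx j) (yy j)" and ?av = "rep_avg (configs S N) (gibbs S \<beta> D hf N g) {..<n}"
  have lav_upd: "lav (?\<psi> j) N (\<rho>(z := \<sigma>)) = lav (?\<psi> j) N \<rho>" if "j' \<in> J" "z = xx j' \<or> z = yy j'" for z j' \<rho> \<sigma>
  proof -
    have "j' \<noteq> j" using that insert.hyps by auto
    hence z: "xx j \<noteq> z" "yy j \<noteq> z" using that dist by (auto dest: injD) (metis dist(1))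
    have k: "k \<noteq> z" if "ty j = TF k \<or> ty j = SF k" for k
      using insert.prems(2)[of j k j'] that \<open>z = xx j' \<or> z = yy j'\<close> by auto
    show ?thesis using z k by (cases "ty j") (auto simp: lav_def ee_def)
  qed
  have "?av (\<lambda>\<rho>. A \<rho> * lprod (insert j J) ?\<psi> N \<rho>) = ?av (\<lambda>\<rho>. (A \<rho> * lav (?\<psi> j) N \<rho>) * lprod J ?\<psi> N \<rho>)"
    using insert.hyps by (simp add: lprod_def mult_ac)
  also have "\<dots> = ?av (\<lambda>\<rho>. (A \<rho> * lav (?\<psi> j) N \<rho>) * (\<Prod>j\<in>J. gfac N g \<rho> (ty j)))"
  proof (rule insert.IH)
    show "A (\<rho>(xx j' := \<sigma>)) * lav (?\<psi> j) N (\<rho>(xx j' := \<sigma>)) = A \<rho> * lav (?\<psi> j) N \<rho>" if "j' \<in> J" for j' \<rho> \<sigma>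
    proof -
      have "A (\<rho>(xx j' := \<sigma>)) = A \<rho>" by (rule insert.prems(3)) (use that in simp)
      thus ?thesis using lav_upd[OF that, of "xx j'"] by (simp only: simp_thms)
    qed
    show "A (\<rho>(yy j' := \<sigma>)) * lav (?\<psi> j) N (\<rho>(yy j' := \<sigma>)) = A \<rho> * lav (?\<psi> j) N \<rho>" if "j' \<in> J" for j' \<rho> \<sigma>
    proof -
      have "A (\<rho>(yy j' := \<sigma>)) = A \<rho>" by (rule insert.prems(4)) (use that in simp)
      thus ?thesis using lav_upd[OF that, of "yy j'"] by (simp only: simp_thms)
    qed
  qed (use insert.prems in auto)
  also have "\<dots> = ?av (\<lambda>\<rho>. (A \<rho> * (\<Prod>j\<in>J. gfac N g \<rho> (ty j))) * lav (?\<psi> j) N \<rho>)"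
    by (simp only: mult_ac)
  also have "\<dots> = ?av (\<lambda>\<rho>. (A \<rho> * (\<Prod>j\<in>J. gfac N g \<rho> (ty j))) * gfac N g \<rho> (ty j))"
  proof (rule replace_factor)
    have g: "(\<Prod>j\<in>J. gfac N g (\<rho>(z := \<sigma>)) (ty j)) = (\<Prod>j\<in>J. gfac N g \<rho> (ty j))" if "z = xx j \<or> z = yy j" for z \<rho> \<sigma>
      by (intro prod.cong refl gfac_upd) (use insert.prems(2) that in blast)
    show "A (\<rho>(xx j := \<sigma>)) * (\<Prod>j'\<in>J. gfac N g (\<rho>(xx j := \<sigma>)) (ty j')) = A \<rho> * (\<Prod>j\<in>J. gfac N g \<rho> (ty j))" for \<rho> \<sigma>
    proof -
      have "A (\<rho>(xx j := \<sigma>)) = A \<rho>" by (rule insert.prems(3)) simp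
      thus ?thesis by (simp only: g[OF disjI1[OF refl]])
    qed
    show "A (\<rho>(yy j := \<sigma>)) * (\<Prod>j'\<in>J. gfac N g (\<rho>(yy j := \<sigma>)) (ty j')) = A \<rho> * (\<Prod>j\<in>J. gfac N g \<rho> (ty j))" for \<rho> \<sigma>
    proof -
      have "A (\<rho>(yy j := \<sigma>)) = A \<rho>" by (rule insert.prems(4)) simp
      thus ?thesis by (simp only: g[OF disjI2[OF refl]])
    qed
  qed (use insert.prems N dist in auto)
  also have "\<dots> = ?av (\<lambda>\<rho>. A \<rho> * (\<Prod>j\<in>insert j J. gfac N g \<rho> (ty j)))"
    using insert.hyps by (simp add: mult_ac)
  finally show ?case .
qed

definition EJ :: "nat \<Rightarrow> (nat \<Rightarrow> fac) \<Rightarrow> nat set \<Rightarrow> nat \<Rightarrow> real" where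
  "EJ n0 ty J N = nu S \<beta> D hf N n0 (\<lambda>g \<rho>. \<Prod>j\<in>J. gfac N g \<rho> (ty j))"

text \<open>Observed replicas carry labels 1 to \<open>n0\<close> and the auxiliary ones lie above,
  so the product of quenched factors becomes an average over \<open>{..<n}\<close>. Labels that
  occur in no factor integrate to 1.\<close>

lemma EJ_eq:
  fixes n :: nat
  assumes J: "finite J" and N: "N > 0" and n: "n0 < n"
    and aux: "\<And>j. j \<in> J \<Longrightarrow> xx j < n \<and> yy j < n"
    and dist: "\<And>j j'. xx j \<noteq> yy j'" "inj xx" "inj yy" "\<And>j. n0 < xx j" "\<And>j. n0 < yy j"
    and orig: "\<And>j k. j \<in> J \<Longrightarrow> ty j = TF k \<or> ty j = SF k \<Longrightarrow> k \<in> {1..n0}"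
  shows "EJ n0 ty J N = nun N n (lprod J (\<lambda>j. ffun (ty j) (xx j) (yy j)) N)"
proof -
  have "gavg_n S \<beta> D hf N n0 g (\<lambda>\<rho>. \<Prod>j\<in>J. gfac N g \<rho> (ty j)) =
    rep_avg (configs S N) (gibbs S \<beta> D hf N g) {..<n} (lprod J (\<lambda>j. ffun (ty j) (xx j) (yy j)) N)" for g
  proof -
    interpret prob_weights "configs S N" "gibbs S \<beta> D hf N g" by (rule prob_weights_G)
    have dep: "depends_on {1..n0} (\<lambda>\<rho>. \<Prod>j\<in>J. gfac N g \<rho> (ty j))"
    proof (intro depends_on_prod depends_onI)
      fix j and \<rho> \<rho>' :: "nat \<Rightarrow> nat \<Rightarrow> real" assume j: "j \<in> J" and eq: "\<And>k. k \<in> {1..n0} \<Longrightarrow> \<rho> k = \<rho>' k"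
      have "\<rho> k = \<rho>' k" if "ty j = TF k \<or> ty j = SF k" for k by (rule eq[OF orig[OF j that]])
      thus "gfac N g \<rho> (ty j) = gfac N g \<rho>' (ty j)"
        by (cases "ty j") (auto simp: gfac_def Tk_def Sk_def)
    qed
    have "gavg_n S \<beta> D hf N n0 g (\<lambda>\<rho>. \<Prod>j\<in>J. gfac N g \<rho> (ty j)) = avg {1..n0} (\<lambda>\<rho>. \<Prod>j\<in>J. gfac N g \<rho> (ty j))"
      by (simp add: gavg_n_def rep_avg_def)
    also have "\<dots> = avg {..<n} (\<lambda>\<rho>. \<Prod>j\<in>J. gfac N g \<rho> (ty j))"
      by (rule avg_extend[symmetric, OF _ _ dep]) (use n in auto)
    also have "\<dots> = avg {..<n} (lprod J (\<lambda>j. ffun (ty j) (xx j) (yy j)) N)"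
    proof -
      have "k \<noteq> xx j' \<and> k \<noteq> yy j'" if "j \<in> J" "ty j = TF k \<or> ty j = SF k" for j j' k
        using orig[OF that] dist(4)[of j'] dist(5)[of j'] by auto
      from replace_factors[where A = "\<lambda>_. 1", OF J N aux dist(1-3) this] show ?thesis by simp
    qed
    finally show ?thesis .
  qed
  thus ?thesis unfolding EJ_def nu_def nun_eq by simp
qed

end

context gs_ht
begin

definition cntT :: "(nat \<Rightarrow> fac) \<Rightarrow> nat set \<Rightarrow> nat \<Rightarrow> nat" where
  "cntT ty J k = card {j \<in> J. ty j = TF k}"

definition cntS :: "(nat \<Rightarrow> fac) \<Rightarrow> nat set \<Rightarrow> nat \<Rightarrow> nat" where
  "cntS ty J k = card {j \<in> J. ty j = SF k}"

definition Wk :: "(nat \<Rightarrow> fac) \<Rightarrow> nat set \<Rightarrow> nat \<Rightarrow> nat \<Rightarrow> real" where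
  "Wk ty J N k = wick (A1sq S \<beta> D hf p q N) (C1sq S \<beta> D hf p q N) (B1sq S \<beta> D hf p q N) (cntT ty J k)
      (cntS ty J k)"

lemma wick_step_EJ:
  assumes J: "finite J" "j0 \<notin> J" and k: "k \<in> {1..n0}"
    and orig: "\<And>j k. j \<in> J \<Longrightarrow> ty j = TF k \<or> ty j = SF k \<Longrightarrow> k \<in> {1..n0}"
  shows "ty j0 = TF k \<Longrightarrow> uord (card J + 2) (\<lambda>N _. EJ n0 ty (insert j0 J) N -
      ((\<Sum>j\<in>{j\<in>J. ty j = TF k}. A1sq S \<beta> D hf p q N * EJ n0 ty (J - {j}) N) + (\<Sum>j\<in>{j\<in>J. ty j =
          SF k}. C1sq S \<beta> D hf p q N * EJ n0 ty (J - {j}) N)))"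
    and "ty j0 = SF k \<Longrightarrow> uord (card J + 2) (\<lambda>N _. EJ n0 ty (insert j0 J) N -
      ((\<Sum>j\<in>{j\<in>J. ty j = TF k}. C1sq S \<beta> D hf p q N * EJ n0 ty (J - {j}) N) + (\<Sum>j\<in>{j\<in>J. ty j =
          SF k}. B1sq S \<beta> D hf p q N * EJ n0 ty (J - {j}) N)))"
proof -
  \<comment> \<open>Offsets of different parity give every factor two labels of its own, all above
    \<open>n0\<close>; \<open>n\<close> exceeds the largest of them.\<close>
  define xx where "xx j = n0 + 1 + 2 * j" for j
  define yy where "yy j = n0 + 2 + 2 * j" for j
  define n where "n = n0 + 3 + 2 * (Max (insert j0 J))"
  have mx: "j \<le> Max (insert j0 J)" if "j \<in> insert j0 J" for j using J that by (intro Max_ge) auto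
  have aux: "xx j < n \<and> yy j < n" if "j \<in> insert j0 J" for j
    using mx[OF that] by (auto simp: xx_def yy_def n_def)
  have dist: "xx j \<noteq> yy j'" "inj xx" "inj yy" "n0 < xx j" "n0 < yy j" for j j'
    unfolding xx_def yy_def by presburger (auto simp: inj_def)
  have j0J: "j \<noteq> j0" if "j \<in> J" for j using that J by auto
  have E: "EJ n0 ty J' N = nun N n (lprod J' (\<lambda>j. ffun (ty j) (xx j) (yy j)) N)"
    if "J' \<subseteq> insert j0 J" "N > 0" "\<And>k. j0 \<in> J' \<Longrightarrow> ty j0 = TF k \<or> ty j0 = SF k \<Longrightarrow> k \<in> {1..n0}" for J' N
  proof (rule EJ_eq[OF _ that(2) _ _ dist])
    show "finite J'" using that(1) J(1) finite_subset by blast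
    show "n0 < n" by (simp add: n_def)
    show "xx j < n \<and> yy j < n" if "j \<in> J'" for j using aux \<open>J' \<subseteq> _\<close> that by blast
    show "k \<in> {1..n0}" if "j \<in> J'" "ty j = TF k \<or> ty j = SF k" for j k
      using that \<open>J' \<subseteq> _\<close> orig[of j k] \<open>\<And>k. j0 \<in> J' \<Longrightarrow> _ \<Longrightarrow> k \<in> {1..n0}\<close>[of k] by blast
  qed
  interpret cavity S \<beta> D hf p q n k "xx j0" "yy j0" J ty xx yy
  proof unfold_locales
    show "xx j < n \<and> yy j < n \<and> xx j \<noteq> yy j \<and> xx j \<notin> {k, xx j0, yy j0} \<and> yy j \<notin> {k, xx j0, yy j0}" if j: "j \<in> J"
        for j
    proof -
      have "xx j \<noteq> xx j0" "yy j \<noteq> yy j0" using j0J[OF j] by (auto simp: xx_def yy_def)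
      moreover have "xx j \<noteq> k" "yy j \<noteq> k" using k by (auto simp: xx_def yy_def)
      ultimately show ?thesis using aux[of j] j dist(1)[of j j] dist(1)[of j j0] dist(1)[of j0 j] by auto
    qed
    show "k' < n \<and> k' \<noteq> xx j0 \<and> k' \<noteq> yy j0" if "j \<in> J" "ty j = TF k' \<or> ty j = SF k'" for j k'
      using orig[OF that] by (auto simp: xx_def yy_def n_def)
  qed (use k J aux[of j0] in \<open>auto simp: xx_def yy_def n_def\<close>)
  have Pm: "Pm j N = EJ n0 ty (J - {j}) N" if "N > 0" for j N
    unfolding Pm_def by (rule E[symmetric]) (use that J in auto)
  have ins: "lprod (insert j0 J) \<psi> N \<rho> = lav (\<psi> j0) N \<rho> * lprod J \<psi> N \<rho>" for N \<rho>
    unfolding lprod_def using J by simp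
  show "uord (card J + 2) (\<lambda>N _. EJ n0 ty (insert j0 J) N -
      ((\<Sum>j\<in>{j\<in>J. ty j = TF k}. A1sq S \<beta> D hf p q N * EJ n0 ty (J - {j}) N) + (\<Sum>j\<in>{j\<in>J. ty j =
          SF k}. C1sq S \<beta> D hf p q N * EJ n0 ty (J - {j}) N)))"
    if t: "ty j0 = TF k"
  proof (rule uord_cong[OF wick_step(1)])
    fix N i :: nat assume "N \<ge> 2"
    hence N: "N > 0" by simp
    have "f1 = \<psi> j0" unfolding f1_def[abs_def] using t by simp
    hence "X N = nun N n (lprod (insert j0 J) \<psi> N)" unfolding X_def ins[abs_def] by simp
    also have "\<dots> = EJ n0 ty (insert j0 J) N" by (rule E[symmetric]) (use N t k in auto)
    finally have X: "X N = EJ n0 ty (insert j0 J) N" .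
    show "EJ n0 ty (insert j0 J) N -
      ((\<Sum>j\<in>{j\<in>J. ty j = TF k}. A1sq S \<beta> D hf p q N * EJ n0 ty (J - {j}) N) + (\<Sum>j\<in>{j\<in>J. ty j =
          SF k}. C1sq S \<beta> D hf p q N * EJ n0 ty (J - {j}) N)) =
      X N - ((\<Sum>j\<in>JT. A1sq S \<beta> D hf p q N * Pm j N) + (\<Sum>j\<in>JS. C1sq S \<beta> D hf p q N * Pm j N))"
      unfolding X JT_def JS_def Pm[OF N] ..
  qed
  show "uord (card J + 2) (\<lambda>N _. EJ n0 ty (insert j0 J) N -
      ((\<Sum>j\<in>{j\<in>J. ty j = TF k}. C1sq S \<beta> D hf p q N * EJ n0 ty (J - {j}) N) + (\<Sum>j\<in>{j\<in>J. ty j =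
          SF k}. B1sq S \<beta> D hf p q N * EJ n0 ty (J - {j}) N)))"
    if t: "ty j0 = SF k"
  proof (rule uord_cong[OF wick_step(2)])
    fix N i :: nat assume "N \<ge> 2"
    hence N: "N > 0" by simp
    have "f2 = \<psi> j0" unfolding f2_def[abs_def] using t by simp
    hence "Y N = nun N n (lprod (insert j0 J) \<psi> N)" unfolding Y_def ins[abs_def] by simp
    also have "\<dots> = EJ n0 ty (insert j0 J) N" by (rule E[symmetric]) (use N t k in auto)
    finally have Y: "Y N = EJ n0 ty (insert j0 J) N" .
    show "EJ n0 ty (insert j0 J) N -
      ((\<Sum>j\<in>{j\<in>J. ty j = TF k}. C1sq S \<beta> D hf p q N * EJ n0 ty (J - {j}) N) + (\<Sum>j\<in>{j\<in>J. ty j =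
          SF k}. B1sq S \<beta> D hf p q N * EJ n0 ty (J - {j}) N)) =
      Y N - ((\<Sum>j\<in>JT. C1sq S \<beta> D hf p q N * Pm j N) + (\<Sum>j\<in>JS. B1sq S \<beta> D hf p q N * Pm j N))"
      unfolding Y JT_def JS_def Pm[OF N] ..
  qed
qed

text \<open>Isolates the factor \<open>1 / N\<close>, so that \<open>uord_divN\<close> can be
  applied to the pairing terms.\<close>

lemma covariance_scale:
  "A1sq S \<beta> D hf p q N = A1sq S \<beta> D hf p q 1 / real N"
  "C1sq S \<beta> D hf p q N = C1sq S \<beta> D hf p q 1 / real N"
  "B1sq S \<beta> D hf p q N = B1sq S \<beta> D hf p q 1 / real N"
  by (simp_all add: A1sq_def B1sq_def C1sq_def)

definition rest :: "(nat \<Rightarrow> fac) \<Rightarrow> nat set \<Rightarrow> nat set" where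
  "rest ty J = {j \<in> J. \<not> is_orig (ty j)}"

text \<open>Induction on the number of factors. \<open>wick_step_EJ\<close> pairs one
  \<open>T_k\<close> or \<open>S_k\<close> with each other factor of the same replica; both
  disappear, the induction hypothesis treats the rest, and the factor \<open>1 / N\<close> of the
  covariances makes up for the two lost orders. Factors \<open>T\<close> and \<open>S\<close> are
  never chosen and form \<open>rest\<close>.\<close>

lemma clt_EJ:
  assumes "finite J" and orig: "\<And>j k. j \<in> J \<Longrightarrow> ty j = TF k \<or> ty j = SF k \<Longrightarrow> k \<in> {1..n0}"
  shows "uord (card J + 1) (\<lambda>N _. EJ n0 ty J N - (\<Prod>k\<in>{1..n0}. Wk ty J N k) * EJ n0 ty (rest ty J) N)"
  using assms
proof (induction "card J" arbitrary: J rule: less_induct)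
  case less
  note fin = less.prems(1) and orig = less.prems(2)
  \<comment> \<open>The induction step for both kinds of factor at once: \<open>UT\<close> and
    \<open>US\<close> are the possible partners, and \<open>P\<close> and \<open>R\<close> the
    corresponding covariances for \<open>N = 1\<close>.\<close>
  have step: "uord (card J + 1) (\<lambda>N _. EJ n0 ty J N - (\<Prod>k\<in>{1..n0}. Wk ty J N k) * EJ n0 ty (rest ty J) N)"
    if j0: "j0 \<in> J" "is_orig (ty j0)" and k: "k \<in> {1..n0}" and J'_def: "J' = J - {j0}"
      and sub: "UT = {j\<in>J'. ty j = TF k}" "US = {j\<in>J'. ty j = SF k}"
      and rec: "uord (card J' + 2) (\<lambda>N _. EJ n0 ty (insert j0 J') N -
          ((\<Sum>j\<in>UT. P / real N * EJ n0 ty (J' - {j}) N) + (\<Sum>j\<in>US. R / real N * EJ n0 ty (J' - {j}) N)))"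
      and w: "\<And>N. (\<Prod>k\<in>{1..n0}. Wk ty J N k) = (\<Sum>j\<in>UT. P / real N * (\<Prod>k\<in>{1..n0}. Wk ty (J' - {j}) N k)) +
          (\<Sum>j\<in>US. R / real N * (\<Prod>k\<in>{1..n0}. Wk ty (J' - {j}) N k))"
    for j0 k J' P R UT US
  proof -
    have J: "insert j0 J' = J" "card J' + 1 = card J" "finite J'"
      using j0 fin card_Suc_Diff1[OF fin j0(1)] by (auto simp: J'_def)
    have each: "uord (card J' + 2) (\<lambda>N _. (EJ n0 ty (J' - {j}) N - (\<Prod>k\<in>{1..n0}. Wk ty (J' - {j}) N k) * EJ n0 ty
        (rest ty J) N) / real N)"
      if j: "j \<in> J'" "is_orig (ty j)" for j
    proof -
      have c: "card (J' - {j}) + 1 = card J'" using card_Suc_Diff1[OF J(3) j(1)] by simp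
      have "rest ty (J' - {j}) = rest ty J" using j j0 by (auto simp: rest_def J'_def)
      moreover have "uord (card (J' - {j}) + 1) (\<lambda>N _. EJ n0 ty (J' - {j}) N -
          (\<Prod>k\<in>{1..n0}. Wk ty (J' - {j}) N k) * EJ n0 ty (rest ty (J' - {j})) N)"
        by (rule less.hyps) (use c J orig in \<open>auto simp: J'_def\<close>)
      ultimately show ?thesis using uord_divN c by fastforce
    qed
    have oT: "j \<in> J' \<and> is_orig (ty j)" if "j \<in> UT" for j using that sub by (simp add: is_orig_def)
    have oS: "j \<in> J' \<and> is_orig (ty j)" if "j \<in> US" for j using that sub by (simp add: is_orig_def)
    have uT: "uord (card J' + 2) (\<lambda>N i. \<Sum>j\<in>UT. P * ((EJ n0 ty (J' - {j}) N - (\<Prod>k\<in>{1..n0}. Wk ty (J' - {j}) N k)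
        * EJ n0 ty (rest ty J) N) / real N))"
      by (intro uord_sum uord_cmult each) (use oT in auto)
    have uS: "uord (card J' + 2) (\<lambda>N i. \<Sum>j\<in>US. R * ((EJ n0 ty (J' - {j}) N - (\<Prod>k\<in>{1..n0}. Wk ty (J' - {j}) N k)
        * EJ n0 ty (rest ty J) N) / real N))"
      by (intro uord_sum uord_cmult each) (use oS in auto)
    have "uord (card J' + 2) (\<lambda>N _. EJ n0 ty J N - (\<Prod>k\<in>{1..n0}. Wk ty J N k) * EJ n0 ty (rest ty J) N)"
    proof (rule uord_cong[OF uord_add[OF uord_add[OF rec uT] uS]])
      fix N i :: nat
      have t: "(\<Sum>j\<in>U. c * ((EJ n0 ty (J' - {j}) N - (\<Prod>k\<in>{1..n0}. Wk ty (J' - {j}) N k) * EJ n0 ty (rest ty J) N)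
          / real N)) =
        (\<Sum>j\<in>U. c / real N * EJ n0 ty (J' - {j}) N) - (\<Sum>j\<in>U. c / real N * (\<Prod>k\<in>{1..n0}. Wk ty (J' - {j}) N k)) *
            EJ n0 ty (rest ty J) N" for U c
        unfolding sum_distrib_right sum_subtractf[symmetric]
        by (intro sum.cong refl) (simp only: times_divide_eq_right times_divide_eq_left right_diff_distrib
            diff_divide_distrib mult.assoc)
      show "EJ n0 ty J N - (\<Prod>k\<in>{1..n0}. Wk ty J N k) * EJ n0 ty (rest ty J) N =
        EJ n0 ty (insert j0 J') N - ((\<Sum>j\<in>UT. P / real N * EJ n0 ty (J' - {j}) N) +
            (\<Sum>j\<in>US. R / real N * EJ n0 ty (J' - {j}) N))
        + (\<Sum>j\<in>UT. P * ((EJ n0 ty (J' - {j}) N - (\<Prod>k\<in>{1..n0}. Wk ty (J' - {j}) N k) * EJ n0 ty (rest ty J) N) /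
            real N))
        + (\<Sum>j\<in>US. R * ((EJ n0 ty (J' - {j}) N - (\<Prod>k\<in>{1..n0}. Wk ty (J' - {j}) N k) * EJ n0 ty (rest ty J) N) /
            real N))"
        unfolding t w J(1) by (simp add: algebra_simps)
    qed
    thus ?thesis using J(2) by (simp add: eval_nat_numeral)
  qed
  have prod_split: "(\<Prod>k\<in>{1..n0}. Wk ty J'' N k) = Wk ty J'' N k * (\<Prod>k\<in>{1..n0} - {k}. Wk ty J N k)"
    if k: "k \<in> {1..n0}" and eq: "\<And>k'. k' \<noteq> k \<Longrightarrow> Wk ty J'' N k' = Wk ty J N k'" for k J'' N
    by (subst prod.remove[OF _ k]) (use eq in \<open>auto intro!: prod.cong\<close>)
  have cnt_eq: "Wk ty (J - {j0} - {j}) N k' = Wk ty J N k'"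
    if "k' \<noteq> k" "ty j0 = TF k \<or> ty j0 = SF k" "ty j = TF k \<or> ty j = SF k" for j0 j N k k'
  proof -
    have "{x \<in> J - {j0} - {j}. ty x = TF k'} = {x \<in> J. ty x = TF k'}" "{x \<in> J - {j0} - {j}. ty x = SF k'} =
        {x \<in> J. ty x = SF k'}"
      using that by auto
    thus ?thesis by (simp only: Wk_def cntT_def cntS_def)
  qed
  have cT: "cntT ty J' k = Suc (cntT ty (J' - {j}) k)" "cntS ty J' k = cntS ty (J' - {j}) k"
    if "j \<in> J'" "ty j = TF k" "finite J'" for J' j k
  proof -
    have "{x \<in> J' - {j}. ty x = TF k} = {x \<in> J'. ty x = TF k} - {j}" "{x \<in> J' - {j}. ty x = SF k} =
        {x \<in> J'. ty x = SF k}"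
      using that by auto
    thus "cntT ty J' k = Suc (cntT ty (J' - {j}) k)" "cntS ty J' k = cntS ty (J' - {j}) k"
      unfolding cntT_def cntS_def using that card_Suc_Diff1[of "{x \<in> J'. ty x = TF k}" j] by auto
  qed
  have cS: "cntS ty J' k = Suc (cntS ty (J' - {j}) k)" "cntT ty J' k = cntT ty (J' - {j}) k"
    if "j \<in> J'" "ty j = SF k" "finite J'" for J' j k
  proof -
    have "{x \<in> J' - {j}. ty x = SF k} = {x \<in> J'. ty x = SF k} - {j}" "{x \<in> J' - {j}. ty x = TF k} =
        {x \<in> J'. ty x = TF k}"
      using that by auto
    thus "cntS ty J' k = Suc (cntS ty (J' - {j}) k)" "cntT ty J' k = cntT ty (J' - {j}) k"
      unfolding cntT_def cntS_def using that card_Suc_Diff1[of "{x \<in> J'. ty x = SF k}" j] by auto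
  qed
  \<comment> \<open>A factor \<open>S_k\<close> is taken only when no \<open>T_k\<close> with the
    same \<open>k\<close> is left, because \<open>wick\<close> recurses on its second count only if
    the first is 0.\<close>
  consider (T) j0 k where "j0 \<in> J" "ty j0 = TF k" | (S) j0 k where "j0 \<in> J" "ty j0 = SF k" "\<And>j. j \<in> J \<Longrightarrow>
      ty j \<noteq> TF k"
    | (none) "\<And>j. j \<in> J \<Longrightarrow> \<not> is_orig (ty j)"
  proof -
    have "is_orig f \<longleftrightarrow> (\<exists>k. f = TF k \<or> f = SF k)" for f by (cases f) (auto simp: is_orig_def)
    thus ?thesis using that by blast
  qed
  thus ?case
  proof cases
    case none
    have "ty j \<noteq> TF k" "ty j \<noteq> SF k" if "j \<in> J" for j k using none[OF that] by (auto simp: is_orig_def)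
    hence e: "{j \<in> J. ty j = TF k} = {}" "{j \<in> J. ty j = SF k} = {}" for k by auto
    have "rest ty J = J" using none by (auto simp: rest_def)
    moreover have "cntT ty J k = 0" "cntS ty J k = 0" for k unfolding cntT_def cntS_def e by simp_all
    ultimately have "rest ty J = J" "\<And>k. cntT ty J k = 0" "\<And>k. cntS ty J k = 0" by blast+
    thus ?thesis by (simp add: Wk_def uord_zero)
  next
    case (T j0 k)
    have k: "k \<in> {1..n0}" using orig T by blast
    let ?J' = "J - {j0}"
    have J': "finite ?J'" "insert j0 ?J' = J" using fin T by auto
    let ?s = "A1sq S \<beta> D hf p q" and ?t = "C1sq S \<beta> D hf p q" and ?r = "B1sq S \<beta> D hf p q"
    let ?UT = "{j\<in>?J'. ty j = TF k}" and ?US = "{j\<in>?J'. ty j = SF k}"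
    have r: "uord (card ?J' + 2) (\<lambda>N _. EJ n0 ty (insert j0 ?J') N -
        ((\<Sum>j\<in>?UT. ?s 1 / real N * EJ n0 ty (?J' - {j}) N) + (\<Sum>j\<in>?US. ?t 1 / real N * EJ n0 ty (?J' - {j}) N)))"
      unfolding covariance_scale[symmetric] by (rule wick_step_EJ(1)[OF J'(1) _ k]) (use orig T in auto)
    show ?thesis
    proof (rule step[OF T(1) _ k refl refl refl r])
      show "is_orig (ty j0)" using T by (simp add: is_orig_def)
      fix N
      let ?w = "wick (?s N) (?t N) (?r N)"
      let ?R = "\<Prod>k\<in>{1..n0} - {k}. Wk ty J N k"
      have "(\<Sum>j\<in>?UT. ?s 1 / real N * (\<Prod>k\<in>{1..n0}. Wk ty (?J' - {j}) N k)) =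
          (\<Sum>j\<in>?UT. ?s N * (?w (cntT ty ?J' k - 1) (cntS ty ?J' k) * ?R))"
      proof (rule sum.cong[OF refl])
        fix j assume j: "j \<in> ?UT"
        have "(\<Prod>k\<in>{1..n0}. Wk ty (?J' - {j}) N k) = Wk ty (?J' - {j}) N k * ?R"
          by (rule prod_split[OF k], rule cnt_eq) (use T j in auto)
        moreover have "Wk ty (?J' - {j}) N k = ?w (cntT ty ?J' k - 1) (cntS ty ?J' k)"
          using cT[of j ?J' k] j J' by (simp add: Wk_def)
        ultimately show "?s 1 / real N * (\<Prod>k\<in>{1..n0}. Wk ty (?J' - {j}) N k) =
            ?s N * (?w (cntT ty ?J' k - 1) (cntS ty ?J' k) * ?R)"
          by (simp only: covariance_scale[of N])
      qed
      also have "\<dots> = real (cntT ty ?J' k) * (?s N * (?w (cntT ty ?J' k - 1) (cntS ty ?J' k) * ?R))"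
          by (simp add: cntT_def)
      finally have sT: "(\<Sum>j\<in>?UT. ?s 1 / real N * (\<Prod>k\<in>{1..n0}. Wk ty (?J' - {j}) N k)) =
          real (cntT ty ?J' k) * (?s N * (?w (cntT ty ?J' k - 1) (cntS ty ?J' k) * ?R))" .
      have "(\<Sum>j\<in>?US. ?t 1 / real N * (\<Prod>k\<in>{1..n0}. Wk ty (?J' - {j}) N k)) =
          (\<Sum>j\<in>?US. ?t N * (?w (cntT ty ?J' k) (cntS ty ?J' k - 1) * ?R))"
      proof (rule sum.cong[OF refl])
        fix j assume j: "j \<in> ?US"
        have "(\<Prod>k\<in>{1..n0}. Wk ty (?J' - {j}) N k) = Wk ty (?J' - {j}) N k * ?R"
          by (rule prod_split[OF k], rule cnt_eq) (use T j in auto)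
        moreover have "Wk ty (?J' - {j}) N k = ?w (cntT ty ?J' k) (cntS ty ?J' k - 1)"
          using cS[of j ?J' k] j J' by (simp add: Wk_def)
        ultimately show "?t 1 / real N * (\<Prod>k\<in>{1..n0}. Wk ty (?J' - {j}) N k) =
            ?t N * (?w (cntT ty ?J' k) (cntS ty ?J' k - 1) * ?R)"
          by (simp only: covariance_scale[of N])
      qed
      also have "\<dots> = real (cntS ty ?J' k) * (?t N * (?w (cntT ty ?J' k) (cntS ty ?J' k - 1) * ?R))"
          by (simp add: cntS_def)
      finally have sS: "(\<Sum>j\<in>?US. ?t 1 / real N * (\<Prod>k\<in>{1..n0}. Wk ty (?J' - {j}) N k)) =
          real (cntS ty ?J' k) * (?t N * (?w (cntT ty ?J' k) (cntS ty ?J' k - 1) * ?R))" .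
      have "(\<Prod>k\<in>{1..n0}. Wk ty J N k) = Wk ty J N k * ?R" by (rule prod_split[OF k]) simp
      also have "Wk ty J N k = ?w (Suc (cntT ty ?J' k)) (cntS ty ?J' k)"
        using cT[of j0 J k] T fin by (simp add: Wk_def)
      finally show "(\<Prod>k\<in>{1..n0}. Wk ty J N k) = (\<Sum>j\<in>?UT. ?s 1 / real N * (\<Prod>k\<in>{1..n0}. Wk ty (?J' - {j}) N k)) +
          (\<Sum>j\<in>?US. ?t 1 / real N * (\<Prod>k\<in>{1..n0}. Wk ty (?J' - {j}) N k))"
        unfolding sT sS by (simp add: algebra_simps)
    qed
  next
    case (S j0 k)
    have k: "k \<in> {1..n0}" using orig S by blast
    let ?J' = "J - {j0}"
    have J': "finite ?J'" "insert j0 ?J' = J" using fin S by auto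
    let ?s = "A1sq S \<beta> D hf p q" and ?t = "C1sq S \<beta> D hf p q" and ?r = "B1sq S \<beta> D hf p q"
    let ?UT = "{j\<in>?J'. ty j = TF k}" and ?US = "{j\<in>?J'. ty j = SF k}"
    have r: "uord (card ?J' + 2) (\<lambda>N _. EJ n0 ty (insert j0 ?J') N -
        ((\<Sum>j\<in>?UT. ?t 1 / real N * EJ n0 ty (?J' - {j}) N) + (\<Sum>j\<in>?US. ?r 1 / real N * EJ n0 ty (?J' - {j}) N)))"
      unfolding covariance_scale[symmetric] by (rule wick_step_EJ(2)[OF J'(1) _ k]) (use orig S in auto)
    show ?thesis
    proof (rule step[OF S(1) _ k refl refl refl r])
      show "is_orig (ty j0)" using S by (simp add: is_orig_def)
      fix N
      let ?w = "wick (?s N) (?t N) (?r N)"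
      let ?R = "\<Prod>k\<in>{1..n0} - {k}. Wk ty J N k"
      have UT: "?UT = {}" using S(3) by auto
      have e: "{j \<in> J. ty j = TF k} = {}" using S(3) by auto
      have z: "cntT ty J k = 0" "cntT ty ?J' k = 0" unfolding cntT_def e UT by simp_all
      have "(\<Sum>j\<in>?US. ?r 1 / real N * (\<Prod>k\<in>{1..n0}. Wk ty (?J' - {j}) N k)) =
          (\<Sum>j\<in>?US. ?r N * (?w 0 (cntS ty ?J' k - 1) * ?R))"
      proof (rule sum.cong[OF refl])
        fix j assume j: "j \<in> ?US"
        have "(\<Prod>k\<in>{1..n0}. Wk ty (?J' - {j}) N k) = Wk ty (?J' - {j}) N k * ?R"
          by (rule prod_split[OF k], rule cnt_eq) (use S j in auto)
        moreover have "Wk ty (?J' - {j}) N k = ?w 0 (cntS ty ?J' k - 1)"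
          using cS[of j ?J' k] j J' z by (simp add: Wk_def)
        ultimately show "?r 1 / real N * (\<Prod>k\<in>{1..n0}. Wk ty (?J' - {j}) N k) =
            ?r N * (?w 0 (cntS ty ?J' k - 1) * ?R)"
          by (simp only: covariance_scale[of N])
      qed
      also have "\<dots> = real (cntS ty ?J' k) * (?r N * (?w 0 (cntS ty ?J' k - 1) * ?R))" by (simp add: cntS_def)
      finally have sS: "(\<Sum>j\<in>?US. ?r 1 / real N * (\<Prod>k\<in>{1..n0}. Wk ty (?J' - {j}) N k)) =
          real (cntS ty ?J' k) * (?r N * (?w 0 (cntS ty ?J' k - 1) * ?R))" .
      have "(\<Prod>k\<in>{1..n0}. Wk ty J N k) = Wk ty J N k * ?R" by (rule prod_split[OF k]) simp
      also have "Wk ty J N k = ?w 0 (Suc (cntS ty ?J' k))"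
        using cS[of j0 J k] S fin z by (simp add: Wk_def)
      finally show "(\<Prod>k\<in>{1..n0}. Wk ty J N k) = (\<Sum>j\<in>?UT. ?t 1 / real N * (\<Prod>k\<in>{1..n0}. Wk ty (?J' - {j}) N k)) +
          (\<Sum>j\<in>?US. ?r 1 / real N * (\<Prod>k\<in>{1..n0}. Wk ty (?J' - {j}) N k))"
        unfolding sS UT by (simp add: algebra_simps)
    qed
  qed
qed

end

text \<open>Powers are spread out into single positions, since pairing and the assignment of
  auxiliary replicas act on individual factors.\<close>

definition factor_list :: "nat \<Rightarrow> (nat \<Rightarrow> nat) \<Rightarrow> (nat \<Rightarrow> nat) \<Rightarrow> nat \<Rightarrow> nat \<Rightarrow> fac list" where
  "factor_list n a b c d =
     concat (map (\<lambda>k. replicate (a k) (TF k) @ replicate (b k) (SF k)) [1..<Suc n]) @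
     replicate c T0 @ replicate d S0"

lemma prod_list_factor_list:
  fixes f :: "fac \<Rightarrow> real"
  shows "prod_list (map f (factor_list n a b c d)) =
    (\<Prod>k\<in>{1..n}. f (TF k) ^ a k) * (\<Prod>k\<in>{1..n}. f (SF k) ^ b k) * f T0 ^ c * f S0 ^ d"
proof -
  have "prod_list (map f (concat (map (\<lambda>k. replicate (a k) (TF k) @ replicate (b k) (SF k)) [1..<Suc n]))) =
    (\<Prod>k\<in>{1..n}. f (TF k) ^ a k) * (\<Prod>k\<in>{1..n}. f (SF k) ^ b k)"
    by (induction n) (simp_all add: mult_ac)
  thus ?thesis by (simp add: factor_list_def mult_ac)
qed

lemma length_filter_factor_list:
  "length (filter P (factor_list n a b c d)) =
    (\<Sum>k\<in>{1..n}. if P (TF k) then a k else 0) + (\<Sum>k\<in>{1..n}. if P (SF k) then b k else 0) +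
    (if P T0 then c else 0) + (if P S0 then d else 0)"
proof -
  have "length (filter P (concat (map (\<lambda>k. replicate (a k) (TF k) @ replicate (b k) (SF k)) [1..<Suc n]))) =
    (\<Sum>k\<in>{1..n}. if P (TF k) then a k else 0) + (\<Sum>k\<in>{1..n}. if P (SF k) then b k else 0)"
    by (induction n) simp_all
  thus ?thesis by (simp add: factor_list_def)
qed

lemma set_factor_list: "f \<in> set (factor_list n a b c d) \<Longrightarrow> f = TF k \<or> f = SF k \<Longrightarrow> k \<in> {1..n}"
  by (auto simp: factor_list_def)

lemma prod_nth_lessThan: "(\<Prod>j<length L. f (L ! j)) = prod_list (map f L)" for f :: "'b \<Rightarrow> real"
  by (simp add: prod.list_conv_set_nth atLeast0LessThan)

context gs_ht
begin

lemma clt: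
  "\<exists>K. \<forall>N\<ge>2. \<bar>nu S \<beta> D hf N n (\<lambda>g \<rho>. (\<Prod>k\<in>{1..n}. Tk S \<beta> D hf N g \<rho> k ^ a k)
                                      * (\<Prod>l\<in>{1..n}. Sk S \<beta> D hf N g \<rho> l ^ b l)
                                      * Tq S \<beta> D hf q N g ^ c * Sp S \<beta> D hf p N g ^ d)
      - (\<Prod>k\<in>{1..n}. wick (A1sq S \<beta> D hf p q N) (C1sq S \<beta> D hf p q N) (B1sq S \<beta> D hf p q N) (a k) (b k))
        * nu S \<beta> D hf N n (\<lambda>g \<rho>. Tq S \<beta> D hf q N g ^ c * Sp S \<beta> D hf p N g ^ d)\<bar>
     \<le> K * real N powr (- (real ((\<Sum>k\<in>{1..n}. a k) + (\<Sum>k\<in>{1..n}. b k) + c + d) + 1) / 2)"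
proof -
  define L where "L = factor_list n a b c d"
  define J where "J = {..<length L}"
  define H where "H = (\<Sum>k\<in>{1..n}. a k) + (\<Sum>k\<in>{1..n}. b k) + c + d"
  have fin: "finite J" by (simp add: J_def)
  have card: "card J = H"
    using length_filter_factor_list[of "\<lambda>_. True" n a b c d] by (simp add: J_def L_def H_def)
  have all: "EJ n ((!) L) J N = nu S \<beta> D hf N n (\<lambda>g \<rho>. (\<Prod>k\<in>{1..n}. Tk S \<beta> D hf N g \<rho> k ^ a k)
                                      * (\<Prod>l\<in>{1..n}. Sk S \<beta> D hf N g \<rho> l ^ b l)
                                      * Tq S \<beta> D hf q N g ^ c * Sp S \<beta> D hf p N g ^ d)" for N
    unfolding EJ_def J_def prod_nth_lessThan unfolding L_def prod_list_factor_list by (simp add: gfac_def)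
  have "(\<Prod>j\<in>rest ((!) L) J. gfac N g \<rho> (L ! j)) = Tq S \<beta> D hf q N g ^ c * Sp S \<beta> D hf p N g ^ d" for N g \<rho>
  proof -
    have "(\<Prod>j\<in>rest ((!) L) J. gfac N g \<rho> (L ! j)) = (\<Prod>j\<in>J. if is_orig (L ! j) then 1 else gfac N g \<rho> (L ! j))"
      using fin by (auto simp: rest_def prod.If_cases intro!: prod.cong)
    also have "\<dots> = prod_list (map (\<lambda>f. if is_orig f then 1 else gfac N g \<rho> f) L)"
      unfolding J_def by (rule prod_nth_lessThan)
    also have "\<dots> = Tq S \<beta> D hf q N g ^ c * Sp S \<beta> D hf p N g ^ d"
      unfolding L_def prod_list_factor_list by (simp add: is_orig_def gfac_def)
    finally show ?thesis .
  qed
  hence rst: "EJ n ((!) L) (rest ((!) L) J) N = nu S \<beta> D hf N n (\<lambda>g \<rho>. Tq S \<beta> D hf q N g ^ c * Sp S \<beta> D hf p N g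
      ^ d)" for N
    unfolding EJ_def by simp
  have cnt: "cntT ((!) L) J k = a k" "cntS ((!) L) J k = b k" if "k \<in> {1..n}" for k
  proof -
    have "card {j \<in> J. L ! j = f} = length (filter (\<lambda>x. x = f) L)" for f
      by (simp add: length_filter_conv_card J_def)
    moreover have "length (filter (\<lambda>x. x = TF k) L) = a k" "length (filter (\<lambda>x. x = SF k) L) = b k"
      unfolding L_def length_filter_factor_list using that by simp_all
    ultimately show "cntT ((!) L) J k = a k" "cntS ((!) L) J k = b k" by (simp_all add: cntT_def cntS_def)
  qed
  have W: "(\<Prod>k\<in>{1..n}. Wk ((!) L) J N k) =
    (\<Prod>k\<in>{1..n}. wick (A1sq S \<beta> D hf p q N) (C1sq S \<beta> D hf p q N) (B1sq S \<beta> D hf p q N) (a k) (b k))" for N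
    by (intro prod.cong refl) (simp only: Wk_def cnt)
  have "uord (card J + 1) (\<lambda>N _. EJ n ((!) L) J N - (\<Prod>k\<in>{1..n}. Wk ((!) L) J N k) * EJ n ((!) L)
      (rest ((!) L) J) N)"
  proof (rule clt_EJ[OF fin])
    fix j k assume "j \<in> J" "L ! j = TF k \<or> L ! j = SF k"
    thus "k \<in> {1..n}" using set_factor_list[of "L ! j" n a b c d k] by (simp add: J_def L_def)
  qed
  then obtain K where K: "\<bar>EJ n ((!) L) J N - (\<Prod>k\<in>{1..n}. Wk ((!) L) J N k) * EJ n ((!) L) (rest ((!) L) J) N\<bar> \<le>
      K / sqrt (real N) ^ (H + 1)"
    if "N \<ge> 2" "i < N" for N i :: nat
    unfolding uord_def card by blast
  have pw: "K / sqrt (real N) ^ (H + 1) = K * real N powr (- (real H + 1) / 2)" if "N \<ge> 2" for N :: nat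
  proof -
    have "sqrt (real N) ^ (H + 1) = sqrt (real N) powr real (H + 1)"
      using that by (intro powr_realpow[symmetric]) auto
    also have "\<dots> = real N powr ((real H + 1) / 2)"
      using that by (simp add: powr_half_sqrt[symmetric] powr_powr add.commute)
    finally have "sqrt (real N) ^ (H + 1) = real N powr ((real H + 1) / 2)" .
    moreover have "- (real H + 1) / 2 = - ((real H + 1) / 2)" by (rule minus_divide_left[symmetric])
    ultimately show ?thesis by (simp only: powr_minus_divide times_divide_eq_right mult_1_right)
  qed
  show ?thesis unfolding H_def[symmetric]
  proof (rule exI[of _ K], intro allI impI)
    fix N :: nat assume N: "N \<ge> 2"
    show "\<bar>nu S \<beta> D hf N n (\<lambda>g \<rho>. (\<Prod>k\<in>{1..n}. Tk S \<beta> D hf N g \<rho> k ^ a k)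
                                      * (\<Prod>l\<in>{1..n}. Sk S \<beta> D hf N g \<rho> l ^ b l)
                                      * Tq S \<beta> D hf q N g ^ c * Sp S \<beta> D hf p N g ^ d)
      - (\<Prod>k\<in>{1..n}. wick (A1sq S \<beta> D hf p q N) (C1sq S \<beta> D hf p q N) (B1sq S \<beta> D hf p q N) (a k) (b k))
        * nu S \<beta> D hf N n (\<lambda>g \<rho>. Tq S \<beta> D hf q N g ^ c * Sp S \<beta> D hf p N g ^ d)\<bar>
     \<le> K * real N powr (- (real H + 1) / 2)"
      using K[OF N, of 0] N unfolding all rst W pw[OF N] by simp
  qed
qed

end

section \<open>Nonvanishing determinants at high temperature\<close>

context gs_model
begin

lemma constant_bounds:
  "\<bar>cD S \<beta> D hf p q\<bar> \<le> 2 * real S ^ 4" "\<bar>cF S \<beta> D hf p q\<bar> \<le> 2 * real S ^ 4" "\<bar>cG S \<beta> D hf p q\<bar> \<le> 2 * real S ^ 4"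
proof -
  let ?m = "meta S \<beta> D hf p q"
  have m1: "\<bar>(?m 1 \<eta>)\<^sup>2\<bar> \<le> real S ^ 2" for \<eta>
    using power_mono[OF meta_abs_le[of 1 \<eta>] abs_ge_zero, of 2] by simp
  have m2: "\<bar>?m 2 \<eta>\<bar> \<le> real S ^ 2" and m4: "\<bar>?m 4 \<eta>\<bar> \<le> real S ^ 4" for \<eta> by (rule meta_abs_le)+
  have prod: "\<bar>x * y\<bar> \<le> real S ^ 4" if "\<bar>x\<bar> \<le> real S ^ 2" "\<bar>y\<bar> \<le> real S ^ 2" for x y :: real
    using mult_mono[OF that] by (simp add: abs_mult flip: power_add)
  have diff: "\<bar>x - y\<bar> \<le> 2 * real S ^ 4" if "\<bar>x\<bar> \<le> real S ^ 4" "\<bar>y\<bar> \<le> real S ^ 4" for x y :: real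
    using that by linarith
  show "\<bar>cD S \<beta> D hf p q\<bar> \<le> 2 * real S ^ 4" unfolding cD_def power2_eq_square
    by (intro std_integral_abs_le diff m4 prod m2)
  show "\<bar>cF S \<beta> D hf p q\<bar> \<le> 2 * real S ^ 4" unfolding cF_def power2_eq_square[of "?m 2 _"]
    by (intro std_integral_abs_le diff prod m2 m1)
  show "\<bar>cG S \<beta> D hf p q\<bar> \<le> 2 * real S ^ 4" unfolding cG_def right_diff_distrib
    by (intro std_integral_abs_le diff prod m2 m1)
qed

text \<open>By \<open>constant_bounds\<close> the combination \<open>F - 3 G\<close> is at most
  \<open>8 * S ^ 4\<close> in absolute value, and the others that occur obey the same bound, so
  \<beta>^2 times each is below 1. Hence the three linear expressions are positive, and the
  remaining term of \<open>cM\<close> is a product of even powers.\<close>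

lemma high_temperature:
  assumes "16 * \<beta>\<^sup>2 * real S ^ 4 \<le> 1"
  shows "cM S \<beta> D hf p q \<noteq> 0" "cM3 S \<beta> D hf p q \<noteq> 0"
proof -
  have small: "\<beta>\<^sup>2 * x < 1" if "\<bar>x\<bar> \<le> 8 * real S ^ 4" for x
  proof -
    have "\<beta>\<^sup>2 * x \<le> \<beta>\<^sup>2 * (8 * real S ^ 4)" using that by (intro mult_left_mono) auto
    thus ?thesis using assms by simp
  qed
  have "cM1 S \<beta> D hf p q > 0" using small[of "cF S \<beta> D hf p q - 3 * cG S \<beta> D hf p q"] constant_bounds
    by (simp add: cM1_def)
  moreover have "cM2 S \<beta> D hf p q > 0" using small[of "cD S \<beta> D hf p q / 2"] constant_bounds
    by (simp add: cM2_def)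
  ultimately have "cM1 S \<beta> D hf p q * cM2 S \<beta> D hf p q > 0" by (rule mult_pos_pos)
  moreover have "\<beta> ^ 4 * (cE S \<beta> D hf p q)\<^sup>2 \<ge> 0" by simp
  ultimately show "cM S \<beta> D hf p q \<noteq> 0" unfolding cM_def by linarith
  have "\<beta>\<^sup>2 * (cF S \<beta> D hf p q - cG S \<beta> D hf p q) < 1" by (rule small) (use constant_bounds in linarith)
  thus "cM3 S \<beta> D hf p q \<noteq> 0" by (simp add: cM3_def)
qed

end

theorem theorem4p5:
  fixes S :: nat and hf D :: real
  assumes "S \<ge> 1" and "hf \<ge> 0"
  shows "\<exists>\<beta>'>0. \<forall>\<beta>. 0 < \<beta> \<and> \<beta> < \<beta>' \<longrightarrow>
    (\<forall>p q. fixed_point S \<beta> D hf p q \<longrightarrow>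
      (\<forall>(n::nat) (a::nat \<Rightarrow> nat) (b::nat \<Rightarrow> nat) (c::nat) (d::nat).
        \<exists>K::real. \<forall>N::nat. N \<ge> 2 \<longrightarrow>
          (\<forall>(M::'a measure) X Y.
             centered_gaussian_pair M X Y (A1sq S \<beta> D hf p q N) (C1sq S \<beta> D hf p q N) (B1sq S \<beta> D hf p q N)
             \<longrightarrow>
             \<bar>nu S \<beta> D hf N n (\<lambda>g \<rho>. (\<Prod>k\<in>{1..n}. Tk S \<beta> D hf N g \<rho> k ^ a k)
                                      * (\<Prod>l\<in>{1..n}. Sk S \<beta> D hf N g \<rho> l ^ b l)
                                      * Tq S \<beta> D hf q N g ^ c * Sp S \<beta> D hf p N g ^ d)
              - (\<Prod>k\<in>{1..n}. (\<integral>\<omega>. X \<omega> ^ a k * Y \<omega> ^ b k \<partial>M))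
                * nu S \<beta> D hf N n (\<lambda>g \<rho>. Tq S \<beta> D hf q N g ^ c * Sp S \<beta> D hf p N g ^ d)\<bar>
             \<le> K * real N powr (- (real ((\<Sum>k\<in>{1..n}. a k) + (\<Sum>k\<in>{1..n}. b k) + c + d) + 1) / 2))))"
proof -
  define c' where "c' = exp (wn 4 * real S ^ 4) * wn 2 * real S ^ 4"
  \<comment> \<open>The three summands of the denominator secure \<open>\<beta> \<le> 1\<close>, the
    smallness in \<open>gs_small\<close> and that of \<open>high_temperature\<close>, by way of
    \<open>\<beta>\<^sup>2 \<le> \<beta>\<close>. The threshold depends on \<open>S\<close>
    alone.\<close>
  define \<beta>' where "\<beta>' = 1 / (1 + 8 * \<bar>c'\<bar> + 16 * real S ^ 4)"
  have den: "1 + 8 * \<bar>c'\<bar> + 16 * real S ^ 4 > 0" by (intro add_pos_nonneg) auto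
  have "\<beta>' > 0" unfolding \<beta>'_def using den by simp
  have small: "\<beta> \<le> 1" "8 * \<beta>\<^sup>2 * c' \<le> 1" "16 * \<beta>\<^sup>2 * real S ^ 4 \<le> 1" if "0 < \<beta>" "\<beta> < \<beta>'" for \<beta>
  proof -
    have "\<beta> * (1 + 8 * \<bar>c'\<bar> + 16 * real S ^ 4) < 1" using that den by (simp add: \<beta>'_def field_simps)
    hence sum: "\<beta> + 8 * (\<beta> * \<bar>c'\<bar>) + 16 * (\<beta> * real S ^ 4) < 1" by (simp add: algebra_simps)
    have nn: "\<beta> * \<bar>c'\<bar> \<ge> 0" "\<beta> * real S ^ 4 \<ge> 0" using that by auto
    show le1: "\<beta> \<le> 1" using sum nn by linarith
    have sq: "\<beta>\<^sup>2 \<le> \<beta>" using that le1 by (simp add: power2_eq_square mult_left_le)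
    have "\<beta>\<^sup>2 * c' \<le> \<beta>\<^sup>2 * \<bar>c'\<bar>" by (intro mult_left_mono) auto
    also have "\<dots> \<le> \<beta> * \<bar>c'\<bar>" using sq by (intro mult_right_mono) auto
    finally have "\<beta>\<^sup>2 * c' \<le> \<beta> * \<bar>c'\<bar>" .
    thus "8 * \<beta>\<^sup>2 * c' \<le> 1" using sum nn that by linarith
    have "\<beta>\<^sup>2 * real S ^ 4 \<le> \<beta> * real S ^ 4" using sq by (intro mult_right_mono) auto
    thus "16 * \<beta>\<^sup>2 * real S ^ 4 \<le> 1" using sum nn that by linarith
  qed
  show ?thesis
  proof (rule exI[of _ \<beta>'], intro conjI \<open>\<beta>' > 0\<close> allI impI)
    fix \<beta> p q and n c d :: nat and a b :: "nat \<Rightarrow> nat"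
    assume \<beta>: "0 < \<beta> \<and> \<beta> < \<beta>'" and fp: "fixed_point S \<beta> D hf p q"
    interpret gs_model S \<beta> D hf p q using fp \<beta> small(1)[of \<beta>] by unfold_locales auto
    interpret gs_ht S \<beta> D hf p q
      using small(2)[of \<beta>] high_temperature[OF small(3)[of \<beta>]] \<beta> by unfold_locales (auto simp: c'_def)
    obtain K where K: "\<bar>nu S \<beta> D hf N n (\<lambda>g \<rho>. (\<Prod>k\<in>{1..n}. Tk S \<beta> D hf N g \<rho> k ^ a k)
                                      * (\<Prod>l\<in>{1..n}. Sk S \<beta> D hf N g \<rho> l ^ b l)
                                      * Tq S \<beta> D hf q N g ^ c * Sp S \<beta> D hf p N g ^ d)
      - (\<Prod>k\<in>{1..n}. wick (A1sq S \<beta> D hf p q N) (C1sq S \<beta> D hf p q N) (B1sq S \<beta> D hf p q N) (a k) (b k))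
        * nu S \<beta> D hf N n (\<lambda>g \<rho>. Tq S \<beta> D hf q N g ^ c * Sp S \<beta> D hf p N g ^ d)\<bar>
     \<le> K * real N powr (- (real ((\<Sum>k\<in>{1..n}. a k) + (\<Sum>k\<in>{1..n}. b k) + c + d) + 1) / 2)"
      if "N \<ge> 2" for N using clt[of n a b c d] by blast
    show "\<exists>K::real. \<forall>N::nat. N \<ge> 2 \<longrightarrow>
          (\<forall>(M::'a measure) X Y.
             centered_gaussian_pair M X Y (A1sq S \<beta> D hf p q N) (C1sq S \<beta> D hf p q N) (B1sq S \<beta> D hf p q N)
             \<longrightarrow>
             \<bar>nu S \<beta> D hf N n (\<lambda>g \<rho>. (\<Prod>k\<in>{1..n}. Tk S \<beta> D hf N g \<rho> k ^ a k)
                                      * (\<Prod>l\<in>{1..n}. Sk S \<beta> D hf N g \<rho> l ^ b l)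
                                      * Tq S \<beta> D hf q N g ^ c * Sp S \<beta> D hf p N g ^ d)
              - (\<Prod>k\<in>{1..n}. (\<integral>\<omega>. X \<omega> ^ a k * Y \<omega> ^ b k \<partial>M))
                * nu S \<beta> D hf N n (\<lambda>g \<rho>. Tq S \<beta> D hf q N g ^ c * Sp S \<beta> D hf p N g ^ d)\<bar>
             \<le> K * real N powr (- (real ((\<Sum>k\<in>{1..n}. a k) + (\<Sum>k\<in>{1..n}. b k) + c + d) + 1) / 2))"
      \<comment> \<open>\<open>K\<close> comes from \<open>clt\<close>, where the Gaussian factor is
        already the number \<open>wick\<close>. It serves for every pair with the given covariance,
        because \<open>gaussian_pair_moment\<close> determines the mixed moments.\<close>
      by (rule exI[of _ K]) (use K in \<open>simp only: gaussian_pair_moment cong: imp_cong; blast\<close>)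
  qed
qed

end
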